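(* Let $H$ be a finite-dimensional quasitriangular Hopf algebra over $\Bbbk$ with $R$-matrix $R=\sum_ks_k\otimes t_k$, let $A$ be a left $H$-comodule algebra with coaction $a\mapsto a_{[-1]}\otimes a_{[0]}$, and let $R_H(A)=A\rtimes_H(\widehat{H}^* )^{\mathrm{op}}$ be the reflective algebra of $A$ with respect to $H$. Then $R_H(A)$ is a left $\mathrm{Drin}(H)$-comodule algebra with coaction $\delta^{\mathrm{Drin}}_{\mathrm{ref}}$ given, for $a\in A$ and $\xi\in(\widehat{H}^* )^{\mathrm{op}}$, by $$\delta^{\mathrm{Drin}}_{\mathrm{ref}}(a)=a_{[-1]}\otimes a_{[0]},$$ $$\delta^{\mathrm{Drin}}_{\mathrm{ref}}(\xi)=\sum_{k,d,d'}\langle\xi,\,t_kh_{d'}S^{-1}(h_d)\rangle\,\Big((s_k)_{(3)}\twoheadrightarrow\xi_d\twoheadleftarrow S((s_k)_{(1)})\Big)(s_k)_{(2)}\otimes\xi_{d'},$$ $$\delta^{\mathrm{Drin}}_{\mathrm{ref}}(a\,\xi)=\delta^{\mathrm{Drin}}_{\mathrm{ref}}(a)\,\delta^{\mathrm{Drin}}_{\mathrm{ref}}(\xi),$$ where $\{h_d,\xi_d\}_d$ and $\{h_{d'},\xi_{d'}\}_{d'}$ are dual bases of $H$.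
   Context: $\Bbbk$ is an algebraically closed field, $\otimes=\otimes_\Bbbk$, sumless Sweedler notation. $R=\sum_ks_k\otimes t_k\in H\otimes H$ is invertible with $(\Delta\otimes \mathrm{Id})R=R_{13}R_{23}$, $(\mathrm{Id}\otimes\Delta)R=R_{13}R_{12}$, $R\Delta(h)=\Delta^{\mathrm{op}}(h)R$. Hopf pairing between $H^*$ and $H$: $\langle\xi\zeta,h\rangle=\langle\xi,h_{(1)}\rangle\langle\zeta,h_{(2)}\rangle$, $\langle\xi,h\ell\rangle=\langle\xi_{(1)},h\rangle\langle\xi_{(2)},\ell\rangle$. Actions of $H$ on $H^*$: $\langle h\twoheadrightarrow\xi,h'\rangle=\langle\xi,h'h\rangle$ and $\langle\xi\twoheadleftarrow h,h'\rangle=\langle\xi,hh'\rangle$. A dual basis $\{h_d,\xi_d\}_d$ of $H$ consists of a basis $h_d$ of $H$ and its dual basis $\xi_d$ of $H^*$. The Drinfeld double $\mathrm{Drin}(H)$ is $H^*\otimes H$ as a vector space (elements written $\xi h$), contains $H$ and $(H^* )^{\mathrm{op}}$ as Hopf subalgebras, has product between them $h\xi=(h_{(3)}\twoheadrightarrow\xi\twoheadleftarrow S(h_{(1)}))h_{(2)}$ for $h\in H$, $\xi\in(H^* )^{\mathrm{op}}$, and has the tensor product unit, coproduct and counit of $H^*\otimes H$. $\widehat{H}$ is $H$ as a vector space with comultiplication $\widehat{\Delta}(h)=\sum_{i,j}t_jh_{(1)}t_i\otimes h_{(2)}s_iS^{-1}(s_j)$, counit $\varepsilon$, and left $H$-action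 $\ell\rightharpoonup h=\ell_{(2)}hS^{-1}(\ell_{(1)})$; $\widehat{H}^*$ is its dual algebra ($=H^*$ as a vector space), with product $\langle\xi\zeta,h\rangle=\langle\xi\otimes\zeta,\widehat{\Delta}(h)\rangle$ and right $H$-action $\langle\xi\leftharpoonup\ell,h\rangle=\langle\xi,\ell\rightharpoonup h\rangle$. The reflective algebra $R_H(A)=A\rtimes_H(\widehat{H}^* )^{\mathrm{op}}$ is the quotient of the free product of the algebras $A$ and $(\widehat{H}^* )^{\mathrm{op}}$ by the relations $\xi a=a_{[0]}(\xi\leftharpoonup a_{[-1]})$; multiplication gives a linear isomorphism $A\otimes(\widehat{H}^* )^{\mathrm{op}}\cong R_H(A)$. *)

theory Defs
  imports "HOL-Algebra.Algebraic_Closure" "Jordan_Normal_Form.Missing_VectorSpace"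
begin

section \<open>Algebras and quotients\<close>

text \<open>\<^locale>\<open>algebra\<close> of \<^theory>\<open>HOL-Algebra.Module\<close> is commutative; here algebras
  are unital and associative.\<close>

locale assoc_algebra = vectorspace K A + A?: ring A
  for K :: "('k, 'r) ring_scheme" (structure) and A :: "('k, 'a, 'm) module_scheme" (structure) +
  assumes smult_mult_left:
      "\<lbrakk>c \<in> carrier K; a \<in> carrier A; b \<in> carrier A\<rbrakk>
        \<Longrightarrow> (c \<odot>\<^bsub>A\<^esub> a) \<otimes>\<^bsub>A\<^esub> b = c \<odot>\<^bsub>A\<^esub> (a \<otimes>\<^bsub>A\<^esub> b)"
    and smult_mult_right:
      "\<lbrakk>c \<in> carrier K; a \<in> carrier A; b \<in> carrier A\<rbrakk>
        \<Longrightarrow> a \<otimes>\<^bsub>A\<^esub> (c \<odot>\<^bsub>A\<^esub> b) = c \<odot>\<^bsub>A\<^esub> (a \<otimes>\<^bsub>A\<^esub> b)"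

definition alg_hom ::
  "('k, 'r) ring_scheme \<Rightarrow> ('k, 'a, 'm) module_scheme \<Rightarrow> ('k, 'b, 'n) module_scheme
    \<Rightarrow> ('a \<Rightarrow> 'b) set"
  where "alg_hom K A B = {f \<in> ring_hom A B. linear_map K A B f}"

definition opposite :: "('k, 'a, 'm) module_scheme \<Rightarrow> ('k, 'a, 'm) module_scheme"
  where "opposite A = A\<lparr>monoid.mult := \<lambda>x y. y \<otimes>\<^bsub>A\<^esub> x\<rparr>"

definition scalars :: "('k, 'r) ring_scheme \<Rightarrow> ('k, 'k) module"
  where "scalars K = \<lparr>carrier = carrier K, monoid.mult = monoid.mult K, one = \<one>\<^bsub>K\<^esub>, zero = \<zero>\<^bsub>K\<^esub>,
    add = add K, smult = monoid.mult K\<rparr>"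

text \<open>The quotient ring \<^term>\<open>M Quot I\<close> together with its scalar multiplication.  It serves both
  for quotients of algebras by ideals and (ignoring the multiplicative part) for quotients
  of vector spaces by subspaces.\<close>

definition quotient :: "('k, 'v, 'm) module_scheme \<Rightarrow> 'v set \<Rightarrow> ('k, 'v set) module"
  where "quotient M I =
    \<lparr>carrier = carrier (M Quot I), monoid.mult = monoid.mult (M Quot I), one = one (M Quot I),
     zero = zero (M Quot I), add = add (M Quot I),
     smult = \<lambda>c Y. \<Union>x\<in>Y. I +>\<^bsub>M\<^esub> (c \<odot>\<^bsub>M\<^esub> x)\<rparr>"

text \<open>The vector space with basis \<open>Y\<close>, as finitely supported functions; \<open>generator K x\<close> is
  the basis vector belonging to \<open>x\<close>.\<close>

definition free_space :: "('k, 'r) ring_scheme \<Rightarrow> 'x set \<Rightarrow> ('k, 'x \<Rightarrow> 'k) module"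
  where "free_space K Y =
    \<lparr>carrier = {f. (\<forall>x. f x \<in> carrier K) \<and> (\<forall>x. x \<notin> Y \<longrightarrow> f x = \<zero>\<^bsub>K\<^esub>) \<and> finite {x. f x \<noteq> \<zero>\<^bsub>K\<^esub>}},
     monoid.mult = undefined, one = undefined,
     zero = \<lambda>x. \<zero>\<^bsub>K\<^esub>, add = \<lambda>f g x. f x \<oplus>\<^bsub>K\<^esub> g x,
     smult = \<lambda>c f x. c \<otimes>\<^bsub>K\<^esub> f x\<rparr>"

definition generator :: "('k, 'r) ring_scheme \<Rightarrow> 'x \<Rightarrow> 'x \<Rightarrow> 'k"
  where "generator K x = (\<lambda>y. if y = x then \<one>\<^bsub>K\<^esub> else \<zero>\<^bsub>K\<^esub>)"


section \<open>Tensor products over \<open>K\<close>\<close>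

type_synonym ('k, 'v, 'w) tensor = "('v \<times> 'w \<Rightarrow> 'k) set"

definition tensor_relations ::
  "('k, 'r) ring_scheme \<Rightarrow> ('k, 'v, 'm) module_scheme \<Rightarrow> ('k, 'w, 'n) module_scheme
    \<Rightarrow> ('v \<times> 'w \<Rightarrow> 'k) set"
  where "tensor_relations K V W =
    (let F = free_space K (carrier V \<times> carrier W); g = \<lambda>v w. generator K (v, w) in
      {g (v \<oplus>\<^bsub>V\<^esub> v') w \<ominus>\<^bsub>F\<^esub> (g v w \<oplus>\<^bsub>F\<^esub> g v' w) |v v' w.
         v \<in> carrier V \<and> v' \<in> carrier V \<and> w \<in> carrier W} \<union>
      {g v (w \<oplus>\<^bsub>W\<^esub> w') \<ominus>\<^bsub>F\<^esub> (g v w \<oplus>\<^bsub>F\<^esub> g v w') |v w w'.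
         v \<in> carrier V \<and> w \<in> carrier W \<and> w' \<in> carrier W} \<union>
      {g (c \<odot>\<^bsub>V\<^esub> v) w \<ominus>\<^bsub>F\<^esub> c \<odot>\<^bsub>F\<^esub> g v w |c v w.
         c \<in> carrier K \<and> v \<in> carrier V \<and> w \<in> carrier W} \<union>
      {g v (c \<odot>\<^bsub>W\<^esub> w) \<ominus>\<^bsub>F\<^esub> c \<odot>\<^bsub>F\<^esub> g v w |c v w.
         c \<in> carrier K \<and> v \<in> carrier V \<and> w \<in> carrier W})"

definition tensor_kernel ::
  "('k, 'r) ring_scheme \<Rightarrow> ('k, 'v, 'm) module_scheme \<Rightarrow> ('k, 'w, 'n) module_scheme
    \<Rightarrow> ('v \<times> 'w \<Rightarrow> 'k) set"
  where "tensor_kernel K V W =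
    LinearCombinations.module.span K (free_space K (carrier V \<times> carrier W)) (tensor_relations K V W)"

definition tensor_space ::
  "('k, 'r) ring_scheme \<Rightarrow> ('k, 'v, 'm) module_scheme \<Rightarrow> ('k, 'w, 'n) module_scheme
    \<Rightarrow> ('k, ('k, 'v, 'w) tensor) module"
  where "tensor_space K V W =
    quotient (free_space K (carrier V \<times> carrier W)) (tensor_kernel K V W)"

definition tens ::
  "('k, 'r) ring_scheme \<Rightarrow> ('k, 'v, 'm) module_scheme \<Rightarrow> ('k, 'w, 'n) module_scheme
    \<Rightarrow> 'v \<Rightarrow> 'w \<Rightarrow> ('k, 'v, 'w) tensor"
  where "tens K V W v w =
    tensor_kernel K V W +>\<^bsub>free_space K (carrier V \<times> carrier W)\<^esub> generator K (v, w)"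

text \<open>For a bilinear \<open>\<beta>\<close> with values in \<open>Z\<close>, \<open>tensor_lift K Z \<beta>\<close> is the linear map sending
  \<open>v \<otimes> w\<close> to \<open>\<beta> v w\<close>; its value does not depend on the representative \<open>u\<close>.  Sumless Sweedler
  expressions are written with it: \<open>\<beta> h\<^sub>(\<^sub>1\<^sub>) h\<^sub>(\<^sub>2\<^sub>)\<close> is \<open>tensor_lift K Z \<beta> (comult H h)\<close>.\<close>

definition tensor_lift ::
  "('k, 'r) ring_scheme \<Rightarrow> ('k, 'z, 'n) module_scheme \<Rightarrow> ('v \<Rightarrow> 'w \<Rightarrow> 'z)
    \<Rightarrow> ('k, 'v, 'w) tensor \<Rightarrow> 'z"
  where "tensor_lift K Z \<beta> t =
    (let u = (SOME u. u \<in> t) in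
      finsum Z (\<lambda>p. u p \<odot>\<^bsub>Z\<^esub> \<beta> (fst p) (snd p)) {p. u p \<noteq> \<zero>\<^bsub>K\<^esub>})"

definition tensor_map ::
  "('k, 'r) ring_scheme \<Rightarrow> ('k, 'c, 'm) module_scheme \<Rightarrow> ('k, 'd, 'n) module_scheme
    \<Rightarrow> ('v \<Rightarrow> 'c) \<Rightarrow> ('w \<Rightarrow> 'd) \<Rightarrow> ('k, 'v, 'w) tensor \<Rightarrow> ('k, 'c, 'd) tensor"
  where "tensor_map K V' W' f g =
    tensor_lift K (tensor_space K V' W') (\<lambda>v w. tens K V' W' (f v) (g w))"

text \<open>The associativity isomorphism from \<open>U \<otimes> (V \<otimes> W)\<close> to \<open>(U \<otimes> V) \<otimes> W\<close>.\<close>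

definition tensor_assoc ::
  "('k, 'r) ring_scheme \<Rightarrow> ('k, 'u, 'l) module_scheme \<Rightarrow> ('k, 'v, 'm) module_scheme
    \<Rightarrow> ('k, 'w, 'n) module_scheme
    \<Rightarrow> ('k, 'u, ('k, 'v, 'w) tensor) tensor \<Rightarrow> ('k, ('k, 'u, 'v) tensor, 'w) tensor"
  where "tensor_assoc K U V W =
    (let UV = tensor_space K U V; UVW = tensor_space K UV W in
      tensor_lift K UVW (\<lambda>u.
        tensor_lift K UVW (\<lambda>v w. tens K UV W (tens K U V u v) w)))"

definition tensor_alg ::
  "('k, 'r) ring_scheme \<Rightarrow> ('k, 'a, 'm) module_scheme \<Rightarrow> ('k, 'b, 'n) module_scheme
    \<Rightarrow> ('k, ('k, 'a, 'b) tensor) module"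
  where "tensor_alg K A B =
    (let T = tensor_space K A B in
      T\<lparr>monoid.mult := \<lambda>t t'. tensor_lift K T (\<lambda>a b.
          tensor_lift K T (\<lambda>a' b'. tens K A B (a \<otimes>\<^bsub>A\<^esub> a') (b \<otimes>\<^bsub>B\<^esub> b')) t') t,
        one := tens K A B \<one>\<^bsub>A\<^esub> \<one>\<^bsub>B\<^esub>\<rparr>)"


section \<open>Bialgebras, Hopf algebras and comodule algebras\<close>

record ('k, 'h) bialg = "('k, 'h) module" +
  comult :: "'h \<Rightarrow> ('k, 'h, 'h) tensor"
  counit :: "'h \<Rightarrow> 'k"

record ('k, 'h) hopf = "('k, 'h) bialg" +
  antipode :: "'h \<Rightarrow> 'h"

locale coalgebra = vectorspace K C
  for K :: "('k, 'r) ring_scheme" (structure) and C :: "('k, 'c, 'm) bialg_scheme" (structure) +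
  assumes comult_linear: "linear_map K C (tensor_space K C C) (comult C)"
    and counit_linear: "linear_map K C (scalars K) (counit C)"
    and coassoc: "c \<in> carrier C \<Longrightarrow>
      tensor_map K (tensor_space K C C) C (comult C) id (comult C c) =
      tensor_assoc K C C C (tensor_map K C (tensor_space K C C) id (comult C) (comult C c))"
    and counit_left: "c \<in> carrier C \<Longrightarrow>
      tensor_lift K C (\<lambda>x y. counit C x \<odot>\<^bsub>C\<^esub> y) (comult C c) = c"
    and counit_right: "c \<in> carrier C \<Longrightarrow>
      tensor_lift K C (\<lambda>x y. counit C y \<odot>\<^bsub>C\<^esub> x) (comult C c) = c"

locale bialgebra = coalgebra K H + assoc_algebra K H
  for K :: "('k, 'r) ring_scheme" (structure) and H :: "('k, 'h, 'm) bialg_scheme" (structure) +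
  assumes comult_hom: "comult H \<in> alg_hom K H (tensor_alg K H H)"
    and counit_hom: "counit H \<in> alg_hom K H (scalars K)"

locale hopf_algebra = bialgebra K H
  for K :: "('k, 'r) ring_scheme" (structure) and H :: "('k, 'h, 'm) hopf_scheme" (structure) +
  assumes antipode_linear: "linear_map K H H (antipode H)"
    and antipode_left: "h \<in> carrier H \<Longrightarrow>
      tensor_lift K H (\<lambda>x y. antipode H x \<otimes>\<^bsub>H\<^esub> y) (comult H h) = counit H h \<odot>\<^bsub>H\<^esub> \<one>\<^bsub>H\<^esub>"
    and antipode_right: "h \<in> carrier H \<Longrightarrow>
      tensor_lift K H (\<lambda>x y. x \<otimes>\<^bsub>H\<^esub> antipode H y) (comult H h) = counit H h \<odot>\<^bsub>H\<^esub> \<one>\<^bsub>H\<^esub>"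

text \<open>Only meaningful when the antipode is bijective, which is automatic in finite dimension.\<close>

definition antipode_inv :: "('k, 'h, 'm) hopf_scheme \<Rightarrow> 'h \<Rightarrow> 'h"
  where "antipode_inv H = inv_into (carrier H) (antipode H)"

locale left_comodule_algebra = H: bialgebra K H + A: assoc_algebra K A
  for K :: "('k, 'r) ring_scheme" (structure) and H :: "('k, 'h, 'm) bialg_scheme"
    and A :: "('k, 'a, 'n) module_scheme" +
  fixes \<rho> :: "'a \<Rightarrow> ('k, 'h, 'a) tensor"
  assumes coaction_hom: "\<rho> \<in> alg_hom K A (tensor_alg K H A)"
    and coaction_coassoc: "a \<in> carrier A \<Longrightarrow>
      tensor_map K (tensor_space K H H) A (comult H) id (\<rho> a) =
      tensor_assoc K H H A (tensor_map K H (tensor_space K H A) id \<rho> (\<rho> a))"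
    and coaction_counit: "a \<in> carrier A \<Longrightarrow>
      tensor_lift K A (\<lambda>h b. counit H h \<odot>\<^bsub>A\<^esub> b) (\<rho> a) = a"

definition leg12 :: "('k, 'r) ring_scheme \<Rightarrow> ('k, 'h, 'm) module_scheme \<Rightarrow> ('k, 'h, 'h) tensor
    \<Rightarrow> ('k, ('k, 'h, 'h) tensor, 'h) tensor"
  where "leg12 K H = (let HH = tensor_space K H H in
    tensor_lift K (tensor_space K HH H) (\<lambda>s t. tens K HH H (tens K H H s t) \<one>\<^bsub>H\<^esub>))"

definition leg13 :: "('k, 'r) ring_scheme \<Rightarrow> ('k, 'h, 'm) module_scheme \<Rightarrow> ('k, 'h, 'h) tensor
    \<Rightarrow> ('k, ('k, 'h, 'h) tensor, 'h) tensor"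
  where "leg13 K H = (let HH = tensor_space K H H in
    tensor_lift K (tensor_space K HH H) (\<lambda>s t. tens K HH H (tens K H H s \<one>\<^bsub>H\<^esub>) t))"

definition leg23 :: "('k, 'r) ring_scheme \<Rightarrow> ('k, 'h, 'm) module_scheme \<Rightarrow> ('k, 'h, 'h) tensor
    \<Rightarrow> ('k, ('k, 'h, 'h) tensor, 'h) tensor"
  where "leg23 K H = (let HH = tensor_space K H H in
    tensor_lift K (tensor_space K HH H) (\<lambda>s t. tens K HH H (tens K H H \<one>\<^bsub>H\<^esub> s) t))"

definition comult_op :: "('k, 'r) ring_scheme \<Rightarrow> ('k, 'h, 'm) bialg_scheme \<Rightarrow> 'h
    \<Rightarrow> ('k, 'h, 'h) tensor"
  where "comult_op K H h =
    tensor_lift K (tensor_space K H H) (\<lambda>x y. tens K H H y x) (comult H h)"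

locale quasitriangular_hopf_algebra = hopf_algebra K H
  for K :: "('k, 'r) ring_scheme" (structure) and H :: "('k, 'h, 'm) hopf_scheme" (structure) +
  fixes R :: "('k, 'h, 'h) tensor"
  assumes R_invertible: "R \<in> Units (tensor_alg K H H)"
    and R_comult_left:
      "tensor_map K (tensor_space K H H) H (comult H) id R =
        leg13 K H R \<otimes>\<^bsub>tensor_alg K (tensor_alg K H H) H\<^esub> leg23 K H R"
    and R_comult_right:
      "tensor_assoc K H H H (tensor_map K H (tensor_space K H H) id (comult H) R) =
        leg13 K H R \<otimes>\<^bsub>tensor_alg K (tensor_alg K H H) H\<^esub> leg12 K H R"
    and R_intertwines: "h \<in> carrier H \<Longrightarrow>
      R \<otimes>\<^bsub>tensor_alg K H H\<^esub> comult H h = comult_op K H h \<otimes>\<^bsub>tensor_alg K H H\<^esub> R"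


section \<open>The dual space and its structures\<close>

text \<open>Linear functionals are extensional functions on the carrier.\<close>

definition dual_space ::
  "('k, 'r) ring_scheme \<Rightarrow> ('k, 'v, 'm) module_scheme \<Rightarrow> ('k, 'v \<Rightarrow> 'k) module"
  where "dual_space K V =
    \<lparr>carrier = {\<xi> \<in> carrier V \<rightarrow>\<^sub>E carrier K. linear_map K V (scalars K) \<xi>},
     monoid.mult = undefined, one = undefined,
     zero = (\<lambda>v\<in>carrier V. \<zero>\<^bsub>K\<^esub>), add = \<lambda>\<xi> \<zeta>. \<lambda>v\<in>carrier V. \<xi> v \<oplus>\<^bsub>K\<^esub> \<zeta> v,
     smult = \<lambda>c \<xi>. \<lambda>v\<in>carrier V. c \<otimes>\<^bsub>K\<^esub> \<xi> v\<rparr>"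

text \<open>The convolution algebra dual to a coalgebra:
  \<open>\<langle>\<xi>\<zeta>, c\<rangle> = \<langle>\<xi>, c\<^sub>(\<^sub>1\<^sub>)\<rangle>\<langle>\<zeta>, c\<^sub>(\<^sub>2\<^sub>)\<rangle>\<close>.\<close>

definition dual_alg ::
  "('k, 'r) ring_scheme \<Rightarrow> ('k, 'c, 'm) bialg_scheme \<Rightarrow> ('k, 'c \<Rightarrow> 'k) module"
  where "dual_alg K C = (dual_space K C)
    \<lparr>monoid.mult := \<lambda>\<xi> \<zeta>. \<lambda>c\<in>carrier C.
        tensor_lift K (scalars K) (\<lambda>x y. \<xi> x \<otimes>\<^bsub>K\<^esub> \<zeta> y) (comult C c),
     one := (\<lambda>c\<in>carrier C. counit C c)\<rparr>"

text \<open>The coproduct of the dual of a finite-dimensional algebra, determined by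
  \<open>\<langle>\<xi>, h\<ell>\<rangle> = \<langle>\<xi>\<^sub>(\<^sub>1\<^sub>), h\<rangle>\<langle>\<xi>\<^sub>(\<^sub>2\<^sub>), \<ell>\<rangle>\<close>.\<close>

definition dual_comult ::
  "('k, 'r) ring_scheme \<Rightarrow> ('k, 'h, 'm) module_scheme \<Rightarrow> ('h \<Rightarrow> 'k)
    \<Rightarrow> ('k, 'h \<Rightarrow> 'k, 'h \<Rightarrow> 'k) tensor"
  where "dual_comult K H \<xi> =
    (THE t. t \<in> carrier (tensor_space K (dual_space K H) (dual_space K H)) \<and>
      (\<forall>h\<in>carrier H. \<forall>l\<in>carrier H.
        tensor_lift K (scalars K) (\<lambda>\<xi>' \<xi>''. \<xi>' h \<otimes>\<^bsub>K\<^esub> \<xi>'' l) t = \<xi> (h \<otimes>\<^bsub>H\<^esub> l)))"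

definition left_act :: "('k, 'h, 'm) module_scheme \<Rightarrow> 'h \<Rightarrow> ('h \<Rightarrow> 'k) \<Rightarrow> 'h \<Rightarrow> 'k"
  where "left_act H h \<xi> = (\<lambda>h'\<in>carrier H. \<xi> (h' \<otimes>\<^bsub>H\<^esub> h))"

definition right_act :: "('k, 'h, 'm) module_scheme \<Rightarrow> ('h \<Rightarrow> 'k) \<Rightarrow> 'h \<Rightarrow> 'h \<Rightarrow> 'k"
  where "right_act H \<xi> h = (\<lambda>h'\<in>carrier H. \<xi> (h \<otimes>\<^bsub>H\<^esub> h'))"

locale dual_bases = vectorspace K V
  for K :: "('k, 'r) ring_scheme" (structure) and V :: "('k, 'v, 'm) module_scheme" (structure) +
  fixes D :: "'d set" and h :: "'d \<Rightarrow> 'v" and \<xi> :: "'d \<Rightarrow> 'v \<Rightarrow> 'k"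
  assumes finite_index: "finite D"
    and inj: "inj_on h D"
    and basis: "basis (h ` D)"
    and functional: "d \<in> D \<Longrightarrow> \<xi> d \<in> carrier (dual_space K V)"
    and pairing: "\<lbrakk>d \<in> D; e \<in> D\<rbrakk> \<Longrightarrow> \<xi> d (h e) = (if d = e then \<one>\<^bsub>K\<^esub> else \<zero>\<^bsub>K\<^esub>)"


section \<open>The Drinfeld double\<close>

text \<open>\<open>drin_cross K H h \<xi>\<close> is the element
  \<open>(h\<^sub>(\<^sub>3\<^sub>) \<twoheadrightarrow> \<xi> \<twoheadleftarrow> S(h\<^sub>(\<^sub>1\<^sub>))) h\<^sub>(\<^sub>2\<^sub>)\<close> of \<open>H\<^sup>* \<otimes> H\<close>.\<close>

definition drin_cross ::
  "('k, 'r) ring_scheme \<Rightarrow> ('k, 'h, 'm) hopf_scheme \<Rightarrow> 'h \<Rightarrow> ('h \<Rightarrow> 'k)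
    \<Rightarrow> ('k, 'h \<Rightarrow> 'k, 'h) tensor"
  where "drin_cross K H h \<xi> =
    (let T = tensor_space K (dual_space K H) H in
      tensor_lift K T (\<lambda>x h3.
        tensor_lift K T (\<lambda>h1 h2.
          tens K (dual_space K H) H
            (left_act H h3 (right_act H \<xi> (antipode H h1))) h2)
          (comult H x))
        (comult H h))"

text \<open>The product is
  \<open>(\<xi>h)(\<zeta>\<ell>) = \<xi> (h\<^sub>(\<^sub>3\<^sub>) \<twoheadrightarrow> \<zeta> \<twoheadleftarrow> S(h\<^sub>(\<^sub>1\<^sub>))) h\<^sub>(\<^sub>2\<^sub>) \<ell>\<close>,
  where the functionals are multiplied in the opposite of \<open>H\<^sup>*\<close>.  The antipode is not recorded:
  it is determined by the bialgebra structure, and comodule algebras do not refer to it.\<close>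

definition drinfeld_double ::
  "('k, 'r) ring_scheme \<Rightarrow> ('k, 'h, 'm) hopf_scheme \<Rightarrow> ('k, ('k, 'h \<Rightarrow> 'k, 'h) tensor) bialg"
  where "drinfeld_double K H =
    (let Hd = opposite (dual_alg K H); T = tensor_space K (dual_space K H) H;
         p = tens K (dual_space K H) H; TT = tensor_space K T T in
      \<lparr>carrier = carrier T,
       monoid.mult = \<lambda>u v.
         tensor_lift K T (\<lambda>\<xi> h.
           tensor_lift K T (\<lambda>\<zeta> l.
             tensor_lift K T (\<lambda>\<zeta>' h'. p (\<xi> \<otimes>\<^bsub>Hd\<^esub> \<zeta>') (h' \<otimes>\<^bsub>H\<^esub> l)) (drin_cross K H h \<zeta>)) v) u,
       one = p \<one>\<^bsub>Hd\<^esub> \<one>\<^bsub>H\<^esub>,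
       zero = \<zero>\<^bsub>T\<^esub>, add = add T, smult = smult T,
       comult = tensor_lift K TT (\<lambda>\<xi> h.
         tensor_lift K TT (\<lambda>\<xi>1 \<xi>2.
           tensor_lift K TT (\<lambda>h1 h2. tens K T T (p \<xi>1 h1) (p \<xi>2 h2)) (comult H h))
           (dual_comult K H \<xi>)),
       counit = tensor_lift K (scalars K) (\<lambda>\<xi> h. \<xi> \<one>\<^bsub>H\<^esub> \<otimes>\<^bsub>K\<^esub> counit H h)\<rparr>)"

definition drin_incl ::
  "('k, 'r) ring_scheme \<Rightarrow> ('k, 'h, 'm) hopf_scheme \<Rightarrow> 'h \<Rightarrow> ('k, 'h \<Rightarrow> 'k, 'h) tensor"
  where "drin_incl K H h = tens K (dual_space K H) H \<one>\<^bsub>dual_alg K H\<^esub> h"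


section \<open>Free products of algebras\<close>

text \<open>The free algebra on \<open>Y\<close>: words in \<open>Y\<close> form a basis, and the product concatenates words.\<close>

definition free_alg :: "('k, 'r) ring_scheme \<Rightarrow> 'x set \<Rightarrow> ('k, 'x list \<Rightarrow> 'k) module"
  where "free_alg K Y = (free_space K (lists Y))
    \<lparr>monoid.mult := \<lambda>f g w. finsum K (\<lambda>i. f (take i w) \<otimes>\<^bsub>K\<^esub> g (drop i w)) {..length w},
     one := generator K []\<rparr>"

text \<open>The elements of \<open>F\<close> that have to vanish for \<open>j\<close> to become a homomorphism of algebras.\<close>

definition hom_relations ::
  "('k, 'r) ring_scheme \<Rightarrow> ('k, 'a, 'm) module_scheme \<Rightarrow> ('k, 'f, 'n) module_scheme
    \<Rightarrow> ('a \<Rightarrow> 'f) \<Rightarrow> 'f set"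
  where "hom_relations K A F j =
    {j (a \<oplus>\<^bsub>A\<^esub> b) \<ominus>\<^bsub>F\<^esub> (j a \<oplus>\<^bsub>F\<^esub> j b) |a b. a \<in> carrier A \<and> b \<in> carrier A} \<union>
    {j (c \<odot>\<^bsub>A\<^esub> a) \<ominus>\<^bsub>F\<^esub> c \<odot>\<^bsub>F\<^esub> j a |c a. c \<in> carrier K \<and> a \<in> carrier A} \<union>
    {j (a \<otimes>\<^bsub>A\<^esub> b) \<ominus>\<^bsub>F\<^esub> j a \<otimes>\<^bsub>F\<^esub> j b |a b. a \<in> carrier A \<and> b \<in> carrier A} \<union>
    {j \<one>\<^bsub>A\<^esub> \<ominus>\<^bsub>F\<^esub> \<one>\<^bsub>F\<^esub>}"

definition free_product_cover ::
  "('k, 'r) ring_scheme \<Rightarrow> ('k, 'a, 'm) module_scheme \<Rightarrow> ('k, 'b, 'n) module_scheme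
    \<Rightarrow> ('k, ('a + 'b) list \<Rightarrow> 'k) module"
  where "free_product_cover K A B = free_alg K (Inl ` carrier A \<union> Inr ` carrier B)"

definition free_product_ideal ::
  "('k, 'r) ring_scheme \<Rightarrow> ('k, 'a, 'm) module_scheme \<Rightarrow> ('k, 'b, 'n) module_scheme
    \<Rightarrow> (('a + 'b) list \<Rightarrow> 'k) set"
  where "free_product_ideal K A B =
    genideal (free_product_cover K A B)
     (hom_relations K A (free_product_cover K A B) (\<lambda>a. generator K [Inl a]) \<union>
      hom_relations K B (free_product_cover K A B) (\<lambda>b. generator K [Inr b]))"

definition free_product ::
  "('k, 'r) ring_scheme \<Rightarrow> ('k, 'a, 'm) module_scheme \<Rightarrow> ('k, 'b, 'n) module_scheme
    \<Rightarrow> ('k, (('a + 'b) list \<Rightarrow> 'k) set) module"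
  where "free_product K A B = quotient (free_product_cover K A B) (free_product_ideal K A B)"

definition free_inl ::
  "('k, 'r) ring_scheme \<Rightarrow> ('k, 'a, 'm) module_scheme \<Rightarrow> ('k, 'b, 'n) module_scheme
    \<Rightarrow> 'a \<Rightarrow> (('a + 'b) list \<Rightarrow> 'k) set"
  where "free_inl K A B a =
    free_product_ideal K A B +>\<^bsub>free_product_cover K A B\<^esub> generator K [Inl a]"

definition free_inr ::
  "('k, 'r) ring_scheme \<Rightarrow> ('k, 'a, 'm) module_scheme \<Rightarrow> ('k, 'b, 'n) module_scheme
    \<Rightarrow> 'b \<Rightarrow> (('a + 'b) list \<Rightarrow> 'k) set"
  where "free_inr K A B b =
    free_product_ideal K A B +>\<^bsub>free_product_cover K A B\<^esub> generator K [Inr b]"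


section \<open>The reflective algebra\<close>

text \<open>\<open>hat K H R\<close> is \<open>H\<close> with its comultiplication replaced by
  \<open>h \<mapsto> \<Sum>i j. t\<^sub>j h\<^sub>(\<^sub>1\<^sub>) t\<^sub>i \<otimes> h\<^sub>(\<^sub>2\<^sub>) s\<^sub>i S\<^sup>-\<^sup>1(s\<^sub>j)\<close>.  Only its coalgebra structure
  is used: the product of \<open>H\<close>, still present in the record, is not compatible with it.\<close>

definition hat ::
  "('k, 'r) ring_scheme \<Rightarrow> ('k, 'h, 'm) hopf_scheme \<Rightarrow> ('k, 'h, 'h) tensor
    \<Rightarrow> ('k, 'h, 'm) hopf_scheme"
  where "hat K H R = H\<lparr>comult := \<lambda>h.
    (let T = tensor_space K H H in
      tensor_lift K T (\<lambda>si ti.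
        tensor_lift K T (\<lambda>sj tj.
          tensor_lift K T (\<lambda>h1 h2.
            tens K H H (tj \<otimes>\<^bsub>H\<^esub> h1 \<otimes>\<^bsub>H\<^esub> ti) (h2 \<otimes>\<^bsub>H\<^esub> si \<otimes>\<^bsub>H\<^esub> antipode_inv H sj))
            (comult H h)) R) R)\<rparr>"

definition hat_act ::
  "('k, 'r) ring_scheme \<Rightarrow> ('k, 'h, 'm) hopf_scheme \<Rightarrow> 'h \<Rightarrow> 'h \<Rightarrow> 'h"
  where "hat_act K H l h =
    tensor_lift K H (\<lambda>l1 l2. l2 \<otimes>\<^bsub>H\<^esub> h \<otimes>\<^bsub>H\<^esub> antipode_inv H l1) (comult H l)"

definition hat_dual_act ::
  "('k, 'r) ring_scheme \<Rightarrow> ('k, 'h, 'm) hopf_scheme \<Rightarrow> ('h \<Rightarrow> 'k) \<Rightarrow> 'h \<Rightarrow> 'h \<Rightarrow> 'k"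
  where "hat_dual_act K H \<xi> l = (\<lambda>h\<in>carrier H. \<xi> (hat_act K H l h))"

definition hat_dual_op ::
  "('k, 'r) ring_scheme \<Rightarrow> ('k, 'h, 'm) hopf_scheme \<Rightarrow> ('k, 'h, 'h) tensor
    \<Rightarrow> ('k, 'h \<Rightarrow> 'k) module"
  where "hat_dual_op K H R = opposite (dual_alg K (hat K H R))"

text \<open>The relations are \<open>\<xi> a = a\<^sub>[\<^sub>0\<^sub>] (\<xi> \<leftharpoonup> a\<^sub>[\<^sub>-\<^sub>1\<^sub>])\<close>.\<close>

definition reflective_ideal ::
  "('k, 'r) ring_scheme \<Rightarrow> ('k, 'h, 'm) hopf_scheme \<Rightarrow> ('k, 'h, 'h) tensor
    \<Rightarrow> ('k, 'a, 'n) module_scheme \<Rightarrow> ('a \<Rightarrow> ('k, 'h, 'a) tensor)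
    \<Rightarrow> (('a + ('h \<Rightarrow> 'k)) list \<Rightarrow> 'k) set set"
  where "reflective_ideal K H R A \<rho> =
    (let B = hat_dual_op K H R; P = free_product K A B; l = free_inl K A B; r = free_inr K A B in
      genideal P
       {r \<xi> \<otimes>\<^bsub>P\<^esub> l a \<ominus>\<^bsub>P\<^esub>
          tensor_lift K P (\<lambda>h b. l b \<otimes>\<^bsub>P\<^esub> r (hat_dual_act K H \<xi> h)) (\<rho> a) |\<xi> a.
        \<xi> \<in> carrier B \<and> a \<in> carrier A})"

definition reflective_alg ::
  "('k, 'r) ring_scheme \<Rightarrow> ('k, 'h, 'm) hopf_scheme \<Rightarrow> ('k, 'h, 'h) tensor
    \<Rightarrow> ('k, 'a, 'n) module_scheme \<Rightarrow> ('a \<Rightarrow> ('k, 'h, 'a) tensor)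
    \<Rightarrow> ('k, (('a + ('h \<Rightarrow> 'k)) list \<Rightarrow> 'k) set set) module"
  where "reflective_alg K H R A \<rho> =
    quotient (free_product K A (hat_dual_op K H R)) (reflective_ideal K H R A \<rho>)"

definition reflective_inl ::
  "('k, 'r) ring_scheme \<Rightarrow> ('k, 'h, 'm) hopf_scheme \<Rightarrow> ('k, 'h, 'h) tensor
    \<Rightarrow> ('k, 'a, 'n) module_scheme \<Rightarrow> ('a \<Rightarrow> ('k, 'h, 'a) tensor)
    \<Rightarrow> 'a \<Rightarrow> (('a + ('h \<Rightarrow> 'k)) list \<Rightarrow> 'k) set set"
  where "reflective_inl K H R A \<rho> a =
    reflective_ideal K H R A \<rho> +>\<^bsub>free_product K A (hat_dual_op K H R)\<^esub>
      free_inl K A (hat_dual_op K H R) a"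

definition reflective_inr ::
  "('k, 'r) ring_scheme \<Rightarrow> ('k, 'h, 'm) hopf_scheme \<Rightarrow> ('k, 'h, 'h) tensor
    \<Rightarrow> ('k, 'a, 'n) module_scheme \<Rightarrow> ('a \<Rightarrow> ('k, 'h, 'a) tensor)
    \<Rightarrow> ('h \<Rightarrow> 'k) \<Rightarrow> (('a + ('h \<Rightarrow> 'k)) list \<Rightarrow> 'k) set set"
  where "reflective_inr K H R A \<rho> \<xi> =
    reflective_ideal K H R A \<rho> +>\<^bsub>free_product K A (hat_dual_op K H R)\<^esub>
      free_inr K A (hat_dual_op K H R) \<xi>"

end

theory Submission
 imports Defs
begin

text \<open>The coaction is conjugation-like: with \<open>U = R\<^sub>1\<^sub>3 X W\<close>, where \<open>X = \<Sum>\<xi>\<^sub>d \<otimes> h\<^sub>d\<close> is the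
  canonical element of the reflective algebra and \<open>W = \<Sum>\<xi>\<^sub>d \<otimes> S\<^sup>-\<^sup>1(h\<^sub>d)\<close> that of the double, it sends
  \<open>\<xi>\<close> to the evaluation of the last leg of \<open>U \<in> Drin(H) \<otimes> R\<^sub>H(A) \<otimes> H\<close> at \<open>\<xi>\<close>.  In these terms the
  product of the reflective algebra is the reflection equation
  \<open>X\<^sub>3 R\<^sub>3\<^sub>4 X\<^sub>4 = \<Delta>\<^sup>o\<^sup>p(X) R\<^sub>3\<^sub>4\<close>, and the claim that \<open>U\<close> satisfies the same equation reduces to the
  hexagon axioms for \<open>R\<close> and the cross relation of the double in the form
  \<open>W\<^sub>3 R\<^sub>3\<^sub>4 R\<^sub>4 = R\<^sub>4 R\<^sub>3\<^sub>4 W\<^sub>3\<close>.  The defining relations with \<open>A\<close> hold because \<open>U\<close> commutes with the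
  images of \<open>A\<close>.\<close>

text \<open>The stated formula dictates \<open>U\<close>: its argument t h' S^-1(h) is the product
  of the H-legs of R, X and W, and the other legs are s \<xi>_d in the double and \<xi>_d' in the
  reflective algebra. Evaluation at one functional is not multiplicative, so products are compared
  in M \<otimes> H \<otimes> H. There a pairing \<open>Th\<close> cancels R_34 in U_3 R_34 U_4 and
  turns \<Delta>^op(U) R_34 into the pairing with a product of reflective functionals, because the
  coproduct of H-hat is \<Delta> twisted by just these copies of R. The coaction is induced through
  the presentation of R_H(A); coassociativity, counit and uniqueness are tested on the products a
  \<xi>, which span. Two inputs are only implicit in the data: S^-1 is a mere choice until S is
  shown bijective, by the Drinfeld element and finite dimension, and the double is a bare record
  whose bialgebra axioms must be derived. Sweedler sums are values of \<open>tensor_lift\<close>,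
  computed on a chosen representative, so each exchange of sums rests on bilinearity, discharged by
  rule collections.\<close>

abbreviation (input) in_carrier (infix ".:" 50)
 where "x .: V \<equiv> x \<in> carrier V"

section \<open>Linear and bilinear maps between module records\<close>

locale field_base = field K for K :: "('k, 'r) ring_scheme" (structure)
begin

abbreviation vs where "vs \<equiv> vectorspace K"
abbreviation alg where "alg \<equiv> assoc_algebra K"
abbreviation lift where "lift \<equiv> tensor_lift K"
abbreviation tsp where "tsp \<equiv> tensor_space K"

text \<open>Unlike \<open>linear_map\<close>, this records no vector space axioms for source and
  target. It depends only on carriers, addition and scalar multiplication, so it transfers between
  records that share them and can be proved along the syntax of an expression.\<close>

definition lin :: "('k, 'v, 'm) module_scheme \<Rightarrow> ('k, 'w, 'n) module_scheme \<Rightarrow> ('v \<Rightarrow> 'w) \<Rightarrow> bool"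
 where "lin V W f \<longleftrightarrow> (\<forall>x\<in>carrier V. f x .: W) \<and>
  (\<forall>x\<in>carrier V. \<forall>y\<in>carrier V. f (x \<oplus>\<^bsub>V\<^esub> y) = f x \<oplus>\<^bsub>W\<^esub> f y) \<and>
  (\<forall>c\<in>carrier K. \<forall>x\<in>carrier V. f (c \<odot>\<^bsub>V\<^esub> x) = c \<odot>\<^bsub>W\<^esub> f x)"

definition bil :: "('k, 'u, 'l) module_scheme \<Rightarrow> ('k, 'v, 'm) module_scheme
  \<Rightarrow> ('k, 'w, 'n) module_scheme \<Rightarrow> ('u \<Rightarrow> 'v \<Rightarrow> 'w) \<Rightarrow> bool"
 where "bil U V W f \<longleftrightarrow> (\<forall>u\<in>carrier U. lin V W (f u)) \<and> (\<forall>v\<in>carrier V. lin U W (%u. f u v))"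

lemma linI:
 assumes "!!x. x .: V ==> f x .: W"
  and "!!x y. [|x .: V; y .: V|] ==> f (x \<oplus>\<^bsub>V\<^esub> y) = f x \<oplus>\<^bsub>W\<^esub> f y"
  and "!!c x. [|c .: K; x .: V|] ==> f (c \<odot>\<^bsub>V\<^esub> x) = c \<odot>\<^bsub>W\<^esub> f x"
 shows "lin V W f"
 using assms by (simp add: lin_def)

lemma lin_closed: "[|lin V W f; x .: V|] ==> f x .: W"
 and lin_add: "[|lin V W f; x .: V; y .: V|] ==> f (x \<oplus>\<^bsub>V\<^esub> y) = f x \<oplus>\<^bsub>W\<^esub> f y"
 and lin_smult: "[|lin V W f; c .: K; x .: V|] ==> f (c \<odot>\<^bsub>V\<^esub> x) = c \<odot>\<^bsub>W\<^esub> f x"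
 by (simp_all add: lin_def)

lemma bilI:
 assumes "!!u. u .: U ==> lin V W (f u)" and "!!v. v .: V ==> lin U W (%u. f u v)"
 shows "bil U V W f"
 using assms by (simp add: bil_def)

lemma bil1: "[|bil U V W f; u .: U|] ==> lin V W (f u)"
 and bil2: "[|bil U V W f; v .: V|] ==> lin U W (%u. f u v)"
 by (simp_all add: bil_def)

lemma bil_closed: "[|bil U V W f; u .: U; v .: V|] ==> f u v .: W"
 by (meson bil1 lin_closed)

lemma lin_cong:
 assumes "!!x. x .: V ==> f x = g x" and "vs V"
 shows "lin V W f = lin V W g"
proof -
 interpret V: vectorspace K V by fact
 show ?thesis using assms(1) by (auto simp: lin_def)
qed

lemma lin_id: "lin V V (%x. x)"
 by (simp add: lin_def)

lemma lin_compose: "[|lin V W f; lin U V g|] ==> lin U W (%x. f (g x))"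
 by (simp add: lin_def)

lemma vectorspace_iff_module: "vs V \<longleftrightarrow> module K V"
 using vectorspace_def field_axioms by blast

lemma vsD:
 assumes "vs V" shows "abelian_group V" "module K V"
proof -
 interpret V: vectorspace K V by fact
 show "abelian_group V" "module K V" by unfold_locales
qed

lemma vsI:
 assumes "abelian_group V"
  and "!!a x. [|a .: K; x .: V|] ==> a \<odot>\<^bsub>V\<^esub> x .: V"
  and "!!a b x. [|a .: K; b .: K; x .: V|] ==>
   (a \<oplus> b) \<odot>\<^bsub>V\<^esub> x = a \<odot>\<^bsub>V\<^esub> x \<oplus>\<^bsub>V\<^esub> b \<odot>\<^bsub>V\<^esub> x"
  and "!!a x y. [|a .: K; x .: V; y .: V|] ==>
   a \<odot>\<^bsub>V\<^esub> (x \<oplus>\<^bsub>V\<^esub> y) = a \<odot>\<^bsub>V\<^esub> x \<oplus>\<^bsub>V\<^esub> a \<odot>\<^bsub>V\<^esub> y"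
  and "!!a b x. [|a .: K; b .: K; x .: V|] ==>
   (a \<otimes> b) \<odot>\<^bsub>V\<^esub> x = a \<odot>\<^bsub>V\<^esub> (b \<odot>\<^bsub>V\<^esub> x)"
  and "!!x. x .: V ==> \<one> \<odot>\<^bsub>V\<^esub> x = x"
 shows "vs V"
 unfolding vectorspace_iff_module
 by (rule moduleI) (use assms is_cring in auto)

lemma linear_map_iff: "linear_map K V W f \<longleftrightarrow> vs V \<and> vs W \<and> lin V W f"
proof
 assume "linear_map K V W f"
 then interpret linear_map K V W f .
 show "vectorspace K V \<and> vectorspace K W \<and> lin V W f"
  by (auto simp: lin_def V.vectorspace_axioms W.vectorspace_axioms)
next
 assume *: "vs V \<and> vs W \<and> lin V W f"
 then interpret V: vectorspace K V by simp
 interpret W: vectorspace K W using * by simp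
 show "linear_map K V W f"
  by unfold_locales (use * in \<open>auto simp: lin_def module_hom_def\<close>)
qed

lemma alg_hom_iff: "f \<in> alg_hom K A B \<longleftrightarrow> f \<in> ring_hom A B \<and> vs A \<and> vs B \<and> lin A B f"
 by (simp add: alg_hom_def linear_map_iff)

lemma lin_zero:
 assumes "vs V" "vs W" "lin V W f" shows "f \<zero>\<^bsub>V\<^esub> = \<zero>\<^bsub>W\<^esub>"
proof -
 interpret linear_map K V W f using assms by (simp add: linear_map_iff)
 show ?thesis by simp
qed

lemma lin_minus:
 assumes "vs V" "vs W" "lin V W f" "x .: V" "y .: V"
 shows "f (x \<ominus>\<^bsub>V\<^esub> y) = f x \<ominus>\<^bsub>W\<^esub> f y"
proof -
 interpret linear_map K V W f using assms by (simp add: linear_map_iff)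
 show ?thesis using assms by (simp add: M.minus_eq a_minus_def)
qed

lemma lin_finsum:
 assumes "vs V" "vs W" "lin V W f" "g \<in> S \<rightarrow> carrier V"
 shows "f (finsum V g S) = finsum W (%i. f (g i)) S"
proof -
 interpret V: vectorspace K V by fact
 interpret W: vectorspace K W by fact
 show ?thesis
 proof (cases "finite S")
  case True
  then show ?thesis using assms(4)
  proof induction
   case empty
   then show ?case using lin_zero[OF assms(1-3)] by simp
  next
   case (insert i S)
   then have "g \<in> S \<rightarrow> carrier V" "g i .: V" by auto
   moreover from this have "(%i. f (g i)) \<in> S \<rightarrow> carrier W" "f (g i) .: W"
    using assms(3) by (auto intro: lin_closed)
   ultimately show ?case using insert
    by (simp add: lin_add[OF assms(3)])
  qed
 qed (simp add: lin_zero[OF assms(1-3)])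
qed

lemma lin_plus:
 assumes "vs W" "lin V W f" "lin V W g"
 shows "lin V W (%x. f x \<oplus>\<^bsub>W\<^esub> g x)"
proof -
 interpret W: vectorspace K W by fact
 have "f x .: W" "g x .: W" if "x .: V" for x
  using assms that by (auto intro: lin_closed)
 then show ?thesis using assms
  by (intro linI) (auto simp: lin_add[of V W f] lin_add[of V W g] lin_smult[of V W f]
    lin_smult[of V W g] W.smult_r_distr W.M.add.m_ac)
qed

lemma lin_zero_map: "vs W ==> lin V W (%x. \<zero>\<^bsub>W\<^esub>)"
proof -
 assume "vs W"
 then interpret W: vectorspace K W .
 show ?thesis by (intro linI) auto
qed

lemma lin_smult_left:
 assumes "vs W" "lin V (scalars K) f" "w .: W"
 shows "lin V W (%x. f x \<odot>\<^bsub>W\<^esub> w)"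
proof -
 interpret W: vectorspace K W by fact
 show ?thesis using assms
  by (auto simp: lin_def scalars_def W.smult_l_distr W.smult_assoc1)
qed

lemma lin_smult_right:
 assumes "vs W" "lin V W f" "c .: K"
 shows "lin V W (%x. c \<odot>\<^bsub>W\<^esub> f x)"
proof -
 interpret W: vectorspace K W by fact
 have "c \<odot>\<^bsub>W\<^esub> (d \<odot>\<^bsub>W\<^esub> f x) = d \<odot>\<^bsub>W\<^esub> (c \<odot>\<^bsub>W\<^esub> f x)" if "d .: K" "x .: V" for d x
  using that assms by (metis W.smult_assoc1 lin_closed m_comm)
 then show ?thesis using assms
  by (auto simp: lin_def W.smult_r_distr)
qed

lemma vs_scalars: "vs (scalars K)"
 by (rule vsI) (auto simp: scalars_def m_assoc l_distr r_distr
   intro!: abelian_groupI a_assoc a_comm exI[of _ "\<ominus> _"] simp: l_neg bexI[of _ "\<ominus> _"])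

lemma scalars_simps [simp]: "carrier (scalars K) = carrier K" "a \<otimes>\<^bsub>scalars K\<^esub> b = a \<otimes> b"
 "a \<oplus>\<^bsub>scalars K\<^esub> b = a \<oplus> b" "a \<odot>\<^bsub>scalars K\<^esub> b = a \<otimes> b" "\<one>\<^bsub>scalars K\<^esub> = \<one>" "\<zero>\<^bsub>scalars K\<^esub> = \<zero>"
 by (simp_all add: scalars_def)

subsection \<open>Free vector spaces and quotients\<close>

lemma free_space_simps [simp]:
 "f \<oplus>\<^bsub>free_space K Y\<^esub> g = (%x. f x \<oplus> g x)" "\<zero>\<^bsub>free_space K Y\<^esub> = (%x. \<zero>)"
 "c \<odot>\<^bsub>free_space K Y\<^esub> f = (%x. c \<otimes> f x)"
 by (simp_all add: free_space_def)

lemma free_space_carrier: "f .: (free_space K Y) \<longleftrightarrow>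
  (\<forall>x. f x .: K) \<and> {x. f x \<noteq> \<zero>} \<subseteq> Y \<and> finite {x. f x \<noteq> \<zero>}"
 by (auto simp: free_space_def)

lemma vs_free_space: "vs (free_space K Y)"
proof (rule vsI)
 have fin: "finite {x. f x \<oplus> g x \<noteq> \<zero>}" if "finite {x. f x \<noteq> \<zero>}" "finite {x. g x \<noteq> \<zero>}"
  for f g :: "'x \<Rightarrow> 'k"
  by (rule finite_subset[OF _ finite_UnI[OF that]]) auto
 show "abelian_group (free_space K Y)"
 proof (rule abelian_groupI)
  show "\<exists>g\<in>carrier (free_space K Y). g \<oplus>\<^bsub>free_space K Y\<^esub> f = \<zero>\<^bsub>free_space K Y\<^esub>"
   if f: "f .: (free_space K Y)" for f
   using f by (intro bexI[of _ "%x. \<ominus> f x"]) (auto simp: free_space_carrier l_neg)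
  show "f \<oplus>\<^bsub>free_space K Y\<^esub> g .: (free_space K Y)"
   if "f .: (free_space K Y)" "g .: (free_space K Y)" for f g
  proof -
   have "{x. f x \<oplus> g x \<noteq> \<zero>} \<subseteq> {x. f x \<noteq> \<zero>} \<union> {x. g x \<noteq> \<zero>}" by auto
   then show ?thesis using that fin by (auto simp: free_space_carrier)
  qed
 qed (auto simp: free_space_carrier a_ac)
 show "c \<odot>\<^bsub>free_space K Y\<^esub> f .: (free_space K Y)"
  if "c .: K" "f .: (free_space K Y)" for c f
 proof -
  have "{x. c \<otimes> f x \<noteq> \<zero>} \<subseteq> {x. f x \<noteq> \<zero>}" using that by (auto simp: free_space_carrier)
  then show ?thesis using that by (auto simp: free_space_carrier intro: finite_subset)
 qed
qed (auto simp: free_space_carrier l_distr r_distr m_assoc)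

lemma generator_closed: "y \<in> Y ==> generator K y .: (free_space K Y)"
 by (auto simp: free_space_carrier generator_def if_distrib cong: if_cong)

text \<open>The finite sum over the support is the one evaluated inside \<open>tensor_lift\<close>,
  so the universal property of the free space carries over to tensor products.\<close>

definition free_lift :: "('k, 'z, 'm) module_scheme \<Rightarrow> ('x \<Rightarrow> 'z) \<Rightarrow> ('x \<Rightarrow> 'k) \<Rightarrow> 'z"
 where "free_lift Z \<phi> u = finsum Z (%p. u p \<odot>\<^bsub>Z\<^esub> \<phi> p) {p. u p \<noteq> \<zero>}"

text \<open>The supports of \<open>u\<close>, \<open>v\<close> and their sum differ; additivity is
  proved over a common finite superset, on which the extra terms vanish.\<close>

lemma free_lift_superset:
 assumes "vs Z" "\<phi> \<in> Y \<rightarrow> carrier Z" "u .: (free_space K Y)"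
  and "finite S" "S \<subseteq> Y" "{p. u p \<noteq> \<zero>} \<subseteq> S"
 shows "free_lift Z \<phi> u = finsum Z (%p. u p \<odot>\<^bsub>Z\<^esub> \<phi> p) S"
proof -
 interpret Z: vectorspace K Z by fact
 show ?thesis unfolding free_lift_def
  by (rule Z.add.finprod_mono_neutral_cong_left) (use assms in \<open>auto simp: free_space_carrier Pi_iff subset_eq\<close>)
qed

lemma lin_free_lift:
 assumes "vs Z" "\<phi> \<in> Y \<rightarrow> carrier Z"
 shows "lin (free_space K Y) Z (free_lift Z \<phi>)"
proof (rule linI)
 interpret Z: vectorspace K Z by fact
 interpret F: vectorspace K "free_space K Y" by (rule vs_free_space)
 show "free_lift Z \<phi> u .: Z" if "u .: (free_space K Y)" for u
  using that assms unfolding free_lift_def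
  by (intro Z.finsum_closed) (auto simp: free_space_carrier Pi_iff subset_eq)
 show "free_lift Z \<phi> (u \<oplus>\<^bsub>free_space K Y\<^esub> v) = free_lift Z \<phi> u \<oplus>\<^bsub>Z\<^esub> free_lift Z \<phi> v"
  if u: "u .: (free_space K Y)" and v: "v .: (free_space K Y)" for u v
 proof -
  let ?S = "{p. u p \<noteq> \<zero>} \<union> {p. v p \<noteq> \<zero>}"
  have S: "finite ?S" "?S \<subseteq> Y" using u v by (auto simp: free_space_carrier)
  have "u \<oplus>\<^bsub>free_space K Y\<^esub> v .: (free_space K Y)" using u v by blast
  moreover have "{p. (u \<oplus>\<^bsub>free_space K Y\<^esub> v) p \<noteq> \<zero>} \<subseteq> ?S" by auto
  ultimately have "free_lift Z \<phi> (u \<oplus>\<^bsub>free_space K Y\<^esub> v) =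
    finsum Z (%p. (u \<oplus>\<^bsub>free_space K Y\<^esub> v) p \<odot>\<^bsub>Z\<^esub> \<phi> p) ?S"
   using assms S by (intro free_lift_superset)
  also have "... = finsum Z (%p. u p \<odot>\<^bsub>Z\<^esub> \<phi> p \<oplus>\<^bsub>Z\<^esub> v p \<odot>\<^bsub>Z\<^esub> \<phi> p) ?S"
   using assms(2) S u v
   by (intro Z.finsum_cong') (auto simp: free_space_carrier Z.smult_l_distr Pi_iff subset_eq)
  also have "... = finsum Z (%p. u p \<odot>\<^bsub>Z\<^esub> \<phi> p) ?S \<oplus>\<^bsub>Z\<^esub> finsum Z (%p. v p \<odot>\<^bsub>Z\<^esub> \<phi> p) ?S"
   using assms(2) S u v
   by (intro Z.finsum_addf) (auto simp: free_space_carrier Pi_iff subset_eq)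
  also have "... = free_lift Z \<phi> u \<oplus>\<^bsub>Z\<^esub> free_lift Z \<phi> v"
   using assms u v S by (simp add: free_lift_superset[where S = ?S and Y = Y])
  finally show ?thesis .
 qed
 show "free_lift Z \<phi> (c \<odot>\<^bsub>free_space K Y\<^esub> u) = c \<odot>\<^bsub>Z\<^esub> free_lift Z \<phi> u"
  if c: "c .: K" and u: "u .: (free_space K Y)" for c u
 proof -
  let ?S = "{p. u p \<noteq> \<zero>}"
  have S: "finite ?S" "?S \<subseteq> Y" using u by (auto simp: free_space_carrier)
  have "c \<odot>\<^bsub>free_space K Y\<^esub> u .: (free_space K Y)" using c u by blast
  moreover have "{p. (c \<odot>\<^bsub>free_space K Y\<^esub> u) p \<noteq> \<zero>} \<subseteq> ?S" using c by auto
  ultimately have "free_lift Z \<phi> (c \<odot>\<^bsub>free_space K Y\<^esub> u) =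
    finsum Z (%p. (c \<odot>\<^bsub>free_space K Y\<^esub> u) p \<odot>\<^bsub>Z\<^esub> \<phi> p) ?S"
   using assms S by (intro free_lift_superset)
  also have "... = finsum Z (%p. c \<odot>\<^bsub>Z\<^esub> (u p \<odot>\<^bsub>Z\<^esub> \<phi> p)) ?S"
   using assms(2) S u c
   by (intro Z.finsum_cong') (auto simp: free_space_carrier Z.smult_assoc1 Pi_iff subset_eq)
  also have "... = c \<odot>\<^bsub>Z\<^esub> finsum Z (%p. u p \<odot>\<^bsub>Z\<^esub> \<phi> p) ?S"
   using assms(2) S u c
   by (intro Z.finsum_smult[symmetric]) (auto simp: free_space_carrier Pi_iff subset_eq)
  finally show ?thesis by (simp add: free_lift_def)
 qed
qed

lemma free_lift_generator:
 assumes "vs Z" "\<phi> y .: Z"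
 shows "free_lift Z \<phi> (generator K y) = \<phi> y"
proof -
 interpret Z: vectorspace K Z by fact
 have "{p. generator K y p \<noteq> \<zero>} = {y}" by (auto simp: generator_def)
 then show ?thesis using assms by (simp add: free_lift_def generator_def)
qed

lemma free_space_expand:
 assumes "u .: (free_space K Y)"
 shows "u = finsum (free_space K Y) (%p. u p \<odot>\<^bsub>free_space K Y\<^esub> generator K p) {p. u p \<noteq> \<zero>}"
proof -
 interpret F: vectorspace K "free_space K Y" by (rule vs_free_space)
 have S: "finite {p. u p \<noteq> \<zero>}" "{p. u p \<noteq> \<zero>} \<subseteq> Y" using assms by (auto simp: free_space_carrier)
 \<comment> \<open>Evaluation at a point is linear, so the identity of functions can be checked
   coordinate by coordinate.\<close>
 have ev: "lin (free_space K Y) (scalars K) (%v. v y)" for y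
  by (intro linI) (auto simp: free_space_carrier)
 have "finsum (free_space K Y) (%p. u p \<odot>\<^bsub>free_space K Y\<^esub> generator K p) {p. u p \<noteq> \<zero>} y = u y" for y
 proof -
  have "finsum (free_space K Y) (%p. u p \<odot>\<^bsub>free_space K Y\<^esub> generator K p) {p. u p \<noteq> \<zero>} y =
   finsum (scalars K) (%p. (u p \<odot>\<^bsub>free_space K Y\<^esub> generator K p) y) {p. u p \<noteq> \<zero>}"
   using S assms by (intro lin_finsum[OF F.vectorspace_axioms vs_scalars ev])
    (auto intro!: F.smult_closed generator_closed simp: free_space_carrier simp del: free_space_simps)
  also have "... = finsum (scalars K) (%p. if p = y then u y else \<zero>) {p. u p \<noteq> \<zero>}"
   using assms vs_scalars
   by (intro abelian_monoid.finsum_cong' abelian_group.axioms(1) vsD(1))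
     (auto simp: generator_def free_space_carrier)
  also have "... = u y"
  proof -
   interpret S: vectorspace K "scalars K" by (rule vs_scalars)
   show ?thesis
   proof (cases "u y = \<zero>")
    case True
    have "finsum (scalars K) (%p. if p = y then u y else \<zero>) {p. u p \<noteq> \<zero>} =
     finsum (scalars K) (%p. \<zero>\<^bsub>scalars K\<^esub>) {p. u p \<noteq> \<zero>}"
     by (rule S.finsum_cong') (auto simp: True)
    then show ?thesis using True S.finsum_zero by simp
   next
    case False
    then show ?thesis using S.finsum_singleton[of y "{p. u p \<noteq> \<zero>}" "%p. u y"] S(1) assms
     by (auto simp: free_space_carrier eq_commute[of y] cong: if_cong)
   qed
  qed
  finally show ?thesis .
 qed
 then show ?thesis by (intro ext) simp
qed

lemma free_space_ext:
 assumes "vs Z" "lin (free_space K Y) Z f" "lin (free_space K Y) Z g"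
  and "!!y. y \<in> Y ==> f (generator K y) = g (generator K y)" "u .: (free_space K Y)"
 shows "f u = g u"
proof -
 interpret Z: vectorspace K Z by fact
 interpret F: vectorspace K "free_space K Y" by (rule vs_free_space)
 let ?S = "{p. u p \<noteq> \<zero>}"
 have S: "finite ?S" "?S \<subseteq> Y" "!!p. u p .: K" using assms by (auto simp: free_space_carrier)
 have cl: "(%p. u p \<odot>\<^bsub>free_space K Y\<^esub> generator K p) \<in> ?S \<rightarrow> carrier (free_space K Y)"
  using S by (auto intro!: F.smult_closed generator_closed simp del: free_space_simps)
 have *: "h u = finsum Z (%p. u p \<odot>\<^bsub>Z\<^esub> h (generator K p)) ?S" if h: "lin (free_space K Y) Z h" for h
 proof -
  have "h u = finsum Z (%p. h (u p \<odot>\<^bsub>free_space K Y\<^esub> generator K p)) ?S"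
   using free_space_expand[OF assms(5)] lin_finsum[OF F.vectorspace_axioms assms(1) h cl] by simp
  also have "... = finsum Z (%p. u p \<odot>\<^bsub>Z\<^esub> h (generator K p)) ?S"
   using S h by (intro Z.finsum_cong')
    (auto simp: lin_smult generator_closed subset_eq intro!: Z.smult_closed lin_closed[OF h] simp del: free_space_simps)
  finally show ?thesis .
 qed
 show ?thesis unfolding *[OF assms(2)] *[OF assms(3)]
  using S assms by (intro Z.finsum_cong') (auto simp: generator_closed subset_eq intro!: Z.smult_closed lin_closed[OF assms(3)])
qed

end

context field_base
begin

lemma abelian_subgroup_of_submodule:
 assumes "vs M" "submodule K I M" shows "abelian_subgroup I M"
proof -
 interpret M: vectorspace K M by fact
 interpret I: submodule K I M by fact
 have inv: "\<ominus>\<^bsub>M\<^esub> x \<in> I" if "x \<in> I" for x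
 proof -
  have "x .: M" using that I.subset by auto
  then have "\<ominus>\<^bsub>M\<^esub> x = (\<ominus> \<one>) \<odot>\<^bsub>M\<^esub> x" by (simp add: M.smult_l_minus)
  then show ?thesis using that by simp
 qed
 show ?thesis
 proof (intro abelian_subgroupI3 additive_subgroupI group.subgroupI[OF M.a_group])
  show "I \<noteq> {}" using I.zero_closed by blast
 qed (use I.subset inv M.abelian_group_axioms in \<open>auto simp flip: a_inv_def\<close>)
qed

lemma quotient_coset:
 assumes "vs M" "submodule K I M"
 shows "T .: (quotient M I) \<longleftrightarrow> (\<exists>x\<in>carrier M. T = I +>\<^bsub>M\<^esub> x)"
  and "[|x .: M; y .: M|] ==> (I +>\<^bsub>M\<^esub> x) \<oplus>\<^bsub>quotient M I\<^esub> (I +>\<^bsub>M\<^esub> y) = I +>\<^bsub>M\<^esub> (x \<oplus>\<^bsub>M\<^esub> y)"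
  and "[|c .: K; x .: M|] ==> c \<odot>\<^bsub>quotient M I\<^esub> (I +>\<^bsub>M\<^esub> x) = I +>\<^bsub>M\<^esub> (c \<odot>\<^bsub>M\<^esub> x)"
  and "[|x .: M; y .: M|] ==> I +>\<^bsub>M\<^esub> x = I +>\<^bsub>M\<^esub> y \<longleftrightarrow> x \<ominus>\<^bsub>M\<^esub> y \<in> I"
  and "[|x .: M|] ==> x \<in> I +>\<^bsub>M\<^esub> x"
  and "[|x .: M; y \<in> I +>\<^bsub>M\<^esub> x|] ==> y .: M \<and> y \<ominus>\<^bsub>M\<^esub> x \<in> I"
proof -
 interpret M: vectorspace K M by fact
 interpret I: submodule K I M by fact
 interpret S: abelian_subgroup I M by (rule abelian_subgroup_of_submodule) fact+
 show "T .: (quotient M I) \<longleftrightarrow> (\<exists>x\<in>carrier M. T = I +>\<^bsub>M\<^esub> x)"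
  by (auto simp: quotient_def FactRing_def A_RCOSETS_def' a_r_coset_def')
 show "(I +>\<^bsub>M\<^esub> x) \<oplus>\<^bsub>quotient M I\<^esub> (I +>\<^bsub>M\<^esub> y) = I +>\<^bsub>M\<^esub> (x \<oplus>\<^bsub>M\<^esub> y)"
  if "x .: M" "y .: M"
  using that by (simp add: quotient_def FactRing_def S.a_rcos_sum)
 show eq: "I +>\<^bsub>M\<^esub> x = I +>\<^bsub>M\<^esub> y \<longleftrightarrow> x \<ominus>\<^bsub>M\<^esub> y \<in> I"
  if "x .: M" "y .: M" for x y
 proof
  assume "I +>\<^bsub>M\<^esub> x = I +>\<^bsub>M\<^esub> y"
  then have "x \<in> I +>\<^bsub>M\<^esub> y" using S.a_rcos_self[OF that(1)] by simp
  then show "x \<ominus>\<^bsub>M\<^esub> y \<in> I" using S.a_rcos_module[of y x] that by (simp add: a_minus_def)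
 next
  assume "x \<ominus>\<^bsub>M\<^esub> y \<in> I"
  then have "x \<in> I +>\<^bsub>M\<^esub> y" using S.a_rcos_module[of y x] that by (simp add: a_minus_def)
  then show "I +>\<^bsub>M\<^esub> x = I +>\<^bsub>M\<^esub> y" using S.a_repr_independence' that by simp
 qed
 show self: "x \<in> I +>\<^bsub>M\<^esub> x" if "x .: M" for x using S.a_rcos_self that .
 show mem: "y .: M \<and> y \<ominus>\<^bsub>M\<^esub> x \<in> I" if "x .: M" "y \<in> I +>\<^bsub>M\<^esub> x" for x y
 proof -
  have "y .: M" using S.a_elemrcos_carrier that by blast
  moreover have "I +>\<^bsub>M\<^esub> y = I +>\<^bsub>M\<^esub> x" using S.a_repr_independence' that by metis
  ultimately show ?thesis using eq that by blast
 qed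
 show "c \<odot>\<^bsub>quotient M I\<^esub> (I +>\<^bsub>M\<^esub> x) = I +>\<^bsub>M\<^esub> (c \<odot>\<^bsub>M\<^esub> x)"
  if cx: "c .: K" "x .: M"
 proof -
  \<comment> \<open>The scalar multiple of a coset is defined as a union over its elements; all
    members of this union coincide.\<close>
  have "I +>\<^bsub>M\<^esub> (c \<odot>\<^bsub>M\<^esub> y) = I +>\<^bsub>M\<^esub> (c \<odot>\<^bsub>M\<^esub> x)" if "y \<in> I +>\<^bsub>M\<^esub> x" for y
  proof -
   have y: "y .: M" "y \<ominus>\<^bsub>M\<^esub> x \<in> I" using mem that cx by blast+
   then have "c \<odot>\<^bsub>M\<^esub> (y \<ominus>\<^bsub>M\<^esub> x) \<in> I" using cx by simp
   then have "c \<odot>\<^bsub>M\<^esub> y \<ominus>\<^bsub>M\<^esub> c \<odot>\<^bsub>M\<^esub> x \<in> I"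
    using y cx by (simp add: M.smult_r_distr M.smult_r_minus M.minus_eq a_minus_def)
   then show ?thesis using eq y cx by simp
  qed
  then have "(\<Union>y\<in>I +>\<^bsub>M\<^esub> x. I +>\<^bsub>M\<^esub> (c \<odot>\<^bsub>M\<^esub> y)) = I +>\<^bsub>M\<^esub> (c \<odot>\<^bsub>M\<^esub> x)"
   by (intro UN_constant_eq[OF self[OF cx(2)]] ballI)
  then show ?thesis by (simp add: quotient_def)
 qed
qed

lemma diff_zero_iff:
 assumes "abelian_group M" "x .: M" "y .: M"
 shows "x \<ominus>\<^bsub>M\<^esub> y = \<zero>\<^bsub>M\<^esub> \<longleftrightarrow> x = y"
proof -
 interpret M: abelian_group M by fact
 show ?thesis using M.add.inv_solve_right[of "\<zero>\<^bsub>M\<^esub>" x y] assms by (auto simp: a_minus_def)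
qed

lemma abelian_group_cong:
 assumes "abelian_group M" "carrier N = carrier M" "add N = add M" "zero N = zero M"
 shows "abelian_group N"
proof -
 interpret M: abelian_group M by fact
 show ?thesis
  by (intro abelian_groupI; simp add: assms(2-) M.add.m_ac)
qed

lemma vs_quotient:
 assumes "vs M" "submodule K I M" shows "vs (quotient M I)"
proof -
 interpret M: vectorspace K M by fact
 interpret S: abelian_subgroup I M by (rule abelian_subgroup_of_submodule) fact+
 note Q = quotient_coset[OF assms]
 show ?thesis
 proof (rule vsI)
  have "abelian_group (M Quot I)"
   by (rule comm_group_abelian_groupI)
    (simp add: FactRing_def S.a_factorgroup_is_comm_group[unfolded A_FactGroup_def'])
  then show "abelian_group (quotient M I)"
   by (rule abelian_group_cong) (simp_all add: quotient_def)
 qed (auto simp: Q(1-3) M.smult_l_distr M.smult_r_distr M.smult_assoc1)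
qed

lemma lin_coset:
 assumes "vs M" "submodule K I M"
 shows "lin M (quotient M I) (%x. I +>\<^bsub>M\<^esub> x)"
 by (rule linI) (auto simp: quotient_coset(1-3)[OF assms])

text \<open>A map out of a quotient is evaluated on an arbitrary representative, as \<open>tensor_lift\<close> does.\<close>

lemma quotient_SOME:
 assumes "vs M" "submodule K I M" "vs Z" "lin M Z f"
  and "!!x. x \<in> I ==> f x = \<zero>\<^bsub>Z\<^esub>" "x .: M"
 shows "f (SOME u. u \<in> I +>\<^bsub>M\<^esub> x) = f x"
proof -
 interpret M: vectorspace K M by fact
 interpret Z: vectorspace K Z by fact
 let ?u = "SOME u. u \<in> I +>\<^bsub>M\<^esub> x"
 have "?u \<in> I +>\<^bsub>M\<^esub> x" using quotient_coset(5)[OF assms(1,2,6)] by (rule someI)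
 then have u: "?u .: M" "?u \<ominus>\<^bsub>M\<^esub> x \<in> I"
  using quotient_coset(6)[OF assms(1,2,6)] by blast+
 then have "f ?u \<ominus>\<^bsub>Z\<^esub> f x = \<zero>\<^bsub>Z\<^esub>"
  using lin_minus[OF assms(1,3,4) u(1) assms(6)] assms(5) by metis
 then show ?thesis using u(1) assms(6) lin_closed[OF assms(4)] by (simp add: diff_zero_iff[OF vsD(1)[OF assms(3)]])
qed

lemma lin_quotient_lift:
 assumes "vs M" "submodule K I M" "vs Z" "lin M Z f"
  and "!!x. x \<in> I ==> f x = \<zero>\<^bsub>Z\<^esub>"
 shows "lin (quotient M I) Z (%t. f (SOME u. u \<in> t))"
proof -
 interpret M: vectorspace K M by fact
 note Q = quotient_coset[OF assms(1,2)] and S = quotient_SOME[OF assms]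
 show ?thesis
  by (rule linI) (auto simp: Q(1-3) S lin_add[OF assms(4)] lin_smult[OF assms(4)] lin_closed[OF assms(4)])
qed

lemma lin_vanish_span:
 assumes "vs V" "vs Z" "lin V Z f" "S \<subseteq> carrier V"
  and "!!x. x \<in> S ==> f x = \<zero>\<^bsub>Z\<^esub>" "x \<in> LinearCombinations.module.span K V S"
 shows "f x = \<zero>\<^bsub>Z\<^esub>"
proof -
 interpret V: vectorspace K V by fact
 interpret Z: vectorspace K Z by fact
 obtain a B where B: "x = V.lincomb a B" "finite B" "B \<subseteq> S" "a \<in> B \<rightarrow> carrier K"
  using assms(6) by (auto simp: V.span_def)
 have "f x = finsum Z (%v. f (a v \<odot>\<^bsub>V\<^esub> v)) B"
  unfolding B(1) V.lincomb_def
  using B assms(4) by (intro lin_finsum[OF assms(1-3)]) (auto intro!: V.smult_closed)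
 also have "... = finsum Z (%v. \<zero>\<^bsub>Z\<^esub>) B"
  using B assms(4,5) by (intro Z.finsum_cong') (auto simp: lin_smult[OF assms(3)] subset_eq Pi_iff)
 finally show ?thesis by simp
qed

subsection \<open>Tensor products\<close>

lemma tensor_relations_closed:
 assumes "vs V" "vs W"
 shows "tensor_relations K V W \<subseteq> carrier (free_space K (carrier V \<times> carrier W))"
proof -
 interpret V: vectorspace K V by fact
 interpret W: vectorspace K W by fact
 interpret F: vectorspace K "free_space K (carrier V \<times> carrier W)" by (rule vs_free_space)
 show ?thesis unfolding tensor_relations_def Let_def
  by (auto intro!: F.minus_closed F.add.m_closed F.smult_closed generator_closed simp del: free_space_simps)
qed

lemma submodule_tensor_kernel:
 assumes "vs V" "vs W"
 shows "submodule K (tensor_kernel K V W) (free_space K (carrier V \<times> carrier W))"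
proof -
 interpret F: vectorspace K "free_space K (carrier V \<times> carrier W)" by (rule vs_free_space)
 show ?thesis unfolding tensor_kernel_def
  by (rule F.span_is_submodule[OF tensor_relations_closed[OF assms]])
qed

lemma vs_tensor: "[|vs V; vs W|] ==> vs (tsp V W)"
 unfolding tensor_space_def by (rule vs_quotient[OF vs_free_space submodule_tensor_kernel])

lemma tens_closed:
 assumes "vs V" "vs W" "v .: V" "w .: W"
 shows "tens K V W v w .: (tsp V W)"
 unfolding tensor_space_def tens_def
  quotient_coset(1)[OF vs_free_space submodule_tensor_kernel[OF assms(1,2)]]
 by (rule bexI[OF refl generator_closed]) (simp add: assms)

lemma bil_tens:
 assumes V: "vs V" and W: "vs W"
 shows "bil V W (tsp V W) (tens K V W)"
proof -
 interpret V: vectorspace K V by fact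
 interpret W: vectorspace K W by fact
 let ?F = "free_space K (carrier V \<times> carrier W)" and ?I = "tensor_kernel K V W"
 interpret F: vectorspace K ?F by (rule vs_free_space)
 note Q = quotient_coset[OF vs_free_space submodule_tensor_kernel[OF V W]]
 have span: "y \<in> ?I" if "y \<in> tensor_relations K V W" for y
  using that F.in_own_span[OF tensor_relations_closed[OF V W]] by (auto simp: tensor_kernel_def)
 note [simp del] = free_space_simps
 note g = generator_closed F.smult_closed F.add.m_closed
 \<comment> \<open>The four families of relations form a left-nested union, and each is reached by
   its own path of \<open>UnI1\<close> and \<open>UnI2\<close>.\<close>
 have mem: "[|v .: V; v' .: V; w .: W|] ==> generator K (v \<oplus>\<^bsub>V\<^esub> v', w) \<ominus>\<^bsub>?F\<^esub> (generator K (v, w) \<oplus>\<^bsub>?F\<^esub> generator K (v', w)) \<in> ?I"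
  "[|v .: V; w .: W; w' .: W|] ==> generator K (v, w \<oplus>\<^bsub>W\<^esub> w') \<ominus>\<^bsub>?F\<^esub> (generator K (v, w) \<oplus>\<^bsub>?F\<^esub> generator K (v, w')) \<in> ?I"
  "[|c .: K; v .: V; w .: W|] ==> generator K (c \<odot>\<^bsub>V\<^esub> v, w) \<ominus>\<^bsub>?F\<^esub> c \<odot>\<^bsub>?F\<^esub> generator K (v, w) \<in> ?I"
  "[|c .: K; v .: V; w .: W|] ==> generator K (v, c \<odot>\<^bsub>W\<^esub> w) \<ominus>\<^bsub>?F\<^esub> c \<odot>\<^bsub>?F\<^esub> generator K (v, w) \<in> ?I" for v v' w w' c
    apply (rule span, unfold tensor_relations_def Let_def)
    apply (rule UnI1, rule UnI1, rule UnI1, intro CollectI exI conjI, rule refl, assumption+)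
   apply (rule span, unfold tensor_relations_def Let_def)
   apply (rule UnI1, rule UnI1, rule UnI2, intro CollectI exI conjI, rule refl, assumption+)
   apply (rule span, unfold tensor_relations_def Let_def)
   apply (rule UnI1, rule UnI2, intro CollectI exI conjI, rule refl, assumption+)
  apply (rule span, unfold tensor_relations_def Let_def)
  apply (rule UnI2, intro CollectI exI conjI, rule refl, assumption+)
  done
 have a1: "tens K V W (v \<oplus>\<^bsub>V\<^esub> v') w = tens K V W v w \<oplus>\<^bsub>tsp V W\<^esub> tens K V W v' w"
  if "v .: V" "v' .: V" "w .: W" for v v' w
  unfolding tensor_space_def tens_def using that mem
  by (simp add: Q(2) Q(4) g)
 have a2: "tens K V W v (w \<oplus>\<^bsub>W\<^esub> w') = tens K V W v w \<oplus>\<^bsub>tsp V W\<^esub> tens K V W v w'"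
  if "v .: V" "w .: W" "w' .: W" for v w w'
  unfolding tensor_space_def tens_def using that mem
  by (simp add: Q(2) Q(4) g)
 have s1: "tens K V W (c \<odot>\<^bsub>V\<^esub> v) w = c \<odot>\<^bsub>tsp V W\<^esub> tens K V W v w"
  if "v .: V" "c .: K" "w .: W" for v c w
  unfolding tensor_space_def tens_def using that mem
  by (simp add: Q(3) Q(4) g)
 have s2: "tens K V W v (c \<odot>\<^bsub>W\<^esub> w) = c \<odot>\<^bsub>tsp V W\<^esub> tens K V W v w"
  if "v .: V" "c .: K" "w .: W" for v c w
  unfolding tensor_space_def tens_def using that mem
  by (simp add: Q(3) Q(4) g)
 show ?thesis
  by (intro bilI linI tens_closed V W) (auto simp: a1 a2 s1 s2)
qed

lemma tensor_lift_free_lift: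
 "lift Z \<beta> t = free_lift Z (%p. \<beta> (fst p) (snd p)) (SOME u. u \<in> t)"
 by (simp add: tensor_lift_def free_lift_def Let_def)

text \<open>The universal property. Bilinearity of \<open>\<beta>\<close> says that its linear
  extension to the free space kills each of the four families of relations, hence their span; the
  choice of representative therefore has no effect on the value.\<close>

lemma tensor_lift_props:
 assumes V: "vs V" and W: "vs W" and Z: "vs Z" and b: "bil V W Z \<beta>"
 shows lin_tensor_lift: "lin (tsp V W) Z (lift Z \<beta>)"
  and tensor_lift_tens: "[|v .: V; w .: W|] ==> lift Z \<beta> (tens K V W v w) = \<beta> v w"
proof -
 interpret V: vectorspace K V by fact
 interpret W: vectorspace K W by fact
 interpret Z: vectorspace K Z by fact
 let ?F = "free_space K (carrier V \<times> carrier W)" and ?I = "tensor_kernel K V W"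
 let ?f = "free_lift Z (%p. \<beta> (fst p) (snd p))"
 interpret F: vectorspace K ?F by (rule vs_free_space)
 note bc = bil_closed[OF b]
 have phi: "(%p. \<beta> (fst p) (snd p)) \<in> carrier V \<times> carrier W \<rightarrow> carrier Z" by (auto intro: bc)
 note l = lin_free_lift[OF Z phi]
 note [simp del] = free_space_simps
 note g = generator_closed F.smult_closed F.add.m_closed
 have gen: "?f (generator K (v, w)) = \<beta> v w" if "v .: V" "w .: W" for v w
  using free_lift_generator[OF Z, of "%p. \<beta> (fst p) (snd p)" "(v, w)"] that bc by simp
 have rel: "?f y = \<zero>\<^bsub>Z\<^esub>" if "y \<in> tensor_relations K V W" for y
  using that unfolding tensor_relations_def Let_def
  by (elim UnE CollectE exE conjE; simp add: lin_minus[OF F.vectorspace_axioms Z l] lin_add[OF l] lin_smult[OF l] g gen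
    lin_add[OF bil1[OF b]] lin_add[OF bil2[OF b]] lin_smult[OF bil1[OF b]] lin_smult[OF bil2[OF b]] bc
    diff_zero_iff[OF vsD(1)[OF Z]] bil_closed[OF bil_tens])
 have van: "?f y = \<zero>\<^bsub>Z\<^esub>" if "y \<in> ?I" for y
  using lin_vanish_span[OF F.vectorspace_axioms Z l tensor_relations_closed[OF V W] rel] that
  by (simp add: tensor_kernel_def)
 show "lin (tsp V W) Z (lift Z \<beta>)"
  unfolding tensor_lift_free_lift tensor_space_def
  by (rule lin_quotient_lift[OF F.vectorspace_axioms submodule_tensor_kernel[OF V W] Z l van])
 show "lift Z \<beta> (tens K V W v w) = \<beta> v w" if "v .: V" "w .: W"
  unfolding tensor_lift_free_lift tens_def
  using that by (simp add: gen generator_closed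
    quotient_SOME[OF F.vectorspace_axioms submodule_tensor_kernel[OF V W] Z l van])
qed

lemma tensor_ext:
 assumes V: "vs V" and W: "vs W" and Z: "vs Z"
  and f: "lin (tsp V W) Z f" and g: "lin (tsp V W) Z g"
  and eq: "!!v w. [|v .: V; w .: W|] ==> f (tens K V W v w) = g (tens K V W v w)"
  and t: "t .: (tsp V W)"
 shows "f t = g t"
proof -
 let ?F = "free_space K (carrier V \<times> carrier W)" and ?I = "tensor_kernel K V W"
 note S = submodule_tensor_kernel[OF V W]
 obtain u where u: "u .: ?F" "t = ?I +>\<^bsub>?F\<^esub> u"
  using t quotient_coset(1)[OF vs_free_space S] by (auto simp: tensor_space_def)
 have l: "lin ?F Z (%u. h (?I +>\<^bsub>?F\<^esub> u))" if "lin (tsp V W) Z h" for h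
  using lin_compose[OF that[unfolded tensor_space_def] lin_coset[OF vs_free_space S]] .
 have "f (?I +>\<^bsub>?F\<^esub> u) = g (?I +>\<^bsub>?F\<^esub> u)"
  by (rule free_space_ext[OF Z l[OF f] l[OF g] _ u(1)]) (auto simp: eq tens_def[symmetric])
 then show ?thesis using u by simp
qed

end

context field_base
begin

subsection \<open>Calculus of tensor expressions\<close>

lemma tensor_lift_closed:
 assumes "vs V" "vs W" "vs Z" "bil V W Z \<beta>" "t .: (tsp V W)"
 shows "lift Z \<beta> t .: Z"
 using lin_tensor_lift[OF assms(1-4)] assms(5) by (rule lin_closed)

lemma tensor_lift_eq:
 assumes "vs V" "vs W" "vs Z" "bil V W Z \<beta>" "lin (tsp V W) Z g"
  and "!!v w. [|v .: V; w .: W|] ==> \<beta> v w = g (tens K V W v w)"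
  and "t .: (tsp V W)"
 shows "lift Z \<beta> t = g t"
 using assms(6) by (intro tensor_ext[OF assms(1-3) lin_tensor_lift[OF assms(1-4)] assms(5) _ assms(7)])
  (simp add: tensor_lift_tens[OF assms(1-4)])

text \<open>Nothing is assumed about \<open>G\<close>, so the monoid laws cannot be invoked. The
  fold is a definite description over the inductive relation \<open>foldSetD\<close>, and this
  relation inspects the summand only on the index set.\<close>

lemma finsum_cong_any:
 assumes "!!i. i \<in> S ==> f i = g i"
 shows "finsum G f S = finsum G g S"
proof -
 have *: "(U, y) \<in> foldSetD E (p \<circ> k) e"
  if "(U, y) \<in> foldSetD E (p \<circ> f) e" "!!i. i \<in> U ==> f i = k i" for U y E p e f k
  using that
 proof (induction rule: foldSetD.induct)
  case emptyI
  then show ?case by (auto intro: foldSetD.emptyI)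
 next
  case (insertI x A y)
  then have "(insert x A, (p \<circ> k) x y) \<in> foldSetD E (p \<circ> k) e" by (intro foldSetD.insertI) auto
  moreover have "(p \<circ> f) x = (p \<circ> k) x" using insertI by simp
  ultimately show ?case by (simp only:)
 qed
 have eq: "(S, y) \<in> foldSetD E (p \<circ> f) e \<longleftrightarrow> (S, y) \<in> foldSetD E (p \<circ> g) e" for y E p e
  using *[of S y E p f e g] *[of S y E p g e f] assms by auto
 show ?thesis unfolding finsum_def finprod_def foldD_def by (simp only: eq)
qed

text \<open>The representative picked by \<open>tensor_lift\<close> is supported in
  \<open>carrier V \<times> carrier W\<close>, so agreement there suffices for arbitrary integrands.
  This is the rule for rewriting under a Sweedler sum.\<close>

lemma tensor_lift_cong:
 assumes t: "t .: (tsp V W)" and V: "vs V" and W: "vs W"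
  and eq: "!!v w. [|v .: V; w .: W|] ==> \<beta> v w = \<gamma> v w"
 shows "lift Z \<beta> t = lift Z \<gamma> t"
proof -
 let ?F = "free_space K (carrier V \<times> carrier W)" and ?I = "tensor_kernel K V W"
 note S = submodule_tensor_kernel[OF V W] and q = quotient_coset[OF vs_free_space submodule_tensor_kernel[OF V W]]
 obtain u where u: "u .: ?F" "t = ?I +>\<^bsub>?F\<^esub> u"
  using t q(1) by (auto simp: tensor_space_def)
 have "(SOME u. u \<in> t) \<in> t" unfolding u(2) by (rule someI[of "%y. y \<in> ?I +>\<^bsub>?F\<^esub> u", OF q(5)[OF u(1)]])
 then have "(SOME u. u \<in> t) .: ?F" using q(6)[OF u(1)] unfolding u(2) by blast
 then have "p \<in> carrier V \<times> carrier W" if "(SOME u. u \<in> t) p \<noteq> \<zero>" for p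
  using that by (auto simp: free_space_carrier)
 then show ?thesis unfolding tensor_lift_def Let_def
  by (intro finsum_cong_any) (auto simp: eq)
qed

lemma lin_tensor_lift_comp:
 assumes "lin Z Z' f" "vs V" "vs W" "vs Z" "vs Z'"
  "bil V W Z \<beta>" "t .: (tsp V W)"
 shows "f (lift Z \<beta> t) = lift Z' (%v w. f (\<beta> v w)) t"
proof -
 have "bil V W Z' (%v w. f (\<beta> v w))"
  by (intro bilI lin_compose[OF assms(1)]) (auto intro: bil1[OF assms(6)] bil2[OF assms(6)])
 from tensor_lift_eq[OF assms(2,3,5) this lin_compose[OF assms(1) lin_tensor_lift[OF assms(2-4,6)]] _ assms(7)]
 show ?thesis by (simp add: tensor_lift_tens[OF assms(2-4,6)])
qed

lemma lin_lift_arg: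
 assumes "lin U (tsp V W) g" "vs V" "vs W" "vs Z" "bil V W Z \<beta>"
 shows "lin U Z (%x. lift Z \<beta> (g x))"
 by (rule lin_compose[OF lin_tensor_lift[OF assms(2-5)] assms(1)])

text \<open>A parameter may occur inside the bilinear expression, as in nested Sweedler sums.
  Additivity and homogeneity in it hold because both sides are linear in the tensor and agree on
  pure tensors.\<close>

lemma lin_lift_fun:
 assumes t: "t .: (tsp V W)"
  and V: "vs V" and W: "vs W" and Z: "vs Z" and U: "vs U"
  and b: "!!x. x .: U ==> bil V W Z (\<beta> x)"
  and l: "!!v w. [|v .: V; w .: W|] ==> lin U Z (%x. \<beta> x v w)"
 shows "lin U Z (%x. lift Z (\<beta> x) t)"
proof -
 interpret U: vectorspace K U by fact
 have lt: "lin (tsp V W) Z (lift Z (\<beta> x))" if "x .: U" for x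
  by (rule lin_tensor_lift[OF V W Z b[OF that]])
 note tt = tensor_lift_tens[OF V W Z b]
 show ?thesis
 proof (rule linI)
  show "lift Z (\<beta> x) t .: Z" if "x .: U" for x
   by (rule lin_closed[OF lt[OF that] t])
  show "lift Z (\<beta> (x \<oplus>\<^bsub>U\<^esub> y)) t = lift Z (\<beta> x) t \<oplus>\<^bsub>Z\<^esub> lift Z (\<beta> y) t"
   if "x .: U" "y .: U" for x y
   using that
   by (intro tensor_lift_eq[OF V W Z b _ _ t] lin_plus[OF Z lt lt]) (auto simp: tt lin_add[OF l])
  show "lift Z (\<beta> (c \<odot>\<^bsub>U\<^esub> x)) t = c \<odot>\<^bsub>Z\<^esub> lift Z (\<beta> x) t"
   if "c .: K" "x .: U" for c x
   using that
   by (intro tensor_lift_eq[OF V W Z b _ _ t] lin_smult_right[OF Z lt]) (auto simp: tt lin_smult[OF l])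
 qed
qed

text \<open>Independent Sweedler sums commute: both sides are linear in \<open>t\<close>, and on a
  pure tensor the sum over \<open>t\<close> reduces to a single term.\<close>

lemma tensor_lift_swap:
 assumes V: "vs V" and W: "vs W" and V': "vs V'" and W': "vs W'"
  and Z: "vs Z"
  and t: "t .: (tsp V W)" and u: "u .: (tsp V' W')"
  and b: "!!a b. [|a .: V; b .: W|] ==> bil V' W' Z (f a b)"
  and b': "!!c d. [|c .: V'; d .: W'|] ==> bil V W Z (%a b. f a b c d)"
 shows "lift Z (%a b. lift Z (f a b) u) t =
  lift Z (%c d. lift Z (%a b. f a b c d) t) u"
proof (rule tensor_lift_eq[OF V W Z _ _ _ t])
 show "bil V W Z (%a b. lift Z (f a b) u)"
  by (assumption | rule b V W bil1[OF b'] bil2[OF b'] lin_lift_fun[OF u V' W' Z] bilI)+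
 show "lin (tsp V W) Z (%t. lift Z (%c d. lift Z (%a b. f a b c d) t) u)"
 proof (rule lin_lift_fun[OF u V' W' Z vs_tensor[OF V W]])
  show "bil V' W' Z (%c d. lift Z (%a b. f a b c d) x)" if "x .: (tsp V W)" for x
   by (assumption | rule b' V' W' bil1[OF b] bil2[OF b] lin_lift_fun[OF that V W Z] bilI)+
 qed (rule lin_tensor_lift[OF V W Z b'])
 show "lift Z (f v w) u =
   lift Z (%c d. lift Z (%a b. f a b c d) (tens K V W v w)) u"
  if "v .: V" "w .: W" for v w
  by (rule tensor_lift_cong[OF u V' W']) (simp add: tensor_lift_tens[OF V W Z b'] that)
qed

lemma lin_tens_left: "[|lin U V f; vs V; vs W; w .: W|]
  ==> lin U (tsp V W) (%x. tens K V W (f x) w)"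
 by (rule lin_compose[OF bil2[OF bil_tens]])

lemma lin_tens_right: "[|lin U W f; vs V; vs W; v .: V|]
  ==> lin U (tsp V W) (%x. tens K V W v (f x))"
 by (rule lin_compose[OF bil1[OF bil_tens]])

lemma tensor_map_props:
 assumes "lin V V' f" "lin W W' g" and V: "vs V" "vs W" "vs V'" "vs W'"
 shows lin_tensor_map: "lin (tsp V W) (tsp V' W') (tensor_map K V' W' f g)"
  and tensor_map_tens: "[|v .: V; w .: W|]
   ==> tensor_map K V' W' f g (tens K V W v w) = tens K V' W' (f v) (g w)"
  and tensor_lift_map: "[|vs Z; bil V' W' Z \<beta>; t .: (tsp V W)|]
   ==> lift Z \<beta> (tensor_map K V' W' f g t) = lift Z (%v w. \<beta> (f v) (g w)) t"
proof -
 have b: "bil V W (tsp V' W') (%v w. tens K V' W' (f v) (g w))"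
  by ((assumption | rule bilI lin_tens_left lin_tens_right assms lin_closed[OF assms(1)] lin_closed[OF assms(2)])+)
 note * = V(1,2) vs_tensor[OF V(3,4)] b
 show "lin (tsp V W) (tsp V' W') (tensor_map K V' W' f g)"
  unfolding tensor_map_def by (rule lin_tensor_lift[OF *])
 show "tensor_map K V' W' f g (tens K V W v w) = tens K V' W' (f v) (g w)"
  if "v .: V" "w .: W"
  unfolding tensor_map_def by (rule tensor_lift_tens[OF * that])
 show "lift Z \<beta> (tensor_map K V' W' f g t) = lift Z (%v w. \<beta> (f v) (g w)) t"
  if Z: "vs Z" and beta: "bil V' W' Z \<beta>" and t: "t .: (tsp V W)"
  unfolding tensor_map_def
   lin_tensor_lift_comp[OF lin_tensor_lift[OF V(3,4) Z beta] V(1,2) vs_tensor[OF V(3,4)] Z b t]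
 by (rule tensor_lift_cong[OF t V(1,2)])
  (simp add: tensor_lift_tens[OF V(3,4) Z beta] lin_closed[OF assms(1)] lin_closed[OF assms(2)])
qed

lemma bil_assoc_inner:
 assumes U: "vs U" and V: "vs V" and W: "vs W" and Z: "vs Z"
  and b: "bil (tsp U V) W Z \<beta>" and u: "u .: U"
 shows "bil V W Z (%v w. \<beta> (tens K U V u v) w)"
proof (rule bilI)
 show "lin W Z (\<beta> (tens K U V u v))" if "v .: V" for v
  by (rule bil1[OF b tens_closed[OF U V u that]])
 show "lin V Z (%v. \<beta> (tens K U V u v) w)" if "w .: W" for w
  by (rule lin_compose[OF bil2[OF b that] lin_tens_right[OF lin_id U V u]])
qed

lemma tensor_assoc_props:
 assumes U: "vs U" and V: "vs V" and W: "vs W"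
 shows lin_tensor_assoc: "lin (tsp U (tsp V W)) (tsp (tsp U V) W)
   (tensor_assoc K U V W)"
  and tensor_assoc_tens: "[|u .: U; v .: V; w .: W|]
   ==> tensor_assoc K U V W (tens K U (tsp V W) u (tens K V W v w)) =
    tens K (tsp U V) W (tens K U V u v) w"
  and tensor_lift_assoc: "[|vs Z; bil (tsp U V) W Z \<beta>;
    t .: (tsp U (tsp V W))|]
   ==> lift Z \<beta> (tensor_assoc K U V W t) =
    lift Z (%u. lift Z (%v w. \<beta> (tens K U V u v) w)) t"
proof -
 let ?UV = "tsp U V" and ?VW = "tsp V W"
 let ?Z = "tsp ?UV W"
 note vs = vs_tensor[OF U V] vs_tensor[OF V W] vs_tensor[OF vs_tensor[OF U V] W]
 have bb: "bil U ?VW Z (%u. lift Z (%v w. \<beta> (tens K U V u v) w))"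
  if Z: "vs Z" and b: "bil ?UV W Z \<beta>" for \<beta> and Z :: "('k, 'z, 'o) module_scheme"
 proof (rule bilI)
  note bi = bil_assoc_inner[OF U V W Z b]
  show "lin ?VW Z (lift Z (%v w. \<beta> (tens K U V u v) w))" if "u .: U" for u
   by (rule lin_tensor_lift[OF V W Z bi[OF that]])
  show "lin U Z (%u. lift Z (%v w. \<beta> (tens K U V u v) w) t)" if t: "t .: ?VW" for t
   by (rule lin_lift_fun[OF t V W Z U bi])
    (auto intro!: lin_compose[OF bil2[OF b]] lin_tens_left lin_id U V)
 qed
 note b0 = bil_tens[OF vs(1) W]
 note b1 = bb[OF vs(3) b0]
 have e: "tensor_assoc K U V W = lift ?Z (%u. lift ?Z (%v w. tens K ?UV W (tens K U V u v) w))"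
  by (simp add: tensor_assoc_def Let_def)
 show l: "lin (tsp U ?VW) ?Z (tensor_assoc K U V W)"
  unfolding e by (rule lin_tensor_lift[OF U vs(2,3) b1])
 show at: "tensor_assoc K U V W (tens K U ?VW u (tens K V W v w)) = tens K ?UV W (tens K U V u v) w"
  if "u .: U" "v .: V" "w .: W" for u v w
  using that by (simp add: e tensor_lift_tens[OF U vs(2,3) b1] tens_closed[OF V W]
    tensor_lift_tens[OF V W vs(3) bil_assoc_inner[OF U V W vs(3) b0]])
 show "lift Z \<beta> (tensor_assoc K U V W t) =
    lift Z (%u. lift Z (%v w. \<beta> (tens K U V u v) w)) t"
  if Z: "vs Z" and b: "bil ?UV W Z \<beta>" and t: "t .: (tsp U ?VW)"
 proof (rule tensor_lift_eq[symmetric, OF U vs(2) Z bb[OF Z b] lin_compose[OF lin_tensor_lift[OF vs(1) W Z b] l] _ t])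
  show "lift Z (%v w. \<beta> (tens K U V u v) w) y =
    lift Z \<beta> (tensor_assoc K U V W (tens K U ?VW u y))"
   if u: "u .: U" and y: "y .: ?VW" for u y
  proof (rule tensor_lift_eq[OF V W Z bil_assoc_inner[OF U V W Z b u] _ _ y])
   show "lin ?VW Z (%y. lift Z \<beta> (tensor_assoc K U V W (tens K U ?VW u y)))"
    by (intro lin_compose[OF lin_tensor_lift[OF vs(1) W Z b]] lin_compose[OF l] lin_tens_right lin_id U vs u)
  qed (simp add: at u tensor_lift_tens[OF vs(1) W Z b] tens_closed[OF U V])
 qed
qed

text \<open>Constructions that only depend on the vector space structure do not distinguish records
 with the same carrier, addition, zero and scalar multiplication.\<close>

definition same_space :: "('k, 'v, 'm) module_scheme \<Rightarrow> ('k, 'v, 'n) module_scheme \<Rightarrow> bool"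
 where "same_space V W \<longleftrightarrow> carrier V = carrier W \<and> add V = add W \<and> zero V = zero W \<and> smult V = smult W"

lemma same_space_vs: "same_space V W ==> vs V \<longleftrightarrow> vs W"
proof -
 have *: "vs W" if "same_space V W" "vs V"
  for V :: "('k, 'v, 'm) module_scheme" and W :: "('k, 'v, 'n) module_scheme"
 proof -
  interpret V: vectorspace K V by fact
  have s: "carrier W = carrier V" "add W = add V" "zero W = zero V" "smult W = smult V"
   using that(1) by (simp_all add: same_space_def)
  have "abelian_group W" by (rule abelian_group_cong[OF V.abelian_group_axioms]) (use s in auto)
  then show ?thesis
   by (rule vsI) (use s in \<open>auto simp: V.smult_l_distr V.smult_r_distr V.smult_assoc1\<close>)
 qed
 show "same_space V W ==> ?thesis"
  using *[of V W] *[of W V] by (auto simp: same_space_def)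
qed

lemma same_space_eqs:
 assumes "same_space V V'"
 shows "finsum V = finsum V'" "lift V = lift V'"
  "lin V W = lin V' W" "lin W V = lin W V'"
  "tensor_relations K V W = tensor_relations K V' W" "tensor_relations K W V = tensor_relations K W V'"
  "tsp V W = tsp V' W" "tsp W V = tsp W V'"
  "tens K V W = tens K V' W" "tens K W V = tens K W V'"
proof -
 note s = assms[unfolded same_space_def]
 show f: "finsum V = finsum V'"
  by (intro ext) (simp add: finsum_def finprod_def s)
 show "lift V = lift V'"
  by (intro ext) (simp add: tensor_lift_def Let_def f s)
 show "lin V W = lin V' W" "lin W V = lin W V'"
  by (intro ext; simp add: lin_def s)+
 show r: "tensor_relations K V W = tensor_relations K V' W" "tensor_relations K W V = tensor_relations K W V'"
  by (simp_all add: tensor_relations_def s)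
 show "tsp V W = tsp V' W" "tsp W V = tsp W V'"
  by (simp_all add: tensor_space_def tensor_kernel_def r s)
 show "tens K V W = tens K V' W" "tens K W V = tens K W V'"
  by (intro ext; simp add: tens_def tensor_kernel_def r s)+
qed

lemma same_space_bil:
 assumes "same_space V V'"
 shows "bil V W Z = bil V' W Z" "bil W V Z = bil W V' Z" "bil W Z V = bil W Z V'"
 by (intro ext; simp add: bil_def same_space_eqs[OF assms] assms[unfolded same_space_def])+

lemma same_space_map:
 assumes "same_space V V'"
 shows "tensor_map K V W = tensor_map K V' W" "tensor_map K W V = tensor_map K W V'"
  "tensor_assoc K V U W = tensor_assoc K V' U W" "tensor_assoc K U V W = tensor_assoc K U V' W"
  "tensor_assoc K U W V = tensor_assoc K U W V'"
 by (intro ext; simp add: tensor_map_def tensor_assoc_def Let_def same_space_eqs[OF assms])+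

subsection \<open>Algebras\<close>

lemma assoc_algebraD:
 assumes "alg A"
 shows "vs A" "ring A" "bil A A A (%x y. x \<otimes>\<^bsub>A\<^esub> y)"
proof -
 interpret A: assoc_algebra K A by fact
 show "vs A" "ring A" by unfold_locales
 show "bil A A A (%x y. x \<otimes>\<^bsub>A\<^esub> y)"
  by (intro bilI linI) (auto simp: A.l_distr A.r_distr A.smult_mult_left A.smult_mult_right)
qed

lemma assoc_algebraI:
 assumes "vs A" "bil A A A (%x y. x \<otimes>\<^bsub>A\<^esub> y)" "\<one>\<^bsub>A\<^esub> .: A"
  and "!!x y z. [|x .: A; y .: A; z .: A|] ==> (x \<otimes>\<^bsub>A\<^esub> y) \<otimes>\<^bsub>A\<^esub> z = x \<otimes>\<^bsub>A\<^esub> (y \<otimes>\<^bsub>A\<^esub> z)"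
  and "!!x. x .: A ==> \<one>\<^bsub>A\<^esub> \<otimes>\<^bsub>A\<^esub> x = x" "!!x. x .: A ==> x \<otimes>\<^bsub>A\<^esub> \<one>\<^bsub>A\<^esub> = x"
 shows "alg A"
proof -
 note b = assms(2)
 have "ring A"
  by (intro ringI vsD(1)[OF assms(1)] monoidI assms bil_closed[OF b])
   (auto intro: lin_add[OF bil2[OF b]] lin_add[OF bil1[OF b]])
 then show ?thesis
  unfolding assoc_algebra_def assoc_algebra_axioms_def
  using assms(1) lin_smult[OF bil2[OF b]] lin_smult[OF bil1[OF b]] by auto
qed

lemma lin_mult_left: "[|lin U A f; alg A; a .: A|] ==> lin U A (%x. f x \<otimes>\<^bsub>A\<^esub> a)"
 by (rule lin_compose[OF bil2[OF assoc_algebraD(3)]])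

lemma lin_mult_right: "[|lin U A f; alg A; a .: A|] ==> lin U A (%x. a \<otimes>\<^bsub>A\<^esub> f x)"
 by (rule lin_compose[OF bil1[OF assoc_algebraD(3)]])

lemma mult_closed: "[|alg A; a .: A; b .: A|] ==> a \<otimes>\<^bsub>A\<^esub> b .: A"
 by (rule bil_closed[OF assoc_algebraD(3)])

lemma one_closed': "alg A ==> \<one>\<^bsub>A\<^esub> .: A"
 by (simp add: assoc_algebraD(2) ring.ring_simprules(6))

lemma same_space_tensor_alg: "same_space (tensor_alg K A B) (tsp A B)"
 by (simp add: same_space_def tensor_alg_def Let_def)

lemma tensor_alg_simps [simp]:
 "carrier (tensor_alg K A B) = carrier (tsp A B)"
 "\<one>\<^bsub>tensor_alg K A B\<^esub> = tens K A B \<one>\<^bsub>A\<^esub> \<one>\<^bsub>B\<^esub>"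
 "a \<oplus>\<^bsub>tensor_alg K A B\<^esub> b = a \<oplus>\<^bsub>tsp A B\<^esub> b"
 "c \<odot>\<^bsub>tensor_alg K A B\<^esub> b = c \<odot>\<^bsub>tsp A B\<^esub> b"
 "\<zero>\<^bsub>tensor_alg K A B\<^esub> = \<zero>\<^bsub>tsp A B\<^esub>"
 by (simp_all add: tensor_alg_def Let_def)

lemma tensor_alg_props:
 assumes A: "alg A" and B: "alg B"
 shows tensor_alg_mult: "[|a .: A; b .: B; a' .: A; b' .: B|]
   ==> tens K A B a b \<otimes>\<^bsub>tensor_alg K A B\<^esub> tens K A B a' b' = tens K A B (a \<otimes>\<^bsub>A\<^esub> a') (b \<otimes>\<^bsub>B\<^esub> b')"
  and assoc_algebra_tensor_alg: "alg (tensor_alg K A B)"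
proof -
 interpret A: assoc_algebra K A by fact
 interpret B: assoc_algebra K B by fact
 let ?T = "tsp A B" and ?M = "tensor_alg K A B"
 note vA = A.vectorspace_axioms and vB = B.vectorspace_axioms
 note vT = vs_tensor[OF vA vB]
 note same = same_space_tensor_alg[of A B]
 have b1: "bil A B ?T (%a' b'. tens K A B (a \<otimes>\<^bsub>A\<^esub> a') (b \<otimes>\<^bsub>B\<^esub> b'))" if "a .: A" "b .: B" for a b
  using that by (intro bilI lin_tens_left lin_tens_right lin_mult_right lin_id A B vA vB mult_closed)
 have b2: "bil A B ?T (%a b. lift ?T (%a' b'. tens K A B (a \<otimes>\<^bsub>A\<^esub> a') (b \<otimes>\<^bsub>B\<^esub> b')) t')"
  if t: "t' .: ?T" for t'
  by (intro bilI lin_lift_fun[OF t vA vB vT] b1 vA vB lin_tens_left lin_tens_right lin_mult_left lin_id A B mult_closed)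
 have e: "t \<otimes>\<^bsub>?M\<^esub> t' = lift ?T (%a b. lift ?T (%a' b'. tens K A B (a \<otimes>\<^bsub>A\<^esub> a') (b \<otimes>\<^bsub>B\<^esub> b')) t') t"
  for t t' by (simp add: tensor_alg_def Let_def)
 show m: "tens K A B a b \<otimes>\<^bsub>?M\<^esub> tens K A B a' b' = tens K A B (a \<otimes>\<^bsub>A\<^esub> a') (b \<otimes>\<^bsub>B\<^esub> b')"
  if "a .: A" "b .: B" "a' .: A" "b' .: B" for a b a' b'
  using that by (simp add: e tensor_lift_tens[OF vA vB vT b2] tensor_lift_tens[OF vA vB vT b1] tens_closed vA vB)
 have bM: "bil ?T ?T ?T (%x y. x \<otimes>\<^bsub>?M\<^esub> y)"
  unfolding e
  by (intro bilI lin_tensor_lift[OF vA vB vT b2] lin_lift_fun[OF _ vA vB vT vT b2])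
   (auto intro: lin_tensor_lift[OF vA vB vT b1])
 note closed = bil_closed[OF bM]
 have ext1: "f t = g t" if "lin ?T ?T f" "lin ?T ?T g" "t .: ?T"
  "!!a b. [|a .: A; b .: B|] ==> f (tens K A B a b) = g (tens K A B a b)" for f g t
  using tensor_ext[OF vA vB vT that(1,2,4,3)] .
 have lM: "lin ?T ?T (%x. u \<otimes>\<^bsub>?M\<^esub> f x)" "lin ?T ?T (%x. f x \<otimes>\<^bsub>?M\<^esub> u)"
  if "lin ?T ?T f" "u .: ?T" for u f
  using lin_compose[OF bil1[OF bM that(2)] that(1)] lin_compose[OF bil2[OF bM that(2)] that(1)] .
 note tc = tens_closed[OF vA vB]
 show "alg ?M"
 proof (rule assoc_algebraI)
  show "vs ?M" using same_space_vs[OF same] vT by simp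
  show "bil ?M ?M ?M (%x y. x \<otimes>\<^bsub>?M\<^esub> y)" unfolding same_space_bil[OF same] by (rule bM)
  show "\<one>\<^bsub>?M\<^esub> .: ?M" by (simp add: tc)
  have one: "\<one>\<^bsub>?M\<^esub> .: ?T" by (simp add: tc)
  note o = bil1[OF bM one] bil2[OF bM one]
  show "\<one>\<^bsub>?M\<^esub> \<otimes>\<^bsub>?M\<^esub> t = t" if "t .: ?M" for t
   by (rule ext1[OF o(1) lin_id]) (use that in \<open>simp_all add: m\<close>)
  show "t \<otimes>\<^bsub>?M\<^esub> \<one>\<^bsub>?M\<^esub> = t" if "t .: ?M" for t
   by (rule ext1[OF o(2) lin_id]) (use that in \<open>simp_all add: m\<close>)
  show "(t \<otimes>\<^bsub>?M\<^esub> u) \<otimes>\<^bsub>?M\<^esub> v = t \<otimes>\<^bsub>?M\<^esub> (u \<otimes>\<^bsub>?M\<^esub> v)" if "t .: ?M" "u .: ?M" "v .: ?M" for t u v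
  proof (rule ext1[of "%t. (t \<otimes>\<^bsub>?M\<^esub> u) \<otimes>\<^bsub>?M\<^esub> v" "%t. t \<otimes>\<^bsub>?M\<^esub> (u \<otimes>\<^bsub>?M\<^esub> v)" t])
   fix a b assume ab: "a .: A" "b .: B"
   let ?p = "tens K A B a b"
   show "(?p \<otimes>\<^bsub>?M\<^esub> u) \<otimes>\<^bsub>?M\<^esub> v = ?p \<otimes>\<^bsub>?M\<^esub> (u \<otimes>\<^bsub>?M\<^esub> v)"
   proof (rule ext1[of "%u. (?p \<otimes>\<^bsub>?M\<^esub> u) \<otimes>\<^bsub>?M\<^esub> v" "%u. ?p \<otimes>\<^bsub>?M\<^esub> (u \<otimes>\<^bsub>?M\<^esub> v)" u])
    fix c d assume cd: "c .: A" "d .: B"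
    let ?q = "tens K A B c d"
    show "(?p \<otimes>\<^bsub>?M\<^esub> ?q) \<otimes>\<^bsub>?M\<^esub> v = ?p \<otimes>\<^bsub>?M\<^esub> (?q \<otimes>\<^bsub>?M\<^esub> v)"
     by (rule ext1[of "%v. (?p \<otimes>\<^bsub>?M\<^esub> ?q) \<otimes>\<^bsub>?M\<^esub> v" "%v. ?p \<otimes>\<^bsub>?M\<^esub> (?q \<otimes>\<^bsub>?M\<^esub> v)" v])
       (simp_all add: m A.m_assoc B.m_assoc that[simplified] ab cd lM lin_id closed tc)
   qed (simp_all add: that[simplified] ab lM lin_id closed tc)
  qed (simp_all add: that[simplified] lM lin_id closed)
 qed
qed

lemma tensor_lift_mult:
 assumes "vs V" "vs W" "vs V'" "vs W'" "alg M"
  and f: "bil V W M f" and g: "bil V' W' M g"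
  and t: "t .: (tsp V W)" and u: "u .: (tsp V' W')"
 shows "lift M f t \<otimes>\<^bsub>M\<^esub> lift M g u =
  lift M (%a b. lift M (%c d. f a b \<otimes>\<^bsub>M\<^esub> g c d) u) t"
proof -
 note vM = assoc_algebraD(1)[OF assms(5)] and bM = assoc_algebraD(3)[OF assms(5)]
 note gc = tensor_lift_closed[OF assms(3,4) vM g u]
 have "lift M f t \<otimes>\<^bsub>M\<^esub> lift M g u = lift M (%a b. f a b \<otimes>\<^bsub>M\<^esub> lift M g u) t"
  by (rule lin_tensor_lift_comp[OF bil2[OF bM gc] assms(1,2) vM vM f t])
 also have "... = lift M (%a b. lift M (%c d. f a b \<otimes>\<^bsub>M\<^esub> g c d) u) t"
 proof (rule tensor_lift_cong[OF t assms(1,2)])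
  show "f v w \<otimes>\<^bsub>M\<^esub> lift M g u = lift M (%c d. f v w \<otimes>\<^bsub>M\<^esub> g c d) u"
   if "v .: V" "w .: W" for v w
   by (rule lin_tensor_lift_comp[OF bil1[OF bM bil_closed[OF f that]] assms(3,4) vM vM g u])
 qed
 finally show ?thesis .
qed

lemma alg_homI:
 assumes "alg A" "alg B" "lin A B f" "f \<one>\<^bsub>A\<^esub> = \<one>\<^bsub>B\<^esub>"
  and "!!x y. [|x .: A; y .: A|] ==> f (x \<otimes>\<^bsub>A\<^esub> y) = f x \<otimes>\<^bsub>B\<^esub> f y"
 shows "f \<in> alg_hom K A B"
 unfolding alg_hom_iff
 by (intro conjI ring_hom_memI assoc_algebraD(1) assms lin_add[OF assms(3)] lin_closed[OF assms(3)])

lemma alg_homD: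
 assumes "f \<in> alg_hom K A B"
 shows "lin A B f" "f \<one>\<^bsub>A\<^esub> = \<one>\<^bsub>B\<^esub>" "[|x .: A; y .: A|] ==> f (x \<otimes>\<^bsub>A\<^esub> y) = f x \<otimes>\<^bsub>B\<^esub> f y"
  "x .: A ==> f x .: B"
 using assms by (auto simp: alg_hom_iff ring_hom_one ring_hom_mult ring_hom_closed)

text \<open>The universal property of the tensor product of algebras. The condition \<open>m\<close>
  combines multiplicativity in each argument with the commutation of the two images.\<close>

lemma alg_hom_tensor_lift:
 assumes A: "alg A" and B: "alg B" and C: "alg C"
  and b: "bil A B C \<beta>" and one: "\<beta> \<one>\<^bsub>A\<^esub> \<one>\<^bsub>B\<^esub> = \<one>\<^bsub>C\<^esub>"
  and m: "!!a b a' b'. [|a .: A; b .: B; a' .: A; b' .: B|]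
   ==> \<beta> (a \<otimes>\<^bsub>A\<^esub> a') (b \<otimes>\<^bsub>B\<^esub> b') = \<beta> a b \<otimes>\<^bsub>C\<^esub> \<beta> a' b'"
 shows "lift C \<beta> \<in> alg_hom K (tensor_alg K A B) C"
proof (rule alg_homI[OF assoc_algebra_tensor_alg[OF A B] C])
 let ?T = "tsp A B" and ?M = "tensor_alg K A B"
 note vA = assoc_algebraD(1)[OF A] and vB = assoc_algebraD(1)[OF B] and vC = assoc_algebraD(1)[OF C]
 note l = lin_tensor_lift[OF vA vB vC b] and lt = tensor_lift_tens[OF vA vB vC b]
 note vT = vs_tensor[OF vA vB] and M = assoc_algebra_tensor_alg[OF A B]
 note same = same_space_eqs[OF same_space_tensor_alg[of A B]]
 show "lin ?M C (lift C \<beta>)" unfolding same by (rule l)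
 show "lift C \<beta> \<one>\<^bsub>?M\<^esub> = \<one>\<^bsub>C\<^esub>" by (simp add: lt one_closed' A B one)
 have LM: "lin ?T ?T (%x. u \<otimes>\<^bsub>?M\<^esub> x)" "lin ?T ?T (%x. x \<otimes>\<^bsub>?M\<^esub> u)" if "u .: ?T" for u
  using bil1[OF assoc_algebraD(3)[OF M], of u] bil2[OF assoc_algebraD(3)[OF M], of u] that
  by (simp_all add: same)
 show "lift C \<beta> (x \<otimes>\<^bsub>?M\<^esub> y) = lift C \<beta> x \<otimes>\<^bsub>C\<^esub> lift C \<beta> y"
  if "x .: ?M" "y .: ?M" for x y
 proof (rule tensor_ext[OF vA vB vC, of "%x. lift C \<beta> (x \<otimes>\<^bsub>?M\<^esub> y)"])
  show "lin ?T C (%x. lift C \<beta> (x \<otimes>\<^bsub>?M\<^esub> y))"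
   using that by (intro lin_compose[OF l LM(2)]) simp
  show "lin ?T C (%x. lift C \<beta> x \<otimes>\<^bsub>C\<^esub> lift C \<beta> y)"
   using that by (intro lin_mult_left l C lin_closed[OF l]) simp
  show "lift C \<beta> (tens K A B a b \<otimes>\<^bsub>?M\<^esub> y) = lift C \<beta> (tens K A B a b) \<otimes>\<^bsub>C\<^esub> lift C \<beta> y"
   if ab: "a .: A" "b .: B" for a b
  proof (rule tensor_ext[OF vA vB vC, of "%y. lift C \<beta> (tens K A B a b \<otimes>\<^bsub>?M\<^esub> y)"])
   show "lin ?T C (%y. lift C \<beta> (tens K A B a b \<otimes>\<^bsub>?M\<^esub> y))"
    by (intro lin_compose[OF l LM(1)] tens_closed vA vB ab)
   show "lin ?T C (%y. lift C \<beta> (tens K A B a b) \<otimes>\<^bsub>C\<^esub> lift C \<beta> y)"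
    by (intro lin_mult_right l C lin_closed[OF l] tens_closed vA vB ab)
  qed (use \<open>y .: ?M\<close> ab in \<open>simp_all add: tensor_alg_mult[OF A B] lt m mult_closed A B\<close>)
 qed (use that in simp_all)
qed

lemma smult_closed': "[|vs V; c .: K; v .: V|] ==> c \<odot>\<^bsub>V\<^esub> v .: V"
 by (rule module.smult_closed[OF vsD(2)])

text \<open>Introduction rules for \<open>lin\<close>, \<open>bil\<close> and membership, arranged
  so that \<open>(assumption | rule ...)+\<close> decomposes a Sweedler expression along its syntax.
  Each later setting extends the collection by rules for its own operations.\<close>

lemmas calc = lin_id lin_tens_left lin_tens_right lin_mult_left lin_mult_right lin_lift_arg lin_lift_fun
 bilI tens_closed mult_closed tensor_lift_closed smult_closed' lin_smult_left lin_smult_right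
 vs_tensor vs_scalars

end

section \<open>Hopf algebras\<close>

locale hopf_base = field_base K for K :: "('k, 'r) ring_scheme" (structure) +
 fixes H :: "('k, 'h, 'm) hopf_scheme"
 assumes hopf: "hopf_algebra K H"
begin

abbreviation HH where "HH \<equiv> tsp H H"
abbreviation hmult (infixl "**" 70) where "x ** y \<equiv> x \<otimes>\<^bsub>H\<^esub> y"
abbreviation uH where "uH \<equiv> \<one>\<^bsub>H\<^esub>"
abbreviation S where "S \<equiv> antipode H"
abbreviation \<epsilon> where "\<epsilon> \<equiv> counit H"
abbreviation \<Delta> where "\<Delta> \<equiv> comult H"
abbreviation sw where "sw Z h f \<equiv> lift Z f (comult H h)"

lemma algH: "alg H" and comult_hom: "\<Delta> \<in> alg_hom K H (tensor_alg K H H)"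
 and counit_hom: "\<epsilon> \<in> alg_hom K H (scalars K)"
 and lin_comult0: "lin H HH \<Delta>" and lin_antipode0: "lin H H S" and lin_counit0: "lin H (scalars K) \<epsilon>"
proof -
 interpret Hopf: hopf_algebra K H by (rule hopf)
 show "alg H" by unfold_locales
 show "\<Delta> \<in> alg_hom K H (tensor_alg K H H)" "\<epsilon> \<in> alg_hom K H (scalars K)"
  by (rule Hopf.comult_hom Hopf.counit_hom)+
 show "lin H HH \<Delta>" "lin H H S" "lin H (scalars K) \<epsilon>"
  using Hopf.comult_linear Hopf.antipode_linear Hopf.counit_linear by (simp_all add: linear_map_iff)
qed

lemmas vsH = assoc_algebraD(1)[OF algH]

lemma lin_comult: "lin U H f ==> lin U HH (%x. \<Delta> (f x))"
 and lin_antipode: "lin U H f ==> lin U H (%x. S (f x))"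
 and lin_counit: "lin U H f ==> lin U (scalars K) (%x. \<epsilon> (f x))"
 by (rule lin_compose[OF lin_comult0] lin_compose[OF lin_antipode0] lin_compose[OF lin_counit0]; assumption)+

lemma comult_closed: "h .: H ==> \<Delta> h .: HH"
 and antipode_closed: "h .: H ==> S h .: H"
 and counit_closed: "h .: H ==> \<epsilon> h .: K"
 and oneH: "uH .: H"
 using lin_closed[OF lin_comult0] lin_closed[OF lin_antipode0] lin_closed[OF lin_counit0] one_closed'[OF algH]
 by auto

lemmas hcalc = calc vsH algH lin_comult lin_antipode lin_counit comult_closed antipode_closed counit_closed oneH

lemma sw_cong:
 assumes "h .: H" "!!a b. [|a .: H; b .: H|] ==> f a b = g a b"
 shows "sw Z h f = sw Z h g"
 by (rule tensor_lift_cong[OF comult_closed[OF assms(1)] vsH vsH assms(2)])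

lemma sw_comp:
 assumes "lin Z Z' F" "vs Z" "vs Z'" "bil H H Z f" "h .: H"
 shows "F (sw Z h f) = sw Z' h (%a b. F (f a b))"
 by (rule lin_tensor_lift_comp[OF assms(1) vsH vsH assms(2-4) comult_closed[OF assms(5)]])

lemma sw_comp':
 assumes "lin Z Z' F" "vs Z" "vs Z'" "bil H H Z f" "h .: H"
  and "!!a b. [|a .: H; b .: H|] ==> F (f a b) = g a b"
 shows "F (sw Z h f) = sw Z' h g"
 unfolding sw_comp[OF assms(1-5)] by (rule sw_cong[OF assms(5,6)])

definition tri :: "('k, 'z, 'o) module_scheme \<Rightarrow> ('h \<Rightarrow> 'h \<Rightarrow> 'h \<Rightarrow> 'z) \<Rightarrow> bool"
 where "tri Z f \<longleftrightarrow> (\<forall>a\<in>carrier H. \<forall>b\<in>carrier H. lin H Z (f a b) \<and> lin H Z (%x. f a x b) \<and> lin H Z (%x. f x a b))"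

lemma triI:
 assumes "!!a b. [|a .: H; b .: H|] ==> lin H Z (%x. f a b x)"
  and "!!a b. [|a .: H; b .: H|] ==> lin H Z (%x. f a x b)"
  and "!!a b. [|a .: H; b .: H|] ==> lin H Z (%x. f x a b)"
 shows "tri Z f"
 using assms by (simp add: tri_def)

lemma triD:
 assumes "tri Z f" "a .: H" "b .: H"
 shows "lin H Z (%x. f a b x)" "lin H Z (%x. f a x b)" "lin H Z (%x. f x a b)"
 using assms by (simp_all add: tri_def)

text \<open>The axiom \<open>coassoc\<close> equates two elements of (H \<otimes> H) \<otimes> H.
  Applying the linear map induced by the trilinear \<open>f\<close> to both turns it into a rule for
  moving the bracket in an iterated coproduct.\<close>

lemma sw_assoc:
 assumes Z: "vs Z" and f: "tri Z f" and h: "h .: H"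
 shows "sw Z h (%a b. sw Z a (%c d. f c d b)) = sw Z h (%a b. sw Z b (%c d. f a c d))"
proof -
 interpret Hopf: hopf_algebra K H by (rule hopf)
 note [simp] = h
 have b1: "bil HH H Z (%t b. lift Z (%c d. f c d b) t)"
  by (assumption | rule triD[OF f] Z hcalc)+
 have b0: "bil H H Z (f a)" if "a .: H" for a
  using that by (intro bilI triD[OF f])
 have b2: "bil H HH Z (%a t. lift Z (f a) t)"
  by (assumption | rule triD[OF f] Z b0 hcalc)+
 have "sw Z h (%a b. sw Z a (%c d. f c d b)) =
   lift Z (%t b. lift Z (%c d. f c d b) t) (tensor_map K HH H \<Delta> id (\<Delta> h))"
  by (rule tensor_lift_map[symmetric, where V = H and W = H and W' = H and g = id, simplified])
    ((assumption | rule lin_comult0 Z b1 lin_id[folded id_def] hcalc h)+)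
 also have "tensor_map K HH H \<Delta> id (\<Delta> h) = tensor_assoc K H H H (tensor_map K H HH id \<Delta> (\<Delta> h))"
  by (rule Hopf.coassoc[OF h])
 also have "lift Z (%t b. lift Z (%c d. f c d b) t) ... =
   lift Z (%u. lift Z (%v w. lift Z (%c d. f c d w) (tens K H H u v)))
    (tensor_map K H HH id \<Delta> (\<Delta> h))"
  by (rule tensor_lift_assoc[OF vsH vsH vsH Z b1])
    (rule lin_closed[OF lin_tensor_map], (assumption | rule lin_comult0 lin_id[folded id_def] hcalc h)+)
 \<comment> \<open>On a pure tensor of \<open>u\<close> and \<open>v\<close> the innermost lift
   evaluates back to \<open>f u v w\<close>, which removes the auxiliary tensor introduced by the
   rebracketing map.\<close>
 also have "... = lift Z (%a t. lift Z (f a) t) (tensor_map K H HH id \<Delta> (\<Delta> h))"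
 proof (rule tensor_lift_cong[OF _ vsH, symmetric])
  show "tensor_map K H HH id \<Delta> (\<Delta> h) .: (tsp H HH)"
    by (rule lin_closed[OF lin_tensor_map], (assumption | rule lin_comult0 lin_id[folded id_def] hcalc h)+)
  show "lift Z (f u) t =
    lift Z (%v w. lift Z (%c d. f c d w) (tens K H H u v)) t"
   if u: "u .: H" and "t .: HH" for u t
  proof (rule tensor_lift_cong[OF that(2) vsH vsH])
   fix v w assume vw: "v .: H" "w .: H"
   have "bil H H Z (%c d. f c d w)" using vw by (intro bilI triD[OF f])
   from tensor_lift_tens[OF vsH vsH Z this u vw(1)]
   show "f u v w = lift Z (%c d. f c d w) (tens K H H u v)" by simp
  qed
 qed (rule hcalc)+
 also have "... = sw Z h (%a b. sw Z b (%c d. f a c d))"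
  by (rule tensor_lift_map[where V = H and W = H and f = id, simplified])
    ((assumption | rule lin_comult0 Z b2 lin_id[folded id_def] hcalc h)+)
 finally show ?thesis .
qed

lemma sw_counit:
 assumes Z: "vs Z" and f: "lin H Z f" and h: "h .: H"
 shows "sw Z h (%a b. \<epsilon> a \<odot>\<^bsub>Z\<^esub> f b) = f h" "sw Z h (%a b. \<epsilon> b \<odot>\<^bsub>Z\<^esub> f a) = f h"
proof -
 interpret Hopf: hopf_algebra K H by (rule hopf)
 have b: "bil H H H (%a b. \<epsilon> a \<odot>\<^bsub>H\<^esub> b)" "bil H H H (%a b. \<epsilon> b \<odot>\<^bsub>H\<^esub> a)"
  by (assumption | rule hcalc)+
 have "sw Z h (%a b. \<epsilon> a \<odot>\<^bsub>Z\<^esub> f b) = sw Z h (%a b. f (\<epsilon> a \<odot>\<^bsub>H\<^esub> b))"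
  "sw Z h (%a b. \<epsilon> b \<odot>\<^bsub>Z\<^esub> f a) = sw Z h (%a b. f (\<epsilon> b \<odot>\<^bsub>H\<^esub> a))"
  by (rule sw_cong[OF h],
    simp add: lin_smult[OF f] counit_closed)+
 then show "sw Z h (%a b. \<epsilon> a \<odot>\<^bsub>Z\<^esub> f b) = f h" "sw Z h (%a b. \<epsilon> b \<odot>\<^bsub>Z\<^esub> f a) = f h"
  using sw_comp[OF f vsH Z b(1) h] sw_comp[OF f vsH Z b(2) h] Hopf.counit_left[OF h] Hopf.counit_right[OF h] by simp_all
qed

lemma sw_antipode:
 assumes Z: "vs Z" and f: "lin H Z f" and h: "h .: H"
 shows "sw Z h (%a b. f (S a ** b)) = \<epsilon> h \<odot>\<^bsub>Z\<^esub> f uH" "sw Z h (%a b. f (a ** S b)) = \<epsilon> h \<odot>\<^bsub>Z\<^esub> f uH"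
proof -
 interpret Hopf: hopf_algebra K H by (rule hopf)
 have b: "bil H H H (%a b. S a ** b)" "bil H H H (%a b. a ** S b)"
  by (assumption | rule hcalc)+
 show "sw Z h (%a b. f (S a ** b)) = \<epsilon> h \<odot>\<^bsub>Z\<^esub> f uH" "sw Z h (%a b. f (a ** S b)) = \<epsilon> h \<odot>\<^bsub>Z\<^esub> f uH"
  using sw_comp[OF f vsH Z b(1) h] sw_comp[OF f vsH Z b(2) h] Hopf.antipode_left[OF h] Hopf.antipode_right[OF h]
   lin_smult[OF f counit_closed[OF h] oneH] by simp_all
qed

lemma sw_mult:
 assumes Z: "vs Z" and f: "bil H H Z f" and h: "h .: H" and l: "l .: H"
 shows "sw Z (h ** l) f = sw Z h (%a b. sw Z l (%c d. f (a ** c) (b ** d)))"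
proof -
 let ?M = "tensor_alg K H H"
 note M = assoc_algebra_tensor_alg[OF algH algH] and same = same_space_eqs[OF same_space_tensor_alg[of H H]]
  same_space_bil[OF same_space_tensor_alg[of H H]]
 have ex: "lift HH (tens K H H) t = t" if "t .: HH" for t
  by (rule tensor_lift_eq[OF vsH vsH vs_tensor[OF vsH vsH] bil_tens[OF vsH vsH] lin_id _ that]) (rule refl)
 have "\<Delta> (h ** l) = \<Delta> h \<otimes>\<^bsub>?M\<^esub> \<Delta> l" using alg_homD(3)[OF comult_hom h l] .
 also have "... = lift ?M (tens K H H) (\<Delta> h) \<otimes>\<^bsub>?M\<^esub> lift ?M (tens K H H) (\<Delta> l)"
  by (simp add: same ex comult_closed h l)
 also have "... = lift ?M (%a b. lift ?M (%c d. tens K H H a b \<otimes>\<^bsub>?M\<^esub> tens K H H c d) (\<Delta> l)) (\<Delta> h)"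
  by (rule tensor_lift_mult[OF vsH vsH vsH vsH M]) (simp_all add: same bil_tens vsH comult_closed h l)
 also have "... = sw HH h (%a b. sw HH l (%c d. tens K H H (a ** c) (b ** d)))"
  unfolding same
 proof (rule sw_cong[symmetric, OF h])
  show "sw HH l (%c d. tens K H H (a ** c) (b ** d)) = sw HH l (%c d. tens K H H a b \<otimes>\<^bsub>?M\<^esub> tens K H H c d)"
   if "a .: H" "b .: H" for a b
   by (rule sw_cong[OF l],
     simp add: tensor_alg_mult[OF algH algH] that)
 qed
 finally have e: "\<Delta> (h ** l) = sw HH h (%a b. sw HH l (%c d. tens K H H (a ** c) (b ** d)))" .
 note F = lin_tensor_lift[OF vsH vsH Z f]
 have "sw Z (h ** l) f = sw Z h (%a b. lift Z f (sw HH l (%c d. tens K H H (a ** c) (b ** d))))"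
  unfolding e by (rule sw_comp[OF F _ Z _ h]) ((assumption | rule hcalc l)+)
 also have "... = sw Z h (%a b. sw Z l (%c d. f (a ** c) (b ** d)))"
 proof (rule sw_cong[OF h])
  fix a b assume ab: "a .: H" "b .: H"
  have "lift Z f (sw HH l (%c d. tens K H H (a ** c) (b ** d))) = sw Z l (%c d. f (a ** c) (b ** d))"
   by (rule sw_comp'[OF F _ Z _ l], (assumption | rule hcalc l ab)+, simp add: tensor_lift_tens[OF vsH vsH Z f] mult_closed algH ab)
  then show "lift Z f (sw HH l (%c d. tens K H H (a ** c) (b ** d))) =
   sw Z l (%c d. f (a ** c) (b ** d))" .
 qed
 finally show ?thesis .
qed

lemma counit_mult: "[|a .: H; b .: H|] ==> \<epsilon> (a ** b) = \<epsilon> a \<otimes> \<epsilon> b"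
 and counit_one: "\<epsilon> uH = \<one>" and comult_one: "\<Delta> uH = tens K H H uH uH"
 using alg_homD(2,3)[OF counit_hom] alg_homD(2)[OF comult_hom] by simp_all

lemma sw_one: "[|vs Z; bil H H Z f|] ==> sw Z uH f = f uH uH"
 by (simp add: comult_one tensor_lift_tens[OF vsH vsH] oneH)

text \<open>Cancellation of an adjacent pair of Sweedler legs, on either side of a third leg.\<close>

lemma sw_cancel_left:
 assumes Z: "vs Z" and f: "bil H H Z f" and h: "h .: H"
 shows "sw Z h (%a b. sw Z a (%c d. f (S c ** d) b)) = f uH h"
  and "sw Z h (%a b. sw Z a (%c d. f (c ** S d) b)) = f uH h"
proof -
 have "sw Z h (%a b. sw Z a (%c d. f (S c ** d) b)) = sw Z h (%a b. \<epsilon> a \<odot>\<^bsub>Z\<^esub> f uH b)"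
  by (rule sw_cong[OF h], simp add: sw_antipode[OF Z bil2[OF f]])
 then show "sw Z h (%a b. sw Z a (%c d. f (S c ** d) b)) = f uH h"
  using sw_counit(1)[OF Z bil1[OF f oneH] h] by simp
 have "sw Z h (%a b. sw Z a (%c d. f (c ** S d) b)) = sw Z h (%a b. \<epsilon> a \<odot>\<^bsub>Z\<^esub> f uH b)"
  by (rule sw_cong[OF h], simp add: sw_antipode[OF Z bil2[OF f]])
 then show "sw Z h (%a b. sw Z a (%c d. f (c ** S d) b)) = f uH h"
  using sw_counit(1)[OF Z bil1[OF f oneH] h] by simp
qed

lemma sw_cancel_right:
 assumes Z: "vs Z" and f: "bil H H Z f" and h: "h .: H"
 shows "sw Z h (%a b. sw Z b (%c d. f a (S c ** d))) = f h uH"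
  and "sw Z h (%a b. sw Z b (%c d. f a (c ** S d))) = f h uH"
proof -
 have "sw Z h (%a b. sw Z b (%c d. f a (S c ** d))) = sw Z h (%a b. \<epsilon> b \<odot>\<^bsub>Z\<^esub> f a uH)"
  by (rule sw_cong[OF h], simp add: sw_antipode[OF Z bil1[OF f]])
 then show "sw Z h (%a b. sw Z b (%c d. f a (S c ** d))) = f h uH"
  using sw_counit(2)[OF Z bil2[OF f oneH] h] by simp
 have "sw Z h (%a b. sw Z b (%c d. f a (c ** S d))) = sw Z h (%a b. \<epsilon> b \<odot>\<^bsub>Z\<^esub> f a uH)"
  by (rule sw_cong[OF h], simp add: sw_antipode[OF Z bil1[OF f]])
 then show "sw Z h (%a b. sw Z b (%c d. f a (c ** S d))) = f h uH"
  using sw_counit(2)[OF Z bil2[OF f oneH] h] by simp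
qed

subsection \<open>Anti-multiplicativity of the antipode\<close>

text \<open>S(hl) = S(h_1 l_1) h_2 l_2 S(l_3) S(h_3), since h_2 S(h_3) and l_2 S(l_3) may be
  inserted; the antipode axiom for the product of the leading legs then leaves S(l) S(h).\<close>

lemma antipode_mult:
 assumes h: "h .: H" and l: "l .: H"
 shows "S (h ** l) = S l ** S h"
proof -
 interpret A: assoc_algebra K H by (rule algH)
 note c = hcalc h l
 \<comment> \<open>The bracketing keeps c' S(d') together, so that the inserted pair for
   \<open>l\<close> can be collapsed inside the one for \<open>h\<close>.\<close>
 define E where "E a a' c c' d d' = S (a ** a') ** ((c ** (c' ** S d')) ** S d)" for a a' c c' d d'
 have E: "lin U H (%x. E (f x) a' c c' d d')" "lin U H (%x. E a (f x) c c' d d')" "lin U H (%x. E a a' (f x) c' d d')"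
  "lin U H (%x. E a a' c (f x) d d')" "lin U H (%x. E a a' c c' (f x) d')" "lin U H (%x. E a a' c c' d (f x))"
  if "lin U H f" "a .: H" "a' .: H" "c .: H" "c' .: H" "d .: H" "d' .: H"
  for U :: "('k, 'h, 'm) hopf_scheme" and f a a' c c' d d'
  unfolding E_def by (insert that, (assumption | rule hcalc)+)
 have "S (h ** l) = sw H h (%a b. sw H b (%c d. S (a ** l) ** (c ** S d)))"
  by (subst sw_cancel_right(2)[OF vsH _ h], (assumption | rule c)+)
    (simp add: mult_closed antipode_closed algH h l oneH)
 also have "... = sw H h (%a b. sw H b (%c d. sw H l (%a' b'. sw H b' (%c' d'. E a a' c c' d d'))))"
 proof (rule sw_cong[OF h], rule sw_cong, assumption)
  fix a b c d assume abcd: "a .: H" "b .: H" "c .: H" "d .: H"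
  have "sw H l (%a' b'. sw H b' (%c' d'. S (a ** a') ** ((c ** (c' ** S d')) ** S d))) =
    S (a ** l) ** ((c ** uH) ** S d)"
   by (rule sw_cancel_right(2)[OF vsH _ l, of "%a' y. S (a ** a') ** ((c ** y) ** S d)"])
    ((assumption | rule hcalc abcd)+)
  then show "S (a ** l) ** (c ** S d) = sw H l (%a' b'. sw H b' (%c' d'. E a a' c c' d d'))"
   by (simp add: E_def abcd)
 qed
 also have "... = sw H h (%p d. sw H p (%a c. sw H l (%a' b'. sw H b' (%c' d'. E a a' c c' d d'))))"
  by (rule sw_assoc[symmetric, OF vsH triI h]; (assumption | rule E hcalc l)+)
 also have "... = sw H h (%p d. sw H p (%a c. sw H l (%q d'. sw H q (%a' c'. E a a' c c' d d'))))"
  by (rule sw_cong[OF h], rule sw_cong, assumption, rule sw_assoc[symmetric, OF vsH triI l]; (assumption | rule E hcalc)+)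
 also have "... = sw H h (%p d. sw H l (%q d'. sw H p (%a c. sw H q (%a' c'. E a a' c c' d d'))))"
  by (rule sw_cong[OF h],
   rule tensor_lift_swap[OF vsH vsH vsH vsH vsH]; (assumption | rule E hcalc l)+)
 also have "... = sw H h (%p d. sw H l (%q d'. \<epsilon> p \<odot>\<^bsub>H\<^esub> (\<epsilon> q \<odot>\<^bsub>H\<^esub> (S d' ** S d))))"
 proof (rule sw_cong[OF h], rule sw_cong[OF l])
  fix p d q d' assume pd: "p .: H" "d .: H" "q .: H" "d' .: H"
  \<comment> \<open>Regrouped in this way, S(aa') cc' is the antipode axiom for the single element
    \<open>p ** q\<close>.\<close>
  have "sw H p (%a c. sw H q (%a' c'. E a a' c c' d d')) =
    sw H p (%a c. sw H q (%a' c'. (S (a ** a') ** (c ** c')) ** (S d' ** S d)))"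
   by (rule sw_cong[OF pd(1)], rule sw_cong[OF pd(3)], simp add: E_def A.m_assoc antipode_closed pd)
  also have "... = sw H (p ** q) (%u v. (S u ** v) ** (S d' ** S d))"
   by (rule sw_mult[symmetric, OF vsH _ pd(1,3)]) ((assumption | rule hcalc pd)+)
  also have "... = \<epsilon> (p ** q) \<odot>\<^bsub>H\<^esub> (uH ** (S d' ** S d))"
   by (rule sw_antipode(1)[OF vsH, of "%y. y ** (S d' ** S d)"]) ((assumption | rule hcalc pd)+)
  also have "... = \<epsilon> p \<odot>\<^bsub>H\<^esub> (\<epsilon> q \<odot>\<^bsub>H\<^esub> (S d' ** S d))"
   by (simp add: counit_mult pd antipode_closed A.smult_assoc1 counit_closed)
  finally show "sw H p (%a c. sw H q (%a' c'. E a a' c c' d d')) = \<epsilon> p \<odot>\<^bsub>H\<^esub> (\<epsilon> q \<odot>\<^bsub>H\<^esub> (S d' ** S d))" .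
 qed
 also have "... = sw H h (%p d. \<epsilon> p \<odot>\<^bsub>H\<^esub> (S l ** S d))"
 proof (rule sw_cong[OF h])
  fix p d assume pd: "p .: H" "d .: H"
  have "sw H l (%q d'. \<epsilon> p \<odot>\<^bsub>H\<^esub> (\<epsilon> q \<odot>\<^bsub>H\<^esub> (S d' ** S d))) = sw H l (%q d'. \<epsilon> q \<odot>\<^bsub>H\<^esub> (\<epsilon> p \<odot>\<^bsub>H\<^esub> (S d' ** S d)))"
   by (rule sw_cong[OF l],
    simp add: pd antipode_closed counit_closed A.smult_assoc1[symmetric] m_comm)
  also have "... = \<epsilon> p \<odot>\<^bsub>H\<^esub> (S l ** S d)"
   by (rule sw_counit(1)[OF vsH _ l]) ((assumption | rule hcalc pd)+)
  finally show "sw H l (%q d'. \<epsilon> p \<odot>\<^bsub>H\<^esub> (\<epsilon> q \<odot>\<^bsub>H\<^esub> (S d' ** S d))) = \<epsilon> p \<odot>\<^bsub>H\<^esub> (S l ** S d)" .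
 qed
 also have "... = S l ** S h"
  by (rule sw_counit(1)[OF vsH _ h]) ((assumption | rule c)+)
 finally show ?thesis .
qed

lemma antipode_one: "S uH = uH"
proof -
 interpret A: assoc_algebra K H by (rule algH)
 have "sw H uH (%a b. S a ** b) = S uH ** uH"
  by (rule sw_one[OF vsH]) ((assumption | rule hcalc)+)
 moreover have "sw H uH (%a b. S a ** b) = \<epsilon> uH \<odot>\<^bsub>H\<^esub> uH"
  by (rule sw_antipode(1)[OF vsH lin_id oneH])
 ultimately show ?thesis by (simp add: counit_one antipode_closed oneH)
qed

text \<open>In the convolution algebra Hom(H, M) a left inverse \<open>f\<close> and a right inverse
  \<open>k\<close> of \<open>g\<close> agree: f = f(gk) = (fg)k = k.\<close>

lemma convolution_inverse_unique:
 assumes M: "alg M" and f: "lin H M f" and g: "lin H M g" and k: "lin H M k"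
  and fg: "!!h. h .: H ==> sw M h (%a b. f a \<otimes>\<^bsub>M\<^esub> g b) = \<epsilon> h \<odot>\<^bsub>M\<^esub> \<one>\<^bsub>M\<^esub>"
  and gk: "!!h. h .: H ==> sw M h (%a b. g a \<otimes>\<^bsub>M\<^esub> k b) = \<epsilon> h \<odot>\<^bsub>M\<^esub> \<one>\<^bsub>M\<^esub>"
  and h: "h .: H"
 shows "f h = k h"
proof -
 interpret M: assoc_algebra K M by (rule M)
 note vM = M.vectorspace_axioms
 note fgk = lin_compose[OF f] lin_compose[OF g] lin_compose[OF k] lin_closed[OF f] lin_closed[OF g] lin_closed[OF k]
  lin_id
 have b: "bil H H M (%a b. f a \<otimes>\<^bsub>M\<^esub> g b)" "bil H H M (%a b. g a \<otimes>\<^bsub>M\<^esub> k b)"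
  by (assumption | rule fgk hcalc M)+
 have "f h = sw M h (%a b. \<epsilon> b \<odot>\<^bsub>M\<^esub> f a)" by (rule sw_counit(2)[symmetric, OF vM f h])
 also have "... = sw M h (%a b. sw M b (%c d. f a \<otimes>\<^bsub>M\<^esub> (g c \<otimes>\<^bsub>M\<^esub> k d)))"
 proof (rule sw_cong[OF h])
  fix x y assume xy: "x .: H" "y .: H"
  have "\<epsilon> y \<odot>\<^bsub>M\<^esub> f x = f x \<otimes>\<^bsub>M\<^esub> (sw M y (%c d. g c \<otimes>\<^bsub>M\<^esub> k d))"
   by (simp add: gk xy counit_closed M.smult_mult_right lin_closed[OF f])
  also have "... = sw M y (%c d. f x \<otimes>\<^bsub>M\<^esub> (g c \<otimes>\<^bsub>M\<^esub> k d))"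
   by (rule sw_comp[OF bil1[OF assoc_algebraD(3)[OF M] lin_closed[OF f xy(1)]] vM vM b(2) xy(2)])
  finally show "\<epsilon> y \<odot>\<^bsub>M\<^esub> f x = sw M y (%c d. f x \<otimes>\<^bsub>M\<^esub> (g c \<otimes>\<^bsub>M\<^esub> k d))" .
 qed
 also have "... = sw M h (%a b. sw M a (%c d. f c \<otimes>\<^bsub>M\<^esub> (g d \<otimes>\<^bsub>M\<^esub> k b)))"
  by (rule sw_assoc[symmetric, OF vM triI h]; (assumption | rule fgk hcalc M)+)
 also have "... = sw M h (%a b. \<epsilon> a \<odot>\<^bsub>M\<^esub> k b)"
 proof (rule sw_cong[OF h])
  fix x y assume xy: "x .: H" "y .: H"
  have "sw M x (%c d. f c \<otimes>\<^bsub>M\<^esub> (g d \<otimes>\<^bsub>M\<^esub> k y)) = sw M x (%c d. (f c \<otimes>\<^bsub>M\<^esub> g d) \<otimes>\<^bsub>M\<^esub> k y)"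
   by (rule sw_cong[OF xy(1)],
    simp add: M.m_assoc fgk(4-6) xy)
  also have "... = sw M x (%c d. f c \<otimes>\<^bsub>M\<^esub> g d) \<otimes>\<^bsub>M\<^esub> k y"
   by (rule sw_comp[symmetric, OF bil2[OF assoc_algebraD(3)[OF M] lin_closed[OF k xy(2)]] vM vM b(1) xy(1)])
  also have "... = \<epsilon> x \<odot>\<^bsub>M\<^esub> k y"
   by (simp add: fg xy counit_closed M.smult_mult_left lin_closed[OF k])
  finally show "sw M x (%c d. f c \<otimes>\<^bsub>M\<^esub> (g d \<otimes>\<^bsub>M\<^esub> k y)) = \<epsilon> x \<odot>\<^bsub>M\<^esub> k y" .
 qed
 also have "... = k h" by (rule sw_counit(1)[OF vM k h])
 finally show ?thesis .
qed

text \<open>In the convolution algebra Hom(H, H \<otimes> H) the map \<Delta> S is a left inverse of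
  \<Delta>, because \<Delta> is multiplicative, and the right-hand side is a right inverse of
  \<Delta>.\<close>

lemma comult_antipode:
 assumes h: "h .: H"
 shows "\<Delta> (S h) = sw HH h (%a b. tens K H H (S b) (S a))"
proof -
 let ?M = "tensor_alg K H H"
 note M = assoc_algebra_tensor_alg[OF algH algH] and same = same_space_eqs[OF same_space_tensor_alg[of H H]]
  same_space_bil[OF same_space_tensor_alg[of H H]]
 interpret A: assoc_algebra K H by (rule algH)
 interpret M: assoc_algebra K ?M by (rule M)
 note vHH = vs_tensor[OF vsH vsH]
 have lk: "lin H HH (%h. sw HH h (%a b. tens K H H (S b) (S a)))"
  by (assumption | rule hcalc)+
 show ?thesis
 proof (rule convolution_inverse_unique[OF M, of "%h. \<Delta> (S h)" \<Delta> "%h. sw HH h (%a b. tens K H H (S b) (S a))", OF _ _ _ _ _ h])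
  show "lin H ?M (%h. \<Delta> (S h))" "lin H ?M \<Delta>" "lin H ?M (%h. sw HH h (%a b. tens K H H (S b) (S a)))"
   unfolding same by (rule lin_comult lin_antipode lin_id lin_comult0 lk)+
  fix x assume x: "x .: H"
  have "sw ?M x (%a b. \<Delta> (S a) \<otimes>\<^bsub>?M\<^esub> \<Delta> b) = sw HH x (%a b. \<Delta> (S a ** b))"
   unfolding same
   by (rule sw_cong[symmetric, OF x],
    simp add: alg_homD(3)[OF comult_hom] antipode_closed)
  also have "... = \<epsilon> x \<odot>\<^bsub>HH\<^esub> \<Delta> uH" by (rule sw_antipode(1)[OF vHH lin_comult0 x])
  finally show "sw ?M x (%a b. \<Delta> (S a) \<otimes>\<^bsub>?M\<^esub> \<Delta> b) = \<epsilon> x \<odot>\<^bsub>?M\<^esub> \<one>\<^bsub>?M\<^esub>" by (simp add: comult_one)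
  have mm: "lin U HH (%x. f x \<otimes>\<^bsub>?M\<^esub> t)" "lin U HH (%x. t \<otimes>\<^bsub>?M\<^esub> f x)" if "lin U HH f" "t .: HH"
   for U :: "('k, 'h, 'm) hopf_scheme" and f t
   using lin_mult_left[of U ?M f, OF _ M] lin_mult_right[of U ?M f, OF _ M] that by (simp_all add: same)
  \<comment> \<open>The product has the legs x_1 S(x_4) \<otimes> x_2 S(x_3). The inner pair x_2,
    x_3 is adjacent and cancels, after which the outer pair becomes adjacent.\<close>
  have "sw ?M x (%a b. \<Delta> a \<otimes>\<^bsub>?M\<^esub> sw HH b (%c d. tens K H H (S d) (S c))) =
    sw HH x (%a b. sw HH a (%e f. sw HH b (%c d. tens K H H (e ** S d) (f ** S c))))"
   unfolding same
  proof (rule sw_cong[OF x])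
   fix p q assume pq: "p .: H" "q .: H"
   have "\<Delta> p = sw HH p (tens K H H)"
    by (rule tensor_lift_eq[symmetric, OF vsH vsH vHH bil_tens[OF vsH vsH] lin_id _ comult_closed[OF pq(1)]]) (rule refl)
   then have "\<Delta> p \<otimes>\<^bsub>?M\<^esub> sw HH q (%c d. tens K H H (S d) (S c)) =
     sw ?M p (tens K H H) \<otimes>\<^bsub>?M\<^esub> sw ?M q (%c d. tens K H H (S d) (S c))" by (simp add: same)
   also have "... = sw ?M p (%e f. sw ?M q (%c d. tens K H H e f \<otimes>\<^bsub>?M\<^esub> tens K H H (S d) (S c)))"
    by (rule tensor_lift_mult[OF vsH vsH vsH vsH M _ _ comult_closed[OF pq(1)] comult_closed[OF pq(2)]];
     unfold same; (assumption | rule bil_tens hcalc)+)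
   also have "... = sw HH p (%e f. sw HH q (%c d. tens K H H (e ** S d) (f ** S c)))"
    unfolding same
    by (rule sw_cong[OF pq(1)], rule sw_cong[OF pq(2)], simp add: tensor_alg_mult[OF algH algH] antipode_closed)
   finally show "\<Delta> p \<otimes>\<^bsub>?M\<^esub> sw HH q (%c d. tens K H H (S d) (S c)) =
     sw HH p (%e f. sw HH q (%c d. tens K H H (e ** S d) (f ** S c)))" .
  qed
  also have "... = sw HH x (%e y. sw HH y (%f b. sw HH b (%c d. tens K H H (e ** S d) (f ** S c))))"
   by (rule sw_assoc[OF vHH triI x]; (assumption | rule hcalc)+)
  also have "... = sw HH x (%e y. sw HH y (%z d. sw HH z (%f c. tens K H H (e ** S d) (f ** S c))))"
   by (rule sw_cong[OF x],
     rule sw_assoc[symmetric, OF vHH triI]; (assumption | rule hcalc)+)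
  also have "... = sw HH x (%e y. tens K H H (e ** S y) uH)"
   by (rule sw_cong[OF x],
     rule sw_cancel_left(2)[OF vHH, of "%a d. tens K H H (e ** S d) a" for e]; (assumption | rule hcalc)+)
  also have "... = \<epsilon> x \<odot>\<^bsub>HH\<^esub> tens K H H uH uH"
   by (rule sw_antipode(2)[OF vHH _ x]) ((assumption | rule hcalc)+)
  finally show "sw ?M x (%a b. \<Delta> a \<otimes>\<^bsub>?M\<^esub> sw HH b (%c d. tens K H H (S d) (S c))) = \<epsilon> x \<odot>\<^bsub>?M\<^esub> \<one>\<^bsub>?M\<^esub>"
   by simp
 qed
qed

lemma sw_antipode_arg:
 assumes Z: "vs Z" and f: "bil H H Z f" and h: "h .: H"
 shows "sw Z (S h) f = sw Z h (%a b. f (S b) (S a))"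
proof -
 note F = lin_tensor_lift[OF vsH vsH Z f]
 have "sw Z (S h) f = sw Z h (%a b. f (S b) (S a))"
  unfolding comult_antipode[OF h]
  by (rule sw_comp'[OF F vs_tensor[OF vsH vsH] Z _ h], (assumption | rule hcalc)+,
   simp add: tensor_lift_tens[OF vsH vsH Z f] antipode_closed)
 then show ?thesis .
qed

end

section \<open>Injective endomorphisms in finite dimension; products in tensor algebras\<close>

context field_base
begin

text \<open>An injective map sends a basis to an independent set of the same cardinality, which is a
  basis by the dimension count; hence the image is everything.\<close>

lemma inj_imp_surj:
 assumes lin: "lin V V f" and V: "vs V" and fin: "vectorspace.fin_dim K V"
  and inj: "!!v. [|v .: V; f v = \<zero>\<^bsub>V\<^esub>|] ==> v = \<zero>\<^bsub>V\<^esub>"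
 shows "inj_on f (carrier V)" "f ` carrier V = carrier V"
proof -
 interpret V: vectorspace K V by (rule V)
 interpret f: linear_map K V V f using lin V by (simp add: linear_map_iff)
 have ker: "f.kerT = {\<zero>\<^bsub>V\<^esub>}"
  using inj lin_zero[OF V V lin] by (auto simp: f.ker_def)
 show i: "inj_on f (carrier V)"
 proof (rule inj_onI)
  fix v w assume vw: "v .: V" "w .: V" "f v = f w"
  then have "f (v \<ominus>\<^bsub>V\<^esub> w) = \<zero>\<^bsub>V\<^esub>"
   by (simp add: lin_minus[OF V V lin] diff_zero_iff[OF vsD(1)[OF V]] lin_closed[OF lin])
  then have "v \<ominus>\<^bsub>V\<^esub> w = \<zero>\<^bsub>V\<^esub>" using inj vw V.minus_closed by blast
  then show "v = w" using vw by (simp add: diff_zero_iff[OF vsD(1)[OF V]])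
 qed
 obtain B where B: "finite B" "V.basis B" using V.finite_basis_exists[OF fin] by blast
 have BV: "B \<subseteq> carrier V" and li: "V.lin_indpt B" using B(2) by (auto simp: V.basis_def)
 have "V.lin_indpt (f ` B)"
 proof
  assume "V.lin_dep (f ` B)"
  then obtain a v where a: "a \<in> f ` B \<rightarrow> carrier K" "V.lincomb a (f ` B) = \<zero>\<^bsub>V\<^esub>" "v \<in> f ` B" "a v \<noteq> \<zero>"
   using V.finite_lin_dep[of "f ` B"] B(1) BV lin_closed[OF lin] by blast
  have "f (V.lincomb (a \<circ> f) B) = \<zero>\<^bsub>V\<^esub>"
   using f.lincomb_linear_image[OF i BV a(1) B(1)] a(2) by simp
  moreover have "V.lincomb (a \<circ> f) B .: V" using BV a(1) by (intro V.lincomb_closed) auto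
  ultimately have "V.lincomb (a \<circ> f) B = \<zero>\<^bsub>V\<^esub>" using inj by blast
  moreover obtain b where "b \<in> B" "(a \<circ> f) b \<noteq> \<zero>" using a(3,4) by auto
  ultimately have "V.lin_dep B"
   using V.lin_dep_crit[of B B "a \<circ> f" b] B(1) BV a(1) by (auto simp: Pi_iff)
  with li show False by simp
 qed
 moreover have "card (f ` B) = V.dim"
  using V.dim_basis[OF B] card_image[OF inj_on_subset[OF i BV]] by simp
 ultimately have "V.basis (f ` B)"
  using B(1) BV lin_closed[OF lin] by (intro V.dim_li_is_basis[OF fin]) auto
 then have gen: "V.span (f ` B) = carrier V" and sub: "f ` B \<subseteq> carrier V" by (auto simp: V.basis_def)
 have "V.span (f ` B) \<subseteq> f.imT"
 proof (rule V.span_is_subset)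
  show "submodule K f.imT V" by (rule f.im_is_submodule)
  show "f ` B \<subseteq> f.imT" using BV by (auto simp: f.im_def)
 qed
 then show "f ` carrier V = carrier V"
  using gen lin_closed[OF lin] by (auto simp: f.im_def)
qed

text \<open>Products such as R \<Delta>(h) in H \<otimes> H become iterated Sweedler sums; the axiom
  \<open>R_intertwines\<close> is brought into usable form by this.\<close>

lemma tensor_lift_product:
 assumes A: "alg A" and B: "alg B" and Z: "vs Z" and f: "bil A B Z f"
  and x: "x .: (tsp A B)" and y: "y .: (tsp A B)"
 shows "lift Z f (x \<otimes>\<^bsub>tensor_alg K A B\<^esub> y) =
  lift Z (%a b. lift Z (%c d. f (a \<otimes>\<^bsub>A\<^esub> c) (b \<otimes>\<^bsub>B\<^esub> d)) y) x"
proof -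
 let ?T = "tsp A B" and ?M = "tensor_alg K A B"
 note vA = assoc_algebraD(1)[OF A] and vB = assoc_algebraD(1)[OF B]
 note vT = vs_tensor[OF vA vB] and M = assoc_algebra_tensor_alg[OF A B]
 note F = lin_tensor_lift[OF vA vB Z f]
 have LM: "lin ?T ?T (%x. u \<otimes>\<^bsub>?M\<^esub> x)" "lin ?T ?T (%x. x \<otimes>\<^bsub>?M\<^esub> u)" if "u .: ?T" for u
  using bil1[OF assoc_algebraD(3)[OF M], of u] bil2[OF assoc_algebraD(3)[OF M], of u] that
  by (simp_all add: same_space_eqs[OF same_space_tensor_alg[of A B]])
 note c = calc A B vA vB Z lin_compose[OF bil1[OF f]] lin_compose[OF bil2[OF f]] bil_closed[OF f] x y
 show ?thesis
 proof (rule tensor_lift_eq[symmetric, OF vA vB Z _ lin_compose[OF F LM(2)[OF y]] _ x])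
  show "bil A B Z (%a b. lift Z (%c d. f (a \<otimes>\<^bsub>A\<^esub> c) (b \<otimes>\<^bsub>B\<^esub> d)) y)"
   by (assumption | rule c)+
  show "lift Z (%c d. f (a \<otimes>\<^bsub>A\<^esub> c) (b \<otimes>\<^bsub>B\<^esub> d)) y = lift Z f (tens K A B a b \<otimes>\<^bsub>?M\<^esub> y)"
   if ab: "a .: A" "b .: B" for a b
  proof (rule tensor_lift_eq[OF vA vB Z _ lin_compose[OF F LM(1)] _ y])
   show "bil A B Z (%c d. f (a \<otimes>\<^bsub>A\<^esub> c) (b \<otimes>\<^bsub>B\<^esub> d))"
    by (assumption | rule c ab)+
  qed (simp_all add: ab tens_closed vA vB tensor_alg_mult[OF A B] tensor_lift_tens[OF vA vB Z f] mult_closed A B)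
 qed
qed

end

section \<open>Quasitriangular Hopf algebras\<close>

locale qt_base = hopf_base K H for K :: "('k, 'r) ring_scheme" (structure) and H :: "('k, 'h, 'm) hopf_scheme" +
 fixes R :: "('k, 'h, 'h) tensor"
 assumes qt: "quasitriangular_hopf_algebra K H R" and fin: "vectorspace.fin_dim K H"
begin

abbreviation Rs where "Rs Z f \<equiv> lift Z f R"

lemma R_closed: "R .: HH"
proof -
 interpret Q: quasitriangular_hopf_algebra K H R by (rule qt)
 show ?thesis using Q.R_invertible by (simp add: Units_def)
qed

lemmas qcalc = hcalc R_closed

lemma Rs_cong:
 assumes "!!a b. [|a .: H; b .: H|] ==> f a b = g a b"
 shows "Rs Z f = Rs Z g"
 by (rule tensor_lift_cong[OF R_closed vsH vsH assms])

lemma Rs_comp: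
 assumes "lin Z Z' F" "vs Z" "vs Z'" "bil H H Z f"
 shows "F (Rs Z f) = Rs Z' (%a b. F (f a b))"
 by (rule lin_tensor_lift_comp[OF assms(1) vsH vsH assms(2-4) R_closed])

lemma Rs_comp':
 assumes "lin Z Z' F" "vs Z" "vs Z'" "bil H H Z f"
  and "!!a b. [|a .: H; b .: H|] ==> F (f a b) = g a b"
 shows "F (Rs Z f) = Rs Z' g"
 unfolding Rs_comp[OF assms(1-4)] by (rule Rs_cong[OF assms(5)])

lemma Rs_swap:
 assumes "vs Z" "!!a b. [|a .: H; b .: H|] ==> bil H H Z (f a b)"
  and "!!c d. [|c .: H; d .: H|] ==> bil H H Z (%a b. f a b c d)"
 shows "Rs Z (%a b. Rs Z (f a b)) = Rs Z (%c d. Rs Z (%a b. f a b c d))"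
 by (rule tensor_lift_swap[OF vsH vsH vsH vsH assms(1) R_closed R_closed assms(2,3)])

abbreviation HHH where "HHH \<equiv> tsp HH H"
abbreviation tens3 where "tens3 x y z \<equiv> tens K HH H (tens K H H x y) z"

lemma algHHH: "alg (tensor_alg K (tensor_alg K H H) H)"
 by (intro assoc_algebra_tensor_alg algH)

lemmas HH_same = same_space_eqs[OF same_space_tensor_alg[of H H]] same_space_bil[OF same_space_tensor_alg[of H H]]
 same_space_eqs[OF same_space_tensor_alg[of "tensor_alg K H H" H]]
 same_space_bil[OF same_space_tensor_alg[of "tensor_alg K H H" H]]

lemma tens3_mult:
 assumes "x .: H" "y .: H" "z .: H" "x' .: H" "y' .: H" "z' .: H"
 shows "tens3 x y z \<otimes>\<^bsub>tensor_alg K (tensor_alg K H H) H\<^esub> tens3 x' y' z' = tens3 (x ** x') (y ** y') (z ** z')"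
 using tensor_alg_mult[OF assoc_algebra_tensor_alg[OF algH algH] algH, of "tens K H H x y" z "tens K H H x' y'" z'] assms
 by (simp add: HH_same tensor_alg_mult[OF algH algH] tens_closed vsH)

lemma lift3_tens3:
 assumes Z: "vs Z" and f: "tri Z f" and "a .: H" "b .: H" "c .: H"
 shows "lift Z (%x z. lift Z (%a b. f a b z) x) (tens3 a b c) = f a b c"
proof -
 have b0: "bil H H Z (%a b. f a b z)" if "z .: H" for z
  using that by (intro bilI triD[OF f])
 have "bil HH H Z (%t z. lift Z (%a b. f a b z) t)"
  by (assumption | rule triD[OF f] Z hcalc)+
 from tensor_lift_tens[OF vs_tensor[OF vsH vsH] vsH Z this] tensor_lift_tens[OF vsH vsH Z b0] assms(3-)
 show ?thesis by (simp add: tens_closed vsH)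
qed

text \<open>Both hexagon axioms compare a coproduct of one leg of \<open>R\<close> with a product of two copies of \<open>R\<close>;
 here \<open>p\<close> and \<open>q\<close> distribute the legs of the two copies.\<close>

lemma leg_product:
 assumes Z: "vs Z" and f: "tri Z f"
  and p: "!!s t. [|s .: H; t .: H|] ==> p1 s t .: H \<and> p2 s t .: H \<and> p3 s t .: H"
  and q: "!!s t. [|s .: H; t .: H|] ==> q1 s t .: H \<and> q2 s t .: H \<and> q3 s t .: H"
  and bp: "bil H H HHH (%s t. tens3 (p1 s t) (p2 s t) (p3 s t))"
  and bq: "bil H H HHH (%s t. tens3 (q1 s t) (q2 s t) (q3 s t))"
 shows "lift Z (%x z. lift Z (%a b. f a b z) x)
   (Rs HHH (%s t. tens3 (p1 s t) (p2 s t) (p3 s t)) \<otimes>\<^bsub>tensor_alg K (tensor_alg K H H) H\<^esub>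
    Rs HHH (%s t. tens3 (q1 s t) (q2 s t) (q3 s t))) =
  Rs Z (%s t. Rs Z (%s' t'. f (p1 s t ** q1 s' t') (p2 s t ** q2 s' t') (p3 s t ** q3 s' t')))"
proof -
 let ?M = "tensor_alg K (tensor_alg K H H) H"
 let ?F = "lift Z (%x z. lift Z (%a b. f a b z) x)"
 let ?P = "%s t. tens3 (p1 s t) (p2 s t) (p3 s t)" and ?Q = "%s t. tens3 (q1 s t) (q2 s t) (q3 s t)"
 note v3 = vs_tensor[OF vs_tensor[OF vsH vsH] vsH]
 note bM = assoc_algebraD(3)[OF algHHH, unfolded HH_same]
 have F: "lin HHH Z ?F"
  by (rule lin_tensor_lift[OF vs_tensor[OF vsH vsH] vsH Z]) ((assumption | rule triD[OF f] Z hcalc)+)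
 have bb: "bil H H HHH (%s' t'. ?P s t \<otimes>\<^bsub>?M\<^esub> ?Q s' t')" if "s .: H" "t .: H" for s t
  using that by (intro bilI lin_compose[OF bil1[OF bM]] bil1[OF bq] bil2[OF bq] bil_closed[OF bp])
 have cl: "Rs HHH ?Q .: HHH" by (rule tensor_lift_closed[OF vsH vsH v3 bq R_closed])
 have "Rs HHH ?P \<otimes>\<^bsub>?M\<^esub> Rs HHH ?Q = Rs HHH (%s t. Rs HHH (%s' t'. ?P s t \<otimes>\<^bsub>?M\<^esub> ?Q s' t'))"
  using tensor_lift_mult[OF vsH vsH vsH vsH algHHH, of ?P ?Q R R] bp bq R_closed by (simp add: HH_same)
 moreover have b2: "bil H H HHH (%s t. Rs HHH (%s' t'. ?P s t \<otimes>\<^bsub>?M\<^esub> ?Q s' t'))"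
  by (intro bilI lin_lift_fun[OF R_closed vsH vsH v3 vsH] bb lin_compose[OF bil2[OF bM]] bil1[OF bp] bil2[OF bp] bil_closed[OF bq])
 ultimately have "?F (Rs HHH ?P \<otimes>\<^bsub>?M\<^esub> Rs HHH ?Q) = Rs Z (%s t. ?F (Rs HHH (%s' t'. ?P s t \<otimes>\<^bsub>?M\<^esub> ?Q s' t')))"
  using Rs_comp[OF F v3 Z b2] by simp
 also have "... = Rs Z (%s t. Rs Z (%s' t'. f (p1 s t ** q1 s' t') (p2 s t ** q2 s' t') (p3 s t ** q3 s' t')))"
 proof (rule Rs_cong)
  fix s t assume st: "s .: H" "t .: H"
  have "?F (Rs HHH (%s' t'. ?P s t \<otimes>\<^bsub>?M\<^esub> ?Q s' t')) = Rs Z (%s' t'. ?F (?P s t \<otimes>\<^bsub>?M\<^esub> ?Q s' t'))"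
   by (rule Rs_comp[OF F v3 Z bb[OF st]])
  also have "... = Rs Z (%s' t'. f (p1 s t ** q1 s' t') (p2 s t ** q2 s' t') (p3 s t ** q3 s' t'))"
  proof (rule Rs_cong)
   show "?F (?P s t \<otimes>\<^bsub>?M\<^esub> ?Q s' t') = f (p1 s t ** q1 s' t') (p2 s t ** q2 s' t') (p3 s t ** q3 s' t')"
    if "s' .: H" "t' .: H" for s' t'
    using p[OF st] q[OF that] by (simp add: tens3_mult lift3_tens3[OF Z f] mult_closed algH)
  qed
  finally show "?F (Rs HHH (%s' t'. ?P s t \<otimes>\<^bsub>?M\<^esub> ?Q s' t')) =
   Rs Z (%s' t'. f (p1 s t ** q1 s' t') (p2 s t ** q2 s' t') (p3 s t ** q3 s' t'))" .
 qed
 finally show ?thesis .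
qed

lemma R_comult1:
 assumes Z: "vs Z" and f: "tri Z f"
 shows "Rs Z (%s t. sw Z s (%a b. f a b t)) = Rs Z (%s t. Rs Z (%s' t'. f s s' (t ** t')))"
proof -
 interpret Q: quasitriangular_hopf_algebra K H R by (rule qt)
 interpret A: assoc_algebra K H by (rule algH)
 let ?F = "lift Z (%x z. lift Z (%a b. f a b z) x)"
 have b1: "bil HH H Z (%t b. lift Z (%c d. f c d b) t)"
  by (assumption | rule triD[OF f] Z hcalc)+
 have "Rs Z (%s t. sw Z s (%a b. f a b t)) = ?F (tensor_map K HH H \<Delta> id R)"
  by (rule tensor_lift_map[symmetric, where V = H and W = H and W' = H and g = id, simplified])
    ((assumption | rule lin_comult0 Z b1 lin_id[folded id_def] qcalc)+)
 also have "... = ?F (Rs HHH (%s t. tens3 s uH t) \<otimes>\<^bsub>tensor_alg K (tensor_alg K H H) H\<^esub> Rs HHH (%s t. tens3 uH s t))"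
  by (simp add: Q.R_comult_left leg13_def leg23_def Let_def)
 also have "... = Rs Z (%s t. Rs Z (%s' t'. f (s ** uH) (uH ** s') (t ** t')))"
  by (rule leg_product[OF Z f]; (assumption | rule conjI qcalc)+)
 also have "... = Rs Z (%s t. Rs Z (%s' t'. f s s' (t ** t')))"
  by (rule Rs_cong, rule Rs_cong, simp)
 finally show ?thesis .
qed

text \<open>In R_13 R_12 the left factor carries the third leg and the right factor the second,
  whence \<open>t'\<close> stands before \<open>t\<close>.\<close>

lemma R_comult2:
 assumes Z: "vs Z" and f: "tri Z f"
 shows "Rs Z (%s t. sw Z t (%a b. f s a b)) = Rs Z (%s t. Rs Z (%s' t'. f (s ** s') t' t))"
proof -
 interpret Q: quasitriangular_hopf_algebra K H R by (rule qt)
 interpret A: assoc_algebra K H by (rule algH)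
 let ?F = "lift Z (%x z. lift Z (%a b. f a b z) x)"
 have b1: "bil HH H Z (%t b. lift Z (%c d. f c d b) t)"
  by (assumption | rule triD[OF f] Z hcalc)+
 have b0: "bil H H Z (f a)" if "a .: H" for a
  using that by (intro bilI triD[OF f])
 have b2: "bil H HH Z (%a t. lift Z (f a) t)"
  by (assumption | rule triD[OF f] Z b0 hcalc)+
 have tc: "tensor_map K H HH id \<Delta> R .: (tsp H HH)"
  by (rule lin_closed[OF lin_tensor_map], (assumption | rule lin_comult0 lin_id[folded id_def] qcalc)+)
 have "Rs Z (%s t. sw Z t (%a b. f s a b)) = lift Z (%a t. lift Z (f a) t) (tensor_map K H HH id \<Delta> R)"
  by (rule tensor_lift_map[symmetric, where V = H and W = H and f = id, simplified])
    ((assumption | rule lin_comult0 Z b2 lin_id[folded id_def] qcalc)+)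
 also have "... = lift Z (%u. lift Z (%v w. lift Z (%c d. f c d w) (tens K H H u v)))
    (tensor_map K H HH id \<Delta> R)"
 proof (rule tensor_lift_cong[OF tc vsH])
  show "lift Z (f u) t =
    lift Z (%v w. lift Z (%c d. f c d w) (tens K H H u v)) t"
   if u: "u .: H" and "t .: HH" for u t
  proof (rule tensor_lift_cong[OF that(2) vsH vsH])
   fix v w assume vw: "v .: H" "w .: H"
   have "bil H H Z (%c d. f c d w)" using vw by (intro bilI triD[OF f])
   from tensor_lift_tens[OF vsH vsH Z this u vw(1)]
   show "f u v w = lift Z (%c d. f c d w) (tens K H H u v)" by simp
  qed
 qed (rule hcalc)+
 also have "... = ?F (tensor_assoc K H H H (tensor_map K H HH id \<Delta> R))"
  by (rule tensor_lift_assoc[symmetric, OF vsH vsH vsH Z b1 tc])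
 also have "... = ?F (Rs HHH (%s t. tens3 s uH t) \<otimes>\<^bsub>tensor_alg K (tensor_alg K H H) H\<^esub> Rs HHH (%s t. tens3 s t uH))"
  by (simp add: Q.R_comult_right leg13_def leg12_def Let_def)
 also have "... = Rs Z (%s t. Rs Z (%s' t'. f (s ** s') (uH ** t') (t ** uH)))"
  by (rule leg_product[OF Z f]; (assumption | rule conjI qcalc)+)
 also have "... = Rs Z (%s t. Rs Z (%s' t'. f (s ** s') t' t))"
  by (rule Rs_cong, rule Rs_cong, simp)
 finally show ?thesis .
qed

lemma R_intertwine:
 assumes Z: "vs Z" and f: "bil H H Z f" and h: "h .: H"
 shows "Rs Z (%s t. sw Z h (%a b. f (s ** a) (t ** b))) = sw Z h (%a b. Rs Z (%s t. f (b ** s) (a ** t)))"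
proof -
 interpret Q: quasitriangular_hopf_algebra K H R by (rule qt)
 note c = qcalc Z h lin_compose[OF bil1[OF f]] lin_compose[OF bil2[OF f]] bil_closed[OF f]
 have bop: "bil H H HH (%x y. tens K H H y x)" by (assumption | rule c)+
 have op: "comult_op K H h .: HH"
  unfolding comult_op_def by (assumption | rule c)+
 have bl: "bil H H Z (%a b. Rs Z (%s t. f (a ** s) (b ** t)))" by (assumption | rule c)+
 have "Rs Z (%s t. sw Z h (%a b. f (s ** a) (t ** b))) = lift Z f (R \<otimes>\<^bsub>tensor_alg K H H\<^esub> \<Delta> h)"
  by (rule tensor_lift_product[symmetric, OF algH algH Z f R_closed comult_closed[OF h]])
 also have "... = lift Z f (comult_op K H h \<otimes>\<^bsub>tensor_alg K H H\<^esub> R)"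
  by (simp add: Q.R_intertwines[OF h])
 also have "... = lift Z (%a b. Rs Z (%s t. f (a ** s) (b ** t))) (comult_op K H h)"
  by (rule tensor_lift_product[OF algH algH Z f op R_closed])
 also have "... = sw Z h (%a b. Rs Z (%s t. f (b ** s) (a ** t)))"
  unfolding comult_op_def
  by (rule sw_comp'[OF lin_tensor_lift[OF vsH vsH Z bl] vs_tensor[OF vsH vsH] Z bop h],
   rule tensor_lift_tens[OF vsH vsH Z bl])
 finally show ?thesis .
qed

lemma idempotent_unit:
 assumes "alg A" "e .: A" "f .: A" "e \<otimes>\<^bsub>A\<^esub> e = e" "e \<otimes>\<^bsub>A\<^esub> f = \<one>\<^bsub>A\<^esub>"
 shows "e = \<one>\<^bsub>A\<^esub>"
proof -
 interpret A: assoc_algebra K A by fact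
 have "e = e \<otimes>\<^bsub>A\<^esub> (e \<otimes>\<^bsub>A\<^esub> f)" using assms by simp
 also have "... = (e \<otimes>\<^bsub>A\<^esub> e) \<otimes>\<^bsub>A\<^esub> f" using assms(2,3) by (simp add: A.m_assoc)
 finally show ?thesis using assms by simp
qed

text \<open>R is a unit of H \<otimes> H, so its image is invertible, and an invertible idempotent
  equals 1.\<close>

lemma R_unit_hom:
 assumes e: "e \<in> alg_hom K (tensor_alg K H H) H" and ee: "e R ** e R = e R"
 shows "e R = uH"
proof -
 interpret Q: quasitriangular_hopf_algebra K H R by (rule qt)
 obtain R' where R': "R' .: HH" "R \<otimes>\<^bsub>tensor_alg K H H\<^esub> R' = \<one>\<^bsub>tensor_alg K H H\<^esub>"
  using Q.R_invertible by (auto simp: Units_def)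
 then have "e R ** e R' = uH"
  using alg_homD(2)[OF e] alg_homD(3)[OF e, of R R'] R_closed by simp
 then show ?thesis
  using alg_homD(4)[OF e] R'(1) R_closed ee by - (rule idempotent_unit[OF algH, of _ "e R'"], simp_all)
qed

text \<open>Applying the counit to the two legs produced by \<Delta> in a hexagon axiom shows that
  the image of R under \<epsilon> \<otimes> id, respectively id \<otimes> \<epsilon>, equals its own
  square. These maps are algebra homomorphisms, so \<open>R_unit_hom\<close> applies.\<close>

lemma R_counit:
 assumes Z: "vs Z" and f: "lin H Z f"
 shows "Rs Z (%s t. \<epsilon> s \<odot>\<^bsub>Z\<^esub> f t) = f uH" "Rs Z (%s t. \<epsilon> t \<odot>\<^bsub>Z\<^esub> f s) = f uH"
proof -
 interpret A: assoc_algebra K H by (rule algH)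
 have b: "bil H H H (%s t. \<epsilon> s \<odot>\<^bsub>H\<^esub> t)" "bil H H H (%s t. \<epsilon> t \<odot>\<^bsub>H\<^esub> s)" by (assumption | rule hcalc)+
 have sm: "(c \<odot>\<^bsub>H\<^esub> a) ** (d \<odot>\<^bsub>H\<^esub> b) = c \<odot>\<^bsub>H\<^esub> (d \<odot>\<^bsub>H\<^esub> (a ** b))" "(c \<otimes> d) \<odot>\<^bsub>H\<^esub> (a ** b) = c \<odot>\<^bsub>H\<^esub> (d \<odot>\<^bsub>H\<^esub> (a ** b))"
  if "c .: K" "d .: K" "a .: H" "b .: H" for a b c d
  using that A.smult_mult_left[of c a "d \<odot>\<^bsub>H\<^esub> b"] A.smult_mult_right[of d a b] by (simp_all add: A.smult_assoc1)
 have e: "lift H (%s t. \<epsilon> s \<odot>\<^bsub>H\<^esub> t) \<in> alg_hom K (tensor_alg K H H) H"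
  by (rule alg_hom_tensor_lift[OF algH algH algH b(1)])
   (simp_all add: counit_one oneH counit_mult counit_closed sm)
 have e': "lift H (%s t. \<epsilon> t \<odot>\<^bsub>H\<^esub> s) \<in> alg_hom K (tensor_alg K H H) H"
  by (rule alg_hom_tensor_lift[OF algH algH algH b(2)])
   (simp_all add: counit_one oneH counit_mult counit_closed sm)
 have "Rs H (%s t. \<epsilon> s \<odot>\<^bsub>H\<^esub> t) ** Rs H (%s t. \<epsilon> s \<odot>\<^bsub>H\<^esub> t) =
   Rs H (%s t. Rs H (%s' t'. (\<epsilon> s \<odot>\<^bsub>H\<^esub> t) ** (\<epsilon> s' \<odot>\<^bsub>H\<^esub> t')))"
  by (rule tensor_lift_mult[OF vsH vsH vsH vsH algH b(1) b(1) R_closed R_closed])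
 also have "... = Rs H (%s t. Rs H (%s' t'. \<epsilon> s \<odot>\<^bsub>H\<^esub> (\<epsilon> s' \<odot>\<^bsub>H\<^esub> (t ** t'))))"
  by (rule Rs_cong, rule Rs_cong, simp add: sm counit_closed)
 also have "... = Rs H (%s t. sw H s (%a b. \<epsilon> a \<odot>\<^bsub>H\<^esub> (\<epsilon> b \<odot>\<^bsub>H\<^esub> t)))"
  by (rule R_comult1[symmetric, OF vsH triI]; (assumption | rule qcalc)+)
 also have "... = Rs H (%s t. \<epsilon> s \<odot>\<^bsub>H\<^esub> t)"
  by (rule Rs_cong, rule sw_counit(1)[OF vsH]; (assumption | rule qcalc)+)
 finally have 1: "Rs H (%s t. \<epsilon> s \<odot>\<^bsub>H\<^esub> t) = uH" by (rule R_unit_hom[OF e])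
 have "Rs H (%s t. \<epsilon> t \<odot>\<^bsub>H\<^esub> s) ** Rs H (%s t. \<epsilon> t \<odot>\<^bsub>H\<^esub> s) =
   Rs H (%s t. Rs H (%s' t'. (\<epsilon> t \<odot>\<^bsub>H\<^esub> s) ** (\<epsilon> t' \<odot>\<^bsub>H\<^esub> s')))"
  by (rule tensor_lift_mult[OF vsH vsH vsH vsH algH b(2) b(2) R_closed R_closed])
 also have "... = Rs H (%s t. Rs H (%s' t'. \<epsilon> t \<odot>\<^bsub>H\<^esub> (\<epsilon> t' \<odot>\<^bsub>H\<^esub> (s ** s'))))"
  by (rule Rs_cong, rule Rs_cong, simp add: sm counit_closed)
 also have "... = Rs H (%s t. sw H t (%a b. \<epsilon> b \<odot>\<^bsub>H\<^esub> (\<epsilon> a \<odot>\<^bsub>H\<^esub> s)))"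
  by (rule R_comult2[symmetric, OF vsH triI, of "%s a b. \<epsilon> b \<odot>\<^bsub>H\<^esub> (\<epsilon> a \<odot>\<^bsub>H\<^esub> s)"]; (assumption | rule qcalc)+)
 also have "... = Rs H (%s t. \<epsilon> t \<odot>\<^bsub>H\<^esub> s)"
  by (rule Rs_cong, rule sw_counit(2)[OF vsH]; (assumption | rule qcalc)+)
 finally have 2: "Rs H (%s t. \<epsilon> t \<odot>\<^bsub>H\<^esub> s) = uH" by (rule R_unit_hom[OF e'])
 have "Rs Z (%s t. \<epsilon> s \<odot>\<^bsub>Z\<^esub> f t) = Rs Z (%s t. f (\<epsilon> s \<odot>\<^bsub>H\<^esub> t))"
  by (rule Rs_cong,
   simp add: lin_smult[OF f] counit_closed)
 then show "Rs Z (%s t. \<epsilon> s \<odot>\<^bsub>Z\<^esub> f t) = f uH"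
  using Rs_comp[OF f vsH Z b(1)] 1 by simp
 have "Rs Z (%s t. \<epsilon> t \<odot>\<^bsub>Z\<^esub> f s) = Rs Z (%s t. f (\<epsilon> t \<odot>\<^bsub>H\<^esub> s))"
  by (rule Rs_cong,
   simp add: lin_smult[OF f] counit_closed)
 then show "Rs Z (%s t. \<epsilon> t \<odot>\<^bsub>Z\<^esub> f s) = f uH"
  using Rs_comp[OF f vsH Z b(2)] 2 by simp
qed

text \<open>The antipode axiom inserted into a hexagon axiom. The first two identities say that (S
  \<otimes> id)R is a two-sided inverse of R; the third is the analogous cancellation for (id
  \<otimes> S)R with the product of the second leg reversed.\<close>

lemma R_cancel:
 assumes Z: "vs Z" and f: "bil H H Z f"
 shows "Rs Z (%s t. Rs Z (%s' t'. f (S s ** s') (t ** t'))) = f uH uH"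
  and "Rs Z (%s t. Rs Z (%s' t'. f (s ** S s') (t ** t'))) = f uH uH"
  and "Rs Z (%s t. Rs Z (%s' t'. f (s ** s') (t' ** S t))) = f uH uH"
proof -
 note c = qcalc Z lin_compose[OF bil1[OF f]] lin_compose[OF bil2[OF f]] bil_closed[OF f]
 have "Rs Z (%s t. Rs Z (%s' t'. f (S s ** s') (t ** t'))) = Rs Z (%s t. sw Z s (%a b. f (S a ** b) t))"
  by (rule R_comult1[symmetric, OF Z triI, of "%a b t. f (S a ** b) t"]; (assumption | rule c)+)
 also have "... = Rs Z (%s t. \<epsilon> s \<odot>\<^bsub>Z\<^esub> f uH t)"
  by (rule Rs_cong, rule sw_antipode(1)[OF Z bil2[OF f]])
 also have "... = f uH uH" by (rule R_counit(1)[OF Z bil1[OF f oneH]])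
 finally show "Rs Z (%s t. Rs Z (%s' t'. f (S s ** s') (t ** t'))) = f uH uH" .
 have "Rs Z (%s t. Rs Z (%s' t'. f (s ** S s') (t ** t'))) = Rs Z (%s t. sw Z s (%a b. f (a ** S b) t))"
  by (rule R_comult1[symmetric, OF Z triI, of "%a b t. f (a ** S b) t"]; (assumption | rule c)+)
 also have "... = Rs Z (%s t. \<epsilon> s \<odot>\<^bsub>Z\<^esub> f uH t)"
  by (rule Rs_cong, rule sw_antipode(2)[OF Z bil2[OF f]])
 also have "... = f uH uH" by (rule R_counit(1)[OF Z bil1[OF f oneH]])
 finally show "Rs Z (%s t. Rs Z (%s' t'. f (s ** S s') (t ** t'))) = f uH uH" .
 have "Rs Z (%s t. Rs Z (%s' t'. f (s ** s') (t' ** S t))) = Rs Z (%s t. sw Z t (%a b. f s (a ** S b)))"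
  by (rule R_comult2[symmetric, OF Z triI, of "%s a b. f s (a ** S b)"]; (assumption | rule c)+)
 also have "... = Rs Z (%s t. \<epsilon> t \<odot>\<^bsub>Z\<^esub> f s uH)"
  by (rule Rs_cong, rule sw_antipode(2)[OF Z bil1[OF f]])
 also have "... = f uH uH" by (rule R_counit(2)[OF Z bil2[OF f oneH]])
 finally show "Rs Z (%s t. Rs Z (%s' t'. f (s ** s') (t' ** S t))) = f uH uH" .
qed

subsection \<open>Bijectivity of the antipode\<close>

text \<open>The Drinfeld element \<open>u = \<Sum> S(t)s\<close> satisfies \<open>uh = S\<^sup>2(h)u\<close> and has the left inverse
 \<open>\<Sum> t S\<^sup>2(s)\<close>; this makes \<open>S\<close> injective.\<close>

lemma drinfeld_element:
 assumes h: "h .: H"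
 shows "Rs H (%s t. S t ** s) ** h = S (S h) ** Rs H (%s t. S t ** s)"
proof -
 interpret A: assoc_algebra K H by (rule algH)
 note c = qcalc h
 have bu: "bil H H H (%s t. S t ** s)" by (assumption | rule c)+
 \<comment> \<open>The factor S(h_2 S(h_3)) = S^2(h_3) S(h_2) is inserted so that t h_2 and s h_1
   occur together. \<open>?g\<close> is the same expression after R \<Delta>(h) = \<Delta>^op(h) R;
   there S(h_1) h_2 cancels and S^2(h) remains on the left.\<close>
 let ?f = "%s t h1 h2 h3. S (S h3) ** (S (t ** h2) ** (s ** h1))"
 let ?g = "%s t h1 h2 h3. S (S h3) ** (S (h1 ** t) ** (h2 ** s))"
 have "Rs H (%s t. S t ** s) ** h = Rs H (%s t. S t ** (s ** h))"
  using Rs_comp[OF lin_mult_left[OF lin_id algH h] vsH vsH bu]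
   Rs_cong[of "%s t. S t ** s ** h" "%s t. S t ** (s ** h)"]
  by (simp add: A.m_assoc antipode_closed h bilI lin_mult_left lin_mult_right lin_antipode lin_id algH mult_closed)
 also have "... = Rs H (%s t. sw H h (%h1 b. sw H b (%h2 h3. ?f s t h1 h2 h3)))"
 proof (rule Rs_cong)
  fix s t assume st: "s .: H" "t .: H"
  have "sw H h (%h1 b. sw H b (%h2 h3. ?f s t h1 h2 h3)) =
    sw H h (%h1 b. sw H b (%h2 h3. S (h2 ** S h3) ** (S t ** (s ** h1))))"
   by (rule sw_cong[OF h], rule sw_cong, assumption, simp add: antipode_mult A.m_assoc antipode_closed st)
  also have "... = S uH ** (S t ** (s ** h))"
   by (rule sw_cancel_right(2)[OF vsH _ h, of "%a y. S y ** (S t ** (s ** a))"]) ((assumption | rule c st)+)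
  finally show "S t ** (s ** h) = sw H h (%h1 b. sw H b (%h2 h3. ?f s t h1 h2 h3))"
   by (simp add: antipode_one antipode_closed st h)
 qed
 also have "... = Rs H (%s t. sw H h (%x h3. sw H x (%h1 h2. ?f s t h1 h2 h3)))"
  by (rule Rs_cong, rule sw_assoc[symmetric, OF vsH triI h]; (assumption | rule c)+)
 also have "... = sw H h (%x h3. Rs H (%s t. sw H x (%h1 h2. ?f s t h1 h2 h3)))"
  by (rule tensor_lift_swap[OF vsH vsH vsH vsH vsH R_closed comult_closed[OF h]]; (assumption | rule c)+)
 also have "... = sw H h (%x h3. sw H x (%h1 h2. Rs H (%s t. ?g s t h1 h2 h3)))"
  by (rule sw_cong[OF h],
    rule R_intertwine[OF vsH, of "%p q. S (S h3) ** (S q ** p)" for h3]; (assumption | rule c)+)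
 also have "... = sw H h (%x h3. Rs H (%s t. sw H x (%h1 h2. ?g s t h1 h2 h3)))"
  by (rule sw_cong[OF h],
    rule tensor_lift_swap[OF vsH vsH vsH vsH vsH comult_closed R_closed]; (assumption | rule c)+)
 also have "... = Rs H (%s t. sw H h (%x h3. sw H x (%h1 h2. ?g s t h1 h2 h3)))"
  by (rule tensor_lift_swap[OF vsH vsH vsH vsH vsH comult_closed[OF h] R_closed]; (assumption | rule c)+)
 also have "... = Rs H (%s t. S (S h) ** (S t ** s))"
 proof (rule Rs_cong)
  fix s t assume st: "s .: H" "t .: H"
  have "sw H h (%x h3. sw H x (%h1 h2. ?g s t h1 h2 h3)) =
    sw H h (%x h3. sw H x (%h1 h2. S (S h3) ** (S t ** ((S h1 ** h2) ** s))))"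
   by (rule sw_cong[OF h], rule sw_cong, assumption, simp add: antipode_mult A.m_assoc antipode_closed st)
  also have "... = S (S h) ** (S t ** (uH ** s))"
   by (rule sw_cancel_left(1)[OF vsH _ h, of "%y b. S (S b) ** (S t ** (y ** s))"]) ((assumption | rule c st)+)
  finally show "sw H h (%x h3. sw H x (%h1 h2. ?g s t h1 h2 h3)) = S (S h) ** (S t ** s)" by (simp add: st)
 qed
 also have "... = S (S h) ** Rs H (%s t. S t ** s)"
  by (rule Rs_comp[symmetric, OF _ vsH vsH bu]) ((assumption | rule c)+)
 finally show ?thesis .
qed

text \<open>Moving S^2(s) to the other side of u by \<open>drinfeld_element\<close> turns the
  product into the sum of t S(t') s' s over two copies of R, which is 1 by the third part of
  \<open>R_cancel\<close>.\<close>

lemma drinfeld_element_left_inverse: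
 "Rs H (%s t. t ** S (S s)) ** Rs H (%s t. S t ** s) = uH"
proof -
 interpret A: assoc_algebra K H by (rule algH)
 note c = qcalc
 let ?u = "Rs H (%s t. S t ** s)"
 have bu: "bil H H H (%s t. S t ** s)" and bv: "bil H H H (%s t. t ** S (S s))" by (assumption | rule c)+
 have u: "?u .: H" by (assumption | rule c)+
 have "Rs H (%s t. t ** S (S s)) ** ?u = Rs H (%s t. (t ** S (S s)) ** ?u)"
  by (rule Rs_comp[OF lin_mult_left[OF lin_id algH u] vsH vsH bv])
 also have "... = Rs H (%s t. Rs H (%s' t'. t ** ((S t' ** s') ** s)))"
 proof (rule Rs_cong)
  fix s t assume st: "s .: H" "t .: H"
  have "(t ** S (S s)) ** ?u = t ** (?u ** s)"
   using drinfeld_element[OF st(1)] u st by (simp add: A.m_assoc antipode_closed)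
  also have "... = Rs H (%s' t'. t ** ((S t' ** s') ** s))"
   by (rule Rs_comp[OF _ vsH vsH bu]) ((assumption | rule c st)+)
  finally show "(t ** S (S s)) ** ?u = Rs H (%s' t'. t ** ((S t' ** s') ** s))" .
 qed
 also have "... = Rs H (%s' t'. Rs H (%s t. t ** ((S t' ** s') ** s)))"
  by (rule Rs_swap[OF vsH]; (assumption | rule c)+)
 also have "... = Rs H (%s' t'. Rs H (%s t. (t ** S t') ** (s' ** s)))"
  by (rule Rs_cong, rule Rs_cong, simp add: A.m_assoc antipode_closed)
 also have "... = uH ** uH"
  by (rule R_cancel(3)[OF vsH, of "%p q. q ** p"]) ((assumption | rule c)+)
 finally show ?thesis by simp
qed

lemma antipode_bij: "inj_on S (carrier H)" "S ` carrier H = carrier H"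
proof -
 interpret A: assoc_algebra K H by (rule algH)
 let ?u = "Rs H (%s t. S t ** s)" and ?v = "Rs H (%s t. t ** S (S s))"
 have uv: "?u .: H" "?v .: H" by (assumption | rule qcalc)+
 have "h = \<zero>\<^bsub>H\<^esub>" if h: "h .: H" and z: "S h = \<zero>\<^bsub>H\<^esub>" for h
 proof -
  have "S (S h) = \<zero>\<^bsub>H\<^esub>" using z lin_zero[OF vsH vsH lin_antipode0] by simp
  then have "?u ** h = \<zero>\<^bsub>H\<^esub>" using drinfeld_element[OF h] uv by simp
  then have "(?v ** ?u) ** h = \<zero>\<^bsub>H\<^esub>" using uv h by (simp add: A.m_assoc)
  then show ?thesis using h by (simp add: drinfeld_element_left_inverse)
 qed
 then show "inj_on S (carrier H)" "S ` carrier H = carrier H"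
  using inj_imp_surj[OF lin_antipode0 vsH fin] by blast+
qed

abbreviation T where "T \<equiv> antipode_inv H"

lemma T_closed: "h .: H ==> T h .: H"
 and S_T: "h .: H ==> S (T h) = h"
 and T_S: "h .: H ==> T (S h) = h"
 using antipode_bij by (auto simp: antipode_inv_def inv_into_into f_inv_into_f)

lemma T_eq: "[|x .: H; S x = y|] ==> T y = x"
 using T_S by blast

lemma lin_T: "lin U H f ==> lin U H (%x. T (f x))"
proof -
 interpret A: assoc_algebra K H by (rule algH)
 have "lin H H T"
  by (rule linI; (rule T_eq)?)
    (simp_all add: T_closed S_T lin_add[OF lin_antipode0] lin_smult[OF lin_antipode0])
 then show "lin U H f ==> lin U H (%x. T (f x))" by (rule lin_compose)
qed

lemma T_mult: "[|a .: H; b .: H|] ==> T (a ** b) = T b ** T a"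
 by (rule T_eq) (simp_all add: T_closed S_T antipode_mult mult_closed algH)

lemma T_one: "T uH = uH"
 by (rule T_eq) (simp_all add: oneH antipode_one)

lemmas tcalc = qcalc lin_T T_closed

lemma sw_T:
 assumes Z: "vs Z" and f: "bil H H Z f" and h: "h .: H"
 shows "sw Z (T h) f = sw Z h (%a b. f (T b) (T a))"
proof -
 note c = tcalc lin_compose[OF bil1[OF f]] lin_compose[OF bil2[OF f]] bil_closed[OF f] Z
 have "sw Z h (%a b. f (T b) (T a)) = sw Z (S (T h)) (%a b. f (T b) (T a))" by (simp add: S_T h)
 also have "... = sw Z (T h) (%a b. f (T (S a)) (T (S b)))"
  by (rule sw_antipode_arg[OF Z _ T_closed[OF h]]) ((assumption | rule c)+)
 also have "... = sw Z (T h) f"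
  by (rule sw_cong[OF T_closed[OF h]], simp add: T_S)
 finally show ?thesis by simp
qed

text \<open>S^-1 is the antipode for the opposite coproduct, so the legs appear in reverse order.
  The identities are the antipode axioms for S with S^-1 applied to the products.\<close>

lemma sw_T_antipode:
 assumes Z: "vs Z" and f: "lin H Z f" and h: "h .: H"
 shows "sw Z h (%a b. f (b ** T a)) = \<epsilon> h \<odot>\<^bsub>Z\<^esub> f uH" "sw Z h (%a b. f (T b ** a)) = \<epsilon> h \<odot>\<^bsub>Z\<^esub> f uH"
proof -
 have fT: "lin H Z (%x. f (T x))" by (rule lin_compose[OF f lin_T[OF lin_id]])
 have "sw Z h (%a b. f (b ** T a)) = sw Z h (%a b. f (T (a ** S b)))"
  by (rule sw_cong[OF h], simp add: T_mult T_S antipode_closed)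
 then show "sw Z h (%a b. f (b ** T a)) = \<epsilon> h \<odot>\<^bsub>Z\<^esub> f uH"
  using sw_antipode(2)[OF Z fT h] by (simp add: T_one)
 have "sw Z h (%a b. f (T b ** a)) = sw Z h (%a b. f (T (S a ** b)))"
  by (rule sw_cong[OF h], simp add: T_mult T_S antipode_closed)
 then show "sw Z h (%a b. f (T b ** a)) = \<epsilon> h \<odot>\<^bsub>Z\<^esub> f uH"
  using sw_antipode(1)[OF Z fT h] by (simp add: T_one)
qed

text \<open>S^-1 applied to the first leg of \<open>R_cancel\<close> reverses the products there.
  The first identity removes R_34 in \<open>Th_product\<close>, the second cancels R_34 against a
  twisting factor of the coproduct of H-hat in \<open>X_R_X\<close>.\<close>

lemma R_cancel_T:
 assumes Z: "vs Z" and f: "bil H H Z f"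
 shows "Rs Z (%s t. Rs Z (%s' t'. f (s' ** T s) (t ** t'))) = f uH uH"
  and "Rs Z (%s t. Rs Z (%s' t'. f (T s' ** s) (t ** t'))) = f uH uH"
proof -
 note c = tcalc Z lin_compose[OF bil1[OF f]] lin_compose[OF bil2[OF f]] bil_closed[OF f]
 have b: "bil H H Z (%p q. f (T p) q)" by (assumption | rule c)+
 have "Rs Z (%s t. Rs Z (%s' t'. f (s' ** T s) (t ** t'))) = Rs Z (%s t. Rs Z (%s' t'. f (T (s ** S s')) (t ** t')))"
  by (rule Rs_cong, rule Rs_cong, simp add: T_mult T_S antipode_closed)
 then show "Rs Z (%s t. Rs Z (%s' t'. f (s' ** T s) (t ** t'))) = f uH uH"
  using R_cancel(2)[OF Z b] by (simp add: T_one)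
 have "Rs Z (%s t. Rs Z (%s' t'. f (T s' ** s) (t ** t'))) = Rs Z (%s t. Rs Z (%s' t'. f (T (S s ** s')) (t ** t')))"
  by (rule Rs_cong, rule Rs_cong, simp add: T_mult T_S antipode_closed)
 then show "Rs Z (%s t. Rs Z (%s' t'. f (T s' ** s) (t ** t'))) = f uH uH"
  using R_cancel(1)[OF Z b] by (simp add: T_one)
qed

end

section \<open>The dual space and the Drinfeld double\<close>

context field_base
begin

lemma dual_space_simps:
 "\<xi> .: (dual_space K V) \<longleftrightarrow> \<xi> \<in> extensional (carrier V) \<and> lin V (scalars K) \<xi> \<and> vs V"
 "\<xi> \<oplus>\<^bsub>dual_space K V\<^esub> \<zeta> = (\<lambda>v\<in>carrier V. \<xi> v \<oplus> \<zeta> v)" "c \<odot>\<^bsub>dual_space K V\<^esub> \<xi> = (\<lambda>v\<in>carrier V. c \<otimes> \<xi> v)"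
 "\<zero>\<^bsub>dual_space K V\<^esub> = (\<lambda>v\<in>carrier V. \<zero>)"
 by (auto simp: dual_space_def linear_map_iff vs_scalars PiE_def lin_def)

lemma dual_eval_closed: "[|\<xi> .: (dual_space K V); v .: V|] ==> \<xi> v .: K"
 by (simp add: dual_space_simps(1) lin_def)

lemma lin_dual_app: "[|\<xi> .: (dual_space K V); lin U V f|] ==> lin U (scalars K) (%x. \<xi> (f x))"
 by (auto simp: dual_space_simps(1) intro: lin_compose)

lemma dual_eqI:
 assumes "\<xi> .: (dual_space K V)" "\<zeta> .: (dual_space K V)" "!!v. v .: V ==> \<xi> v = \<zeta> v"
 shows "\<xi> = \<zeta>"
 using assms by (auto simp: dual_space_simps(1) intro: extensionalityI)

lemma dual_restrict_closed:
 assumes "lin V (scalars K) f" "vs V" shows "(\<lambda>v\<in>carrier V. f v) .: (dual_space K V)"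
proof -
 have "lin V (scalars K) (\<lambda>v\<in>carrier V. f v) = lin V (scalars K) f"
  by (rule lin_cong[OF _ assms(2)]) simp
 then show ?thesis using assms by (simp add: dual_space_simps(1))
qed

lemma lin_eval: "v .: V ==> lin (dual_space K V) (scalars K) (%\<xi>. \<xi> v)"
 by (intro linI) (simp_all add: dual_space_simps(2,3) dual_eval_closed)

lemma lin_dual_restrict:
 assumes "!!u. u .: U ==> lin V (scalars K) (f u)" "!!v. v .: V ==> lin U (scalars K) (%u. f u v)"
  and "vs V"
 shows "lin U (dual_space K V) (%u. \<lambda>v\<in>carrier V. f u v)"
proof (rule linI)
 show "(\<lambda>v\<in>carrier V. f x v) .: (dual_space K V)" if "x .: U" for x
  by (rule dual_restrict_closed[OF assms(1)[OF that] assms(3)])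
qed (auto simp: dual_space_simps(2,3) lin_add[OF assms(2)] lin_smult[OF assms(2)] intro!: restrict_ext)

lemma vs_dual:
 assumes V: "vs V" shows "vs (dual_space K V)"
proof -
 interpret V: vectorspace K V by (rule V)
 interpret S: vectorspace K "scalars K" by (rule vs_scalars)
 let ?D = "dual_space K V"
 have r: "(\<lambda>v\<in>carrier V. f v) .: ?D" if "lin V (scalars K) f" for f
  by (rule dual_restrict_closed[OF that V])
 have l: "lin V (scalars K) \<xi>" and e: "\<xi> \<in> extensional (carrier V)" if "\<xi> .: ?D" for \<xi>
  using that by (simp_all add: dual_space_simps(1))
 have add: "\<xi> \<oplus>\<^bsub>?D\<^esub> \<zeta> .: ?D" if "\<xi> .: ?D" "\<zeta> .: ?D" for \<xi> \<zeta>
  using r[OF lin_plus[OF vs_scalars l[OF that(1)] l[OF that(2)]]] by (simp add: dual_space_simps(2))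
 have sm: "c \<odot>\<^bsub>?D\<^esub> \<xi> .: ?D" if "\<xi> .: ?D" "c .: K" for \<xi> c
  using r[OF lin_smult_right[OF vs_scalars l[OF that(1)] that(2)]] by (simp add: dual_space_simps(3))
 have z: "\<zero>\<^bsub>?D\<^esub> .: ?D"
  using r[OF lin_zero_map[OF vs_scalars]] by (simp add: dual_space_simps(4))
 have ev: "(\<xi> \<oplus>\<^bsub>?D\<^esub> \<zeta>) v = \<xi> v \<oplus> \<zeta> v" "(c \<odot>\<^bsub>?D\<^esub> \<xi>) v = c \<otimes> \<xi> v" "\<zero>\<^bsub>?D\<^esub> v = \<zero>" if "v .: V" for \<xi> \<zeta> c v
  using that by (simp_all add: dual_space_simps(2-4))
 have c: "\<xi> v .: K" if "\<xi> .: ?D" "v .: V" for \<xi> v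
  by (rule dual_eval_closed[OF that])
 show ?thesis
 proof (rule vsI)
  show "abelian_group ?D"
  proof (rule abelian_groupI)
   show "\<exists>\<zeta>\<in>carrier ?D. \<zeta> \<oplus>\<^bsub>?D\<^esub> \<xi> = \<zero>\<^bsub>?D\<^esub>" if x: "\<xi> .: ?D" for \<xi>
    by (rule bexI[OF _ sm[OF x, of "\<ominus> \<one>"]], rule dual_eqI[OF add[OF sm[OF x] x] z])
     (simp_all add: ev c[OF x] l_minus l_neg)
   show "\<zero>\<^bsub>?D\<^esub> \<oplus>\<^bsub>?D\<^esub> \<xi> = \<xi>" if x: "\<xi> .: ?D" for \<xi>
    by (rule dual_eqI[OF add[OF z x] x]) (simp add: ev c[OF x])
   show "\<xi> \<oplus>\<^bsub>?D\<^esub> \<zeta> \<oplus>\<^bsub>?D\<^esub> \<chi> = \<xi> \<oplus>\<^bsub>?D\<^esub> (\<zeta> \<oplus>\<^bsub>?D\<^esub> \<chi>)"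
    if x: "\<xi> .: ?D" "\<zeta> .: ?D" "\<chi> .: ?D" for \<xi> \<zeta> \<chi>
    by (rule dual_eqI[OF add[OF add[OF x(1,2)] x(3)] add[OF x(1) add[OF x(2,3)]]]) (simp add: ev c[OF x(1)] c[OF x(2)] c[OF x(3)] a_assoc)
   show "\<xi> \<oplus>\<^bsub>?D\<^esub> \<zeta> = \<zeta> \<oplus>\<^bsub>?D\<^esub> \<xi>" if x: "\<xi> .: ?D" "\<zeta> .: ?D" for \<xi> \<zeta>
    by (rule dual_eqI[OF add[OF x] add[OF x(2,1)]]) (simp add: ev c[OF x(1)] c[OF x(2)] a_comm)
  qed (fact add z)+
  show "a \<odot>\<^bsub>?D\<^esub> \<xi> .: ?D" if "a .: K" "\<xi> .: ?D" for a \<xi> by (rule sm[OF that(2,1)])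
  show "(a \<oplus> b) \<odot>\<^bsub>?D\<^esub> \<xi> = a \<odot>\<^bsub>?D\<^esub> \<xi> \<oplus>\<^bsub>?D\<^esub> b \<odot>\<^bsub>?D\<^esub> \<xi>"
   if x: "a .: K" "b .: K" "\<xi> .: ?D" for a b \<xi>
   by (rule dual_eqI[OF sm add[OF sm sm]]) (simp_all add: x ev c[OF x(3)] l_distr)
  show "a \<odot>\<^bsub>?D\<^esub> (\<xi> \<oplus>\<^bsub>?D\<^esub> \<zeta>) = a \<odot>\<^bsub>?D\<^esub> \<xi> \<oplus>\<^bsub>?D\<^esub> a \<odot>\<^bsub>?D\<^esub> \<zeta>"
   if x: "a .: K" "\<xi> .: ?D" "\<zeta> .: ?D" for a \<xi> \<zeta>
   by (rule dual_eqI[OF sm[OF add] add[OF sm sm]]) (simp_all add: x ev c[OF x(2)] c[OF x(3)] r_distr)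
  show "(a \<otimes> b) \<odot>\<^bsub>?D\<^esub> \<xi> = a \<odot>\<^bsub>?D\<^esub> (b \<odot>\<^bsub>?D\<^esub> \<xi>)"
   if x: "a .: K" "b .: K" "\<xi> .: ?D" for a b \<xi>
   by (rule dual_eqI[OF sm sm[OF sm]]) (simp_all add: x ev c[OF x(3)] m_assoc)
  show "\<one> \<odot>\<^bsub>?D\<^esub> \<xi> = \<xi>" if x: "\<xi> .: ?D" for \<xi>
   by (rule dual_eqI[OF sm[OF x one_closed] x]) (simp add: ev c[OF x])
 qed
qed

lemma same_space_dual:
 assumes "same_space V W" shows "dual_space K V = dual_space K W"
 by (simp add: dual_space_def linear_map_iff same_space_vs[OF assms] same_space_eqs[OF assms]
   assms[unfolded same_space_def])

lemma same_space_opposite: "same_space (opposite A) A"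
 by (simp add: same_space_def opposite_def)

lemma opposite_simps [simp]:
 "carrier (opposite A) = carrier A" "x \<otimes>\<^bsub>opposite A\<^esub> y = y \<otimes>\<^bsub>A\<^esub> x" "\<one>\<^bsub>opposite A\<^esub> = \<one>\<^bsub>A\<^esub>"
 "x \<oplus>\<^bsub>opposite A\<^esub> y = x \<oplus>\<^bsub>A\<^esub> y" "c \<odot>\<^bsub>opposite A\<^esub> y = c \<odot>\<^bsub>A\<^esub> y" "\<zero>\<^bsub>opposite A\<^esub> = \<zero>\<^bsub>A\<^esub>"
 by (simp_all add: opposite_def)

lemma same_space_dual_alg: "same_space (dual_alg K C) (dual_space K C)"
 by (simp add: same_space_def dual_alg_def)

lemma dual_alg_simps:
 "carrier (dual_alg K C) = carrier (dual_space K C)"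
 "\<xi> \<otimes>\<^bsub>dual_alg K C\<^esub> \<zeta> = (\<lambda>c\<in>carrier C. lift (scalars K) (%x y. \<xi> x \<otimes> \<zeta> y) (comult C c))"
 "\<one>\<^bsub>dual_alg K C\<^esub> = (\<lambda>c\<in>carrier C. counit C c)"
 by (simp_all add: dual_alg_def)

lemma lin_Kmult_left: "[|lin U (scalars K) f; c .: K|] ==> lin U (scalars K) (%x. f x \<otimes> c)"
 using lin_smult_left[OF vs_scalars, of U f c] by simp

lemma lin_Kmult_right: "[|lin U (scalars K) f; c .: K|] ==> lin U (scalars K) (%x. c \<otimes> f x)"
 using lin_smult_right[OF vs_scalars, of U f c] by simp

lemma tensor_lift_closed_K:
 assumes "t .: (tsp V W)" "vs V" "vs W" "bil V W (scalars K) \<beta>"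
 shows "lift (scalars K) \<beta> t .: K"
 using tensor_lift_closed[OF assms(2,3) vs_scalars assms(4,1)] by simp

lemma dual_bases_expand:
 assumes "dual_bases K V D h x"
 shows "v .: V ==> v = (\<Oplus>\<^bsub>V\<^esub>d\<in>D. x d v \<odot>\<^bsub>V\<^esub> h d)"
  and "\<xi> .: (dual_space K V) ==> \<xi> = (\<Oplus>\<^bsub>dual_space K V\<^esub>d\<in>D. \<xi> (h d) \<odot>\<^bsub>dual_space K V\<^esub> x d)"
  and "d \<in> D ==> h d .: V" "d \<in> D ==> x d .: (dual_space K V)" "finite D" "vs V"
proof -
 interpret S: vectorspace K "scalars K" by (rule vs_scalars)
 have V: "vs V" and fin: "finite D" and inj: "inj_on h D" and basis: "vectorspace.basis K V (h ` D)"
  and functional: "!!d. d \<in> D ==> x d .: (dual_space K V)"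
  and pairing: "!!d e. [|d \<in> D; e \<in> D|] ==> x d (h e) = (if d = e then \<one> else \<zero>)"
  using assms by (auto simp: dual_bases_def dual_bases_axioms_def)
 show "vs V" by (rule V)
 have xc: "x d v .: K" if "d \<in> D" "v .: V" for d v
  by (rule dual_eval_closed[OF functional[OF that(1)] that(2)])
 interpret V: vectorspace K V by (rule V)
 have h: "h d .: V" if "d \<in> D" for d using that basis by (auto simp: V.basis_def)
 show "d \<in> D ==> h d .: V" "d \<in> D ==> x d .: (dual_space K V)" "finite D"
  by (fact h functional fin)+
 have e: "v = (\<Oplus>\<^bsub>V\<^esub>d\<in>D. x d v \<odot>\<^bsub>V\<^esub> h d)" if v: "v .: V" for v
 proof -
  have "v \<in> V.span (h ` D)" using basis v by (simp add: V.basis_def)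
  then obtain a where a: "a \<in> h ` D \<rightarrow> carrier K" "v = V.lincomb a (h ` D)"
   using V.finite_in_span[of "h ` D" v] fin h by blast
  have v_eq: "v = (\<Oplus>\<^bsub>V\<^esub>d\<in>D. a (h d) \<odot>\<^bsub>V\<^esub> h d)"
   unfolding a(2) V.lincomb_def using a(1) h by (intro V.finsum_reindex[OF _ inj]) (auto simp: Pi_iff)
  \<comment> \<open>Pairing with the dual functional isolates one coefficient, so the coefficients
    obtained from the spanning property are the values of the functionals
    \<open>x e\<close>.\<close>
  have "x e v = a (h e)" if e: "e \<in> D" for e
  proof -
   have l: "lin V (scalars K) (x e)" using functional[OF e] by (simp add: dual_space_simps(1))
   have "x e v = (\<Oplus>\<^bsub>scalars K\<^esub>d\<in>D. x e (a (h d) \<odot>\<^bsub>V\<^esub> h d))"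
    by (subst v_eq, rule lin_finsum[OF V vs_scalars l]) (use a(1) h in \<open>auto simp: Pi_iff\<close>)
   also have "... = (\<Oplus>\<^bsub>scalars K\<^esub>d\<in>D. if e = d then a (h d) else \<zero>)"
    using a(1) h e by (intro S.finsum_cong') (auto simp: lin_smult[OF l] pairing Pi_iff)
   also have "... = a (h e)"
    using S.finsum_singleton[OF e fin, of "%d. a (h d)"] a(1) e unfolding scalars_simps
    by (auto simp: Pi_iff)
   finally show ?thesis .
  qed
  then have "(\<Oplus>\<^bsub>V\<^esub>d\<in>D. x d v \<odot>\<^bsub>V\<^esub> h d) = (\<Oplus>\<^bsub>V\<^esub>d\<in>D. a (h d) \<odot>\<^bsub>V\<^esub> h d)"
   using a(1) h by (intro V.finsum_cong') (auto simp: Pi_iff)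
  then show ?thesis using v_eq by simp
 qed
 show "v .: V ==> v = (\<Oplus>\<^bsub>V\<^esub>d\<in>D. x d v \<odot>\<^bsub>V\<^esub> h d)" by (rule e)
 interpret D: vectorspace K "dual_space K V" by (rule vs_dual[OF V])
 show "\<xi> = (\<Oplus>\<^bsub>dual_space K V\<^esub>d\<in>D. \<xi> (h d) \<odot>\<^bsub>dual_space K V\<^esub> x d)" if xi: "\<xi> .: (dual_space K V)"
 proof (rule dual_eqI[OF xi])
  have cl: "(%d. \<xi> (h d) \<odot>\<^bsub>dual_space K V\<^esub> x d) \<in> D \<rightarrow> carrier (dual_space K V)"
   using xi functional h by (auto intro!: D.smult_closed dual_eval_closed[OF xi])
  show "(\<Oplus>\<^bsub>dual_space K V\<^esub>d\<in>D. \<xi> (h d) \<odot>\<^bsub>dual_space K V\<^esub> x d) .: (dual_space K V)"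
   using cl by (rule D.finsum_closed)
  fix v assume v: "v .: V"
  have l: "lin V (scalars K) \<xi>" using xi by (simp add: dual_space_simps(1))
  have "\<xi> v = (\<Oplus>\<^bsub>scalars K\<^esub>d\<in>D. \<xi> (x d v \<odot>\<^bsub>V\<^esub> h d))"
   by (subst e[OF v], rule lin_finsum[OF V vs_scalars l]) (use h v in \<open>auto simp: xc\<close>)
  also have "... = (\<Oplus>\<^bsub>scalars K\<^esub>d\<in>D. (\<xi> (h d) \<odot>\<^bsub>dual_space K V\<^esub> x d) v)"
   using h v functional xi
   by (intro S.finsum_cong')
    (auto simp: dual_space_simps(3) lin_smult[OF l] xc dual_eval_closed[OF xi] m_comm)
  also have "... = (\<Oplus>\<^bsub>dual_space K V\<^esub>d\<in>D. \<xi> (h d) \<odot>\<^bsub>dual_space K V\<^esub> x d) v"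
   by (rule lin_finsum[symmetric, OF vs_dual[OF V] vs_scalars lin_eval[OF v] cl])
  finally show "\<xi> v = (\<Oplus>\<^bsub>dual_space K V\<^esub>d\<in>D. \<xi> (h d) \<odot>\<^bsub>dual_space K V\<^esub> x d) v" .
 qed
qed

text \<open>The canonical element \<open>\<Sum>\<^sub>d \<xi>\<^sub>d \<otimes> h\<^sub>d\<close>.\<close>

definition canonical :: "('k, 'v, 'm) module_scheme \<Rightarrow> 'd set \<Rightarrow> ('d \<Rightarrow> 'v) \<Rightarrow> ('d \<Rightarrow> 'v \<Rightarrow> 'k) \<Rightarrow> ('k, 'v \<Rightarrow> 'k, 'v) tensor"
 where "canonical V D h x = (\<Oplus>\<^bsub>tsp (dual_space K V) V\<^esub>d\<in>D. tens K (dual_space K V) V (x d) (h d))"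

text \<open>Contracting one leg of the canonical element with a functional or a vector gives that
  functional or vector back in the other leg. Sums over a dual basis thereby become lifts of one
  fixed tensor and obey the same exchange rules as Sweedler sums.\<close>

lemma canonical_props:
 assumes B: "dual_bases K V D h x"
 shows canonical_closed: "canonical V D h x .: (tsp (dual_space K V) V)"
  and lift_canonical: "[|vs Z; bil (dual_space K V) V Z f|]
   ==> lift Z f (canonical V D h x) = (\<Oplus>\<^bsub>Z\<^esub>d\<in>D. f (x d) (h d))"
  and canonical_dual: "[|vs Z; lin (dual_space K V) Z F; \<xi> .: (dual_space K V)|]
   ==> lift Z (%x h. \<xi> h \<odot>\<^bsub>Z\<^esub> F x) (canonical V D h x) = F \<xi>"
  and canonical_vector: "[|vs Z; lin V Z G; v .: V|]
   ==> lift Z (%x h. x v \<odot>\<^bsub>Z\<^esub> G h) (canonical V D h x) = G v"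
proof -
 note e = dual_bases_expand[OF B]
 note V = e(6) and D = vs_dual[OF e(6)]
 let ?T = "tsp (dual_space K V) V"
 interpret T: vectorspace K ?T by (rule vs_tensor[OF D V])
 have cl: "(%d. tens K (dual_space K V) V (x d) (h d)) \<in> D \<rightarrow> carrier ?T"
  using e(3,4) by (auto intro: tens_closed D V)
 show "canonical V D h x .: ?T" unfolding canonical_def using cl by (rule T.finsum_closed)
 have s: "lift Z f (canonical V D h x) = (\<Oplus>\<^bsub>Z\<^esub>d\<in>D. f (x d) (h d))"
  if Z: "vs Z" and f: "bil (dual_space K V) V Z f" for f and Z :: "('k, 'z, 'o) module_scheme"
 proof -
  interpret Z: vectorspace K Z by (rule Z)
  have "lift Z f (canonical V D h x) = (\<Oplus>\<^bsub>Z\<^esub>d\<in>D. lift Z f (tens K (dual_space K V) V (x d) (h d)))"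
   unfolding canonical_def by (rule lin_finsum[OF vs_tensor[OF D V] Z lin_tensor_lift[OF D V Z f] cl])
  also have "... = (\<Oplus>\<^bsub>Z\<^esub>d\<in>D. f (x d) (h d))"
   using e(3,4) by (intro Z.finsum_cong') (auto simp: tensor_lift_tens[OF D V Z f] intro: bil_closed[OF f])
  finally show ?thesis .
 qed
 show "[|vs Z; bil (dual_space K V) V Z f|] ==> lift Z f (canonical V D h x) = (\<Oplus>\<^bsub>Z\<^esub>d\<in>D. f (x d) (h d))"
  by (rule s)
 show "lift Z (%x h. \<xi> h \<odot>\<^bsub>Z\<^esub> F x) (canonical V D h x) = F \<xi>"
  if Z: "vs Z" and F: "lin (dual_space K V) Z F" and xi: "\<xi> .: (dual_space K V)"
 proof -
  interpret Z: vectorspace K Z by (rule Z)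
  interpret D: vectorspace K "dual_space K V" by (rule D)
  have "F \<xi> = (\<Oplus>\<^bsub>Z\<^esub>d\<in>D. F (\<xi> (h d) \<odot>\<^bsub>dual_space K V\<^esub> x d))"
   by (subst e(2)[OF xi], rule lin_finsum[OF D Z F]) (use e(3,4) xi in \<open>auto intro!: D.smult_closed dual_eval_closed[OF xi]\<close>)
  also have "... = (\<Oplus>\<^bsub>Z\<^esub>d\<in>D. \<xi> (h d) \<odot>\<^bsub>Z\<^esub> F (x d))"
   using e(3,4) xi by (intro Z.finsum_cong') (auto simp: lin_smult[OF F] dual_eval_closed[OF xi] lin_closed[OF F])
  also have "... = lift Z (%x h. \<xi> h \<odot>\<^bsub>Z\<^esub> F x) (canonical V D h x)"
   by (rule s[symmetric, OF Z])
    ((assumption | rule bilI lin_smult_left lin_smult_right lin_dual_app[OF xi, OF lin_id] F Z lin_closed[OF F] dual_eval_closed[OF xi])+)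
  finally show ?thesis by simp
 qed
 show "lift Z (%x h. x v \<odot>\<^bsub>Z\<^esub> G h) (canonical V D h x) = G v"
  if Z: "vs Z" and G: "lin V Z G" and v: "v .: V"
 proof -
  interpret Z: vectorspace K Z by (rule Z)
  interpret V: vectorspace K V by (rule V)
  have "G v = (\<Oplus>\<^bsub>Z\<^esub>d\<in>D. G (x d v \<odot>\<^bsub>V\<^esub> h d))"
   by (subst e(1)[OF v], rule lin_finsum[OF V Z G]) (use e(3,4) v in \<open>auto intro!: V.smult_closed dual_eval_closed[OF e(4)]\<close>)
  also have "... = (\<Oplus>\<^bsub>Z\<^esub>d\<in>D. x d v \<odot>\<^bsub>Z\<^esub> G (h d))"
   using e(3,4) v dual_eval_closed[OF e(4) v]
   by (intro Z.finsum_cong') (auto simp: lin_smult[OF G] lin_closed[OF G])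
  also have "... = lift Z (%x h. x v \<odot>\<^bsub>Z\<^esub> G h) (canonical V D h x)"
   by (rule s[symmetric, OF Z])
    ((assumption | rule bilI lin_smult_left lin_smult_right lin_eval G Z v lin_closed[OF G] dual_eval_closed)+)
  finally show ?thesis by simp
 qed
qed

text \<open>A map can be moved from the functional leg to the vector leg of the canonical element:
  both positions represent L in the tensor product of the dual space and V. The transposed
  functional is expanded in a second copy, and the first copy is then contracted at L(k).\<close>

lemma canonical_transpose:
 assumes B: "dual_bases K V D bs ds" and Z: "vs Z" and f: "bil (dual_space K V) V Z f"
  and L: "lin V V L"
 shows "lift Z (%x h. f (\<lambda>v\<in>carrier V. x (L v)) h) (canonical V D bs ds) =
  lift Z (%x h. f x (L h)) (canonical V D bs ds)"
proof -
 let ?C = "canonical V D bs ds" and ?Vd = "dual_space K V"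
 have V: "vs V" by (rule dual_bases_expand(6)[OF B])
 note D = vs_dual[OF V] and cC = canonical_closed[OF B]
 note c = lin_id lin_tens_left lin_tens_right lin_lift_arg lin_lift_fun bilI lin_smult_left lin_smult_right
  smult_closed' tensor_lift_closed V D Z cC lin_eval lin_compose[OF L] lin_closed[OF L]
  dual_eval_closed[of _ V] bil_closed[OF f] lin_compose[OF bil1[OF f]]
  lin_compose[OF bil2[OF f]] lin_dual_restrict dual_restrict_closed lin_dual_app[of _ V]
 have "lift Z (%x h. f (\<lambda>v\<in>carrier V. x (L v)) h) ?C =
  lift Z (%x h. lift Z (%y k. x (L k) \<odot>\<^bsub>Z\<^esub> f y h) ?C) ?C"
 proof (rule tensor_lift_cong[OF cC D V])
  fix x h assume xh: "x .: ?Vd" "h .: V"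
  have r: "(\<lambda>v\<in>carrier V. x (L v)) .: ?Vd" by (assumption | rule c xh)+
  have "f (\<lambda>v\<in>carrier V. x (L v)) h = lift Z (%y k. (\<lambda>v\<in>carrier V. x (L v)) k \<odot>\<^bsub>Z\<^esub> f y h) ?C"
   by (rule canonical_dual[symmetric, OF B Z bil2[OF f xh(2)] r])
  also have "... = lift Z (%y k. x (L k) \<odot>\<^bsub>Z\<^esub> f y h) ?C"
   by (rule tensor_lift_cong[symmetric, OF cC D V]) simp
  finally show "f (\<lambda>v\<in>carrier V. x (L v)) h = lift Z (%y k. x (L k) \<odot>\<^bsub>Z\<^esub> f y h) ?C" .
 qed
 also have "... = lift Z (%y k. lift Z (%x h. x (L k) \<odot>\<^bsub>Z\<^esub> f y h) ?C) ?C"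
  by (rule tensor_lift_swap[OF D V D V Z cC cC]; (assumption | rule c)+)
 also have "... = lift Z (%y k. f y (L k)) ?C"
  by (rule tensor_lift_cong[OF cC D V], rule canonical_vector[OF B Z];
   (assumption | rule c)+)
 finally show ?thesis .
qed

text \<open>Two copies of the canonical element multiply, in the convolution algebra dual to any
 coproduct \<open>\<Gamma>\<close>, to the coproduct of the vector leg.\<close>

lemma canonical_convolution:
 assumes B: "dual_bases K V D bs ds" and Z: "vs Z" and \<Gamma>: "lin V (tsp V V) \<Gamma>"
  and f1: "!!a b. [|a .: V; b .: V|] ==> lin (dual_space K V) Z (%x. f x a b)"
  and f2: "!!x. x .: (dual_space K V) ==> bil V V Z (f x)"
 shows "lift Z (%x h. lift Z (%x' h'.
   f (\<lambda>c\<in>carrier V. lift (scalars K) (%a b. x a \<otimes> x' b) (\<Gamma> c)) h h') (canonical V D bs ds)) (canonical V D bs ds) =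
  lift Z (%x h. lift Z (f x) (\<Gamma> h)) (canonical V D bs ds)"
proof -
 let ?C = "canonical V D bs ds" and ?Vd = "dual_space K V"
 have V: "vs V" by (rule dual_bases_expand(6)[OF B])
 note D = vs_dual[OF V] and cC = canonical_closed[OF B]
 note c = lin_id lin_tens_left lin_tens_right lin_lift_arg lin_lift_fun bilI lin_smult_left lin_smult_right
  lin_Kmult_left lin_Kmult_right smult_closed' tensor_lift_closed_K tensor_lift_closed V D Z cC lin_eval lin_compose[OF \<Gamma>] lin_closed[OF \<Gamma>]
  dual_eval_closed[of _ V] bil_closed[OF f2] lin_compose[OF bil1[OF f2]] lin_compose[OF bil2[OF f2]] lin_compose[OF f1]
  lin_dual_restrict dual_restrict_closed lin_dual_app[of _ V] vs_scalars m_closed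
 let ?m = "%x x'. \<lambda>c\<in>carrier V. lift (scalars K) (%a b. x a \<otimes> x' b) (\<Gamma> c)"
 have m: "?m x x' .: ?Vd" if "x .: ?Vd" "x' .: ?Vd" for x x'
  by (assumption | rule c that)+
 have m1: "lin ?Vd ?Vd (?m x)" if "x .: ?Vd" for x by (assumption | rule c that)+
 have m2: "lin ?Vd ?Vd (%x. ?m x x')" if "x' .: ?Vd" for x' by (assumption | rule c that)+
 \<comment> \<open>The convolution of the two functionals is expanded in a third copy of the
   canonical element; afterwards each of the original copies can be contracted against one leg of
   \<Gamma>(k).\<close>
 have "lift Z (%x h. lift Z (%x' h'. f (?m x x') h h') ?C) ?C =
  lift Z (%x h. lift Z (%x' h'. lift Z (%y k.
   lift Z (%a b. x a \<odot>\<^bsub>Z\<^esub> (x' b \<odot>\<^bsub>Z\<^esub> f y h h')) (\<Gamma> k)) ?C) ?C) ?C"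
 proof (rule tensor_lift_cong[OF cC D V],
   rule tensor_lift_cong[OF cC D V])
  fix x h x' h' assume xh: "x .: ?Vd" "h .: V" "x' .: ?Vd" "h' .: V"
  have "f (?m x x') h h' = lift Z (%y k. ?m x x' k \<odot>\<^bsub>Z\<^esub> f y h h') ?C"
   by (rule canonical_dual[symmetric, OF B Z f1[OF xh(2,4)] m[OF xh(1,3)]])
  also have "... = lift Z (%y k. lift Z (%a b. x a \<odot>\<^bsub>Z\<^esub> (x' b \<odot>\<^bsub>Z\<^esub> f y h h')) (\<Gamma> k)) ?C"
  proof (rule tensor_lift_cong[OF cC D V])
   fix y k assume yk: "y .: ?Vd" "k .: V"
   have fz: "f y h h' .: Z" by (rule bil_closed[OF f2[OF yk(1)] xh(2,4)])
   have "?m x x' k \<odot>\<^bsub>Z\<^esub> f y h h' = lift Z (%a b. (x a \<otimes> x' b) \<odot>\<^bsub>Z\<^esub> f y h h') (\<Gamma> k)"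
    unfolding restrict_apply'[OF yk(2)]
    by (rule lin_tensor_lift_comp[OF lin_smult_left[OF Z lin_id fz] V V vs_scalars Z])
     ((assumption | rule c xh yk)+)
   also have "... = lift Z (%a b. x a \<odot>\<^bsub>Z\<^esub> (x' b \<odot>\<^bsub>Z\<^esub> f y h h')) (\<Gamma> k)"
    by (rule tensor_lift_cong[OF lin_closed[OF \<Gamma> yk(2)] V V],
     simp add: module.smult_assoc1[OF vsD(2)[OF Z]] dual_eval_closed[OF xh(1)] dual_eval_closed[OF xh(3)] fz)
   finally show "?m x x' k \<odot>\<^bsub>Z\<^esub> f y h h' = lift Z (%a b. x a \<odot>\<^bsub>Z\<^esub> (x' b \<odot>\<^bsub>Z\<^esub> f y h h')) (\<Gamma> k)" .
  qed
  finally show "f (?m x x') h h' =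
   lift Z (%y k. lift Z (%a b. x a \<odot>\<^bsub>Z\<^esub> (x' b \<odot>\<^bsub>Z\<^esub> f y h h')) (\<Gamma> k)) ?C" .
 qed
 also have "... = lift Z (%x h. lift Z (%y k. lift Z (%x' h'.
   lift Z (%a b. x a \<odot>\<^bsub>Z\<^esub> (x' b \<odot>\<^bsub>Z\<^esub> f y h h')) (\<Gamma> k)) ?C) ?C) ?C"
  by (rule tensor_lift_cong[OF cC D V],
   rule tensor_lift_swap[OF D V D V Z cC cC]; (assumption | rule c)+)
 also have "... = lift Z (%y k. lift Z (%x h. lift Z (%x' h'.
   lift Z (%a b. x a \<odot>\<^bsub>Z\<^esub> (x' b \<odot>\<^bsub>Z\<^esub> f y h h')) (\<Gamma> k)) ?C) ?C) ?C"
  by (rule tensor_lift_swap[OF D V D V Z cC cC]; (assumption | rule c)+)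
 also have "... = lift Z (%y k. lift Z (f y) (\<Gamma> k)) ?C"
 proof (rule tensor_lift_cong[OF cC D V])
  fix y k assume yk: "y .: ?Vd" "k .: V"
  have G: "\<Gamma> k .: (tsp V V)" by (rule lin_closed[OF \<Gamma> yk(2)])
  have "lift Z (%x h. lift Z (%x' h'.
    lift Z (%a b. x a \<odot>\<^bsub>Z\<^esub> (x' b \<odot>\<^bsub>Z\<^esub> f y h h')) (\<Gamma> k)) ?C) ?C =
   lift Z (%x h. lift Z (%a b. lift Z (%x' h'.
    x a \<odot>\<^bsub>Z\<^esub> (x' b \<odot>\<^bsub>Z\<^esub> f y h h')) ?C) (\<Gamma> k)) ?C"
   by (rule tensor_lift_cong[OF cC D V],
    rule tensor_lift_swap[OF D V V V Z cC G]; (assumption | rule c yk)+)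
  also have "... = lift Z (%x h. lift Z (%a b. x a \<odot>\<^bsub>Z\<^esub> f y h b) (\<Gamma> k)) ?C"
  proof (rule tensor_lift_cong[OF cC D V], rule tensor_lift_cong[OF G V V])
   fix x h a b assume xh: "x .: ?Vd" "h .: V" "a .: V" "b .: V"
   have "lift Z (%x' h'. x a \<odot>\<^bsub>Z\<^esub> (x' b \<odot>\<^bsub>Z\<^esub> f y h h')) ?C =
     x a \<odot>\<^bsub>Z\<^esub> lift Z (%x' h'. x' b \<odot>\<^bsub>Z\<^esub> f y h h') ?C"
    by (rule lin_tensor_lift_comp[symmetric, OF lin_smult_right[OF Z lin_id] D V Z Z _ cC])
     ((assumption | rule c yk xh)+)
   also have "... = x a \<odot>\<^bsub>Z\<^esub> f y h b"
    by (subst canonical_vector[OF B Z]) ((assumption | rule c yk xh refl)+)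
   finally show "lift Z (%x' h'. x a \<odot>\<^bsub>Z\<^esub> (x' b \<odot>\<^bsub>Z\<^esub> f y h h')) ?C = x a \<odot>\<^bsub>Z\<^esub> f y h b" .
  qed
  also have "... = lift Z (%a b. lift Z (%x h. x a \<odot>\<^bsub>Z\<^esub> f y h b) ?C) (\<Gamma> k)"
   by (rule tensor_lift_swap[OF D V V V Z cC G]; (assumption | rule c yk)+)
  also have "... = lift Z (f y) (\<Gamma> k)"
   by (rule tensor_lift_cong[OF G V V], rule canonical_vector[OF B Z];
    (assumption | rule c yk)+)
  finally show "lift Z (%x h. lift Z (%x' h'.
    lift Z (%a b. x a \<odot>\<^bsub>Z\<^esub> (x' b \<odot>\<^bsub>Z\<^esub> f y h h')) (\<Gamma> k)) ?C) ?C = lift Z (f y) (\<Gamma> k)" .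
 qed
 finally show ?thesis .
qed

end

context hopf_base
begin

subsection \<open>Rebracketing iterated coproducts\<close>

abbreviation sw3 where "sw3 Z h f \<equiv> sw Z h (%x c. sw Z x (%a b. f a b c))"

lemma tri_bil:
 assumes "tri Z f" "a .: H"
 shows "bil H H Z (f a)" "bil H H Z (%x. f x a)" "bil H H Z (%x y. f x y a)"
 using assms by (auto intro!: bilI triD[OF assms(1)])

lemma sw3_bil:
 assumes Z: "vs Z" and f: "tri Z f"
 shows "bil H H Z (%x c. sw Z x (%a b. f a b c))"
 by (assumption | rule triD[OF f] Z hcalc)+

lemma sw3_cong:
 assumes h: "h .: H"
  and eq: "!!a b c. [|a .: H; b .: H; c .: H|] ==> f a b c = g a b c"
 shows "sw3 Z h f = sw3 Z h g"
 by (rule sw_cong[OF h], rule sw_cong, assumption, rule eq)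

lemma sw3_comp:
 assumes F: "lin Z Z' F" and Z: "vs Z" and Z': "vs Z'" and f: "tri Z f" and h: "h .: H"
 shows "F (sw3 Z h f) = sw3 Z' h (%a b c. F (f a b c))"
proof -
 have "F (sw3 Z h f) = sw3 Z' h (%a b c. F (f a b c))"
  by (rule sw_comp'[OF F Z Z' sw3_bil[OF Z f] h],
   rule sw_comp[OF F Z Z' tri_bil(3)[OF f]])
 then show ?thesis .
qed

lemma sw3_comp':
 assumes "lin Z Z' F" "vs Z" "vs Z'" "tri Z f" "h .: H"
  and "!!a b c. [|a .: H; b .: H; c .: H|] ==> F (f a b c) = g a b c"
 shows "F (sw3 Z h f) = sw3 Z' h g"
 unfolding sw3_comp[OF assms(1-5)] by (rule sw3_cong[OF assms(5,6)])

lemma sw3_mult: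
 assumes Z: "vs Z" and f: "tri Z f" and h: "h .: H" and l: "l .: H"
 shows "sw3 Z (h ** l) f = sw3 Z h (%a b c. sw3 Z l (%a' b' c'. f (a ** a') (b ** b') (c ** c')))"
proof -
 note t = lin_compose[OF triD(1)[OF f]] lin_compose[OF triD(2)[OF f]] lin_compose[OF triD(3)[OF f]] Z hcalc l
 have "sw3 Z (h ** l) f = sw Z h (%x c. sw Z l (%x' c'. sw Z (x ** x') (%a b. f a b (c ** c'))))"
  by (rule sw_mult[OF Z sw3_bil[OF Z f] h l])
 also have "... = sw Z h (%x c. sw Z l (%x' c'. sw Z x (%a b. sw Z x' (%a' b'. f (a ** a') (b ** b') (c ** c')))))"
  by (rule sw_cong[OF h], rule sw_cong[OF l],
   rule sw_mult[OF Z tri_bil(3)[OF f]]; (assumption | rule t)+)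
 also have "... = sw3 Z h (%a b c. sw3 Z l (%a' b' c'. f (a ** a') (b ** b') (c ** c')))"
  by (rule sw_cong[OF h], rule tensor_lift_swap[OF vsH vsH vsH vsH Z];
   (assumption | rule t)+)
 finally show ?thesis .
qed

lemma sw_swap:
 assumes "vs Z" "h .: H" "l .: H"
  and "!!a b. [|a .: H; b .: H|] ==> bil H H Z (f a b)"
  and "!!c d. [|c .: H; d .: H|] ==> bil H H Z (%a b. f a b c d)"
 shows "sw Z h (%a b. sw Z l (f a b)) = sw Z l (%c d. sw Z h (%a b. f a b c d))"
 by (rule tensor_lift_swap[OF vsH vsH vsH vsH assms(1) comult_closed[OF assms(2)] comult_closed[OF assms(3)] assms(4,5)])

text \<open>Brings the two middle ones of four legs under a common coproduct, so that they can be
  cancelled.\<close>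

lemma sw4_rebracket:
 assumes Z: "vs Z" and h: "h .: H"
  and f: "!!b c d. [|b .: H; c .: H; d .: H|] ==> lin H Z (%x. f x b c d)"
   "!!b c d. [|b .: H; c .: H; d .: H|] ==> lin H Z (%x. f b x c d)"
   "!!b c d. [|b .: H; c .: H; d .: H|] ==> lin H Z (%x. f b c x d)"
   "!!b c d. [|b .: H; c .: H; d .: H|] ==> lin H Z (%x. f b c d x)"
 shows "sw Z h (%h1 h2. sw Z h1 (%a b. sw Z h2 (%c d. f a b c d))) =
  sw Z h (%a q. sw Z q (%k d. sw Z k (%b c. f a b c d)))"
proof -
 note t = f Z hcalc
 have "sw Z h (%h1 h2. sw Z h1 (%a b. sw Z h2 (%c d. f a b c d))) =
   sw Z h (%a q. sw Z q (%b h2. sw Z h2 (%c d. f a b c d)))"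
  by (rule sw_assoc[OF Z triI h]; (assumption | rule t)+)
 also have "... = sw Z h (%a q. sw Z q (%k d. sw Z k (%b c. f a b c d)))"
  by (rule sw_cong[OF h], rule sw_assoc[symmetric, OF Z triI]; (assumption | rule t)+)
 finally show ?thesis .
qed

text \<open>Five legs, with either the two outer legs split in pairs or the middle leg split in
  three. The first shape arises when \<open>act\<close> is distributed over a convolution, the
  second from passing h across two functionals in turn.\<close>

lemma sw5_rebracket:
 assumes Z: "vs Z" and h: "h .: H"
  and f: "!!b c d e. [|b .: H; c .: H; d .: H; e .: H|] ==> lin H Z (%x. f x b c d e)"
   "!!b c d e. [|b .: H; c .: H; d .: H; e .: H|] ==> lin H Z (%x. f b x c d e)"
   "!!b c d e. [|b .: H; c .: H; d .: H; e .: H|] ==> lin H Z (%x. f b c x d e)"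
   "!!b c d e. [|b .: H; c .: H; d .: H; e .: H|] ==> lin H Z (%x. f b c d x e)"
   "!!b c d e. [|b .: H; c .: H; d .: H; e .: H|] ==> lin H Z (%x. f b c d e x)"
 shows "sw3 Z h (%u m w. sw Z u (%a b. sw Z w (%d e. f a b m d e))) =
  sw3 Z h (%a y e. sw3 Z y (%b m d. f a b m d e))"
proof -
 note t = f Z hcalc
 have "sw3 Z h (%u m w. sw Z u (%a b. sw Z w (%d e. f a b m d e))) =
   sw Z h (%x w. sw Z x (%a z. sw Z z (%b m. sw Z w (%d e. f a b m d e))))"
  by (rule sw_cong[OF h], rule sw_assoc[OF Z triI]; (assumption | rule t)+)
 also have "... = sw Z h (%a q. sw Z q (%z w. sw Z z (%b m. sw Z w (%d e. f a b m d e))))"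
  by (rule sw_assoc[OF Z triI h]; (assumption | rule t)+)
 also have "... = sw Z h (%a q. sw Z q (%z w. sw Z w (%d e. sw Z z (%b m. f a b m d e))))"
  by (rule sw_cong[OF h], rule sw_cong, assumption, rule sw_swap[OF Z]; (assumption | rule t)+)
 also have "... = sw Z h (%a q. sw Z q (%y e. sw Z y (%z d. sw Z z (%b m. f a b m d e))))"
  by (rule sw_cong[OF h], rule sw_assoc[symmetric, OF Z triI]; (assumption | rule t)+)
 also have "... = sw3 Z h (%a y e. sw3 Z y (%b m d. f a b m d e))"
  by (rule sw_assoc[symmetric, OF Z triI h]; (assumption | rule t)+)
 finally show ?thesis .
qed

text \<open>Six legs of \<open>h\<close>, of which the third and the fourth are neighbours, so that
  c S(a') collapses to the unit. This is the cancellation behind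
  \<open>comult_cross\<close>.\<close>

lemma sw6_cancel:
 assumes Z: "vs Z" and h: "h .: H"
  and f: "!!b c d e. [|b .: H; c .: H; d .: H; e .: H|] ==> lin H Z (%x. f x b c d e)"
   "!!b c d e. [|b .: H; c .: H; d .: H; e .: H|] ==> lin H Z (%x. f b x c d e)"
   "!!b c d e. [|b .: H; c .: H; d .: H; e .: H|] ==> lin H Z (%x. f b c x d e)"
   "!!b c d e. [|b .: H; c .: H; d .: H; e .: H|] ==> lin H Z (%x. f b c d x e)"
   "!!b c d e. [|b .: H; c .: H; d .: H; e .: H|] ==> lin H Z (%x. f b c d e x)"
 shows "sw Z h (%h1 h2. sw3 Z h1 (%a b c. sw3 Z h2 (%a' d e. f a b (c ** S a') d e))) =
  sw3 Z h (%a y e. sw Z y (%b d. f a b uH d e))"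
proof -
 have f3: "lin H Z (%x. f b c (g x) d e)" if "lin H H g" "b .: H" "c .: H" "d .: H" "e .: H"
  for g b c d e using lin_compose[OF f(3)] that by blast
 note t = f(1,2,4,5) f3 Z hcalc
 have "sw Z h (%h1 h2. sw3 Z h1 (%a b c. sw3 Z h2 (%a' d e. f a b (c ** S a') d e))) =
   sw Z h (%h1 h2. sw Z h1 (%x c. sw Z h2 (%x' e. sw Z x (%a b. sw Z x' (%a' d. f a b (c ** S a') d e)))))"
  by (rule sw_cong[OF h], rule sw_cong, assumption, rule sw_swap[OF Z]; (assumption | rule t)+)
 also have "... = sw Z h (%h1 h2. sw Z h1 (%x c. sw Z h2 (%x' e. sw Z x' (%a' d. sw Z x (%a b. f a b (c ** S a') d e)))))"
  by (rule sw_cong[OF h], rule sw_cong, assumption, rule sw_cong, assumption, rule sw_swap[OF Z]; (assumption | rule t)+)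
 also have "... = sw Z h (%h1 h2. sw Z h1 (%x c. sw Z h2 (%a' w. sw Z w (%d e. sw Z x (%a b. f a b (c ** S a') d e)))))"
  by (rule sw_cong[OF h], rule sw_cong, assumption, rule sw_assoc[OF Z triI]; (assumption | rule t)+)
 also have "... = sw Z h (%x q. sw Z q (%k w. sw Z k (%c a'. sw Z w (%d e. sw Z x (%a b. f a b (c ** S a') d e)))))"
  by (rule sw4_rebracket[OF Z h]; (assumption | rule t)+)
 also have "... = sw Z h (%x q. sw Z q (%d e. sw Z x (%a b. f a b uH d e)))"
  by (rule sw_cong[OF h],
   rule sw_cancel_left(2)[OF Z, of "%y w. sw Z w (%d e. sw Z x (%a b. f a b y d e))" for x]; (assumption | rule t)+)
 also have "... = sw Z h (%r e. sw Z r (%x d. sw Z x (%a b. f a b uH d e)))"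
  by (rule sw_assoc[symmetric, OF Z triI h]; (assumption | rule t)+)
 also have "... = sw3 Z h (%a y e. sw Z y (%b d. f a b uH d e))"
  by (rule sw_cong[OF h], rule sw_assoc[OF Z triI]; (assumption | rule t)+)
 finally show ?thesis .
qed

lemma sw3_one:
 assumes Z: "vs Z" and f: "tri Z f" shows "sw3 Z uH f = f uH uH uH"
 using sw_one[OF Z sw3_bil[OF Z f]] sw_one[OF Z tri_bil(3)[OF f oneH]] by simp

lemma counit_antipode: assumes h: "h .: H" shows "\<epsilon> (S h) = \<epsilon> h"
proof -
 have "\<epsilon> (S h) = sw (scalars K) h (%a b. \<epsilon> b \<odot>\<^bsub>scalars K\<^esub> \<epsilon> (S a))"
  by (rule sw_counit(2)[symmetric, OF vs_scalars _ h]) ((assumption | rule hcalc)+)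
 also have "... = sw (scalars K) h (%a b. \<epsilon> (S a ** b))"
  by (rule sw_cong[symmetric, OF h],
   simp add: counit_mult antipode_closed counit_closed m_comm)
 also have "... = \<epsilon> h" using sw_antipode(1)[OF vs_scalars lin_counit0 h] by (simp add: counit_one counit_closed h)
 finally show ?thesis .
qed

subsection \<open>The algebra structure of the Drinfeld double\<close>

abbreviation Hs where "Hs \<equiv> dual_space K H"
abbreviation DT where "DT \<equiv> tsp Hs H"
abbreviation pt where "pt \<equiv> tens K Hs H"
abbreviation Drin where "Drin \<equiv> drinfeld_double K H"
abbreviation Drin_mult (infixl "*D" 70) where "u *D v \<equiv> u \<otimes>\<^bsub>Drin\<^esub> v"

text \<open>The product in the opposite algebra of H^*, which is the one used in the double; hence
  \<zeta> is evaluated on the leading leg.\<close>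

definition conv :: "('h \<Rightarrow> 'k) \<Rightarrow> ('h \<Rightarrow> 'k) \<Rightarrow> 'h \<Rightarrow> 'k"
 where "conv \<xi> \<zeta> = (\<lambda>c\<in>carrier H. sw (scalars K) c (%a b. \<zeta> a \<otimes> \<xi> b))"

text \<open>This is c \<twoheadrightarrow> \<zeta> \<twoheadleftarrow> S(a), the functional that
  appears when h passes \<zeta>, with a and c the outer legs of h.\<close>

definition act :: "'h \<Rightarrow> ('h \<Rightarrow> 'k) \<Rightarrow> 'h \<Rightarrow> 'h \<Rightarrow> 'k"
 where "act a \<zeta> c = (\<lambda>y\<in>carrier H. \<zeta> (S a ** (y ** c)))"

definition eps :: "'h \<Rightarrow> 'k" where "eps = (\<lambda>y\<in>carrier H. \<epsilon> y)"

lemma vsHs: "vs Hs" by (rule vs_dual[OF vsH])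

lemma dual_app_closed: "[|\<xi> .: Hs; h .: H|] ==> \<xi> h .: K"
 by (rule dual_eval_closed)

lemma lin_dual_app': "[|\<xi> .: Hs; lin U H f|] ==> lin U (scalars K) (%x. \<xi> (f x))"
 by (rule lin_dual_app)

lemmas kcalc = hcalc lin_eval[of _ H] lin_Kmult_left lin_Kmult_right m_closed
 tensor_lift_closed_K vsHs

lemmas kcalc' = kcalc lin_dual_restrict[of _ H] dual_restrict_closed[of H] lin_dual_app' dual_app_closed

lemma conv_closed: "[|\<xi> .: Hs; \<zeta> .: Hs|] ==> conv \<xi> \<zeta> .: Hs"
 unfolding conv_def by (assumption | rule kcalc')+

lemma act_closed: "[|a .: H; \<zeta> .: Hs; c .: H|] ==> act a \<zeta> c .: Hs"
 unfolding act_def by (assumption | rule kcalc')+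

lemma eps_closed: "eps .: Hs"
 unfolding eps_def by (assumption | rule kcalc')+

lemma lin_conv1: "\<zeta> .: Hs ==> lin Hs Hs (%\<xi>. conv \<xi> \<zeta>)"
 and lin_conv2: "\<xi> .: Hs ==> lin Hs Hs (%\<zeta>. conv \<xi> \<zeta>)"
 unfolding conv_def by (assumption | rule kcalc')+

lemma lin_act1: "[|\<zeta> .: Hs; c .: H|] ==> lin H Hs (%a. act a \<zeta> c)"
 and lin_act2: "[|a .: H; c .: H|] ==> lin Hs Hs (%\<zeta>. act a \<zeta> c)"
 and lin_act3: "[|\<zeta> .: Hs; a .: H|] ==> lin H Hs (%c. act a \<zeta> c)"
 unfolding act_def by (assumption | rule kcalc')+

lemma lin_conv_comp:
 "[|lin U Hs f; \<zeta> .: Hs|] ==> lin U Hs (%x. conv (f x) \<zeta>)"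
 "[|lin U Hs f; \<xi> .: Hs|] ==> lin U Hs (%x. conv \<xi> (f x))"
 by (rule lin_compose[OF lin_conv1] lin_compose[OF lin_conv2]; assumption)+

lemma lin_act_comp:
 "[|lin U H f; \<zeta> .: Hs; c .: H|] ==> lin U Hs (%x. act (f x) \<zeta> c)"
 "[|lin U Hs g; a .: H; c .: H|] ==> lin U Hs (%x. act a (g x) c)"
 "[|lin U H f; \<zeta> .: Hs; a .: H|] ==> lin U Hs (%x. act a \<zeta> (f x))"
 by (rule lin_compose[OF lin_act1] lin_compose[OF lin_act2] lin_compose[OF lin_act3]; assumption)+

lemma conv_apply: "c .: H ==> conv \<xi> \<zeta> c = sw (scalars K) c (%a b. \<zeta> a \<otimes> \<xi> b)"
 and act_apply: "y .: H ==> act a \<zeta> c y = \<zeta> (S a ** (y ** c))"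
 and eps_apply: "y .: H ==> eps y = \<epsilon> y"
 by (simp_all add: conv_def act_def eps_def)

lemmas dcalc = kcalc conv_closed act_closed eps_closed lin_conv_comp lin_act_comp lin_dual_app' dual_app_closed

lemma conv_assoc:
 assumes x: "\<xi> .: Hs" "\<zeta> .: Hs" "\<chi> .: Hs"
 shows "conv (conv \<xi> \<zeta>) \<chi> = conv \<xi> (conv \<zeta> \<chi>)"
proof (rule dual_eqI)
 show "conv (conv \<xi> \<zeta>) \<chi> .: Hs" "conv \<xi> (conv \<zeta> \<chi>) .: Hs" by (assumption | rule dcalc x)+
 fix c assume c: "c .: H"
 note t = dcalc x lin_id
 have "conv (conv \<xi> \<zeta>) \<chi> c = sw (scalars K) c (%a b. sw (scalars K) b (%d e. \<chi> a \<otimes> (\<zeta> d \<otimes> \<xi> e)))"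
  unfolding conv_apply[OF c]
 proof (rule sw_cong[OF c])
  fix a b assume ab: "a .: H" "b .: H"
  show "\<chi> a \<otimes> conv \<xi> \<zeta> b = sw (scalars K) b (%d e. \<chi> a \<otimes> (\<zeta> d \<otimes> \<xi> e))"
   unfolding conv_apply[OF ab(2)]
   by (rule sw_comp[OF lin_Kmult_right[OF lin_id] vs_scalars vs_scalars _ ab(2)]) ((assumption | rule t ab)+)
 qed
 also have "... = sw (scalars K) c (%a b. sw (scalars K) a (%d e. \<chi> d \<otimes> (\<zeta> e \<otimes> \<xi> b)))"
  by (rule sw_assoc[symmetric, OF vs_scalars triI c]; (assumption | rule t)+)
 also have "... = conv \<xi> (conv \<zeta> \<chi>) c"
  unfolding conv_apply[OF c]
 proof (rule sw_cong[OF c])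
  fix a b assume ab: "a .: H" "b .: H"
  have "conv \<zeta> \<chi> a \<otimes> \<xi> b = sw (scalars K) a (%d e. \<chi> d \<otimes> (\<zeta> e \<otimes> \<xi> b))"
   unfolding conv_apply[OF ab(1)]
   by (rule sw_comp'[OF lin_Kmult_left[OF lin_id] vs_scalars vs_scalars _ ab(1)], (assumption | rule t ab)+,
    simp add: m_assoc dual_app_closed[OF x(1)] dual_app_closed[OF x(2)] dual_app_closed[OF x(3)] ab)
  then show "sw (scalars K) a (%d e. \<chi> d \<otimes> (\<zeta> e \<otimes> \<xi> b)) = conv \<zeta> \<chi> a \<otimes> \<xi> b" by simp
 qed
 finally show "conv (conv \<xi> \<zeta>) \<chi> c = conv \<xi> (conv \<zeta> \<chi>) c" .
qed

lemma conv_eps: assumes x: "\<xi> .: Hs" shows "conv eps \<xi> = \<xi>" "conv \<xi> eps = \<xi>"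
proof -
 have l: "lin H (scalars K) \<xi>" using x by (simp add: dual_space_simps(1))
 have "conv eps \<xi> c = \<xi> c" "conv \<xi> eps c = \<xi> c" if c: "c .: H" for c
 proof -
  have "conv eps \<xi> c = sw (scalars K) c (%a b. \<epsilon> b \<odot>\<^bsub>scalars K\<^esub> \<xi> a)" unfolding conv_apply[OF c]
   by (rule sw_cong[OF c],
    simp add: eps_apply m_comm counit_closed dual_app_closed[OF x])
  then show "conv eps \<xi> c = \<xi> c" using sw_counit(2)[OF vs_scalars l c] by simp
  have "conv \<xi> eps c = sw (scalars K) c (%a b. \<epsilon> a \<odot>\<^bsub>scalars K\<^esub> \<xi> b)" unfolding conv_apply[OF c]
   by (rule sw_cong[OF c], simp add: eps_apply)
  then show "conv \<xi> eps c = \<xi> c" using sw_counit(1)[OF vs_scalars l c] by simp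
 qed
 then show "conv eps \<xi> = \<xi>" "conv \<xi> eps = \<xi>"
  by (auto intro!: dual_eqI[of _ H] conv_closed eps_closed x)
qed

lemma act_act:
 assumes "a .: H" "c .: H" "a' .: H" "c' .: H" "\<zeta> .: Hs"
 shows "act a (act a' \<zeta> c') c = act (a ** a') \<zeta> (c ** c')"
proof -
 interpret A: assoc_algebra K H by (rule algH)
 show ?thesis
  by (rule dual_eqI[of _ H]) (use assms in \<open>simp_all add: act_closed act_apply antipode_mult antipode_closed A.m_assoc\<close>)
qed

lemma act_one: "\<zeta> .: Hs ==> act uH \<zeta> uH = \<zeta>"
proof -
 interpret A: assoc_algebra K H by (rule algH)
 show "\<zeta> .: Hs ==> act uH \<zeta> uH = \<zeta>"
  by (rule dual_eqI[of _ H]) (simp_all add: act_closed act_apply antipode_one)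
qed

text \<open>\<open>conv\<close> splits S(a) y c by the coproduct. Since \<Delta>(S(a)) = S(a_2)
  \<otimes> S(a_1), the legs of \<open>a\<close> are reversed while those of \<open>c\<close> are
  not, which explains the crossed indices.\<close>

lemma act_conv:
 assumes ac: "a .: H" "c .: H" and x: "\<xi> .: Hs" "\<zeta> .: Hs"
 shows "act a (conv \<xi> \<zeta>) c = sw Hs a (%a1 a2. sw Hs c (%c1 c2. conv (act a1 \<xi> c2) (act a2 \<zeta> c1)))"
proof (rule dual_eqI)
 note t = dcalc x ac lin_id
 show "act a (conv \<xi> \<zeta>) c .: Hs" by (assumption | rule t)+
 show "sw Hs a (%a1 a2. sw Hs c (%c1 c2. conv (act a1 \<xi> c2) (act a2 \<zeta> c1))) .: Hs"
  by (assumption | rule t)+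
 fix y assume y: "y .: H"
 let ?k = "scalars K"
 let ?f = "%a1 a2 y1 y2 c1 c2. \<zeta> (S a2 ** (y1 ** c1)) \<otimes> \<xi> (S a1 ** (y2 ** c2))"
 have b: "bil H H ?k (%u v. \<zeta> u \<otimes> \<xi> v)" by (assumption | rule t)+
 have "act a (conv \<xi> \<zeta>) c y = sw ?k (S a ** (y ** c)) (%u v. \<zeta> u \<otimes> \<xi> v)"
  by (simp add: act_apply y conv_apply mult_closed algH antipode_closed ac)
 also have "... = sw ?k (S a) (%a1 a2. sw ?k (y ** c) (%u v. \<zeta> (a1 ** u) \<otimes> \<xi> (a2 ** v)))"
  by (rule sw_mult[OF vs_scalars b]) ((assumption | rule t y)+)
 also have "... = sw ?k a (%a1 a2. sw ?k (y ** c) (%u v. \<zeta> (S a2 ** u) \<otimes> \<xi> (S a1 ** v)))"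
  by (rule sw_antipode_arg[OF vs_scalars _ ac(1)]) ((assumption | rule t y)+)
 also have "... = sw ?k a (%a1 a2. sw ?k y (%y1 y2. sw ?k c (%c1 c2. ?f a1 a2 y1 y2 c1 c2)))"
  by (rule sw_cong[OF ac(1)],
   rule sw_mult[OF vs_scalars _ y ac(2)]; (assumption | rule t)+)
 also have "... = sw ?k a (%a1 a2. sw ?k c (%c1 c2. sw ?k y (%y1 y2. ?f a1 a2 y1 y2 c1 c2)))"
  by (rule sw_cong[OF ac(1)],
   rule sw_swap[OF vs_scalars]; (assumption | rule t y)+)
 also have "... = sw ?k a (%a1 a2. (sw Hs c (%c1 c2. conv (act a1 \<xi> c2) (act a2 \<zeta> c1))) y)"
 proof (rule sw_cong[OF ac(1)])
  fix a1 a2 assume a: "a1 .: H" "a2 .: H"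
  have "(sw Hs c (%c1 c2. conv (act a1 \<xi> c2) (act a2 \<zeta> c1))) y = sw ?k c (%c1 c2. conv (act a1 \<xi> c2) (act a2 \<zeta> c1) y)"
   by (rule sw_comp[OF lin_eval[OF y] vsHs vs_scalars _ ac(2)]) ((assumption | rule t a)+)
  also have "... = sw ?k c (%c1 c2. sw ?k y (%y1 y2. ?f a1 a2 y1 y2 c1 c2))"
   unfolding conv_apply[OF y]
   by (rule sw_cong[symmetric, OF ac(2)],
    rule sw_cong[OF y], simp add: act_apply)
  finally show "sw ?k c (%c1 c2. sw ?k y (%y1 y2. ?f a1 a2 y1 y2 c1 c2)) =
   (sw Hs c (%c1 c2. conv (act a1 \<xi> c2) (act a2 \<zeta> c1))) y" by simp
 qed
 also have "... = (sw Hs a (%a1 a2. sw Hs c (%c1 c2. conv (act a1 \<xi> c2) (act a2 \<zeta> c1)))) y"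
  by (rule sw_comp[symmetric, OF lin_eval[OF y] vsHs vs_scalars _ ac(1)]) ((assumption | rule t)+)
 finally show "act a (conv \<xi> \<zeta>) c y =
  (sw Hs a (%a1 a2. sw Hs c (%c1 c2. conv (act a1 \<xi> c2) (act a2 \<zeta> c1)))) y" .
qed

text \<open>The product of the double is built from left multiplication by functionals and by \<open>H\<close>;
 its associativity reduces to the relations between these operators.\<close>

definition LX :: "('h \<Rightarrow> 'k) \<Rightarrow> ('k, 'h \<Rightarrow> 'k, 'h) tensor \<Rightarrow> ('k, 'h \<Rightarrow> 'k, 'h) tensor"
 where "LX \<xi> v = lift DT (%\<zeta> l. pt (conv \<xi> \<zeta>) l) v"

definition LH :: "'h \<Rightarrow> ('k, 'h \<Rightarrow> 'k, 'h) tensor \<Rightarrow> ('k, 'h \<Rightarrow> 'k, 'h) tensor"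
 where "LH h v = lift DT (%\<zeta> l. sw3 DT h (%a b c. pt (act a \<zeta> c) (b ** l))) v"

lemma vsDT: "vs DT" by (rule vs_tensor[OF vsHs vsH])

lemma LX_pt: "[|\<xi> .: Hs; \<zeta> .: Hs; l .: H|] ==> LX \<xi> (pt \<zeta> l) = pt (conv \<xi> \<zeta>) l"
 unfolding LX_def by (rule tensor_lift_tens[OF vsHs vsH vsDT]) ((assumption | rule dcalc)+)

lemma LH_pt: "[|h .: H; \<zeta> .: Hs; l .: H|]
  ==> LH h (pt \<zeta> l) = sw3 DT h (%a b c. pt (act a \<zeta> c) (b ** l))"
 unfolding LH_def by (rule tensor_lift_tens[OF vsHs vsH vsDT]) ((assumption | rule dcalc)+)

lemma lin_LX: "v .: DT ==> lin Hs DT (%\<xi>. LX \<xi> v)" "\<xi> .: Hs ==> lin DT DT (LX \<xi>)"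
 unfolding LX_def by (assumption | rule dcalc lin_tensor_lift)+

lemma lin_LH: "v .: DT ==> lin H DT (%h. LH h v)" "h .: H ==> lin DT DT (LH h)"
 unfolding LH_def by (assumption | rule dcalc lin_tensor_lift)+

lemma lin_L_comp:
 "[|lin U Hs f; v .: DT|] ==> lin U DT (%x. LX (f x) v)"
 "[|lin U DT g; \<xi> .: Hs|] ==> lin U DT (%x. LX \<xi> (g x))"
 "[|lin U H k; v .: DT|] ==> lin U DT (%x. LH (k x) v)"
 "[|lin U DT g; h .: H|] ==> lin U DT (%x. LH h (g x))"
 by (rule lin_compose[OF lin_LX(1)] lin_compose[OF lin_LX(2)] lin_compose[OF lin_LH(1)] lin_compose[OF lin_LH(2)];
   assumption)+

lemma L_closed: "[|\<xi> .: Hs; v .: DT|] ==> LX \<xi> v .: DT"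
 "[|h .: H; v .: DT|] ==> LH h v .: DT"
 by (rule lin_closed[OF lin_LX(2)] lin_closed[OF lin_LH(2)]; assumption)+

lemmas ecalc = dcalc vsDT lin_L_comp L_closed

lemma DT_ext:
 assumes "vs Z" "lin DT Z f" "lin DT Z g"
  and "!!\<xi> h. [|\<xi> .: Hs; h .: H|] ==> f (pt \<xi> h) = g (pt \<xi> h)" and "v .: DT"
 shows "f v = g v"
 by (rule tensor_ext[OF vsHs vsH assms(1-3) assms(4,5)])

lemma LX_LX:
 assumes "\<xi> .: Hs" "\<zeta> .: Hs" "v .: DT"
 shows "LX \<xi> (LX \<zeta> v) = LX (conv \<xi> \<zeta>) v"
 by (rule DT_ext[of DT "%v. LX \<xi> (LX \<zeta> v)", OF vsDT _ _ _ assms(3)]; ((assumption | rule ecalc assms)+)?)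
  (simp add: LX_pt conv_assoc conv_closed assms)

text \<open>The iterated coproduct of a product is the product of the iterated coproducts, and by
  \<open>act_act\<close> the outer legs compose in the matching order.\<close>

lemma LH_LH:
 assumes h: "h .: H" and l: "l .: H" and v: "v .: DT"
 shows "LH h (LH l v) = LH (h ** l) v"
proof (rule DT_ext[of DT "%v. LH h (LH l v)", OF vsDT _ _ _ v])
 interpret A: assoc_algebra K H by (rule algH)
 show "lin DT DT (%v. LH h (LH l v))" "lin DT DT (LH (h ** l))"
  by (assumption | rule ecalc h l lin_LH)+
 fix \<chi> m assume x: "\<chi> .: Hs" "m .: H"
 note t = ecalc h l x lin_id
 have "LH h (LH l (pt \<chi> m)) = sw3 DT l (%a' b' c'. LH h (pt (act a' \<chi> c') (b' ** m)))"
  unfolding LH_pt[OF l x]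
  by (rule sw3_comp[OF lin_LH(2)[OF h] vsDT vsDT triI l]; (assumption | rule t)+)
 also have "... = sw3 DT l (%a' b' c'. sw3 DT h (%a b c. pt (act (a ** a') \<chi> (c ** c')) ((b ** b') ** m)))"
 proof (rule sw3_cong[OF l])
  fix a' b' c' assume a: "a' .: H" "b' .: H" "c' .: H"
  have "LH h (pt (act a' \<chi> c') (b' ** m)) = sw3 DT h (%a b c. pt (act a (act a' \<chi> c') c) (b ** (b' ** m)))"
   by (rule LH_pt[OF h]) ((assumption | rule t a)+)
  also have "... = sw3 DT h (%a b c. pt (act (a ** a') \<chi> (c ** c')) ((b ** b') ** m))"
   by (rule sw3_cong[OF h]) (simp add: act_act x a A.m_assoc)
  finally show "LH h (pt (act a' \<chi> c') (b' ** m)) =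
   sw3 DT h (%a b c. pt (act (a ** a') \<chi> (c ** c')) ((b ** b') ** m))" .
 qed
 also have "... = sw DT l (%x' c'. sw3 DT h (%a b c. sw DT x' (%a' b'. pt (act (a ** a') \<chi> (c ** c')) ((b ** b') ** m))))"
  by (rule sw_cong[OF l],
   rule trans[OF sw_swap[OF vsDT]], (assumption | rule t)+,
   rule sw_cong[OF h], rule sw_swap[OF vsDT]; (assumption | rule t)+)
 also have "... = sw3 DT h (%a b c. sw3 DT l (%a' b' c'. pt (act (a ** a') \<chi> (c ** c')) ((b ** b') ** m)))"
  by (rule trans[OF sw_swap[OF vsDT]], (assumption | rule t)+,
   rule sw_cong[OF h], rule sw_swap[OF vsDT]; (assumption | rule t)+)
 also have "... = sw3 DT (h ** l) (%a b c. pt (act a \<chi> c) (b ** m))"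
  by (rule sw3_mult[symmetric, OF vsDT triI h l]; (assumption | rule t)+)
 also have "... = LH (h ** l) (pt \<chi> m)" by (rule LH_pt[symmetric]) ((assumption | rule t)+)
 finally show "LH h (LH l (pt \<chi> m)) = LH (h ** l) (pt \<chi> m)" .
qed

text \<open>The cross relation of the double in operator form. On pure tensors it reduces to
  \<open>act_conv\<close>, followed by the fivefold rebracketing
  \<open>sw5_rebracket\<close>.\<close>

lemma LH_LX:
 assumes h: "h .: H" and z: "\<zeta> .: Hs" and v: "v .: DT"
 shows "LH h (LX \<zeta> v) = sw3 DT h (%a b c. LX (act a \<zeta> c) (LH b v))"
proof (rule DT_ext[of DT "%v. LH h (LX \<zeta> v)", OF vsDT _ _ _ v])
 show "lin DT DT (%v. LH h (LX \<zeta> v))" "lin DT DT (%v. sw3 DT h (%a b c. LX (act a \<zeta> c) (LH b v)))"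
  by (assumption | rule ecalc h z)+
 fix \<chi> m assume x: "\<chi> .: Hs" "m .: H"
 note t = ecalc h z x lin_id
 let ?f = "%a b m' d e. pt (conv (act a \<zeta> e) (act b \<chi> d)) (m' ** m)"
 have "LH h (LX \<zeta> (pt \<chi> m)) = sw3 DT h (%a b c. pt (act a (conv \<zeta> \<chi>) c) (b ** m))"
  by (simp add: LX_pt z x, rule LH_pt) ((assumption | rule t)+)
 also have "... = sw3 DT h (%u b w. sw DT u (%a a'. sw DT w (%d e. ?f a a' b d e)))"
 proof (rule sw3_cong[OF h])
  fix a b c assume abc: "a .: H" "b .: H" "c .: H"
  have "pt (act a (conv \<zeta> \<chi>) c) (b ** m) = sw DT a (%a1 a2. sw DT c (%c1 c2. ?f a1 a2 b c1 c2))"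
   unfolding act_conv[OF abc(1,3) z x(1)]
   by (rule sw_comp'[OF lin_tens_left[OF lin_id] vsHs vsDT _ abc(1)], (assumption | rule t abc)+,
    rule sw_comp[OF lin_tens_left[OF lin_id] vsHs vsDT _ abc(3)]; (assumption | rule t abc)+)
  then show "pt (act a (conv \<zeta> \<chi>) c) (b ** m) = sw DT a (%a1 a2. sw DT c (%c1 c2. ?f a1 a2 b c1 c2))" .
 qed
 also have "... = sw3 DT h (%a y e. sw3 DT y (%b m' d. ?f a b m' d e))"
  by (rule sw5_rebracket[OF vsDT h]; (assumption | rule t)+)
 also have "... = sw3 DT h (%a b c. LX (act a \<zeta> c) (LH b (pt \<chi> m)))"
 proof (rule sw3_cong[OF h])
  fix a y e assume abc: "a .: H" "y .: H" "e .: H"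
  have "LX (act a \<zeta> e) (LH y (pt \<chi> m)) = sw3 DT y (%b m' d. LX (act a \<zeta> e) (pt (act b \<chi> d) (m' ** m)))"
   unfolding LH_pt[OF abc(2) x]
   by (rule sw3_comp[OF lin_LX(2) vsDT vsDT triI abc(2)]; (assumption | rule t abc)+)
  also have "... = sw3 DT y (%b m' d. ?f a b m' d e)"
   by (rule sw3_cong[symmetric, OF abc(2)])
    (simp add: LX_pt act_closed z x abc mult_closed algH)
  finally show "sw3 DT y (%b m' d. ?f a b m' d e) = LX (act a \<zeta> e) (LH y (pt \<chi> m))" by simp
 qed
 finally show "LH h (LX \<zeta> (pt \<chi> m)) = sw3 DT h (%a b c. LX (act a \<zeta> c) (LH b (pt \<chi> m)))" .
qed

lemma Drin_simps:
 "carrier Drin = carrier DT" "\<one>\<^bsub>Drin\<^esub> = pt eps uH" "same_space Drin DT"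
 by (simp_all add: drinfeld_double_def Let_def same_space_def dual_alg_simps eps_def)

lemma drin_cross_eq:
 assumes "h .: H" "\<xi> .: Hs"
 shows "drin_cross K H h \<xi> = sw3 DT h (%a b c. pt (act a \<xi> c) b)"
proof -
 have e: "pt (act a \<xi> c) b = pt (left_act H c (right_act H \<xi> (S a))) b"
  if "a .: H" "b .: H" "c .: H" for a b c
  using that by (auto simp: left_act_def right_act_def act_def mult_closed algH intro!: restrict_ext arg_cong2[of _ _ _ _ pt])
 show ?thesis
  unfolding drin_cross_def Let_def
  by (rule sym, rule sw3_cong[OF assms(1)]) (rule e)
qed

lemma Drin_mult:
 assumes u: "u .: DT" and v: "v .: DT"
 shows "u *D v = lift DT (%\<xi> h. LX \<xi> (LH h v)) u"
proof -
 have e: "u *D v = lift DT (%\<xi> h. lift DT (%\<zeta> l.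
   lift DT (%\<zeta>' h'. pt (conv \<xi> \<zeta>') (h' ** l)) (drin_cross K H h \<zeta>)) v) u"
  by (simp add: drinfeld_double_def Let_def dual_alg_simps conv_def)
 show ?thesis unfolding e
 proof (rule tensor_lift_cong[symmetric, OF u vsHs vsH])
  fix \<xi> h assume x: "\<xi> .: Hs" "h .: H"
  have b: "bil Hs H DT (%\<zeta> l. sw3 DT h (%a b c. pt (conv \<xi> (act a \<zeta> c)) (b ** l)))"
   by (assumption | rule ecalc x)+
  have "lift DT (%\<zeta> l. sw3 DT h (%a b c. pt (conv \<xi> (act a \<zeta> c)) (b ** l))) v = LX \<xi> (LH h v)"
  proof (rule tensor_lift_eq[OF vsHs vsH vsDT b _ _ v])
   show "lin DT DT (%v. LX \<xi> (LH h v))" by (assumption | rule ecalc x)+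
   fix \<zeta> l assume z: "\<zeta> .: Hs" "l .: H"
   have "LX \<xi> (LH h (pt \<zeta> l)) = sw3 DT h (%a b c. LX \<xi> (pt (act a \<zeta> c) (b ** l)))"
    unfolding LH_pt[OF x(2) z]
    by (rule sw3_comp[OF lin_LX(2) vsDT vsDT triI x(2)]; (assumption | rule ecalc x z)+)
   also have "... = sw3 DT h (%a b c. pt (conv \<xi> (act a \<zeta> c)) (b ** l))"
    by (rule sw3_cong[symmetric, OF x(2)])
     (simp add: LX_pt act_closed x z mult_closed algH)
   finally show "sw3 DT h (%a b c. pt (conv \<xi> (act a \<zeta> c)) (b ** l)) = LX \<xi> (LH h (pt \<zeta> l))" by simp
  qed
  moreover have "lift DT (%\<zeta> l. sw3 DT h (%a b c. pt (conv \<xi> (act a \<zeta> c)) (b ** l))) v =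
   lift DT (%\<zeta> l. lift DT (%\<zeta>' h'. pt (conv \<xi> \<zeta>') (h' ** l)) (drin_cross K H h \<zeta>)) v"
  proof (rule tensor_lift_cong[OF v vsHs vsH])
   fix \<zeta> l assume z: "\<zeta> .: Hs" "l .: H"
   have b2: "bil Hs H DT (%\<zeta>' h'. pt (conv \<xi> \<zeta>') (h' ** l))" by (assumption | rule ecalc x z)+
   have "lift DT (%\<zeta>' h'. pt (conv \<xi> \<zeta>') (h' ** l)) (drin_cross K H h \<zeta>) =
     sw3 DT h (%a b c. lift DT (%\<zeta>' h'. pt (conv \<xi> \<zeta>') (h' ** l)) (pt (act a \<zeta> c) b))"
    unfolding drin_cross_eq[OF x(2) z(1)]
    by (rule sw3_comp[OF lin_tensor_lift[OF vsHs vsH vsDT b2] vsDT vsDT triI x(2)]; (assumption | rule ecalc x z)+)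
   also have "... = sw3 DT h (%a b c. pt (conv \<xi> (act a \<zeta> c)) (b ** l))"
    by (rule sw3_cong[symmetric, OF x(2)])
     (simp add: tensor_lift_tens[OF vsHs vsH vsDT b2] act_closed z)
   finally show "sw3 DT h (%a b c. pt (conv \<xi> (act a \<zeta> c)) (b ** l)) =
    lift DT (%\<zeta>' h'. pt (conv \<xi> \<zeta>') (h' ** l)) (drin_cross K H h \<zeta>)" by simp
  qed
  ultimately show "LX \<xi> (LH h v) = lift DT (%\<zeta> l.
   lift DT (%\<zeta>' h'. pt (conv \<xi> \<zeta>') (h' ** l)) (drin_cross K H h \<zeta>)) v" by simp
 qed
qed

lemma pt_mult: "[|\<xi> .: Hs; h .: H; v .: DT|] ==> pt \<xi> h *D v = LX \<xi> (LH h v)"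
 by (subst Drin_mult, (assumption | rule ecalc)+, rule tensor_lift_tens[OF vsHs vsH vsDT]; (assumption | rule ecalc)+)

text \<open>The counit is multiplicative and invariant under S, so \<open>act a eps c\<close> is
  \<open>eps\<close> scaled by \<epsilon>(a) and \<epsilon>(c), and the two outer legs of
  \<open>h\<close> are absorbed by the counit axiom.\<close>

lemma LH_eps:
 assumes h: "h .: H" and l: "l .: H" shows "LH h (pt eps l) = pt eps (h ** l)"
proof -
 interpret A: assoc_algebra K H by (rule algH)
 note t = ecalc h l lin_id
 have ae: "act a eps c = (\<epsilon> a \<otimes> \<epsilon> c) \<odot>\<^bsub>Hs\<^esub> eps" if ac: "a .: H" "c .: H" for a c
  using ac by (auto simp: act_def eps_def dual_space_simps(3) counit_mult counit_antipode antipode_closed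
    counit_closed m_ac intro!: restrict_ext)
 have pe: "pt (act a eps c) (b ** l) = \<epsilon> a \<odot>\<^bsub>DT\<^esub> (\<epsilon> c \<odot>\<^bsub>DT\<^esub> pt eps (b ** l))"
  if "a .: H" "b .: H" "c .: H" for a b c
  using that lin_smult[OF bil2[OF bil_tens[OF vsHs vsH]], of "b ** l" "\<epsilon> a \<otimes> \<epsilon> c" eps]
  by (simp add: ae eps_closed counit_closed mult_closed algH l module.smult_assoc1[OF vsD(2)[OF vsDT]]
   tens_closed vsHs vsH)
 have "LH h (pt eps l) = sw3 DT h (%a b c. \<epsilon> a \<odot>\<^bsub>DT\<^esub> (\<epsilon> c \<odot>\<^bsub>DT\<^esub> pt eps (b ** l)))"
  unfolding LH_pt[OF h eps_closed l]
  by (rule sw3_cong[OF h]) (rule pe)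
 also have "... = sw DT h (%x c. \<epsilon> c \<odot>\<^bsub>DT\<^esub> pt eps (x ** l))"
  by (rule sw_cong[OF h], rule sw_counit(1)[OF vsDT]; (assumption | rule t)+)
 also have "... = pt eps (h ** l)"
  by (rule sw_counit(2)[OF vsDT _ h]) ((assumption | rule t)+)
 finally show ?thesis .
qed

text \<open>Left multiplication by \<open>pt \<xi> h\<close> is \<open>LX \<xi>\<close> after
  \<open>LH h\<close>. Associativity therefore amounts to both operators commuting with right
  multiplication by \<open>w\<close>: for \<open>LX\<close> this is \<open>LX_LX\<close>, for
  \<open>LH\<close> it is \<open>LH_LX\<close> together with \<open>LH_LH\<close>.\<close>

lemma algD: "alg Drin"
proof (rule assoc_algebraI)
 interpret A: assoc_algebra K H by (rule algH)
 note same = same_space_eqs[OF Drin_simps(3)] same_space_bil[OF Drin_simps(3)]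
 show "vs Drin" using same_space_vs[OF Drin_simps(3)] vsDT by simp
 have cl: "u *D v .: DT" if "u .: DT" "v .: DT" for u v
  unfolding Drin_mult[OF that] by (assumption | rule ecalc that)+
 have b: "bil DT DT DT (%x y. x *D y)"
 proof (rule bilI)
  fix u assume u: "u .: DT"
  show "lin DT DT (%v. u *D v)"
   by (subst lin_cong[OF Drin_mult[OF u] vsDT], assumption) ((assumption | rule ecalc u)+)
  show "lin DT DT (%v. v *D u)"
   by (subst lin_cong[OF Drin_mult[OF _ u] vsDT], assumption) ((assumption | rule ecalc u)+)
 qed
 then show "bil Drin Drin Drin (%x y. x *D y)" by (simp add: same)
 show "\<one>\<^bsub>Drin\<^esub> .: Drin" by (simp add: Drin_simps tens_closed vsHs vsH eps_closed oneH)
 have assoc: "(u *D v) *D w = u *D (v *D w)"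
  if u: "u .: DT" and v: "v .: DT" and w: "w .: DT" for u v w
 proof -
  note bc = lin_compose[OF bil1[OF b]] lin_compose[OF bil2[OF b]] cl lin_id
  have X: "LX \<xi> x *D w = LX \<xi> (x *D w)" if z: "\<xi> .: Hs" and x: "x .: DT" for \<xi> x
  proof (rule DT_ext[of DT "%x. LX \<xi> x *D w", OF vsDT _ _ _ x])
   show "lin DT DT (%x. LX \<xi> x *D w)" "lin DT DT (%x. LX \<xi> (x *D w))"
    by (assumption | rule bc ecalc z w)+
   show "LX \<xi> (pt \<zeta> h) *D w = LX \<xi> (pt \<zeta> h *D w)" if "\<zeta> .: Hs" "h .: H" for \<zeta> h
    using that by (simp add: LX_pt z pt_mult w conv_closed LX_LX L_closed)
  qed
  have Y: "LH h x *D w = LH h (x *D w)" if h: "h .: H" and x: "x .: DT" for h x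
  proof (rule DT_ext[of DT "%x. LH h x *D w", OF vsDT _ _ _ x])
   show "lin DT DT (%x. LH h x *D w)" "lin DT DT (%x. LH h (x *D w))"
    by (assumption | rule bc ecalc h w)+
   fix \<zeta> l assume z: "\<zeta> .: Hs" "l .: H"
   note t = ecalc bc h w z
   have "LH h (pt \<zeta> l) *D w = sw3 DT h (%a b c. LX (act a \<zeta> c) (LH b (LH l w)))"
    unfolding LH_pt[OF h z]
    by (rule sw3_comp'[OF bil2[OF b w] vsDT vsDT triI h], (assumption | rule t)+)
     (simp add: pt_mult act_closed z w mult_closed algH LH_LH)
   also have "... = LH h (LX \<zeta> (LH l w))"
    by (rule LH_LX[symmetric]) ((assumption | rule t)+)
   also have "... = LH h (pt \<zeta> l *D w)" by (simp add: pt_mult z w)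
   finally show "LH h (pt \<zeta> l) *D w = LH h (pt \<zeta> l *D w)" .
  qed
  show ?thesis
  proof (rule DT_ext[of DT "%u. (u *D v) *D w", OF vsDT _ _ _ u])
   show "lin DT DT (%u. u *D v *D w)" "lin DT DT (%u. u *D (v *D w))"
    by (assumption | rule bc v w)+
  qed (simp add: pt_mult v w cl X Y L_closed)
 qed
 then show "(u *D v) *D w = u *D (v *D w)"
  if "u .: Drin" "v .: Drin" "w .: Drin" for u v w
  using that by (simp add: Drin_simps(1))
 have o: "pt eps uH .: DT" by (simp add: tens_closed vsHs vsH eps_closed oneH)
 show "\<one>\<^bsub>Drin\<^esub> *D u = u" if "u .: Drin" for u
 proof (rule DT_ext[of DT "%u. \<one>\<^bsub>Drin\<^esub> *D u" "%u. u", OF vsDT _ lin_id])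
  show "lin DT DT ((\<otimes>\<^bsub>Drin\<^esub>) \<one>\<^bsub>Drin\<^esub>)" unfolding Drin_simps(2) by (rule bil1[OF b o])
  fix \<zeta> l assume z: "\<zeta> .: Hs" "l .: H"
  have "LH uH (pt \<zeta> l) = pt (act uH \<zeta> uH) (uH ** l)"
   unfolding LH_pt[OF oneH z] by (rule sw3_one[OF vsDT triI]; (assumption | rule ecalc z)+)
  then show "\<one>\<^bsub>Drin\<^esub> *D pt \<zeta> l = pt \<zeta> l"
   by (simp add: Drin_simps(2) pt_mult eps_closed oneH tens_closed vsHs vsH z act_one LX_pt conv_eps)
 qed (use that in \<open>simp add: Drin_simps(1)\<close>)
 show "u *D \<one>\<^bsub>Drin\<^esub> = u" if "u .: Drin" for u
 proof (rule DT_ext[of DT "%u. u *D \<one>\<^bsub>Drin\<^esub>" "%u. u", OF vsDT _ lin_id])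
  show "lin DT DT (%u. u *D \<one>\<^bsub>Drin\<^esub>)" unfolding Drin_simps(2) by (rule bil2[OF b o])
  show "pt \<zeta> l *D \<one>\<^bsub>Drin\<^esub> = pt \<zeta> l" if "\<zeta> .: Hs" "l .: H" for \<zeta> l
   using that by (simp add: Drin_simps(2) pt_mult o LH_eps oneH LX_pt eps_closed conv_eps)
 qed (use that in \<open>simp add: Drin_simps(1)\<close>)
qed

lemma LH_one:
 assumes "\<zeta> .: Hs" "l .: H" shows "LH uH (pt \<zeta> l) = pt \<zeta> l"
proof -
 interpret A: assoc_algebra K H by (rule algH)
 have "LH uH (pt \<zeta> l) = pt (act uH \<zeta> uH) (uH ** l)"
  unfolding LH_pt[OF oneH assms] by (rule sw3_one[OF vsDT triI]; (assumption | rule ecalc assms)+)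
 then show ?thesis using assms by (simp add: act_one)
qed

lemma pt_mult_dual: "[|\<xi> .: Hs; \<zeta> .: Hs; l .: H|] ==> pt \<xi> uH *D pt \<zeta> l = pt (conv \<xi> \<zeta>) l"
 by (simp add: pt_mult oneH tens_closed vsHs vsH LH_one LX_pt)

lemma pt_mult_eps: "[|h .: H; \<zeta> .: Hs; l .: H|] ==> pt \<zeta> l *D pt eps h = pt \<zeta> (l ** h)"
 by (simp add: pt_mult tens_closed vsHs vsH LH_eps LX_pt eps_closed mult_closed algH conv_eps)

lemma pt_eps_mult:
 assumes "h .: H" "\<xi> .: Hs"
 shows "pt eps h *D pt \<xi> uH = sw3 DT h (%a b c. pt (act a \<xi> c) b)"
proof -
 interpret A: assoc_algebra K H by (rule algH)
 have v: "sw3 DT h (%a b c. pt (act a \<xi> c) b) .: DT" by (assumption | rule ecalc assms)+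
 have "LX eps v = v" if "v .: DT" for v
  by (rule DT_ext[of DT "LX eps" "%v. v", OF vsDT lin_LX(2)[OF eps_closed] lin_id _ that])
   (simp add: LX_pt eps_closed conv_eps)
 moreover have "LH h (pt \<xi> uH) = sw3 DT h (%a b c. pt (act a \<xi> c) b)"
  unfolding LH_pt[OF assms(1,2) oneH]
  by (rule sw3_cong[OF assms(1)]) simp
 ultimately show ?thesis
  using assms v by (simp add: pt_mult eps_closed tens_closed vsHs vsH oneH)
qed

lemmas Drin_same = same_space_eqs[OF Drin_simps(3)] same_space_bil[OF Drin_simps(3)]
 same_space_map[OF Drin_simps(3)]

lemma Dmult:
 "[|u .: DT; v .: DT|] ==> u *D v .: DT"
 "[|lin U DT f; v .: DT|] ==> lin U DT (%x. f x *D v)"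
 "[|lin U DT f; v .: DT|] ==> lin U DT (%x. v *D f x)"
 using mult_closed[OF algD] lin_mult_left[OF _ algD] lin_mult_right[OF _ algD]
 by (simp_all add: Drin_simps(1) Drin_same)

text \<open>The two-sided translate \<open>v \<mapsto> \<xi>(wvc)\<close>, of which both coregular actions are special cases.\<close>

definition bi :: "'h \<Rightarrow> ('h \<Rightarrow> 'k) \<Rightarrow> 'h \<Rightarrow> 'h \<Rightarrow> 'k"
 where "bi w \<xi> c = (\<lambda>v\<in>carrier H. \<xi> (w ** (v ** c)))"

lemma bi_closed: "[|w .: H; \<xi> .: Hs; c .: H|] ==> bi w \<xi> c .: Hs"
 unfolding bi_def by (assumption | rule kcalc')+

lemma lin_bi:
 "[|\<xi> .: Hs; c .: H|] ==> lin H Hs (%w. bi w \<xi> c)"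
 "[|w .: H; c .: H|] ==> lin Hs Hs (%\<xi>. bi w \<xi> c)"
 "[|w .: H; \<xi> .: Hs|] ==> lin H Hs (%c. bi w \<xi> c)"
 unfolding bi_def by (assumption | rule kcalc')+

lemma lin_bi_comp:
 "[|lin U H f; \<xi> .: Hs; c .: H|] ==> lin U Hs (%x. bi (f x) \<xi> c)"
 "[|lin U Hs g; w .: H; c .: H|] ==> lin U Hs (%x. bi w (g x) c)"
 "[|lin U H f; w .: H; \<xi> .: Hs|] ==> lin U Hs (%x. bi w \<xi> (f x))"
 by (rule lin_compose[OF lin_bi(1)] lin_compose[OF lin_bi(2)] lin_compose[OF lin_bi(3)]; assumption)+

lemma bi_apply: "v .: H ==> bi w \<xi> c v = \<xi> (w ** (v ** c))"
 by (simp add: bi_def)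

lemma bi_bi:
 assumes "w .: H" "c .: H" "w' .: H" "c' .: H" "\<xi> .: Hs"
 shows "bi w (bi w' \<xi> c') c = bi (w' ** w) \<xi> (c ** c')"
proof -
 interpret A: assoc_algebra K H by (rule algH)
 show ?thesis
  by (rule dual_eqI[of _ H]) (use assms in \<open>simp_all add: bi_closed bi_apply A.m_assoc\<close>)
qed

lemma bi_one: "\<xi> .: Hs ==> bi uH \<xi> uH = \<xi>"
proof -
 interpret A: assoc_algebra K H by (rule algH)
 show "\<xi> .: Hs ==> bi uH \<xi> uH = \<xi>" by (rule dual_eqI[of _ H]) (simp_all add: bi_closed bi_apply)
qed

lemma act_bi: "act a \<xi> c = bi (S a) \<xi> c"
 by (simp add: act_def bi_def)

lemma bi_conv:
 assumes c: "c .: H" and x: "\<xi> .: Hs" "\<zeta> .: Hs"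
 shows "bi c (conv \<xi> \<zeta>) uH = sw Hs c (%a b. conv (bi b \<xi> uH) (bi a \<zeta> uH))"
proof (rule dual_eqI)
 interpret A: assoc_algebra K H by (rule algH)
 note t = dcalc x c lin_id bi_closed lin_bi_comp
 show "bi c (conv \<xi> \<zeta>) uH .: Hs" by (assumption | rule t)+
 show "sw Hs c (%a b. conv (bi b \<xi> uH) (bi a \<zeta> uH)) .: Hs" by (assumption | rule t)+
 fix y assume y: "y .: H"
 let ?k = "scalars K"
 have b: "bil H H ?k (%u v. \<zeta> u \<otimes> \<xi> v)" by (assumption | rule t)+
 have "bi c (conv \<xi> \<zeta>) uH y = sw ?k (c ** y) (%u v. \<zeta> u \<otimes> \<xi> v)"
  by (simp add: bi_apply y conv_apply c)
 also have "... = sw ?k c (%a b. sw ?k y (%u v. \<zeta> (a ** u) \<otimes> \<xi> (b ** v)))" by (rule sw_mult[OF vs_scalars b c y])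
 also have "... = sw ?k c (%a b. conv (bi b \<xi> uH) (bi a \<zeta> uH) y)"
  unfolding conv_apply[OF y]
  by (rule sw_cong[OF c], rule sw_cong[OF y], simp add: bi_apply)
 also have "... = (sw Hs c (%a b. conv (bi b \<xi> uH) (bi a \<zeta> uH))) y"
  by (rule sw_comp[symmetric, OF lin_eval[OF y] vsHs vs_scalars _ c]) ((assumption | rule t)+)
 finally show "bi c (conv \<xi> \<zeta>) uH y = (sw Hs c (%a b. conv (bi b \<xi> uH) (bi a \<zeta> uH))) y" .
qed

end

section \<open>Sums over a dual basis and the coproduct of the dual space\<close>

locale dual_base = hopf_base K H for K :: "('k, 'r) ring_scheme" (structure) and H :: "('k, 'h, 'm) hopf_scheme" +
 fixes D :: "'d set" and bs :: "'d \<Rightarrow> 'h" and ds :: "'d \<Rightarrow> 'h \<Rightarrow> 'k"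
 assumes db: "dual_bases K H D bs ds"
begin

abbreviation C where "C \<equiv> canonical H D bs ds"
abbreviation Cs where "Cs Z f \<equiv> lift Z f C"
abbreviation TT where "TT \<equiv> tsp DT DT"
abbreviation tt where "tt \<equiv> tens K DT DT"
abbreviation DD where "DD \<equiv> tensor_alg K Drin Drin"
abbreviation DD_mult (infixl "*E" 70) where "u *E v \<equiv> u \<otimes>\<^bsub>DD\<^esub> v"

lemma C_closed: "C .: DT" by (rule canonical_closed[OF db])

lemma vsTT: "vs TT" by (rule vs_tensor[OF vsDT vsDT])

lemma Cs_cong:
 assumes "!!a b. [|a .: Hs; b .: H|] ==> f a b = g a b"
 shows "Cs Z f = Cs Z g"
 by (rule tensor_lift_cong[OF C_closed vsHs vsH assms])

lemma Cs_comp: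
 assumes "lin Z Z' F" "vs Z" "vs Z'" "bil Hs H Z f"
 shows "F (Cs Z f) = Cs Z' (%a b. F (f a b))"
 by (rule lin_tensor_lift_comp[OF assms(1) vsHs vsH assms(2-4) C_closed])

lemma Cs_comp':
 assumes "lin Z Z' F" "vs Z" "vs Z'" "bil Hs H Z f"
  and "!!a b. [|a .: Hs; b .: H|] ==> F (f a b) = g a b"
 shows "F (Cs Z f) = Cs Z' g"
 unfolding Cs_comp[OF assms(1-4)] by (rule Cs_cong[OF assms(5)])

lemma scalars_closedI: "x .: K ==> x .: (scalars K)" by simp

lemmas fcalc = ecalc Dmult C_closed vsTT bi_closed lin_bi_comp scalars_closedI

text \<open>\<open>dual_comult\<close> is a definite description. The witness pairs each dual basis
  functional with the translate v \<mapsto> \<xi>(gv) of \<xi>; contracting the canonical element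
  shows that it satisfies the defining property.\<close>

lemma lift_dual_comult_aux:
 assumes "\<xi> .: Hs"
 shows "dual_comult K H \<xi> = Cs (tsp Hs Hs) (%x g. tens K Hs Hs x (bi g \<xi> uH))"
proof -
 interpret A: assoc_algebra K H by (rule algH)
 let ?HH = "tsp Hs Hs" and ?t = "Cs (tsp Hs Hs) (%x g. tens K Hs Hs x (bi g \<xi> uH))"
 note vHH = vs_tensor[OF vsHs vsHs]
 let ?e = "%h l. lift (scalars K) (%\<xi>' \<xi>''. \<xi>' h \<otimes> \<xi>'' l)"
 have be: "bil Hs Hs (scalars K) (%\<xi>' \<xi>''. \<xi>' h \<otimes> \<xi>'' l)" if "h .: H" "l .: H" for h l
  by (assumption | rule fcalc that)+
 have t: "?t .: ?HH" by (assumption | rule fcalc assms)+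
 have te: "?e h l ?t = \<xi> (h ** l)" if hl: "h .: H" "l .: H" for h l
 proof -
  have "?e h l ?t = Cs (scalars K) (%x g. ?e h l (tens K Hs Hs x (bi g \<xi> uH)))"
   by (rule Cs_comp[OF lin_tensor_lift[OF vsHs vsHs vs_scalars be[OF hl]] vHH vs_scalars])
    ((assumption | rule fcalc assms)+)
  also have "... = Cs (scalars K) (%x g. x h \<odot>\<^bsub>scalars K\<^esub> \<xi> (g ** l))"
   by (rule Cs_cong[symmetric],
    simp add: tensor_lift_tens[OF vsHs vsHs vs_scalars be[OF hl]] bi_closed oneH assms bi_apply hl)
  also have "... = \<xi> (h ** l)"
   by (rule canonical_vector[OF db vs_scalars _ hl(1)]) ((assumption | rule fcalc assms hl)+)
  finally show ?thesis .
 qed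
 \<comment> \<open>Uniqueness: an element of the tensor square of the dual space is recovered from
   its values on pairs of vectors, by contracting two copies of the canonical element.\<close>
 have expand: "u = Cs ?HH (%x g. Cs ?HH (%x' g'. ?e g g' u \<odot>\<^bsub>?HH\<^esub> tens K Hs Hs x x'))" if u: "u .: ?HH" for u
 proof (rule tensor_ext[OF vsHs vsHs vHH lin_id _ _ u])
  have le: "lin ?HH (scalars K) (?e h l)" if "h .: H" "l .: H" for h l
   by (rule lin_tensor_lift[OF vsHs vsHs vs_scalars be[OF that]])
  have ec: "?e h l u .: K" if "h .: H" "l .: H" "u .: ?HH" for h l u
   using lin_closed[OF le[OF that(1,2)] that(3)] by simp
  have l1: "lin H (scalars K) (%h. ?e h l u)" if "l .: H" "u .: ?HH" for l u
   by ((assumption | rule lin_lift_fun[OF that(2) vsHs vsHs] fcalc that)+)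
  have l2: "lin H (scalars K) (%l. ?e h l u)" if "h .: H" "u .: ?HH" for h u
   by ((assumption | rule lin_lift_fun[OF that(2) vsHs vsHs] fcalc that)+)
  show "lin ?HH ?HH (%u. Cs ?HH (%x g. Cs ?HH (%x' g'. ?e g g' u \<odot>\<^bsub>?HH\<^esub> tens K Hs Hs x x')))"
   by (assumption | rule le ec l1 l2 fcalc)+
  fix v w assume vw: "v .: Hs" "w .: Hs"
  have "Cs ?HH (%x g. Cs ?HH (%x' g'. ?e g g' (tens K Hs Hs v w) \<odot>\<^bsub>?HH\<^esub> tens K Hs Hs x x')) =
    Cs ?HH (%x g. v g \<odot>\<^bsub>?HH\<^esub> tens K Hs Hs x w)"
  proof (rule Cs_cong)
   fix x g assume xg: "x .: Hs" "g .: H"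
   have "Cs ?HH (%x' g'. ?e g g' (tens K Hs Hs v w) \<odot>\<^bsub>?HH\<^esub> tens K Hs Hs x x') =
    Cs ?HH (%x' g'. w g' \<odot>\<^bsub>?HH\<^esub> (v g \<odot>\<^bsub>?HH\<^esub> tens K Hs Hs x x'))"
    by (rule Cs_cong[symmetric],
     simp add: tensor_lift_tens[OF vsHs vsHs vs_scalars be] xg vw m_comm
      module.smult_assoc1[OF vsD(2)[OF vHH], symmetric] tens_closed vsHs dual_app_closed[OF vw(1)] dual_app_closed[OF vw(2)])
   also have "... = v g \<odot>\<^bsub>?HH\<^esub> tens K Hs Hs x w"
    by (rule canonical_dual[OF db vHH _ vw(2)]) ((assumption | rule fcalc vw xg)+)
   finally show "Cs ?HH (%x' g'. ?e g g' (tens K Hs Hs v w) \<odot>\<^bsub>?HH\<^esub> tens K Hs Hs x x') = v g \<odot>\<^bsub>?HH\<^esub> tens K Hs Hs x w" .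
  qed
  also have "... = tens K Hs Hs v w"
   by (rule canonical_dual[OF db vHH _ vw(1)]) ((assumption | rule fcalc vw)+)
  finally show "tens K Hs Hs v w =
   Cs ?HH (%x g. Cs ?HH (%x' g'. ?e g g' (tens K Hs Hs v w) \<odot>\<^bsub>?HH\<^esub> tens K Hs Hs x x'))" by simp
 qed
 show ?thesis unfolding dual_comult_def
 proof (rule the_equality)
  show "?t .: ?HH \<and> (\<forall>h\<in>carrier H. \<forall>l\<in>carrier H. ?e h l ?t = \<xi> (h ** l))" using t te by blast
  fix u assume u: "u .: ?HH \<and> (\<forall>h\<in>carrier H. \<forall>l\<in>carrier H. ?e h l u = \<xi> (h ** l))"
  have "Cs ?HH (%x g. Cs ?HH (%x' g'. \<xi> (g ** g') \<odot>\<^bsub>?HH\<^esub> tens K Hs Hs x x')) =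
    Cs ?HH (%x g. Cs ?HH (%x' g'. ?e g g' v \<odot>\<^bsub>?HH\<^esub> tens K Hs Hs x x'))"
   if "\<forall>h\<in>carrier H. \<forall>l\<in>carrier H. ?e h l v = \<xi> (h ** l)" for v
   by (rule Cs_cong, rule Cs_cong) (use that in simp)
  from this[of u] this[of ?t] show "u = ?t"
   using expand[of u] expand[OF t] u te by simp
 qed
qed

text \<open>The free basis functional may be placed in either leg of the coproduct of \<xi>. Having
  both forms lets later arguments decide which leg becomes the translate of \<xi> and which one is
  available for contraction.\<close>

lemma lift_dual_comult:
 assumes x: "\<xi> .: Hs" and Z: "vs Z" and F: "bil Hs Hs Z F"
 shows "lift Z F (dual_comult K H \<xi>) = Cs Z (%x g. F x (bi g \<xi> uH))"
  and "lift Z F (dual_comult K H \<xi>) = Cs Z (%x g. F (bi uH \<xi> g) x)"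
proof -
 interpret A: assoc_algebra K H by (rule algH)
 let ?HH = "tsp Hs Hs"
 note t = lin_compose[OF bil1[OF F]] lin_compose[OF bil2[OF F]] bil_closed[OF F] fcalc x Z
 note L = lin_tensor_lift[OF vsHs vsHs Z F]
 have "lift Z F (dual_comult K H \<xi>) = Cs Z (%x g. lift Z F (tens K Hs Hs x (bi g \<xi> uH)))"
  unfolding lift_dual_comult_aux[OF x]
  by (rule Cs_comp[OF L vs_tensor[OF vsHs vsHs] Z]) ((assumption | rule t)+)
 also have "... = Cs Z (%x g. F x (bi g \<xi> uH))"
  by (rule Cs_cong[symmetric],
   simp add: tensor_lift_tens[OF vsHs vsHs Z F] bi_closed oneH x)
 finally show 1: "lift Z F (dual_comult K H \<xi>) = Cs Z (%x g. F x (bi g \<xi> uH))" .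
 also have "... = Cs Z (%x g. Cs Z (%y k. \<xi> (g ** k) \<odot>\<^bsub>Z\<^esub> F x y))"
 proof (rule Cs_cong)
  fix z g assume zg: "z .: Hs" "g .: H"
  have "F z (bi g \<xi> uH) = Cs Z (%y k. bi g \<xi> uH k \<odot>\<^bsub>Z\<^esub> F z y)"
   by (rule canonical_dual[symmetric, OF db Z bil1[OF F zg(1)]]) ((assumption | rule t zg)+)
  also have "... = Cs Z (%y k. \<xi> (g ** k) \<odot>\<^bsub>Z\<^esub> F z y)"
   by (rule Cs_cong[symmetric], simp add: bi_apply)
  finally show "F z (bi g \<xi> uH) = Cs Z (%y k. \<xi> (g ** k) \<odot>\<^bsub>Z\<^esub> F z y)" .
 qed
 also have "... = Cs Z (%y k. Cs Z (%x g. \<xi> (g ** k) \<odot>\<^bsub>Z\<^esub> F x y))"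
  by (rule tensor_lift_swap[OF vsHs vsH vsHs vsH Z C_closed C_closed]; (assumption | rule t)+)
 also have "... = Cs Z (%y k. F (bi uH \<xi> k) y)"
 proof (rule Cs_cong)
  fix z g assume zg: "z .: Hs" "g .: H"
  have "F (bi uH \<xi> g) z = Cs Z (%y k. bi uH \<xi> g k \<odot>\<^bsub>Z\<^esub> F y z)"
   by (rule canonical_dual[symmetric, OF db Z bil2[OF F zg(1)]]) ((assumption | rule t zg)+)
  also have "... = Cs Z (%y k. \<xi> (k ** g) \<odot>\<^bsub>Z\<^esub> F y z)"
   by (rule Cs_cong[symmetric], simp add: bi_apply zg)
  finally show "Cs Z (%x k. \<xi> (k ** g) \<odot>\<^bsub>Z\<^esub> F x z) = F (bi uH \<xi> g) z" by simp
 qed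
 finally show "lift Z F (dual_comult K H \<xi>) = Cs Z (%x g. F (bi uH \<xi> g) x)" .
qed

subsection \<open>The bialgebra structure of the Drinfeld double\<close>

lemma comult_Drin_def:
 "comult Drin u = lift TT (%\<xi> h. lift TT (%\<xi>1 \<xi>2.
  sw TT h (%h1 h2. tt (pt \<xi>1 h1) (pt \<xi>2 h2))) (dual_comult K H \<xi>)) u"
 by (simp add: drinfeld_double_def Let_def)

lemma comult_bil: "bil Hs H TT (%\<xi> h. Cs TT (%x g. sw TT h (%h1 h2. tt (pt x h1) (pt (bi g \<xi> uH) h2))))"
 by (assumption | rule fcalc)+

lemma comult_dual_bil: "h .: H ==> bil Hs Hs TT (%\<xi>1 \<xi>2. sw TT h (%h1 h2. tt (pt \<xi>1 h1) (pt \<xi>2 h2)))"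
 by (assumption | rule fcalc)+

lemma comult_Drin_lift:
 assumes "u .: DT"
 shows "comult Drin u = lift TT (%\<xi> h. Cs TT (%x g. sw TT h (%h1 h2. tt (pt x h1) (pt (bi g \<xi> uH) h2)))) u"
 unfolding comult_Drin_def
 by (rule tensor_lift_cong[symmetric, OF assms vsHs vsH])
  (simp add: lift_dual_comult(1)[OF _ vsTT comult_dual_bil])

lemma lin_comult_Drin: "lin DT TT (comult Drin)"
 by (subst lin_cong[OF comult_Drin_lift vsDT], assumption) (rule lin_tensor_lift[OF vsHs vsH vsTT comult_bil])

lemma comult_pt:
 assumes "\<xi> .: Hs" "h .: H"
 shows "comult Drin (pt \<xi> h) = Cs TT (%x g. sw TT h (%h1 h2. tt (pt x h1) (pt (bi g \<xi> uH) h2)))"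
  and "comult Drin (pt \<xi> h) = Cs TT (%x g. sw TT h (%h1 h2. tt (pt (bi uH \<xi> g) h1) (pt x h2)))"
proof -
 show 1: "comult Drin (pt \<xi> h) = Cs TT (%x g. sw TT h (%h1 h2. tt (pt x h1) (pt (bi g \<xi> uH) h2)))"
  using assms by (simp add: comult_Drin_lift tens_closed vsHs vsH tensor_lift_tens[OF vsHs vsH vsTT comult_bil])
 show "comult Drin (pt \<xi> h) = Cs TT (%x g. sw TT h (%h1 h2. tt (pt (bi uH \<xi> g) h1) (pt x h2)))"
  unfolding 1 using lift_dual_comult[OF assms(1) vsTT comult_dual_bil[OF assms(2)]] by simp
qed

lemma comult_pt_apply:
 assumes x: "\<xi> .: Hs" "h .: H" and F: "lin TT Z F" and Z: "vs Z"
 shows "F (comult Drin (pt \<xi> h)) = Cs Z (%x g. sw Z h (%h1 h2. F (tt (pt x h1) (pt (bi g \<xi> uH) h2))))"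
  and "F (comult Drin (pt \<xi> h)) = Cs Z (%x g. sw Z h (%h1 h2. F (tt (pt (bi uH \<xi> g) h1) (pt x h2))))"
proof -
 note t = lin_compose[OF F] fcalc x Z
 have "F (comult Drin (pt \<xi> h)) = Cs Z (%x g. sw Z h (%h1 h2. F (tt (pt x h1) (pt (bi g \<xi> uH) h2))))"
  unfolding comult_pt(1)[OF x] by (rule Cs_comp'[OF F vsTT Z], (assumption | rule t)+, rule sw_comp[OF F vsTT Z _ x(2)]; (assumption | rule t)+)
 then show "F (comult Drin (pt \<xi> h)) = Cs Z (%x g. sw Z h (%h1 h2. F (tt (pt x h1) (pt (bi g \<xi> uH) h2))))" .
 have "F (comult Drin (pt \<xi> h)) = Cs Z (%x g. sw Z h (%h1 h2. F (tt (pt (bi uH \<xi> g) h1) (pt x h2))))"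
  unfolding comult_pt(2)[OF x] by (rule Cs_comp'[OF F vsTT Z], (assumption | rule t)+, rule sw_comp[OF F vsTT Z _ x(2)]; (assumption | rule t)+)
 then show "F (comult Drin (pt \<xi> h)) = Cs Z (%x g. sw Z h (%h1 h2. F (tt (pt (bi uH \<xi> g) h1) (pt x h2))))" .
qed

text \<open>On the left the outer coproduct uses the form with the basis functional last and the
  inner one the form with it first; on the right the roles are exchanged. Either way the middle
  functional is v \<mapsto> \<xi>(k v g) between two basis functionals, and what remains is
  coassociativity in H.\<close>

lemma Drin_coassoc:
 assumes u: "u .: DT"
 shows "tensor_map K TT DT (comult Drin) id (comult Drin u) =
  tensor_assoc K DT DT DT (tensor_map K DT TT id (comult Drin) (comult Drin u))"
proof (rule DT_ext[of _ "%u. tensor_map K TT DT (comult Drin) id (comult Drin u)", OF _ _ _ _ u])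
 let ?Z = "tsp TT DT"
 note vZ = vs_tensor[OF vsTT vsDT]
 note lid = lin_id[folded id_def]
 note m1 = lin_tensor_map[OF lin_comult_Drin lid vsDT vsDT vsTT vsDT]
 note m2 = lin_compose[OF lin_tensor_assoc[OF vsDT vsDT vsDT] lin_tensor_map[OF lid lin_comult_Drin vsDT vsDT vsDT vsTT]]
 show "vs ?Z" by (rule vZ)
 show "lin DT ?Z (%u. tensor_map K TT DT (comult Drin) id (comult Drin u))" by (rule lin_compose[OF m1 lin_comult_Drin])
 show "lin DT ?Z (%u. tensor_assoc K DT DT DT (tensor_map K DT TT id (comult Drin) (comult Drin u)))"
  by (rule lin_compose[OF m2 lin_comult_Drin])
 fix \<xi> h assume x: "\<xi> .: Hs" "h .: H"
 note t = fcalc x vZ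
 let ?f = "%z k x g a b c. tens K TT DT (tt (pt z a) (pt (bi k \<xi> g) b)) (pt x c)"
 interpret A: assoc_algebra K H by (rule algH)
 have "tensor_map K TT DT (comult Drin) id (comult Drin (pt \<xi> h)) =
   Cs ?Z (%x g. sw ?Z h (%h1 h2. Cs ?Z (%z k. sw ?Z h1 (%a b. ?f z k x g a b h2))))"
  unfolding comult_pt_apply(2)[OF x m1 vZ]
 proof (rule sym, rule Cs_cong, rule sw_cong[OF x(2)])
  fix y g h1 h2 assume y: "y .: Hs" "g .: H" "h1 .: H" "h2 .: H"
  have b: "bi uH \<xi> g .: Hs" by (assumption | rule t y)+
  have "tensor_map K TT DT (comult Drin) id (tt (pt (bi uH \<xi> g) h1) (pt y h2)) =
   tens K TT DT (comult Drin (pt (bi uH \<xi> g) h1)) (pt y h2)"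
   by (subst tensor_map_tens[OF lin_comult_Drin lid vsDT vsDT vsTT vsDT]) ((assumption | rule t y)+, simp)
  also have "... = Cs ?Z (%z k. sw ?Z h1 (%a b. tens K TT DT (tt (pt z a) (pt (bi k (bi uH \<xi> g) uH) b)) (pt y h2)))"
   by (rule comult_pt_apply(1)[OF b y(3) lin_tens_left[OF lin_id] vZ]) ((assumption | rule t y)+)
  also have "... = Cs ?Z (%z k. sw ?Z h1 (%a b. ?f z k y g a b h2))"
   by (rule Cs_cong[symmetric], rule sw_cong[OF y(3)], simp add: bi_bi x y oneH)
  finally show "Cs ?Z (%z k. sw ?Z h1 (%a b. ?f z k y g a b h2)) =
   tensor_map K TT DT (comult Drin) id (tt (pt (bi uH \<xi> g) h1) (pt y h2))" by simp
 qed
 also have "... = Cs ?Z (%x g. Cs ?Z (%z k. sw ?Z h (%h1 h2. sw ?Z h1 (%a b. ?f z k x g a b h2))))"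
  by (rule Cs_cong,
   rule tensor_lift_swap[OF vsH vsH vsHs vsH vZ comult_closed[OF x(2)] C_closed]; (assumption | rule t)+)
 also have "... = Cs ?Z (%z k. Cs ?Z (%x g. sw ?Z h (%h1 h2. sw ?Z h1 (%a b. ?f z k x g a b h2))))"
  by (rule tensor_lift_swap[OF vsHs vsH vsHs vsH vZ C_closed C_closed]; (assumption | rule t)+)
 also have "... = Cs ?Z (%z k. Cs ?Z (%x g. sw ?Z h (%a h2. sw ?Z h2 (%b c. ?f z k x g a b c))))"
  by (rule Cs_cong, rule Cs_cong,
   rule sw_assoc[OF vZ triI x(2)]; (assumption | rule t)+)
 also have "... = Cs ?Z (%z k. sw ?Z h (%a h2. Cs ?Z (%x g. sw ?Z h2 (%b c. ?f z k x g a b c))))"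
  by (rule Cs_cong,
   rule tensor_lift_swap[OF vsHs vsH vsH vsH vZ C_closed comult_closed[OF x(2)]]; (assumption | rule t)+)
 also have "... = tensor_assoc K DT DT DT (tensor_map K DT TT id (comult Drin) (comult Drin (pt \<xi> h)))"
  unfolding comult_pt_apply(1)[OF x m2 vZ]
 proof (rule Cs_cong, rule sw_cong[OF x(2)])
  fix y g h1 h2 assume y: "y .: Hs" "g .: H" "h1 .: H" "h2 .: H"
  have b: "bi g \<xi> uH .: Hs" by (assumption | rule t y)+
  have p: "pt y h1 .: DT" by (assumption | rule t y)+
  have "tensor_map K DT TT id (comult Drin) (tt (pt y h1) (pt (bi g \<xi> uH) h2)) =
   tens K DT TT (pt y h1) (comult Drin (pt (bi g \<xi> uH) h2))"
   by (subst tensor_map_tens[OF lid lin_comult_Drin vsDT vsDT vsDT vsTT]) ((assumption | rule t y)+, simp)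
  then have "tensor_assoc K DT DT DT (tensor_map K DT TT id (comult Drin) (tt (pt y h1) (pt (bi g \<xi> uH) h2))) =
   Cs ?Z (%x k. sw ?Z h2 (%b c. tensor_assoc K DT DT DT
    (tens K DT TT (pt y h1) (tt (pt (bi uH (bi g \<xi> uH) k) b) (pt x c)))))"
   by simp (rule comult_pt_apply(2)[OF b y(4) lin_compose[OF lin_tensor_assoc[OF vsDT vsDT vsDT]
     lin_tens_right[OF lin_id vsDT vsTT p]] vZ])
  also have "... = Cs ?Z (%x k. sw ?Z h2 (%b c. ?f y g x k h1 b c))"
   by (rule Cs_cong[symmetric], rule sw_cong[OF y(4)],
    simp add: bi_bi x y oneH tensor_assoc_tens[OF vsDT vsDT vsDT] tens_closed vsHs vsH bi_closed)
  finally show "Cs ?Z (%x k. sw ?Z h2 (%b c. ?f y g x k h1 b c)) =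
   tensor_assoc K DT DT DT (tensor_map K DT TT id (comult Drin) (tt (pt y h1) (pt (bi g \<xi> uH) h2)))" by simp
 qed
 finally show "tensor_map K TT DT (comult Drin) id (comult Drin (pt \<xi> h)) =
   tensor_assoc K DT DT DT (tensor_map K DT TT id (comult Drin) (comult Drin (pt \<xi> h)))" .
qed

lemma counit_Drin_bil: "bil Hs H (scalars K) (%\<xi> h. \<xi> uH \<otimes> \<epsilon> h)"
 by (assumption | rule fcalc)+

lemma lin_counit_Drin: "lin DT (scalars K) (counit Drin)"
 and counit_pt: "[|\<xi> .: Hs; h .: H|] ==> counit Drin (pt \<xi> h) = \<xi> uH \<otimes> \<epsilon> h"
 using lin_tensor_lift[OF vsHs vsH vs_scalars counit_Drin_bil] tensor_lift_tens[OF vsHs vsH vs_scalars counit_Drin_bil]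
 by (simp_all add: drinfeld_double_def Let_def)

text \<open>In each identity the form of the coproduct is chosen so that the counit evaluates the
  basis functional at 1. Contraction then sets the vector leg to 1 and leaves the untranslated
  \<xi>.\<close>

lemma Drin_counit:
 assumes u: "u .: DT"
 shows "lift DT (%x y. counit Drin x \<odot>\<^bsub>DT\<^esub> y) (comult Drin u) = u"
  and "lift DT (%x y. counit Drin y \<odot>\<^bsub>DT\<^esub> x) (comult Drin u) = u"
proof -
 interpret A: assoc_algebra K H by (rule algH)
 note t = fcalc lin_compose[OF lin_counit_Drin] lin_closed[OF lin_counit_Drin, simplified]
 have b: "bil DT DT DT (%x y. counit Drin x \<odot>\<^bsub>DT\<^esub> y)" "bil DT DT DT (%x y. counit Drin y \<odot>\<^bsub>DT\<^esub> x)"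
  by (assumption | rule t)+
 note L = lin_tensor_lift[OF vsDT vsDT vsDT b(1)] lin_tensor_lift[OF vsDT vsDT vsDT b(2)]
 note LT = tensor_lift_tens[OF vsDT vsDT vsDT b(1)] tensor_lift_tens[OF vsDT vsDT vsDT b(2)]
 have e: "lift DT (%x y. counit Drin x \<odot>\<^bsub>DT\<^esub> y) (comult Drin (pt \<xi> h)) = pt \<xi> h"
   "lift DT (%x y. counit Drin y \<odot>\<^bsub>DT\<^esub> x) (comult Drin (pt \<xi> h)) = pt \<xi> h"
  if x: "\<xi> .: Hs" "h .: H" for \<xi> h
 proof -
  note sm = module.smult_assoc1[OF vsD(2)[OF vsDT]]
  have "lift DT (%x y. counit Drin x \<odot>\<^bsub>DT\<^esub> y) (comult Drin (pt \<xi> h)) =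
    Cs DT (%z g. z uH \<odot>\<^bsub>DT\<^esub> sw DT h (%h1 h2. \<epsilon> h1 \<odot>\<^bsub>DT\<^esub> pt (bi g \<xi> uH) h2))"
   unfolding comult_pt_apply(1)[OF x L(1) vsDT]
  proof (rule sym, rule Cs_cong)
   fix z g assume z: "z .: Hs" "g .: H"
   have "z uH \<odot>\<^bsub>DT\<^esub> sw DT h (%h1 h2. \<epsilon> h1 \<odot>\<^bsub>DT\<^esub> pt (bi g \<xi> uH) h2) = sw DT h (%h1 h2. lift DT (%x y. counit Drin x \<odot>\<^bsub>DT\<^esub> y) (tt (pt z h1) (pt (bi g \<xi> uH) h2)))"
    by (rule sw_comp'[OF lin_smult_right[OF vsDT lin_id] vsDT vsDT _ x(2)], (assumption | rule fcalc x z)+,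
     simp add: LT tens_closed vsHs vsH bi_closed x z counit_pt sm dual_app_closed counit_closed)
   then show "z uH \<odot>\<^bsub>DT\<^esub> sw DT h (%h1 h2. \<epsilon> h1 \<odot>\<^bsub>DT\<^esub> pt (bi g \<xi> uH) h2) =
    sw DT h (%h1 h2. lift DT (%x y. counit Drin x \<odot>\<^bsub>DT\<^esub> y) (tt (pt z h1) (pt (bi g \<xi> uH) h2)))" .
  qed
  also have "... = sw DT h (%h1 h2. \<epsilon> h1 \<odot>\<^bsub>DT\<^esub> pt (bi uH \<xi> uH) h2)"
   by (rule canonical_vector[OF db vsDT _ oneH]) ((assumption | rule fcalc x)+)
  also have "... = pt (bi uH \<xi> uH) h"
   by (rule sw_counit(1)[OF vsDT _ x(2)]) ((assumption | rule fcalc x)+)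
  finally show "lift DT (%x y. counit Drin x \<odot>\<^bsub>DT\<^esub> y) (comult Drin (pt \<xi> h)) = pt \<xi> h"
   by (simp add: bi_one x)
  have "lift DT (%x y. counit Drin y \<odot>\<^bsub>DT\<^esub> x) (comult Drin (pt \<xi> h)) =
    Cs DT (%z g. z uH \<odot>\<^bsub>DT\<^esub> sw DT h (%h1 h2. \<epsilon> h2 \<odot>\<^bsub>DT\<^esub> pt (bi uH \<xi> g) h1))"
   unfolding comult_pt_apply(2)[OF x L(2) vsDT]
  proof (rule sym, rule Cs_cong)
   fix z g assume z: "z .: Hs" "g .: H"
   have "z uH \<odot>\<^bsub>DT\<^esub> sw DT h (%h1 h2. \<epsilon> h2 \<odot>\<^bsub>DT\<^esub> pt (bi uH \<xi> g) h1) = sw DT h (%h1 h2. lift DT (%x y. counit Drin y \<odot>\<^bsub>DT\<^esub> x) (tt (pt (bi uH \<xi> g) h1) (pt z h2)))"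
    by (rule sw_comp'[OF lin_smult_right[OF vsDT lin_id] vsDT vsDT _ x(2)], (assumption | rule fcalc x z)+,
     simp add: LT tens_closed vsHs vsH bi_closed x z counit_pt sm dual_app_closed counit_closed)
   then show "z uH \<odot>\<^bsub>DT\<^esub> sw DT h (%h1 h2. \<epsilon> h2 \<odot>\<^bsub>DT\<^esub> pt (bi uH \<xi> g) h1) =
    sw DT h (%h1 h2. lift DT (%x y. counit Drin y \<odot>\<^bsub>DT\<^esub> x) (tt (pt (bi uH \<xi> g) h1) (pt z h2)))" .
  qed
  also have "... = sw DT h (%h1 h2. \<epsilon> h2 \<odot>\<^bsub>DT\<^esub> pt (bi uH \<xi> uH) h1)"
   by (rule canonical_vector[OF db vsDT _ oneH]) ((assumption | rule fcalc x)+)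
  also have "... = pt (bi uH \<xi> uH) h"
   by (rule sw_counit(2)[OF vsDT _ x(2)]) ((assumption | rule fcalc x)+)
  finally show "lift DT (%x y. counit Drin y \<odot>\<^bsub>DT\<^esub> x) (comult Drin (pt \<xi> h)) = pt \<xi> h"
   by (simp add: bi_one x)
 qed
 show "lift DT (%x y. counit Drin x \<odot>\<^bsub>DT\<^esub> y) (comult Drin u) = u"
  by (rule DT_ext[OF vsDT lin_compose[OF L(1) lin_comult_Drin] lin_id e(1) u])
 show "lift DT (%x y. counit Drin y \<odot>\<^bsub>DT\<^esub> x) (comult Drin u) = u"
  by (rule DT_ext[OF vsDT lin_compose[OF L(2) lin_comult_Drin] lin_id e(2) u])
qed

lemma DD_same: "same_space DD TT"
 using same_space_tensor_alg[of Drin Drin] by (simp add: Drin_same)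

lemmas algDD = assoc_algebra_tensor_alg[OF algD algD]
lemmas DD_eqs = same_space_eqs[OF DD_same] same_space_bil[OF DD_same]

lemma DD_mult:
 "[|u .: TT; v .: TT|] ==> u *E v .: TT"
 "[|lin U TT f; v .: TT|] ==> lin U TT (%x. f x *E v)"
 "[|lin U TT f; v .: TT|] ==> lin U TT (%x. v *E f x)"
 using mult_closed[OF algDD] lin_mult_left[OF _ algDD] lin_mult_right[OF _ algDD]
 by (simp_all add: Drin_same DD_eqs)

lemma DD_assoc: "[|u .: TT; v .: TT; w .: TT|] ==> (u *E v) *E w = u *E (v *E w)"
 using assoc_algebraD(2)[OF algDD] ring.ring_simprules(11)[of DD u v w] by (simp add: Drin_same)

lemma tt_mult: "[|u .: DT; v .: DT; u' .: DT; v' .: DT|]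
  ==> tt u v *E tt u' v' = tt (u *D u') (v *D v')"
 using tensor_alg_mult[OF algD algD, of u v u' v'] by (simp add: Drin_simps(1) Drin_same)

lemmas gcalc = fcalc DD_mult lin_compose[OF lin_comult_Drin] lin_closed[OF lin_comult_Drin]

lemma comult_eps: assumes h: "h .: H"
 shows "comult Drin (pt eps h) = sw TT h (%a b. tt (pt eps a) (pt eps b))"
proof -
 interpret A: assoc_algebra K H by (rule algH)
 have be: "bi g eps uH = \<epsilon> g \<odot>\<^bsub>Hs\<^esub> eps" if "g .: H" for g
  using that by (auto simp: bi_def eps_def dual_space_simps(3) counit_mult intro!: restrict_ext)
 have "comult Drin (pt eps h) = Cs TT (%x g. sw TT h (%h1 h2. tt (pt x h1) (pt (bi g eps uH) h2)))"
  by (rule comult_pt(1)[OF eps_closed h])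
 also have "... = Cs TT (%x g. eps g \<odot>\<^bsub>TT\<^esub> sw TT h (%h1 h2. tt (pt x h1) (pt eps h2)))"
 proof (rule Cs_cong)
  fix z g assume z: "z .: Hs" "g .: H"
  have l: "lin Hs TT (%u. sw TT h (%h1 h2. tt (pt z h1) (pt u h2)))" by (assumption | rule fcalc h z)+
  show "sw TT h (%h1 h2. tt (pt z h1) (pt (bi g eps uH) h2)) =
   eps g \<odot>\<^bsub>TT\<^esub> sw TT h (%h1 h2. tt (pt z h1) (pt eps h2))"
   using lin_smult[OF l counit_closed[OF z(2)] eps_closed] by (simp add: be z eps_apply)
 qed
 also have "... = sw TT h (%h1 h2. tt (pt eps h1) (pt eps h2))"
  by (rule canonical_dual[OF db vsTT _ eps_closed]) ((assumption | rule fcalc h)+)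
 finally show ?thesis .
qed

lemma comult_dual_one: assumes x: "\<xi> .: Hs"
 shows "comult Drin (pt \<xi> uH) = Cs TT (%x g. tt (pt x uH) (pt (bi g \<xi> uH) uH))"
 unfolding comult_pt(1)[OF x oneH]
 by (rule sym, rule Cs_cong, rule sw_one[symmetric, OF vsTT];
  (assumption | rule fcalc x)+)

lemma comult_pt_split:
 assumes x: "\<xi> .: Hs" and h: "h .: H"
 shows "comult Drin (pt \<xi> h) = comult Drin (pt \<xi> uH) *E comult Drin (pt eps h)"
proof -
 interpret A: assoc_algebra K H by (rule algH)
 note t = gcalc x h
 have E: "sw TT h (%a b. tt (pt eps a) (pt eps b)) .: TT" by (assumption | rule t)+
 have "comult Drin (pt \<xi> uH) *E comult Drin (pt eps h) =
  Cs TT (%x g. tt (pt x uH) (pt (bi g \<xi> uH) uH) *E sw TT h (%a b. tt (pt eps a) (pt eps b)))"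
  unfolding comult_dual_one[OF x] comult_eps[OF h]
  by (rule Cs_comp[OF DD_mult(2)[OF lin_id E] vsTT vsTT]) ((assumption | rule t)+)
 also have "... = comult Drin (pt \<xi> h)"
  unfolding comult_pt(1)[OF x h]
 proof (rule sym, rule Cs_cong)
  fix z g assume z: "z .: Hs" "g .: H"
  have "tt (pt z uH) (pt (bi g \<xi> uH) uH) *E sw TT h (%a b. tt (pt eps a) (pt eps b)) =
   sw TT h (%a b. tt (pt z uH) (pt (bi g \<xi> uH) uH) *E tt (pt eps a) (pt eps b))"
   by (rule sw_comp[OF DD_mult(3)[OF lin_id] vsTT vsTT _ h]) ((assumption | rule t z)+)
  also have "... = sw TT h (%h1 h2. tt (pt z h1) (pt (bi g \<xi> uH) h2))"
   by (rule sw_cong[symmetric, OF h],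
    simp add: tt_mult tens_closed vsHs vsH oneH eps_closed z bi_closed x pt_mult_eps)
  finally show "sw TT h (%h1 h2. tt (pt z h1) (pt (bi g \<xi> uH) h2)) =
   tt (pt z uH) (pt (bi g \<xi> uH) uH) *E sw TT h (%a b. tt (pt eps a) (pt eps b))" by simp
 qed
 finally show ?thesis by simp
qed

lemma comult_eps_mult:
 assumes h: "h .: H" and l: "l .: H"
 shows "comult Drin (pt eps (h ** l)) = comult Drin (pt eps h) *E comult Drin (pt eps l)"
proof -
 note t = gcalc h l
 have b: "bil H H TT (%a b. tt (pt eps a) (pt eps b))" by (assumption | rule t)+
 have "comult Drin (pt eps h) *E comult Drin (pt eps l) =
  sw TT h (%a b. sw TT l (%c d. tt (pt eps a) (pt eps b) *E tt (pt eps c) (pt eps d)))"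
  unfolding comult_eps[OF h] comult_eps[OF l]
  using tensor_lift_mult[OF vsH vsH vsH vsH algDD, of "%a b. tt (pt eps a) (pt eps b)" "%a b. tt (pt eps a) (pt eps b)"] b
   comult_closed[OF h] comult_closed[OF l] by (simp add: DD_eqs)
 also have "... = sw TT h (%a b. sw TT l (%c d. tt (pt eps (a ** c)) (pt eps (b ** d))))"
  by (rule sw_cong[symmetric, OF h], rule sw_cong[OF l], simp add: tt_mult tens_closed vsHs vsH eps_closed pt_mult_eps)
 also have "... = comult Drin (pt eps (h ** l))"
  unfolding comult_eps[OF mult_closed[OF algH h l]] by (rule sw_mult[symmetric, OF vsTT b h l])
 finally show ?thesis by simp
qed

lemma comult_conv:
 assumes x: "\<xi> .: Hs" "\<zeta> .: Hs"
 shows "comult Drin (pt (conv \<xi> \<zeta>) uH) = comult Drin (pt \<xi> uH) *E comult Drin (pt \<zeta> uH)"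
proof -
 note t = gcalc x
 let ?f = "%z k g. tt (pt z uH) (pt (conv (bi g \<xi> uH) (bi k \<zeta> uH)) uH)"
 have b: "bil Hs H TT (%x g. tt (pt x uH) (pt (bi g \<xi> uH) uH))" if "\<xi> .: Hs" for \<xi>
  by (assumption | rule gcalc that)+
 have "comult Drin (pt \<xi> uH) *E comult Drin (pt \<zeta> uH) =
  Cs TT (%x g. Cs TT (%y k. tt (pt x uH) (pt (bi g \<xi> uH) uH) *E tt (pt y uH) (pt (bi k \<zeta> uH) uH)))"
  unfolding comult_dual_one[OF x(1)] comult_dual_one[OF x(2)]
  using tensor_lift_mult[OF vsHs vsH vsHs vsH algDD, of "%x g. tt (pt x uH) (pt (bi g \<xi> uH) uH)"
   "%x g. tt (pt x uH) (pt (bi g \<zeta> uH) uH)"] b[OF x(1)] b[OF x(2)] C_closed by (simp add: DD_eqs)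
 also have "... = Cs TT (%x g. Cs TT (%y k. ?f (conv x y) k g))"
  by (rule Cs_cong[symmetric], rule Cs_cong,
   simp add: tt_mult tens_closed vsHs vsH oneH bi_closed x pt_mult_dual)
 \<comment> \<open>\<open>conv x y\<close> evaluates \<open>y\<close> on the leading leg, whereas
   \<open>canonical_convolution\<close> expects the outer functional there; exchanging the sums
   reconciles the two.\<close>
 also have "... = Cs TT (%y k. Cs TT (%x g. ?f (conv x y) k g))"
  by (rule tensor_lift_swap[OF vsHs vsH vsHs vsH vsTT C_closed C_closed]; (assumption | rule t)+)
 also have "... = Cs TT (%z c. sw TT c (%a b. ?f z a b))"
 proof -
  have "Cs TT (%y k. Cs TT (%x g. ?f (\<lambda>c\<in>carrier H. sw (scalars K) c (%a b. y a \<otimes> x b)) k g)) =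
    Cs TT (%z c. sw TT c (%a b. ?f z a b))"
   by (rule canonical_convolution[OF db vsTT lin_comult0]; (assumption | rule t)+)
  then show ?thesis by (simp only: conv_def[symmetric])
 qed
 also have "... = comult Drin (pt (conv \<xi> \<zeta>) uH)"
  unfolding comult_dual_one[OF conv_closed[OF x]]
 proof (rule Cs_cong)
  fix z c assume z: "z .: Hs" "c .: H"
  show "sw TT c (%a b. ?f z a b) = tt (pt z uH) (pt (bi c (conv \<xi> \<zeta>) uH) uH)"
   unfolding bi_conv[OF z(2) x]
   by (rule sw_comp[symmetric, of Hs TT "%u. tt (pt z uH) (pt u uH)", OF _ vsHs vsTT _ z(2)])
    ((assumption | rule t z)+)
 qed
 finally show ?thesis by simp
qed

end

section \<open>Multiplicativity of the coproduct and the counit of the double\<close>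

context dual_base
begin

lemma tt_sw3:
 assumes "h1 .: H" "h2 .: H" "tri DT f" "tri DT g"
 shows "tt (sw3 DT h1 f) (sw3 DT h2 g) = sw3 TT h1 (%a b c. sw3 TT h2 (%a' b' c'. tt (f a b c) (g a' b' c')))"
proof -
 note f = triD[OF assms(3)] lin_compose[OF triD(1)[OF assms(3)]] lin_compose[OF triD(2)[OF assms(3)]]
   lin_compose[OF triD(3)[OF assms(3)]] lin_closed[OF triD(1)[OF assms(3)]]
 note g = triD[OF assms(4)] lin_compose[OF triD(1)[OF assms(4)]] lin_compose[OF triD(2)[OF assms(4)]]
   lin_compose[OF triD(3)[OF assms(4)]] lin_closed[OF triD(1)[OF assms(4)]]
 note t = gcalc assms(1,2) f g
 have cg: "sw3 DT h2 g .: DT" by (assumption | rule t)+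
 have "tt (sw3 DT h1 f) (sw3 DT h2 g) = sw3 TT h1 (%a b c. sw3 TT h2 (%a' b' c'. tt (f a b c) (g a' b' c')))"
  by (rule sw3_comp'[OF lin_tens_left[OF lin_id vsDT vsDT cg] vsDT vsTT assms(3,1)])
   (rule sw3_comp[OF lin_tens_right[OF lin_id vsDT vsDT] vsDT vsTT assms(4,2)], (assumption | rule t)+)
 then show ?thesis .
qed

lemma Cs_sw_swap:
 assumes "vs Z" "h .: H"
  and "!!a b. [|a .: Hs; b .: H|] ==> bil H H Z (f a b)"
  and "!!c d. [|c .: H; d .: H|] ==> bil Hs H Z (%a b. f a b c d)"
 shows "Cs Z (%a b. sw Z h (f a b)) = sw Z h (%c d. Cs Z (%a b. f a b c d))"
 by (rule tensor_lift_swap[OF vsHs vsH vsH vsH assms(1) C_closed comult_closed[OF assms(2)] assms(3,4)])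

text \<open>Transposition of y \<mapsto> S(a) y c: an action on the functional leg of the canonical
  element becomes a product in its vector leg.\<close>

lemma Cs_act:
 assumes ac: "a .: H" "c .: H" and Z: "vs Z" and f: "bil Hs H Z f"
 shows "Cs Z (%x g. f (act a x c) g) = Cs Z (%x g. f x (S a ** (g ** c)))"
 unfolding act_def
 by (rule canonical_transpose[OF db Z f]) ((assumption | rule fcalc ac)+)

text \<open>In \<Delta>(h)\<Delta>(\<xi>) let a, b, c be the legs of h_1 and a', d, e those of h_2.
  Transposing the action of a and c to the vector leg g makes the second functional a translate of
  \<xi> by S(a) g c S(a') and e. The pair c S(a') consists of neighbouring legs of h and cancels,
  and the result is the coproduct of the crossed element.\<close>

lemma comult_cross:
 assumes h: "h .: H" and x: "\<xi> .: Hs"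
 shows "comult Drin (pt eps h *D pt \<xi> uH) = comult Drin (pt eps h) *E comult Drin (pt \<xi> uH)"
proof -
 interpret A: assoc_algebra K H by (rule algH)
 note t = gcalc h x
 let ?f = "%a b m d e. Cs TT (%z g. tt (pt z b) (pt (bi (S a ** (g ** m)) \<xi> e) d))"
 have bH: "bil H H TT (%a b. tt (pt eps a) (pt eps b))" by (assumption | rule t)+
 have bX: "bil Hs H TT (%z g. tt (pt z uH) (pt (bi g \<xi> uH) uH))" by (assumption | rule t)+
 have "comult Drin (pt eps h) *E comult Drin (pt \<xi> uH) =
  sw TT h (%h1 h2. Cs TT (%z g. tt (pt eps h1) (pt eps h2) *E tt (pt z uH) (pt (bi g \<xi> uH) uH)))"
  unfolding comult_eps[OF h] comult_dual_one[OF x]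
  using tensor_lift_mult[OF vsH vsH vsHs vsH algDD, of "%a b. tt (pt eps a) (pt eps b)"
    "%z g. tt (pt z uH) (pt (bi g \<xi> uH) uH)"] bH bX C_closed comult_closed[OF h] by (simp add: DD_eqs)
 also have "... = sw TT h (%h1 h2. Cs TT (%z g. sw3 TT h1 (%a b c. sw3 TT h2 (%a' d e.
   tt (pt (act a z c) b) (pt (act a' (bi g \<xi> uH) e) d)))))"
 proof (rule sym, rule sw_cong[OF h], rule Cs_cong)
  fix h1 h2 z g assume y: "h1 .: H" "h2 .: H" "z .: Hs" "g .: H"
  have c: "pt eps h1 .: DT" "pt eps h2 .: DT" "pt z uH .: DT"
   "pt (bi g \<xi> uH) uH .: DT" "bi g \<xi> uH .: Hs"
   by (assumption | rule t y)+
  show "sw3 TT h1 (%a b c. sw3 TT h2 (%a' d e. tt (pt (act a z c) b) (pt (act a' (bi g \<xi> uH) e) d))) =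
   tt (pt eps h1) (pt eps h2) *E tt (pt z uH) (pt (bi g \<xi> uH) uH)"
   unfolding tt_mult[OF c(1-4)] pt_eps_mult[OF y(1,3)] pt_eps_mult[OF y(2) c(5)]
   by (rule tt_sw3[symmetric, OF y(1,2) triI triI]; (assumption | rule t y)+)
 qed
 also have "... = sw TT h (%h1 h2. sw TT h1 (%u c. Cs TT (%z g. sw TT u (%a b. sw3 TT h2 (%a' d e.
   tt (pt (act a z c) b) (pt (act a' (bi g \<xi> uH) e) d))))))"
  by (rule sw_cong[OF h], rule Cs_sw_swap[OF vsTT]; (assumption | rule t)+)
 also have "... = sw TT h (%h1 h2. sw3 TT h1 (%a b c. Cs TT (%z g. sw3 TT h2 (%a' d e.
   tt (pt (act a z c) b) (pt (act a' (bi g \<xi> uH) e) d)))))"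
  by (rule sw_cong[OF h], rule sw_cong, assumption, rule Cs_sw_swap[OF vsTT]; (assumption | rule t)+)
 also have "... = sw TT h (%h1 h2. sw3 TT h1 (%a b c. sw3 TT h2 (%a' d e. ?f a b (c ** S a') d e)))"
 proof (rule sw_cong[OF h], rule sw3_cong, assumption)
  fix h1 h2 a b c assume y: "h1 .: H" "h2 .: H" "a .: H" "b .: H" "c .: H"
  have "Cs TT (%z g. sw3 TT h2 (%a' d e. tt (pt (act a z c) b) (pt (act a' (bi g \<xi> uH) e) d))) =
   sw TT h2 (%u e. Cs TT (%z g. sw TT u (%a' d. tt (pt (act a z c) b) (pt (act a' (bi g \<xi> uH) e) d))))"
   by (rule Cs_sw_swap[OF vsTT y(2)]; (assumption | rule t y)+)
  also have "... = sw3 TT h2 (%a' d e. Cs TT (%z g. tt (pt (act a z c) b) (pt (act a' (bi g \<xi> uH) e) d)))"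
   by (rule sw_cong[OF y(2)], rule Cs_sw_swap[OF vsTT]; (assumption | rule t y)+)
  also have "... = sw3 TT h2 (%a' d e. ?f a b (c ** S a') d e)"
  proof (rule sw3_cong[OF y(2)])
   fix a' d e assume w: "a' .: H" "d .: H" "e .: H"
   have "Cs TT (%z g. tt (pt (act a z c) b) (pt (act a' (bi g \<xi> uH) e) d)) =
     Cs TT (%z g. tt (pt z b) (pt (act a' (bi (S a ** (g ** c)) \<xi> uH) e) d))"
    by (rule Cs_act[OF y(3,5) vsTT, of "%z g. tt (pt z b) (pt (act a' (bi g \<xi> uH) e) d)"]; (assumption | rule t y w)+)
   also have "... = ?f a b (c ** S a') d e"
    by (rule Cs_cong,
     simp add: act_bi bi_bi x y w mult_closed antipode_closed oneH A.m_assoc)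
   finally show "Cs TT (%z g. tt (pt (act a z c) b) (pt (act a' (bi g \<xi> uH) e) d)) = ?f a b (c ** S a') d e" .
  qed
  finally show "Cs TT (%z g. sw3 TT h2 (%a' d e. tt (pt (act a z c) b) (pt (act a' (bi g \<xi> uH) e) d))) =
   sw3 TT h2 (%a' d e. ?f a b (c ** S a') d e)" .
 qed
 also have "... = sw3 TT h (%a y e. sw TT y (%b d. ?f a b uH d e))"
  by (rule sw6_cancel[OF vsTT h]; (assumption | rule t)+)
 also have "... = sw3 TT h (%a y e. comult Drin (pt (act a \<xi> e) y))"
 proof (rule sw3_cong[OF h])
  fix a y e assume y: "a .: H" "y .: H" "e .: H"
  have "comult Drin (pt (act a \<xi> e) y) = Cs TT (%z g. sw TT y (%b d. tt (pt z b) (pt (bi g (act a \<xi> e) uH) d)))"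
   by (rule comult_pt(1)) ((assumption | rule t y)+)
  also have "... = sw TT y (%b d. Cs TT (%z g. tt (pt z b) (pt (bi g (act a \<xi> e) uH) d)))"
   by (rule Cs_sw_swap[OF vsTT y(2)]; (assumption | rule t y)+)
  also have "... = sw TT y (%b d. ?f a b uH d e)"
   by (rule sw_cong[OF y(2)], rule Cs_cong, simp add: act_bi bi_bi x y antipode_closed oneH)
  finally show "sw TT y (%b d. ?f a b uH d e) = comult Drin (pt (act a \<xi> e) y)" by simp
 qed
 also have "... = comult Drin (pt eps h *D pt \<xi> uH)"
  unfolding pt_eps_mult[OF h x]
  by (rule sw3_comp[symmetric, OF lin_comult_Drin vsDT vsTT triI h]; (assumption | rule t)+)
 finally show ?thesis by simp
qed

text \<open>A linear map out of the double is multiplicative once it is so on the generators.\<close>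

lemma Drin_hom_ext:
 assumes B: "alg B" and F: "lin DT B F"
  and X: "!!\<xi> \<zeta> l. [|\<xi> .: Hs; \<zeta> .: Hs; l .: H|]
   ==> F (pt (conv \<xi> \<zeta>) l) = F (pt \<xi> uH) \<otimes>\<^bsub>B\<^esub> F (pt \<zeta> l)"
  and Y: "!!\<zeta> h l. [|\<zeta> .: Hs; h .: H; l .: H|]
   ==> F (pt \<zeta> (h ** l)) = F (pt \<zeta> h) \<otimes>\<^bsub>B\<^esub> F (pt eps l)"
  and XY: "!!h \<xi>. [|h .: H; \<xi> .: Hs|]
   ==> F (pt eps h *D pt \<xi> uH) = F (pt eps h) \<otimes>\<^bsub>B\<^esub> F (pt \<xi> uH)"
  and u: "u .: DT" and v: "v .: DT"
 shows "F (u *D v) = F u \<otimes>\<^bsub>B\<^esub> F v"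
proof -
 interpret B: assoc_algebra K B by (rule B)
 interpret Dr: assoc_algebra K Drin by (rule algD)
 interpret A: assoc_algebra K H by (rule algH)
 note t = gcalc B lin_compose[OF F] lin_closed[OF F] lin_mult_left[OF _ B] lin_mult_right[OF _ B]
 note vB = B.vectorspace_axioms
 have pc: "pt \<xi> h .: DT" if "\<xi> .: Hs" "h .: H" for \<xi> h
  using that by (simp add: tens_closed vsHs vsH)
 note Dm = Dr.m_assoc[unfolded Drin_simps(1)]
 have 1: "F (pt \<xi> uH *D w) = F (pt \<xi> uH) \<otimes>\<^bsub>B\<^esub> F w" if x: "\<xi> .: Hs" and w: "w .: DT" for \<xi> w
  by (rule DT_ext[of B "%w. F (pt \<xi> uH *D w)", OF vB _ _ _ w]; ((assumption | rule t x)+)?)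
   (simp add: pt_mult_dual X x)
 have 2: "F (w *D pt eps l) = F w \<otimes>\<^bsub>B\<^esub> F (pt eps l)" if l: "l .: H" and w: "w .: DT" for l w
  by (rule DT_ext[of B "%w. F (w *D pt eps l)", OF vB _ _ _ w]; ((assumption | rule t l)+)?)
   (simp add: pt_mult_eps Y l)
 show ?thesis
 proof (rule DT_ext[of B "%u. F (u *D v)", OF vB _ _ _ u])
  show "lin DT B (%u. F (u *D v))" "lin DT B (%u. F u \<otimes>\<^bsub>B\<^esub> F v)" by (assumption | rule t v)+
  fix \<xi> h assume x: "\<xi> .: Hs" "h .: H"
  show "F (pt \<xi> h *D v) = F (pt \<xi> h) \<otimes>\<^bsub>B\<^esub> F v"
  proof (rule DT_ext[of B "%v. F (pt \<xi> h *D v)", OF vB _ _ _ v])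
   show "lin DT B (%v. F (pt \<xi> h *D v))" "lin DT B (%v. F (pt \<xi> h) \<otimes>\<^bsub>B\<^esub> F v)" by (assumption | rule t x)+
   fix \<zeta> l assume z: "\<zeta> .: Hs" "l .: H"
   note c = pc[OF x(1) oneH] pc[OF eps_closed x(2)] pc[OF z(1) oneH] pc[OF eps_closed z(2)]
   have e: "pt \<xi> h = pt \<xi> uH *D pt eps h" "pt \<zeta> l = pt \<zeta> uH *D pt eps l"
    using x z by (simp_all add: pt_mult_eps oneH)
   have "F (pt \<xi> h *D pt \<zeta> l) = F (pt \<xi> uH *D ((pt eps h *D pt \<zeta> uH) *D pt eps l))"
    using c by (simp add: e Dm Dmult(1))
   also have "... = F (pt \<xi> uH) \<otimes>\<^bsub>B\<^esub> ((F (pt eps h) \<otimes>\<^bsub>B\<^esub> F (pt \<zeta> uH)) \<otimes>\<^bsub>B\<^esub> F (pt eps l))"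
    using c x z by (simp add: 1 2 XY Dmult(1))
   also have "... = (F (pt \<xi> uH) \<otimes>\<^bsub>B\<^esub> F (pt eps h)) \<otimes>\<^bsub>B\<^esub> (F (pt \<zeta> uH) \<otimes>\<^bsub>B\<^esub> F (pt eps l))"
    using c lin_closed[OF F] by (simp add: B.m_assoc)
   also have "... = F (pt \<xi> h) \<otimes>\<^bsub>B\<^esub> F (pt \<zeta> l)"
    using Y[OF x(1) oneH x(2)] Y[OF z(1) oneH z(2)] x z by simp
   finally show "F (pt \<xi> h *D pt \<zeta> l) = F (pt \<xi> h) \<otimes>\<^bsub>B\<^esub> F (pt \<zeta> l)" .
  qed
 qed
qed

lemma comult_Drin_hom: "comult Drin \<in> alg_hom K Drin DD"
proof (rule alg_homI[OF algD algDD])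
 interpret A: assoc_algebra K H by (rule algH)
 have l: "lin DT DD (comult Drin)" unfolding DD_eqs by (rule lin_comult_Drin)
 show "lin Drin DD (comult Drin)" unfolding Drin_same by (rule l)
 have "comult Drin (pt eps uH) = tt (pt eps uH) (pt eps uH)"
  unfolding comult_eps[OF oneH] by (rule sw_one[OF vsTT]) ((assumption | rule gcalc)+)
 then show "comult Drin \<one>\<^bsub>Drin\<^esub> = \<one>\<^bsub>DD\<^esub>" by (simp add: Drin_simps Drin_same)
 have pc: "comult Drin (pt \<xi> h) .: TT" if "\<xi> .: Hs" "h .: H" for \<xi> h
  using that by (simp add: lin_closed[OF lin_comult_Drin] tens_closed vsHs vsH)
 show "comult Drin (u *D v) = comult Drin u *E comult Drin v"
  if "u .: Drin" "v .: Drin" for u v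
 proof (rule Drin_hom_ext[OF algDD l])
  fix \<xi> \<zeta> l assume x: "\<xi> .: Hs" "\<zeta> .: Hs" "l .: H"
  show "comult Drin (pt (conv \<xi> \<zeta>) l) = comult Drin (pt \<xi> uH) *E comult Drin (pt \<zeta> l)"
   unfolding comult_pt_split[OF conv_closed[OF x(1,2)] x(3)] comult_pt_split[OF x(2,3)]
   using x by (simp add: comult_conv DD_assoc pc oneH eps_closed)
 next
  fix \<zeta> h l assume x: "\<zeta> .: Hs" "h .: H" "l .: H"
  have "comult Drin (pt \<zeta> (h ** l)) = comult Drin (pt \<zeta> uH) *E comult Drin (pt eps (h ** l))"
   by (rule comult_pt_split) (use x in simp_all)
  also have "... = (comult Drin (pt \<zeta> uH) *E comult Drin (pt eps h)) *E comult Drin (pt eps l)"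
   using x by (simp add: comult_eps_mult DD_assoc pc oneH eps_closed)
  also have "... = comult Drin (pt \<zeta> h) *E comult Drin (pt eps l)"
   using comult_pt_split[OF x(1,2)] by simp
  finally show "comult Drin (pt \<zeta> (h ** l)) = comult Drin (pt \<zeta> h) *E comult Drin (pt eps l)" .
 qed (use that in \<open>auto simp: comult_cross Drin_simps(1)\<close>)
qed

lemma alg_scalars: "alg (scalars K)"
 by (rule assoc_algebraI[OF vs_scalars])
  (auto intro!: bilI linI simp: l_distr r_distr m_assoc m_lcomm)

lemma counit_Drin_hom: "counit Drin \<in> alg_hom K Drin (scalars K)"
proof (rule alg_homI[OF algD alg_scalars])
 interpret A: assoc_algebra K H by (rule algH)
 show "lin Drin (scalars K) (counit Drin)" unfolding Drin_same by (rule lin_counit_Drin)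
 show "counit Drin \<one>\<^bsub>Drin\<^esub> = \<one>\<^bsub>scalars K\<^esub>"
  by (simp add: Drin_simps counit_pt eps_closed oneH eps_apply counit_one)
 have c1: "conv \<xi> \<zeta> uH = \<zeta> uH \<otimes> \<xi> uH" if x: "\<xi> .: Hs" "\<zeta> .: Hs" for \<xi> \<zeta>
  unfolding conv_apply[OF oneH] by (rule sw_one[OF vs_scalars]) ((assumption | rule fcalc x)+)
 show "counit Drin (u *D v) = counit Drin u \<otimes>\<^bsub>scalars K\<^esub> counit Drin v"
  if "u .: Drin" "v .: Drin" for u v
 proof (rule Drin_hom_ext[OF alg_scalars lin_counit_Drin])
  fix h \<xi> assume x: "h .: H" "\<xi> .: Hs"
  let ?k = "scalars K"
  \<comment> \<open>After evaluation at 1 the crossed functional leaves \<xi>(S(a) c) with the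
    middle leg under the counit; the outer legs become adjacent and the antipode axiom
    applies.\<close>
  have "counit Drin (pt eps h *D pt \<xi> uH) = sw3 ?k h (%a b c. counit Drin (pt (act a \<xi> c) b))"
   unfolding pt_eps_mult[OF x]
   by (rule sw3_comp[OF lin_counit_Drin vsDT vs_scalars triI x(1)]; (assumption | rule gcalc x)+)
  also have "... = sw3 ?k h (%a b c. \<epsilon> b \<odot>\<^bsub>?k\<^esub> \<xi> (S a ** c))"
   by (rule sw3_cong[symmetric, OF x(1)])
    (simp add: counit_pt act_closed x act_apply oneH m_comm counit_closed dual_app_closed[OF x(2)] antipode_closed)
  also have "... = sw ?k h (%a c. \<xi> (S a ** c))"
   by (rule sw_cong[OF x(1)], rule sw_counit(2)[OF vs_scalars];
    (assumption | rule gcalc x)+)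
  also have "... = \<epsilon> h \<odot>\<^bsub>?k\<^esub> \<xi> uH"
   by (rule sw_antipode(1)[OF vs_scalars _ x(1)]) ((assumption | rule gcalc x)+)
  finally show "counit Drin (pt eps h *D pt \<xi> uH) = counit Drin (pt eps h) \<otimes>\<^bsub>?k\<^esub> counit Drin (pt \<xi> uH)"
   using x by (simp add: counit_pt eps_closed oneH eps_apply counit_one counit_closed dual_app_closed[OF x(2)])
 qed (use that in \<open>auto simp: Drin_simps(1) counit_pt conv_closed oneH eps_closed c1 counit_one counit_mult
   eps_apply dual_app_closed counit_closed m_ac\<close>)
qed

lemma Drin_smult: "c \<odot>\<^bsub>Drin\<^esub> u = c \<odot>\<^bsub>DT\<^esub> u"
 by (simp add: drinfeld_double_def Let_def)

lemma bialgebra_Drin: "bialgebra K Drin"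
proof -
 interpret Dr: assoc_algebra K Drin by (rule algD)
 have "coalgebra K Drin"
  unfolding coalgebra_def coalgebra_axioms_def
  by (simp add: Dr.vectorspace_axioms linear_map_iff Drin_same Drin_simps(1) vs_tensor vsDT vsTT vs_scalars
    lin_comult_Drin lin_counit_Drin Drin_coassoc Drin_smult Drin_counit)
 then show ?thesis
  unfolding bialgebra_def bialgebra_axioms_def
  using algD comult_Drin_hom counit_Drin_hom by simp
qed

end

section \<open>Presentations of algebras\<close>

context field_base
begin

subsection \<open>The free algebra\<close>

lemma same_space_free_alg: "same_space (free_alg K Y) (free_space K (lists Y))"
 by (simp add: same_space_def free_alg_def)

lemmas free_alg_eqs = same_space_eqs[OF same_space_free_alg] same_space_bil[OF same_space_free_alg]

lemma free_alg_simps: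
 "carrier (free_alg K Y) = carrier (free_space K (lists Y))" "\<one>\<^bsub>free_alg K Y\<^esub> = generator K []"
 "f \<otimes>\<^bsub>free_alg K Y\<^esub> g = (%w. \<Oplus>i\<in>{..length w}. f (take i w) \<otimes> g (drop i w))"
 by (simp_all add: free_alg_def)

lemma free_alg_mult_closed:
 assumes f: "f .: (free_space K (lists Y))" and g: "g .: (free_space K (lists Y))"
 shows "f \<otimes>\<^bsub>free_alg K Y\<^esub> g .: (free_space K (lists Y))"
proof -
 have c: "f w .: K" "g w .: K" for w using f g by (auto simp: free_space_carrier)
 let ?h = "f \<otimes>\<^bsub>free_alg K Y\<^esub> g"
 let ?S = "(%(u, v). u @ v) ` ({u. f u \<noteq> \<zero>} \<times> {v. g v \<noteq> \<zero>})"
 have "w \<in> ?S" if "?h w \<noteq> \<zero>" for w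
 proof (rule ccontr)
  assume w: "w \<notin> ?S"
  have "f (take i w) = \<zero> \<or> g (drop i w) = \<zero>" for i
  proof (rule ccontr)
   assume "\<not> ?thesis"
   then have "take i w @ drop i w \<in> ?S" by blast
   then show False using w by simp
  qed
  then have "f (take i w) \<otimes> g (drop i w) = \<zero>" for i using c by (metis l_null r_null)
  then have "?h w = \<zero>" by (simp add: free_alg_simps(3))
  then show False using that by simp
 qed
 then have "{w. ?h w \<noteq> \<zero>} \<subseteq> ?S" by blast
 moreover have "finite ?S" using f g by (simp add: free_space_carrier)
 moreover have "?S \<subseteq> lists Y"
 proof (rule image_subsetI)
  fix p assume p: "p \<in> {u. f u \<noteq> \<zero>} \<times> {v. g v \<noteq> \<zero>}"
  have "fst p \<in> {u. f u \<noteq> \<zero>}" "snd p \<in> {v. g v \<noteq> \<zero>}" using p by auto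
  then have "fst p \<in> lists Y" "snd p \<in> lists Y" using f g unfolding free_space_carrier by blast+
  then show "(case p of (u, v) \<Rightarrow> u @ v) \<in> lists Y" by (simp add: case_prod_beta)
 qed
 moreover have "?h w .: K" for w using c by (simp add: free_alg_simps(3) Pi_iff)
 ultimately show ?thesis by (auto simp: free_space_carrier intro: finite_subset)
qed

lemma free_alg_bil: "bil (free_space K (lists Y)) (free_space K (lists Y)) (free_space K (lists Y)) (%f g. f \<otimes>\<^bsub>free_alg K Y\<^esub> g)"
proof (intro bilI linI free_alg_mult_closed)
 fix f g h assume "f .: (free_space K (lists Y))" "g .: (free_space K (lists Y))"
  "h .: (free_space K (lists Y))"
 then have c: "f w .: K" "g w .: K" "h w .: K" for w by (auto simp: free_space_carrier)
 show "f \<otimes>\<^bsub>free_alg K Y\<^esub> (g \<oplus>\<^bsub>free_space K (lists Y)\<^esub> h) =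
   f \<otimes>\<^bsub>free_alg K Y\<^esub> g \<oplus>\<^bsub>free_space K (lists Y)\<^esub> f \<otimes>\<^bsub>free_alg K Y\<^esub> h"
  "(g \<oplus>\<^bsub>free_space K (lists Y)\<^esub> h) \<otimes>\<^bsub>free_alg K Y\<^esub> f =
   g \<otimes>\<^bsub>free_alg K Y\<^esub> f \<oplus>\<^bsub>free_space K (lists Y)\<^esub> h \<otimes>\<^bsub>free_alg K Y\<^esub> f"
  using c by (auto simp: free_alg_simps(3) l_distr r_distr finsum_addf Pi_iff intro!: ext)
next
 fix k f g assume "k .: K" "f .: (free_space K (lists Y))" "g .: (free_space K (lists Y))"
 then have c: "f w .: K" "g w .: K" "k .: K" for w by (auto simp: free_space_carrier)
 have k: "(\<Oplus>i\<in>{..n}. k \<otimes> F i) = k \<otimes> (\<Oplus>i\<in>{..n}. F i)" if "!!i. F i .: K" for F and n :: nat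
  using that c(3) by (intro finsum_rdistr[symmetric]) auto
 show "f \<otimes>\<^bsub>free_alg K Y\<^esub> (k \<odot>\<^bsub>free_space K (lists Y)\<^esub> g) = k \<odot>\<^bsub>free_space K (lists Y)\<^esub> (f \<otimes>\<^bsub>free_alg K Y\<^esub> g)"
  "(k \<odot>\<^bsub>free_space K (lists Y)\<^esub> g) \<otimes>\<^bsub>free_alg K Y\<^esub> f = k \<odot>\<^bsub>free_space K (lists Y)\<^esub> (g \<otimes>\<^bsub>free_alg K Y\<^esub> f)"
  using c by (auto simp: free_alg_simps(3) m_assoc m_lcomm[of _ k] k intro!: ext)
qed

lemma generator_mult: "generator K u \<otimes>\<^bsub>free_alg K Y\<^esub> generator K v = generator K (u @ v)"
proof
 fix w
 \<comment> \<open>Only the cut of the word at position \<open>length u\<close> contributes, and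
   only if the word is \<open>u @ v\<close>.\<close>
 have "(\<Oplus>i\<in>{..length w}. generator K u (take i w) \<otimes> generator K v (drop i w)) =
   (\<Oplus>i\<in>{..length w}. if length u = i then (if w = u @ v then \<one> else \<zero>) else \<zero>)"
 proof (rule finsum_cong')
  fix i assume "i \<in> {..length w}"
  then show "generator K u (take i w) \<otimes> generator K v (drop i w) =
    (if length u = i then (if w = u @ v then \<one> else \<zero>) else \<zero>)"
   using append_take_drop_id[of i w] by (auto simp: generator_def min_def)
 qed auto
 also have "... = (if w = u @ v then \<one> else \<zero>)"
 proof (cases "w = u @ v")
  case True
  then show ?thesis using finsum_singleton[of "length u" "{..length w}" "%i. \<one>"] by simp
 next
  case False
  have "(\<Oplus>i\<in>{..length w}. if length u = i then (if w = u @ v then \<one> else \<zero>) else \<zero>) = (\<Oplus>i\<in>{..length w}. \<zero>)"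
   by (rule finsum_cong') (use False in auto)
  then show ?thesis using False by simp
 qed
 finally show "(generator K u \<otimes>\<^bsub>free_alg K Y\<^esub> generator K v) w = generator K (u @ v) w"
  by (simp add: free_alg_simps(3)) (simp add: generator_def)
qed

lemma free_alg_algebra: "alg (free_alg K Y)"
proof (rule assoc_algebraI)
 let ?F = "free_space K (lists Y)" and ?M = "free_alg K Y"
 note b = free_alg_bil[of Y]
 show "vs ?M" using same_space_vs[OF same_space_free_alg] vs_free_space by metis
 show "bil ?M ?M ?M (%f g. f \<otimes>\<^bsub>?M\<^esub> g)" unfolding free_alg_eqs by (rule b)
 have gc: "generator K w .: ?F" if "w \<in> lists Y" for w by (rule generator_closed[OF that])
 show "\<one>\<^bsub>?M\<^esub> .: ?M" unfolding free_alg_simps by (rule gc) simp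
 show "\<one>\<^bsub>?M\<^esub> \<otimes>\<^bsub>?M\<^esub> f = f" if "f .: ?M" for f
  by (rule free_space_ext[OF vs_free_space[of "lists Y"], of _ "%f. \<one>\<^bsub>?M\<^esub> \<otimes>\<^bsub>?M\<^esub> f" "%f. f"])
   (use that in \<open>simp_all only: free_alg_simps(1,2) bil1[OF b gc] lin_id generator_mult append_Nil lists.Nil\<close>)
 show "f \<otimes>\<^bsub>?M\<^esub> \<one>\<^bsub>?M\<^esub> = f" if "f .: ?M" for f
  by (rule free_space_ext[OF vs_free_space[of "lists Y"], of _ "%f. f \<otimes>\<^bsub>?M\<^esub> \<one>\<^bsub>?M\<^esub>" "%f. f"])
   (use that in \<open>simp_all only: free_alg_simps(1,2) bil2[OF b gc] lin_id generator_mult append_Nil2 lists.Nil\<close>)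
 fix f g h assume c: "f .: ?M" "g .: ?M" "h .: ?M"
 note c = c[unfolded free_alg_simps(1)]
 note t = lin_compose[OF bil1[OF b]] lin_compose[OF bil2[OF b]] bil_closed[OF b] lin_id gc vs_free_space c
 show "(f \<otimes>\<^bsub>?M\<^esub> g) \<otimes>\<^bsub>?M\<^esub> h = f \<otimes>\<^bsub>?M\<^esub> (g \<otimes>\<^bsub>?M\<^esub> h)"
 proof (rule free_space_ext[OF vs_free_space _ _ _ c(1), of _ "%f. (f \<otimes>\<^bsub>?M\<^esub> g) \<otimes>\<^bsub>?M\<^esub> h"])
  show "lin ?F ?F (%f. f \<otimes>\<^bsub>?M\<^esub> g \<otimes>\<^bsub>?M\<^esub> h)" "lin ?F ?F (%f. f \<otimes>\<^bsub>?M\<^esub> (g \<otimes>\<^bsub>?M\<^esub> h))" by (assumption | rule t)+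
  fix u assume u: "u \<in> lists Y"
  show "(generator K u \<otimes>\<^bsub>?M\<^esub> g) \<otimes>\<^bsub>?M\<^esub> h = generator K u \<otimes>\<^bsub>?M\<^esub> (g \<otimes>\<^bsub>?M\<^esub> h)"
  proof (rule free_space_ext[OF vs_free_space _ _ _ c(2), of _ "%g. (generator K u \<otimes>\<^bsub>?M\<^esub> g) \<otimes>\<^bsub>?M\<^esub> h"])
   show "lin ?F ?F (%g. generator K u \<otimes>\<^bsub>?M\<^esub> g \<otimes>\<^bsub>?M\<^esub> h)" "lin ?F ?F (%g. generator K u \<otimes>\<^bsub>?M\<^esub> (g \<otimes>\<^bsub>?M\<^esub> h))"
    by (assumption | rule t u)+
   fix v assume v: "v \<in> lists Y"
   show "(generator K u \<otimes>\<^bsub>?M\<^esub> generator K v) \<otimes>\<^bsub>?M\<^esub> h = generator K u \<otimes>\<^bsub>?M\<^esub> (generator K v \<otimes>\<^bsub>?M\<^esub> h)"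
   proof (rule free_space_ext[OF vs_free_space _ _ _ c(3), of _ "%h. (generator K u \<otimes>\<^bsub>?M\<^esub> generator K v) \<otimes>\<^bsub>?M\<^esub> h"])
    show "lin ?F ?F (%h. generator K u \<otimes>\<^bsub>?M\<^esub> generator K v \<otimes>\<^bsub>?M\<^esub> h)"
     "lin ?F ?F (%h. generator K u \<otimes>\<^bsub>?M\<^esub> (generator K v \<otimes>\<^bsub>?M\<^esub> h))"
     by (assumption | rule t u v)+
   qed (simp only: generator_mult append_assoc)
  qed
 qed
qed

lemma free_alg_universal:
 assumes B: "alg B" and \<phi>: "\<phi> \<in> Y \<rightarrow> carrier B"
 obtains \<theta> where "\<theta> \<in> alg_hom K (free_alg K Y) B" "!!y. y \<in> Y ==> \<theta> (generator K [y]) = \<phi> y"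
proof -
 interpret B: assoc_algebra K B by (rule B)
 let ?F = "free_space K (lists Y)" and ?M = "free_alg K Y"
 define ev where "ev w = foldr (%y b. \<phi> y \<otimes>\<^bsub>B\<^esub> b) w \<one>\<^bsub>B\<^esub>" for w
 have evc: "ev w .: B" if "w \<in> lists Y" for w
  using that \<phi> by (induction w) (auto simp: ev_def)
 have eva: "ev (u @ v) = ev u \<otimes>\<^bsub>B\<^esub> ev v" if "u \<in> lists Y" "v \<in> lists Y" for u v
  using that
 proof (induction u)
  case Nil
  then show ?case using evc[OF Nil(1)] by (simp add: ev_def)
 next
  case (Cons y u)
  then have "\<phi> y .: B" using \<phi> by auto
  then show ?case using Cons evc[of u] evc[of v] by (simp add: ev_def B.m_assoc)
 qed
 let ?\<theta> = "free_lift B ev"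
 have evp: "ev \<in> lists Y \<rightarrow> carrier B" using evc by blast
 have l: "lin ?F B ?\<theta>" by (rule lin_free_lift[OF B.vectorspace_axioms evp])
 have g: "?\<theta> (generator K w) = ev w" if "w \<in> lists Y" for w
  by (rule free_lift_generator[where \<phi> = ev, OF B.vectorspace_axioms evc[OF that]])
 note b = free_alg_bil[of Y]
 have gc: "generator K w .: ?F" if "w \<in> lists Y" for w by (rule generator_closed[OF that])
 note t = lin_compose[OF l] lin_compose[OF bil1[OF b]] lin_compose[OF bil2[OF b]] bil_closed[OF b] lin_id gc
  lin_mult_left[OF _ B] lin_mult_right[OF _ B] lin_closed[OF l]
 have "?\<theta> \<in> alg_hom K ?M B"
 proof (rule alg_homI[OF free_alg_algebra B])
  show "lin ?M B ?\<theta>" unfolding free_alg_eqs by (rule l)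
  show "?\<theta> \<one>\<^bsub>?M\<^esub> = \<one>\<^bsub>B\<^esub>" unfolding free_alg_simps by (subst g) (simp_all add: ev_def)
  fix f h assume c: "f .: ?M" "h .: ?M"
  note c = c[unfolded free_alg_simps(1)]
  show "?\<theta> (f \<otimes>\<^bsub>?M\<^esub> h) = ?\<theta> f \<otimes>\<^bsub>B\<^esub> ?\<theta> h"
  proof (rule free_space_ext[OF B.vectorspace_axioms _ _ _ c(1), of "%f. ?\<theta> (f \<otimes>\<^bsub>?M\<^esub> h)"])
   show "lin ?F B (%f. ?\<theta> (f \<otimes>\<^bsub>?M\<^esub> h))" "lin ?F B (%f. ?\<theta> f \<otimes>\<^bsub>B\<^esub> ?\<theta> h)" by (assumption | rule t c)+
   fix u assume u: "u \<in> lists Y"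
   show "?\<theta> (generator K u \<otimes>\<^bsub>?M\<^esub> h) = ?\<theta> (generator K u) \<otimes>\<^bsub>B\<^esub> ?\<theta> h"
   proof (rule free_space_ext[OF B.vectorspace_axioms _ _ _ c(2), of "%h. ?\<theta> (generator K u \<otimes>\<^bsub>?M\<^esub> h)"])
    show "lin ?F B (%h. ?\<theta> (generator K u \<otimes>\<^bsub>?M\<^esub> h))" "lin ?F B (%h. ?\<theta> (generator K u) \<otimes>\<^bsub>B\<^esub> ?\<theta> h)"
     by (assumption | rule t c u)+
    show "?\<theta> (generator K u \<otimes>\<^bsub>?M\<^esub> generator K v) = ?\<theta> (generator K u) \<otimes>\<^bsub>B\<^esub> ?\<theta> (generator K v)"
     if "v \<in> lists Y" for v
     using that u by (simp add: generator_mult g eva del: append_in_lists_conv) (subst g, simp_all add: eva)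
   qed
  qed
 qed
 moreover have "?\<theta> (generator K [y]) = \<phi> y" if "y \<in> Y" for y
  using that \<phi> by (subst g) (auto simp: ev_def Pi_iff)
 ultimately show thesis using that by blast
qed

subsection \<open>Quotient algebras\<close>

text \<open>Ideals of the underlying ring are closed under scalars because c x = (c 1) x. Hence
  \<open>genideal\<close>, which refers to the ring structure alone, yields quotients that are
  algebras.\<close>

lemma ideal_submodule:
 assumes A: "alg A" and I: "ideal I A"
 shows "submodule K I A"
proof -
 interpret A: assoc_algebra K A by (rule A)
 interpret I: ideal I A by (rule I)
 have "c \<odot>\<^bsub>A\<^esub> x \<in> I" if "c .: K" "x \<in> I" for c x
 proof -
  have "x .: A" using that I.a_subset by blast
  then have "c \<odot>\<^bsub>A\<^esub> x = (c \<odot>\<^bsub>A\<^esub> \<one>\<^bsub>A\<^esub>) \<otimes>\<^bsub>A\<^esub> x" using that by (simp add: A.smult_mult_left)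
  then show ?thesis using that I.I_l_closed by simp
 qed
 then show ?thesis
  unfolding submodule_def using A.module_axioms I.a_subset by auto
qed

lemma quotient_algebra:
 assumes A: "alg A" and I: "ideal I A"
 shows "alg (quotient A I)" and "(%x. I +>\<^bsub>A\<^esub> x) \<in> alg_hom K A (quotient A I)"
proof -
 interpret A: assoc_algebra K A by (rule A)
 interpret I: ideal I A by (rule I)
 note s = ideal_submodule[OF A I] and vA = A.vectorspace_axioms
 note Q = quotient_coset(1-3)[OF vA s]
 note vQ = vs_quotient[OF vA s]
 have m: "(I +>\<^bsub>A\<^esub> x) \<otimes>\<^bsub>quotient A I\<^esub> (I +>\<^bsub>A\<^esub> y) = I +>\<^bsub>A\<^esub> (x \<otimes>\<^bsub>A\<^esub> y)" if "x .: A" "y .: A" for x y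
  using that by (simp add: quotient_def FactRing_def I.rcoset_mult_add)
 have o: "\<one>\<^bsub>quotient A I\<^esub> = I +>\<^bsub>A\<^esub> \<one>\<^bsub>A\<^esub>" by (simp add: quotient_def FactRing_def)
 show alg: "alg (quotient A I)"
 proof (rule assoc_algebraI[OF vQ])
  show "bil (quotient A I) (quotient A I) (quotient A I) (%x y. x \<otimes>\<^bsub>quotient A I\<^esub> y)"
  proof (intro bilI linI)
   fix u v assume "u .: (quotient A I)" "v .: (quotient A I)"
   then show "u \<otimes>\<^bsub>quotient A I\<^esub> v .: (quotient A I)" "v \<otimes>\<^bsub>quotient A I\<^esub> u .: (quotient A I)"
    by (fastforce simp: Q m)+
  next
   fix u v w assume "u .: (quotient A I)" "v .: (quotient A I)" "w .: (quotient A I)"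
   then obtain x y z where x: "x .: A" "y .: A" "z .: A"
    "u = I +>\<^bsub>A\<^esub> x" "v = I +>\<^bsub>A\<^esub> y" "w = I +>\<^bsub>A\<^esub> z" by (auto simp: Q(1))
   then show "u \<otimes>\<^bsub>quotient A I\<^esub> (v \<oplus>\<^bsub>quotient A I\<^esub> w) = u \<otimes>\<^bsub>quotient A I\<^esub> v \<oplus>\<^bsub>quotient A I\<^esub> u \<otimes>\<^bsub>quotient A I\<^esub> w"
    "(v \<oplus>\<^bsub>quotient A I\<^esub> w) \<otimes>\<^bsub>quotient A I\<^esub> u = v \<otimes>\<^bsub>quotient A I\<^esub> u \<oplus>\<^bsub>quotient A I\<^esub> w \<otimes>\<^bsub>quotient A I\<^esub> u"
    by (simp_all add: Q(2) m A.l_distr A.r_distr)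
  next
   fix c u v assume c: "c .: K" "u .: (quotient A I)" "v .: (quotient A I)"
   then obtain x y where x: "x .: A" "y .: A" "u = I +>\<^bsub>A\<^esub> x" "v = I +>\<^bsub>A\<^esub> y" by (auto simp: Q(1))
   then show "u \<otimes>\<^bsub>quotient A I\<^esub> (c \<odot>\<^bsub>quotient A I\<^esub> v) = c \<odot>\<^bsub>quotient A I\<^esub> (u \<otimes>\<^bsub>quotient A I\<^esub> v)"
    "(c \<odot>\<^bsub>quotient A I\<^esub> v) \<otimes>\<^bsub>quotient A I\<^esub> u = c \<odot>\<^bsub>quotient A I\<^esub> (v \<otimes>\<^bsub>quotient A I\<^esub> u)"
    using c(1) by (simp_all add: Q(3) m A.smult_mult_left A.smult_mult_right)
  qed
  show "\<one>\<^bsub>quotient A I\<^esub> .: (quotient A I)" by (auto simp: Q(1) o)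
  show "(u \<otimes>\<^bsub>quotient A I\<^esub> v) \<otimes>\<^bsub>quotient A I\<^esub> w = u \<otimes>\<^bsub>quotient A I\<^esub> (v \<otimes>\<^bsub>quotient A I\<^esub> w)"
   if "u .: (quotient A I)" "v .: (quotient A I)" "w .: (quotient A I)" for u v w
   using that by (auto simp: Q(1) m A.m_assoc)
  show "\<one>\<^bsub>quotient A I\<^esub> \<otimes>\<^bsub>quotient A I\<^esub> u = u" "u \<otimes>\<^bsub>quotient A I\<^esub> \<one>\<^bsub>quotient A I\<^esub> = u"
   if "u .: (quotient A I)" for u
   using that by (auto simp: Q(1) m o)
 qed
 show "(%x. I +>\<^bsub>A\<^esub> x) \<in> alg_hom K A (quotient A I)"
  by (rule alg_homI[OF A alg lin_coset[OF vA s]]) (simp_all add: m o)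
qed

lemma alg_hom_vanish_genideal:
 assumes A: "alg A" and B: "alg B" and f: "f \<in> alg_hom K A B" and S: "S \<subseteq> carrier A"
  and z: "!!x. x \<in> S ==> f x = \<zero>\<^bsub>B\<^esub>" and x: "x \<in> genideal A S"
 shows "f x = \<zero>\<^bsub>B\<^esub>"
proof -
 interpret A: assoc_algebra K A by (rule A)
 interpret B: assoc_algebra K B by (rule B)
 interpret h: ring_hom_ring A B f
  by (rule ring_hom_ringI2[OF A.ring_axioms B.ring_axioms]) (use f in \<open>simp add: alg_hom_iff\<close>)
 have k: "a_kernel A B f = {x \<in> carrier A. f x = \<zero>\<^bsub>B\<^esub>}" by (rule a_kernel_def')
 have "S \<subseteq> a_kernel A B f"
 proof
  show "y \<in> a_kernel A B f" if "y \<in> S" for y using that S z[OF that] unfolding k by blast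
 qed
 from A.genideal_minimal[OF h.kernel_is_ideal this] x have "x \<in> a_kernel A B f" by (rule subsetD)
 then show ?thesis unfolding k by simp
qed

lemma presentation:
 assumes A: "alg A" and S: "S \<subseteq> carrier A"
 defines "Q \<equiv> quotient A (genideal A S)" and "\<pi> \<equiv> %x. genideal A S +>\<^bsub>A\<^esub> x"
 shows presentation_algebra: "alg Q"
  and presentation_hom: "\<pi> \<in> alg_hom K A Q"
  and presentation_surj: "t .: Q ==> \<exists>x\<in>carrier A. t = \<pi> x"
  and presentation_relation: "x \<in> S ==> \<pi> x = \<zero>\<^bsub>Q\<^esub>"
  and presentation_lift: "[|alg B; f \<in> alg_hom K A B; !!x. x \<in> S ==> f x = \<zero>\<^bsub>B\<^esub>|]
   ==> \<exists>g\<in>alg_hom K Q B. \<forall>x\<in>carrier A. g (\<pi> x) = f x"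
  and presentation_ext: "[|!!x. x .: A ==> F (\<pi> x) = G (\<pi> x); t .: Q|] ==> F t = G t"
proof -
 interpret A: assoc_algebra K A by (rule A)
 let ?I = "genideal A S"
 have I: "ideal ?I A" by (rule A.genideal_ideal[OF S])
 note s = ideal_submodule[OF A I] and vA = A.vectorspace_axioms
 note Qc = quotient_coset[OF vA s]
 show alg: "alg Q" and hom: "\<pi> \<in> alg_hom K A Q"
  unfolding Q_def \<pi>_def by (rule quotient_algebra[OF A I])+
 show surj: "t .: Q ==> \<exists>x\<in>carrier A. t = \<pi> x" for t
  unfolding Q_def \<pi>_def Qc(1) .
 show "\<pi> x = \<zero>\<^bsub>Q\<^esub>" if "x \<in> S"
 proof -
  have "x .: A" "x \<in> ?I" using that S A.genideal_self[OF S] by blast+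
  then have "\<pi> x = \<pi> \<zero>\<^bsub>A\<^esub>" unfolding \<pi>_def using Qc(4)[of x "\<zero>\<^bsub>A\<^esub>"] by (simp add: a_minus_def)
  also have "... = \<zero>\<^bsub>Q\<^esub>" by (rule lin_zero[OF vA assoc_algebraD(1)[OF alg] alg_homD(1)[OF hom]])
  finally show ?thesis .
 qed
 show "\<exists>g\<in>alg_hom K Q B. \<forall>x\<in>carrier A. g (\<pi> x) = f x"
  if B: "alg B" and f: "f \<in> alg_hom K A B" and z: "!!x. x \<in> S ==> f x = \<zero>\<^bsub>B\<^esub>"
 proof -
  have v: "f x = \<zero>\<^bsub>B\<^esub>" if "x \<in> ?I" for x by (rule alg_hom_vanish_genideal[OF A B f S z that])
  let ?g = "%t. f (SOME u. u \<in> t)"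
  note vB = assoc_algebraD(1)[OF B]
  have e: "?g (\<pi> x) = f x" if "x .: A" for x
   unfolding \<pi>_def by (rule quotient_SOME[OF vA s vB alg_homD(1)[OF f] v that])
  have "?g \<in> alg_hom K Q B"
  proof (rule alg_homI[OF alg B])
   show "lin Q B ?g" unfolding Q_def by (rule lin_quotient_lift[OF vA s vB alg_homD(1)[OF f] v])
   show "?g \<one>\<^bsub>Q\<^esub> = \<one>\<^bsub>B\<^esub>" using e[OF A.one_closed] alg_homD(2)[OF hom] alg_homD(2)[OF f] by simp
   fix t u assume "t .: Q" "u .: Q"
   then obtain x y where x: "x .: A" "y .: A" "t = \<pi> x" "u = \<pi> y" using surj by meson
   have "t \<otimes>\<^bsub>Q\<^esub> u = \<pi> (x \<otimes>\<^bsub>A\<^esub> y)" using alg_homD(3)[OF hom x(1,2)] x by simp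
   then show "?g (t \<otimes>\<^bsub>Q\<^esub> u) = ?g t \<otimes>\<^bsub>B\<^esub> ?g u"
    using e[of "x \<otimes>\<^bsub>A\<^esub> y"] e[OF x(1)] e[OF x(2)] x alg_homD(3)[OF f x(1,2)] by simp
  qed
  then show ?thesis by (rule rev_bexI) (intro ballI e)
 qed
 show "F t = G t" if "!!x. x .: A ==> F (\<pi> x) = G (\<pi> x)" "t .: Q"
 proof -
  obtain x where "x .: A" "t = \<pi> x" using surj[OF \<open>t .: Q\<close>] by (rule bexE)
  then show ?thesis by (simp add: that(1))
 qed
qed

subsection \<open>Free products\<close>

text \<open>The relations of a free product make sense for any vector space with a closed product
  and a unit. The opposite dual of H-hat enters at this level; associativity in the free product is
  supplied by the free algebra.\<close>

definition prealg :: "('k, 'b, 'm) module_scheme \<Rightarrow> bool"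
 where "prealg B \<longleftrightarrow> vs B \<and> \<one>\<^bsub>B\<^esub> .: B \<and> (\<forall>x\<in>carrier B. \<forall>y\<in>carrier B. x \<otimes>\<^bsub>B\<^esub> y .: B)"

definition prehom :: "('k, 'b, 'm) module_scheme \<Rightarrow> ('k, 'c, 'n) module_scheme \<Rightarrow> ('b \<Rightarrow> 'c) \<Rightarrow> bool"
 where "prehom B M f \<longleftrightarrow> lin B M f \<and> f \<one>\<^bsub>B\<^esub> = \<one>\<^bsub>M\<^esub> \<and>
  (\<forall>x\<in>carrier B. \<forall>y\<in>carrier B. f (x \<otimes>\<^bsub>B\<^esub> y) = f x \<otimes>\<^bsub>M\<^esub> f y)"

lemma prealg_algebra: "alg A ==> prealg A"
 by (simp add: prealg_def assoc_algebraD(1) one_closed' mult_closed)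

lemma prehom_alg_hom: "f \<in> alg_hom K A B ==> prehom A B f"
 by (simp add: prehom_def alg_homD)

lemma hom_relations_closed:
 assumes M: "alg M" and B: "prealg B" and j: "j \<in> carrier B \<rightarrow> carrier M"
 shows "hom_relations K B M j \<subseteq> carrier M"
proof -
 interpret M: assoc_algebra K M by (rule M)
 interpret VB: vectorspace K B using B by (simp add: prealg_def)
 have c: "j x .: M" if "x .: B" for x using j that by blast
 have B': "\<one>\<^bsub>B\<^esub> .: B" "!!x y. [|x .: B; y .: B|] ==> x \<otimes>\<^bsub>B\<^esub> y .: B"
  using B by (auto simp: prealg_def)
 show ?thesis unfolding hom_relations_def by (auto simp: c B')
qed

text \<open>Read in both directions: for the projection onto the free product it shows that the
  canonical maps are homomorphisms, and for a map built from given homomorphisms it shows that the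
  map factors through the quotient.\<close>

lemma hom_relations_vanish:
 assumes M: "alg M" and N: "alg N" and B: "prealg B" and j: "j \<in> carrier B \<rightarrow> carrier M"
  and f: "f \<in> alg_hom K M N"
 shows "(\<forall>r\<in>hom_relations K B M j. f r = \<zero>\<^bsub>N\<^esub>) \<longleftrightarrow> prehom B N (%b. f (j b))"
proof -
 interpret M: assoc_algebra K M by (rule M)
 interpret N: assoc_algebra K N by (rule N)
 interpret VB: vectorspace K B using B by (simp add: prealg_def)
 have c: "j x .: M" if "x .: B" for x using j that by blast
 have B': "\<one>\<^bsub>B\<^esub> .: B" "!!x y. [|x .: B; y .: B|] ==> x \<otimes>\<^bsub>B\<^esub> y .: B"
  using B by (auto simp: prealg_def)
 note m = lin_minus[OF assoc_algebraD(1)[OF M] assoc_algebraD(1)[OF N] alg_homD(1)[OF f]]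
 note d = diff_zero_iff[OF N.abelian_group_axioms]
 have "(\<forall>r\<in>hom_relations K B M j. f r = \<zero>\<^bsub>N\<^esub>) \<longleftrightarrow>
  (\<forall>a\<in>carrier B. \<forall>b\<in>carrier B. f (j (a \<oplus>\<^bsub>B\<^esub> b) \<ominus>\<^bsub>M\<^esub> (j a \<oplus>\<^bsub>M\<^esub> j b)) = \<zero>\<^bsub>N\<^esub>) \<and>
  (\<forall>c\<in>carrier K. \<forall>a\<in>carrier B. f (j (c \<odot>\<^bsub>B\<^esub> a) \<ominus>\<^bsub>M\<^esub> c \<odot>\<^bsub>M\<^esub> j a) = \<zero>\<^bsub>N\<^esub>) \<and>
  (\<forall>a\<in>carrier B. \<forall>b\<in>carrier B. f (j (a \<otimes>\<^bsub>B\<^esub> b) \<ominus>\<^bsub>M\<^esub> j a \<otimes>\<^bsub>M\<^esub> j b) = \<zero>\<^bsub>N\<^esub>) \<and>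
  f (j \<one>\<^bsub>B\<^esub> \<ominus>\<^bsub>M\<^esub> \<one>\<^bsub>M\<^esub>) = \<zero>\<^bsub>N\<^esub>"
  unfolding hom_relations_def by blast
 then show ?thesis
  by (simp add: d m c B' prehom_def lin_def alg_homD(2-4)[OF f] lin_add[OF alg_homD(1)[OF f]]
    lin_smult[OF alg_homD(1)[OF f]]) blast
qed

definition fp_words :: "('k, 'a, 'm) module_scheme \<Rightarrow> ('k, 'b, 'n) module_scheme \<Rightarrow> ('a + 'b) set"
 where "fp_words A B = Inl ` carrier A \<union> Inr ` carrier B"

lemma free_product_props:
 fixes A :: "('k, 'a, 'm) module_scheme" and B :: "('k, 'b, 'n) module_scheme"
 assumes A: "prealg A" and B: "prealg B"
 defines "P \<equiv> free_product K A B" and "F \<equiv> free_product_cover K A B"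
  and "\<pi> \<equiv> %x. free_product_ideal K A B +>\<^bsub>free_product_cover K A B\<^esub> x"
 shows free_product_algebra: "alg P"
  and free_inl_hom: "prehom A P (free_inl K A B)"
  and free_inr_hom: "prehom B P (free_inr K A B)"
  and free_product_universal: "[|alg M; prehom A M \<phi>; prehom B M \<psi>|]
   ==> \<exists>\<theta>\<in>alg_hom K P M. (\<forall>a\<in>carrier A. \<theta> (free_inl K A B a) = \<phi> a) \<and> (\<forall>b\<in>carrier B. \<theta> (free_inr K A B b) = \<psi> b)"
  and free_product_proj: "\<pi> \<in> alg_hom K (free_alg K (fp_words A B)) P"
  and free_product_surj: "t .: P ==> \<exists>x\<in>carrier (free_alg K (fp_words A B)). t = \<pi> x"
proof -
 let ?i = "%a. generator K [Inl a]" and ?j = "%b. generator K [Inr b]"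
 let ?S = "hom_relations K A F ?i \<union> hom_relations K B F ?j"
 have F: "F = free_alg K (fp_words A B)" by (simp add: F_def free_product_cover_def fp_words_def)
 have algF: "alg F" unfolding F by (rule free_alg_algebra)
 have ij: "?i \<in> carrier A \<rightarrow> carrier F" "?j \<in> carrier B \<rightarrow> carrier F"
  by (auto simp: F free_alg_simps(1) fp_words_def intro!: generator_closed)
 have S: "?S \<subseteq> carrier F" using hom_relations_closed[OF algF A ij(1)] hom_relations_closed[OF algF B ij(2)] by blast
 have I: "free_product_ideal K A B = genideal F ?S" by (simp add: free_product_ideal_def F_def)
 have P: "P = quotient F (genideal F ?S)" by (simp add: P_def free_product_def I F_def)
 have pi: "\<pi> = (%x. genideal F ?S +>\<^bsub>F\<^esub> x)" by (simp add: \<pi>_def I F_def)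
 note pr = presentation[OF algF S, folded P pi]
 show algP: "alg P" by (rule pr(1))
 show "\<pi> \<in> alg_hom K (free_alg K (fp_words A B)) P" using pr(2) by (simp add: F)
 show "t .: P ==> \<exists>x\<in>carrier (free_alg K (fp_words A B)). t = \<pi> x" using pr(3) by (simp add: F)
 have il: "free_inl K A B = (%a. \<pi> (?i a))" and ir: "free_inr K A B = (%b. \<pi> (?j b))"
  by (auto simp: free_inl_def free_inr_def \<pi>_def F_def)
 show "prehom A P (free_inl K A B)" "prehom B P (free_inr K A B)"
  unfolding il ir using hom_relations_vanish[OF algF algP A ij(1) pr(2)] hom_relations_vanish[OF algF algP B ij(2) pr(2)]
   pr(4) by blast+
 show "\<exists>\<theta>\<in>alg_hom K P M. (\<forall>a\<in>carrier A. \<theta> (free_inl K A B a) = \<phi> a) \<and> (\<forall>b\<in>carrier B. \<theta> (free_inr K A B b) = \<psi> b)"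
  if M: "alg M" and \<phi>: "prehom A M \<phi>" and \<psi>: "prehom B M \<psi>"
 proof -
  have "case_sum \<phi> \<psi> \<in> fp_words A B \<rightarrow> carrier M"
   using \<phi> \<psi> by (auto simp: fp_words_def prehom_def lin_closed)
  then obtain \<theta> where \<theta>: "\<theta> \<in> alg_hom K F M" "!!y. y \<in> fp_words A B ==> \<theta> (generator K [y]) = case_sum \<phi> \<psi> y"
   unfolding F by (rule free_alg_universal[OF M]) blast
  have e: "\<theta> (?i a) = \<phi> a" if "a .: A" for a using \<theta>(2)[of "Inl a"] that by (simp add: fp_words_def)
  have e': "\<theta> (?j b) = \<psi> b" if "b .: B" for b using \<theta>(2)[of "Inr b"] that by (simp add: fp_words_def)
  interpret VA: vectorspace K A using A by (simp add: prealg_def)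
  interpret VB: vectorspace K B using B by (simp add: prealg_def)
  have "prehom A M (%a. \<theta> (?i a))" using \<phi> A by (simp add: prehom_def prealg_def lin_def e)
  moreover have "prehom B M (%b. \<theta> (?j b))" using \<psi> B by (simp add: prehom_def prealg_def lin_def e')
  ultimately have z: "\<theta> x = \<zero>\<^bsub>M\<^esub>" if "x \<in> ?S" for x
   using that hom_relations_vanish[OF algF M A ij(1) \<theta>(1)] hom_relations_vanish[OF algF M B ij(2) \<theta>(1)] by blast
  have "\<exists>g\<in>alg_hom K P M. \<forall>x\<in>carrier F. g (\<pi> x) = \<theta> x" by (rule pr(5)[OF M \<theta>(1) z])
  then obtain g where g: "g \<in> alg_hom K P M" "\<forall>x\<in>carrier F. g (\<pi> x) = \<theta> x" by (elim bexE) (rule that)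
  have "g (free_inl K A B a) = \<phi> a" if "a .: A" for a
   unfolding il using bspec[OF g(2) funcset_mem[OF ij(1) that]] e[OF that] by simp
  moreover have "g (free_inr K A B b) = \<psi> b" if "b .: B" for b
   unfolding ir using bspec[OF g(2) funcset_mem[OF ij(2) that]] e'[OF that] by simp
  ultimately show ?thesis using g(1) by (intro bexI[of _ g] conjI ballI)
 qed
qed

text \<open>Induction over words. \<open>Q\<close> is a relation between pairs of linear maps that
  is stable under precomposition with left multiplication by a generator; the letters are absorbed
  into the maps one after another until only the value at 1 has to be compared.\<close>

lemma free_product_induct:
 assumes A: "prealg A" and B: "prealg B" and Z: "vs Z"
  and f: "lin (free_product K A B) Z f" and g: "lin (free_product K A B) Z g"
  and word: "!!f g. [|lin (free_product K A B) Z f; lin (free_product K A B) Z g; Q f g|]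
    ==> f \<one>\<^bsub>free_product K A B\<^esub> = g \<one>\<^bsub>free_product K A B\<^esub>"
  and left: "!!f g a. [|lin (free_product K A B) Z f; lin (free_product K A B) Z g; Q f g; a .: A|]
    ==> Q (%x. f (free_inl K A B a \<otimes>\<^bsub>free_product K A B\<^esub> x)) (%x. g (free_inl K A B a \<otimes>\<^bsub>free_product K A B\<^esub> x))"
  and right: "!!f g b. [|lin (free_product K A B) Z f; lin (free_product K A B) Z g; Q f g; b .: B|]
    ==> Q (%x. f (free_inr K A B b \<otimes>\<^bsub>free_product K A B\<^esub> x)) (%x. g (free_inr K A B b \<otimes>\<^bsub>free_product K A B\<^esub> x))"
  and Q: "Q f g" and t: "t .: (free_product K A B)"
 shows "f t = g t"
proof -
 let ?P = "free_product K A B" and ?Y = "fp_words A B"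
 let ?\<pi> = "%x. free_product_ideal K A B +>\<^bsub>free_product_cover K A B\<^esub> x"
 note P = free_product_algebra[OF A B] and pi = free_product_proj[OF A B]
 note pl = alg_homD(1)[OF pi, unfolded free_alg_eqs]
 have gc: "generator K w .: (free_alg K ?Y)" if "w \<in> lists ?Y" for w
  unfolding free_alg_simps using that by (rule generator_closed)
 have w: "f (?\<pi> (generator K w)) = g (?\<pi> (generator K w))"
  if "w \<in> lists ?Y" "lin ?P Z f" "lin ?P Z g" "Q f g" for w f g
  using that
 proof (induction w arbitrary: f g)
  case Nil
  then show ?case using word alg_homD(2)[OF pi] by (simp add: free_alg_simps(2))
 next
  case (Cons y w)
  have yw: "generator K (y # w) = generator K [y] \<otimes>\<^bsub>free_alg K ?Y\<^esub> generator K w" by (simp add: generator_mult)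
  have e: "?\<pi> (generator K (y # w)) = ?\<pi> (generator K [y]) \<otimes>\<^bsub>?P\<^esub> ?\<pi> (generator K w)"
   unfolding yw by (rule alg_homD(3)[OF pi]; rule gc) (use Cons.hyps in auto)
  have c: "?\<pi> (generator K [y]) .: ?P" by (rule alg_homD(4)[OF pi gc]) (use Cons.hyps in auto)
  have l: "lin ?P Z (%x. h (?\<pi> (generator K [y]) \<otimes>\<^bsub>?P\<^esub> x))" if "lin ?P Z h" for h
   by (rule lin_compose[OF that lin_mult_right[OF lin_id P c]])
  have q: "Q (%x. f (?\<pi> (generator K [y]) \<otimes>\<^bsub>?P\<^esub> x)) (%x. g (?\<pi> (generator K [y]) \<otimes>\<^bsub>?P\<^esub> x))"
   using Cons.hyps(1) left[OF Cons.prems] right[OF Cons.prems]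
   by (auto simp: fp_words_def free_inl_def free_inr_def)
  show ?case unfolding e by (rule Cons.IH[OF l l q]) (rule Cons.prems)+
 qed
 obtain x where x: "x .: (free_alg K ?Y)" "t = ?\<pi> x" using free_product_surj[OF A B t] by blast
 show ?thesis unfolding x(2)
  by (rule free_space_ext[OF Z lin_compose[OF f pl] lin_compose[OF g pl] _ x(1)[unfolded free_alg_simps(1)]])
   (rule w[OF _ f g Q])
qed

end

section \<open>The reflective algebra\<close>

locale ref_base = qt_base K H R for K :: "('k, 'r) ring_scheme" (structure) and H :: "('k, 'h, 'm) hopf_scheme" and R +
 fixes A :: "('k, 'a, 'n) module_scheme" and \<rho> :: "'a \<Rightarrow> ('k, 'h, 'a) tensor"
 assumes comod: "left_comodule_algebra K H A \<rho>"
begin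

abbreviation HA where "HA \<equiv> tsp H A"
abbreviation co where "co Z a f \<equiv> lift Z f (\<rho> a)"

lemma algA: "alg A" and rho_hom: "\<rho> \<in> alg_hom K A (tensor_alg K H A)" and lin_rho0: "lin A HA \<rho>"
proof -
 interpret Co: left_comodule_algebra K H A \<rho> by (rule comod)
 show "alg A" by unfold_locales
 show "\<rho> \<in> alg_hom K A (tensor_alg K H A)" by (rule Co.coaction_hom)
 then show "lin A HA \<rho>" by (simp add: alg_hom_iff same_space_eqs[OF same_space_tensor_alg[of H A]])
qed

lemmas vsA = assoc_algebraD(1)[OF algA]

lemma lin_rho: "lin U A f ==> lin U HA (%x. \<rho> (f x))" and rho_closed: "a .: A ==> \<rho> a .: HA"
 by (rule lin_compose[OF lin_rho0], assumption) (rule lin_closed[OF lin_rho0])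

lemmas acalc = tcalc algA vsA lin_rho rho_closed

lemma co_cong:
 assumes "a .: A"
  and "!!h b. [|h .: H; b .: A|] ==> f h b = g h b"
 shows "co Z a f = co Z a g"
 by (rule tensor_lift_cong[OF rho_closed[OF assms(1)] vsH vsA assms(2)])

lemma co_comp:
 assumes "lin Z Z' F" "vs Z" "vs Z'" "bil H A Z f" "a .: A"
 shows "F (co Z a f) = co Z' a (%h b. F (f h b))"
 by (rule lin_tensor_lift_comp[OF assms(1) vsH vsA assms(2-4) rho_closed[OF assms(5)]])

lemma co_comp':
 assumes "lin Z Z' F" "vs Z" "vs Z'" "bil H A Z f" "a .: A"
  and "!!h b. [|h .: H; b .: A|] ==> F (f h b) = g h b"
 shows "F (co Z a f) = co Z' a g"
 unfolding co_comp[OF assms(1-5)] by (rule co_cong[OF assms(5,6)])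

lemma co_coassoc:
 assumes Z: "vs Z" and a: "a .: A"
  and f: "!!q c. [|q .: H; c .: A|] ==> lin H Z (%x. f x q c)"
   "!!p c. [|p .: H; c .: A|] ==> lin H Z (%x. f p x c)"
   "!!p q. [|p .: H; q .: H|] ==> lin A Z (%x. f p q x)"
 shows "co Z a (%l b. sw Z l (%p q. f p q b)) = co Z a (%p b. co Z b (%q c. f p q c))"
proof -
 interpret Co: left_comodule_algebra K H A \<rho> by (rule comod)
 note t = f Z acalc a
 have b1: "bil HH A Z (%t b. lift Z (%p q. f p q b) t)" by (assumption | rule t)+
 have b0: "bil H A Z (f p)" if "p .: H" for p using that by (intro bilI f)
 have b2: "bil H HA Z (%p t. lift Z (f p) t)" by (assumption | rule t b0)+
 note lid = lin_id[folded id_def]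
 have tc: "tensor_map K H HA id \<rho> (\<rho> a) .: (tsp H HA)"
  by (rule lin_closed[OF lin_tensor_map], (assumption | rule lin_rho0 lid t)+)
 have "co Z a (%l b. sw Z l (%p q. f p q b)) =
   lift Z (%t b. lift Z (%p q. f p q b) t) (tensor_map K HH A \<Delta> id (\<rho> a))"
  by (rule tensor_lift_map[symmetric, where V = H and W = A and W' = A and g = id, simplified])
    ((assumption | rule lin_comult0 Z b1 lid t)+)
 also have "... = lift Z (%t b. lift Z (%p q. f p q b) t)
   (tensor_assoc K H H A (tensor_map K H HA id \<rho> (\<rho> a)))"
  by (simp add: Co.coaction_coassoc[OF a])
 also have "... = lift Z (%u. lift Z (%v w. lift Z (%p q. f p q w) (tens K H H u v)))
   (tensor_map K H HA id \<rho> (\<rho> a))"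
  by (rule tensor_lift_assoc[OF vsH vsH vsA Z b1 tc])
 also have "... = lift Z (%p t. lift Z (f p) t) (tensor_map K H HA id \<rho> (\<rho> a))"
 proof (rule tensor_lift_cong[OF tc vsH, symmetric])
  show "lift Z (f u) t =
    lift Z (%v w. lift Z (%p q. f p q w) (tens K H H u v)) t"
   if u: "u .: H" and "t .: HA" for u t
  proof (rule tensor_lift_cong[OF that(2) vsH vsA])
   fix v w assume vw: "v .: H" "w .: A"
   have "bil H H Z (%p q. f p q w)" using vw by (intro bilI f)
   from tensor_lift_tens[OF vsH vsH Z this u vw(1)]
   show "f u v w = lift Z (%p q. f p q w) (tens K H H u v)" by simp
  qed
 qed (rule acalc)+
 also have "... = co Z a (%p b. co Z b (%q c. f p q c))"
  by (rule tensor_lift_map[where V = H and W = A and f = id, simplified])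
    ((assumption | rule lin_rho0 Z b2 lid t)+)
 finally show ?thesis .
qed

lemma co_counit:
 assumes Z: "vs Z" and f: "lin A Z f" and a: "a .: A"
 shows "co Z a (%h b. \<epsilon> h \<odot>\<^bsub>Z\<^esub> f b) = f a"
proof -
 interpret Co: left_comodule_algebra K H A \<rho> by (rule comod)
 have b: "bil H A A (%h b. \<epsilon> h \<odot>\<^bsub>A\<^esub> b)" by (assumption | rule acalc)+
 have "co Z a (%h b. \<epsilon> h \<odot>\<^bsub>Z\<^esub> f b) = co Z a (%h b. f (\<epsilon> h \<odot>\<^bsub>A\<^esub> b))"
  by (rule co_cong[OF a],
   simp add: lin_smult[OF f] counit_closed)
 also have "... = f (co A a (%h b. \<epsilon> h \<odot>\<^bsub>A\<^esub> b))" by (rule co_comp[symmetric, OF f vsA Z b a])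
 also have "co A a (%h b. \<epsilon> h \<odot>\<^bsub>A\<^esub> b) = a" by (rule Co.coaction_counit[OF a])
 finally show ?thesis .
qed

abbreviation B where "B \<equiv> hat_dual_op K H R"
abbreviation hcom where "hcom \<equiv> comult (hat K H R)"

lemma hat_simps: "same_space (hat K H R) H" "counit (hat K H R) = \<epsilon>"
 "hcom c = Rs HH (%s t. Rs HH (%s' t'. sw HH c (%a b. tens K H H ((t' ** a) ** t) ((b ** s) ** T s'))))"
 by (simp_all add: hat_def same_space_def Let_def)

lemma lin_hcom: "lin H HH hcom"
 unfolding hat_simps(3) by (assumption | rule acalc)+

text \<open>The product in the opposite of the algebra dual to H-hat; it is opposite to convolution
  over the twisted coproduct, so \<zeta> is evaluated on the leading leg.\<close>

definition hconv :: "('h \<Rightarrow> 'k) \<Rightarrow> ('h \<Rightarrow> 'k) \<Rightarrow> 'h \<Rightarrow> 'k"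
 where "hconv \<xi> \<zeta> = (\<lambda>c\<in>carrier H. lift (scalars K) (%x y. \<zeta> x \<otimes> \<xi> y) (hcom c))"

lemma B_simps: "same_space B Hs" "carrier B = carrier Hs" "\<xi> \<otimes>\<^bsub>B\<^esub> \<zeta> = hconv \<xi> \<zeta>" "\<one>\<^bsub>B\<^esub> = eps"
proof -
 have d: "dual_space K (hat K H R) = Hs" by (rule same_space_dual[OF hat_simps(1)])
 have c: "carrier (hat K H R) = carrier H" using hat_simps(1) by (simp add: same_space_def)
 show "same_space B Hs"
  using same_space_opposite[of "dual_alg K (hat K H R)"] same_space_dual_alg[of "hat K H R"]
  by (simp add: hat_dual_op_def same_space_def d)
 then show "carrier B = carrier Hs" by (simp add: same_space_def)
 show "\<xi> \<otimes>\<^bsub>B\<^esub> \<zeta> = hconv \<xi> \<zeta>" "\<one>\<^bsub>B\<^esub> = eps"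
  by (simp_all add: hat_dual_op_def dual_alg_simps c hconv_def eps_def hat_simps(2))
qed

lemmas B_same = same_space_eqs[OF B_simps(1)]

lemma hconv_closed: "[|\<xi> .: Hs; \<zeta> .: Hs|] ==> hconv \<xi> \<zeta> .: Hs"
 unfolding hconv_def by (assumption | rule kcalc' lin_compose[OF lin_hcom] lin_closed[OF lin_hcom])+

lemma hconv_apply: "c .: H ==> hconv \<xi> \<zeta> c = lift (scalars K) (%x y. \<zeta> x \<otimes> \<xi> y) (hcom c)"
 by (simp add: hconv_def)

lemma prealg_B: "prealg B"
 using same_space_vs[OF B_simps(1)] vsHs by (simp add: prealg_def B_simps(2-4) eps_closed hconv_closed)

lemma prehom_B_iff: "prehom B M f \<longleftrightarrow> lin Hs M f \<and> f eps = \<one>\<^bsub>M\<^esub> \<and>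
  (\<forall>\<xi>\<in>carrier Hs. \<forall>\<zeta>\<in>carrier Hs. f (hconv \<xi> \<zeta>) = f \<xi> \<otimes>\<^bsub>M\<^esub> f \<zeta>)"
 by (simp add: prehom_def B_same B_simps(2-4))

definition hact :: "('h \<Rightarrow> 'k) \<Rightarrow> 'h \<Rightarrow> 'h \<Rightarrow> 'k" where "hact = hat_dual_act K H"

lemma hact_apply: "h .: H ==> hact \<xi> l h = \<xi> (sw H l (%a b. (b ** h) ** T a))"
 by (simp add: hact_def hat_dual_act_def hat_act_def)

lemma hact_closed: "[|\<xi> .: Hs; l .: H|] ==> hact \<xi> l .: Hs"
 and lin_hact1: "l .: H ==> lin Hs Hs (%\<xi>. hact \<xi> l)"
 and lin_hact2: "\<xi> .: Hs ==> lin H Hs (%l. hact \<xi> l)"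
 unfolding hact_def hat_dual_act_def hat_act_def by (assumption | rule kcalc' lin_T T_closed)+

lemma lin_hact_comp: "[|lin U H f; \<xi> .: Hs|] ==> lin U Hs (%x. hact \<xi> (f x))"
 by (rule lin_compose[OF lin_hact2])

abbreviation P where "P \<equiv> free_product K A B"
abbreviation fl where "fl \<equiv> free_inl K A B"
abbreviation fr where "fr \<equiv> free_inr K A B"
abbreviation Ref where "Ref \<equiv> reflective_alg K H R A \<rho>"
abbreviation Ref_mult (infixl "*F" 70) where "u *F v \<equiv> u \<otimes>\<^bsub>Ref\<^esub> v"
abbreviation inA where "inA \<equiv> reflective_inl K H R A \<rho>"
abbreviation inX where "inX \<equiv> reflective_inr K H R A \<rho>"

lemmas algP = free_product_algebra[OF prealg_algebra[OF algA] prealg_B]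
lemmas fl_hom = free_inl_hom[OF prealg_algebra[OF algA] prealg_B]
lemmas fr_hom = free_inr_hom[OF prealg_algebra[OF algA] prealg_B]

lemma lin_fl: "lin A P fl" and lin_fr: "lin Hs P fr"
 using fl_hom fr_hom by (simp_all add: prehom_B_iff, simp_all add: prehom_def)

lemmas pcalc = acalc algP assoc_algebraD(1)[OF algP] lin_compose[OF lin_fl] lin_compose[OF lin_fr]
 lin_closed[OF lin_fl] lin_closed[OF lin_fr] lin_hact_comp hact_closed

definition rel_rhs where "rel_rhs \<xi> a = co P a (%h b. fl b \<otimes>\<^bsub>P\<^esub> fr (hact \<xi> h))"
definition ref_relations where "ref_relations =
 {fr \<xi> \<otimes>\<^bsub>P\<^esub> fl a \<ominus>\<^bsub>P\<^esub> rel_rhs \<xi> a |\<xi> a. \<xi> .: Hs \<and> a .: A}"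

lemma rel_rhs_closed: "[|\<xi> .: Hs; a .: A|] ==> rel_rhs \<xi> a .: P"
 unfolding rel_rhs_def by (assumption | rule pcalc)+

lemma ref_relations_closed: "ref_relations \<subseteq> carrier P"
proof -
 interpret P: assoc_algebra K P by (rule algP)
 show ?thesis unfolding ref_relations_def
  by (auto intro!: P.minus_closed P.m_closed rel_rhs_closed lin_closed[OF lin_fl] lin_closed[OF lin_fr])
qed

abbreviation pj where "pj \<equiv> %x. reflective_ideal K H R A \<rho> +>\<^bsub>P\<^esub> x"

lemma reflective_ideal_eq: "reflective_ideal K H R A \<rho> = genideal P ref_relations"
 by (simp add: reflective_ideal_def Let_def ref_relations_def rel_rhs_def hact_def B_simps(2))

lemmas ref_pres = presentation[OF algP ref_relations_closed,
 folded reflective_ideal_eq, folded reflective_alg_def]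

lemmas algRef = ref_pres(1)
lemmas vsRef = assoc_algebraD(1)[OF algRef]

lemma inA_eq: "inA a = pj (fl a)" and inX_eq: "inX \<xi> = pj (fr \<xi>)"
 by (simp_all add: reflective_inl_def reflective_inr_def)

lemma prehom_compose: "[|prehom C M f; g \<in> alg_hom K M N; vs C|] ==> prehom C N (%x. g (f x))"
 by (auto simp: prehom_def alg_homD(2,3) lin_closed intro: lin_compose[OF alg_homD(1)])

lemma inA_hom: "inA \<in> alg_hom K A Ref"
proof -
 have "prehom A Ref (%a. pj (fl a))" by (rule prehom_compose[OF fl_hom ref_pres(2) vsA])
 then show ?thesis unfolding inA_eq[abs_def]
  by (intro alg_homI[OF algA algRef]) (auto simp: prehom_def)
qed

lemma inX_hom: "prehom B Ref inX"
 unfolding inX_eq[abs_def] using prehom_compose[OF fr_hom ref_pres(2)] prealg_B by (simp add: prealg_def)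

lemma lin_inA: "lin A Ref inA" and lin_inX: "lin Hs Ref inX"
 and inX_mult: "[|\<xi> .: Hs; \<zeta> .: Hs|] ==> inX (hconv \<xi> \<zeta>) = inX \<xi> *F inX \<zeta>"
 and inX_one: "inX eps = \<one>\<^bsub>Ref\<^esub>"
 using alg_homD(1)[OF inA_hom] inX_hom by (simp_all add: prehom_B_iff)

lemmas rcalc = pcalc algRef vsRef lin_compose[OF lin_inA] lin_compose[OF lin_inX]
 lin_closed[OF lin_inA] lin_closed[OF lin_inX]

lemma image_rel_rhs:
 assumes M: "alg M" and g: "g \<in> alg_hom K P M" and x: "\<xi> .: Hs" "a .: A"
 shows "g (rel_rhs \<xi> a) = co M a (%h b. g (fl b) \<otimes>\<^bsub>M\<^esub> g (fr (hact \<xi> h)))"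
proof -
 note vM = assoc_algebraD(1)[OF M] and vP = assoc_algebraD(1)[OF algP]
 note l = alg_homD(1)[OF g]
 have "g (rel_rhs \<xi> a) = co M a (%h b. g (fl b) \<otimes>\<^bsub>M\<^esub> g (fr (hact \<xi> h)))"
  unfolding rel_rhs_def by (rule co_comp'[OF l vP vM _ x(2)], (assumption | rule pcalc x)+,
   simp add: alg_homD(3)[OF g] lin_closed[OF lin_fl] lin_closed[OF lin_fr] hact_closed x)
 then show ?thesis .
qed

text \<open>Serves twice: for the projection onto \<open>Ref\<close> it yields the commutation
  relation in \<open>Ref\<close>, and for a homomorphism into an arbitrary target it is the
  condition for factoring through \<open>Ref\<close>.\<close>

lemma relation_vanish_iff:
 assumes M: "alg M" and g: "g \<in> alg_hom K P M" and x: "\<xi> .: Hs" "a .: A"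
 shows "g (fr \<xi> \<otimes>\<^bsub>P\<^esub> fl a \<ominus>\<^bsub>P\<^esub> rel_rhs \<xi> a) = \<zero>\<^bsub>M\<^esub> \<longleftrightarrow>
  g (fr \<xi>) \<otimes>\<^bsub>M\<^esub> g (fl a) = co M a (%h b. g (fl b) \<otimes>\<^bsub>M\<^esub> g (fr (hact \<xi> h)))"
proof -
 interpret P: assoc_algebra K P by (rule algP)
 interpret M: assoc_algebra K M by (rule M)
 have c: "fr \<xi> .: P" "fl a .: P" "rel_rhs \<xi> a .: P"
  using x by (simp_all add: lin_closed[OF lin_fl] lin_closed[OF lin_fr] rel_rhs_closed)
 have "g (fr \<xi> \<otimes>\<^bsub>P\<^esub> fl a \<ominus>\<^bsub>P\<^esub> rel_rhs \<xi> a) = g (fr \<xi>) \<otimes>\<^bsub>M\<^esub> g (fl a) \<ominus>\<^bsub>M\<^esub> g (rel_rhs \<xi> a)"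
  using c by (simp add: lin_minus[OF P.vectorspace_axioms M.vectorspace_axioms alg_homD(1)[OF g]] alg_homD(3)[OF g])
 moreover have "g (fr \<xi>) \<otimes>\<^bsub>M\<^esub> g (fl a) .: M" "g (rel_rhs \<xi> a) .: M"
  using c by (simp_all add: lin_closed[OF alg_homD(1)[OF g]])
 ultimately show ?thesis
  by (simp add: diff_zero_iff[OF M.abelian_group_axioms] image_rel_rhs[OF M g x, symmetric])
qed

lemma ref_relation:
 assumes x: "\<xi> .: Hs" "a .: A"
 shows "inX \<xi> *F inA a = co Ref a (%h b. inA b *F inX (hact \<xi> h))"
proof -
 have "fr \<xi> \<otimes>\<^bsub>P\<^esub> fl a \<ominus>\<^bsub>P\<^esub> rel_rhs \<xi> a \<in> ref_relations" using x by (auto simp: ref_relations_def)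
 from ref_pres(4)[OF this] show ?thesis
  unfolding relation_vanish_iff[OF algRef ref_pres(2) x] inA_eq inX_eq .
qed

lemma ref_universal:
 assumes M: "alg M" and \<phi>: "\<phi> \<in> alg_hom K A M" and \<psi>: "prehom B M \<psi>"
  and rel: "!!\<xi> a. [|\<xi> .: Hs; a .: A|] ==> \<psi> \<xi> \<otimes>\<^bsub>M\<^esub> \<phi> a = co M a (%h b. \<phi> b \<otimes>\<^bsub>M\<^esub> \<psi> (hact \<xi> h))"
 obtains \<delta> where "\<delta> \<in> alg_hom K Ref M" "!!a. a .: A ==> \<delta> (inA a) = \<phi> a" "!!\<xi>. \<xi> .: Hs ==> \<delta> (inX \<xi>) = \<psi> \<xi>"
proof -
 note vM = assoc_algebraD(1)[OF M]
 have "\<exists>\<theta>\<in>alg_hom K P M. (\<forall>a\<in>carrier A. \<theta> (fl a) = \<phi> a) \<and> (\<forall>b\<in>carrier B. \<theta> (fr b) = \<psi> b)"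
  by (rule free_product_universal[OF prealg_algebra[OF algA] prealg_B M prehom_alg_hom[OF \<phi>] \<psi>])
 then obtain \<theta> where \<theta>: "\<theta> \<in> alg_hom K P M" and ta: "!!a. a .: A ==> \<theta> (fl a) = \<phi> a"
  and tb: "!!b. b .: Hs ==> \<theta> (fr b) = \<psi> b"
  unfolding B_simps(2) by (elim bexE conjE) (rule that, assumption, (erule (1) bspec)+)
 have lp: "lin Hs M \<psi>" using \<psi> by (simp add: prehom_B_iff)
 have v: "\<theta> y = \<zero>\<^bsub>M\<^esub>" if y: "y \<in> ref_relations" for y
 proof -
  obtain \<xi> a where x: "\<xi> .: Hs" "a .: A" "y = fr \<xi> \<otimes>\<^bsub>P\<^esub> fl a \<ominus>\<^bsub>P\<^esub> rel_rhs \<xi> a"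
   using y by (auto simp: ref_relations_def)
  have "co M a (%h b. \<phi> b \<otimes>\<^bsub>M\<^esub> \<psi> (hact \<xi> h)) = co M a (%h b. \<theta> (fl b) \<otimes>\<^bsub>M\<^esub> \<theta> (fr (hact \<xi> h)))"
   by (rule co_cong[OF x(2)], simp add: ta tb hact_closed x)
  then show ?thesis
   unfolding x(3) relation_vanish_iff[OF M \<theta> x(1,2)] using rel[OF x(1,2)] ta[OF x(2)] tb[OF x(1)] by simp
 qed
 have "\<exists>g\<in>alg_hom K Ref M. \<forall>x\<in>carrier P. g (pj x) = \<theta> x" by (rule ref_pres(5)[OF M \<theta> v])
 then obtain g where g: "g \<in> alg_hom K Ref M" "\<forall>x\<in>carrier P. g (pj x) = \<theta> x" by (elim bexE) (rule that)
 show thesis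
 proof (rule that[OF g(1)])
  show "g (inA a) = \<phi> a" if "a .: A" for a
   unfolding inA_eq using bspec[OF g(2) lin_closed[OF lin_fl that]] ta[OF that] by simp
  show "g (inX \<xi>) = \<psi> \<xi>" if "\<xi> .: Hs" for \<xi>
   unfolding inX_eq using bspec[OF g(2) lin_closed[OF lin_fr that]] tb[OF that] by simp
 qed
qed

text \<open>The relations move all elements of \<open>A\<close> to the left, so the products \<open>a\<xi>\<close> span.\<close>

lemma ref_span:
 fixes Z :: "('k, 'z, 'q) module_scheme"
 assumes Z: "vs Z" and f: "lin Ref Z f" and g: "lin Ref Z g"
  and eq: "!!a \<xi>. [|a .: A; \<xi> .: Hs|] ==> f (inA a *F inX \<xi>) = g (inA a *F inX \<xi>)"
  and r: "r .: Ref"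
 shows "f r = g r"
proof -
 interpret Re: assoc_algebra K Ref by (rule algRef)
 define agree where "agree F G \<longleftrightarrow> lin Ref Z F \<and> lin Ref Z G \<and>
   (\<forall>a\<in>carrier A. \<forall>\<xi>\<in>carrier Hs. F (inA a *F inX \<xi>) = G (inA a *F inX \<xi>))" for F G
 \<comment> \<open>\<open>free_product_induct\<close> works with maps on the free product, whereas
   the relations hold in \<open>Ref\<close>. \<open>Q\<close> records that both maps factor through
   \<open>Ref\<close> and agree there on the products a \<xi>.\<close>
 define Q where "Q f' g' \<longleftrightarrow> (\<exists>F G. agree F G \<and> (\<forall>x\<in>carrier P. f' x = F (pj x)) \<and> (\<forall>x\<in>carrier P. g' x = G (pj x)))"
  for f' g' :: "_ \<Rightarrow> 'z"
 note c = lin_closed[OF lin_inA] lin_closed[OF lin_inX]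
 note pl = alg_homD(1)[OF ref_pres(2)]
 have A1: "agree (%x. F (inA a *F x)) (%x. G (inA a *F x))" if "agree F G" "a .: A" for F G a
  using that unfolding agree_def
  by (auto simp: c Re.m_assoc[symmetric] alg_homD(3)[OF inA_hom, symmetric] mult_closed[OF algA]
    intro!: lin_compose[OF _ lin_mult_right[OF lin_id algRef]])
 \<comment> \<open>The defining relation rewrites \<zeta> a \<xi> as a sum of terms a_[0] times a
   product of two functionals, which is again a single functional; so agreement on the products a
   \<xi> is preserved.\<close>
 have A2: "agree (%x. F (inX \<zeta> *F x)) (%x. G (inX \<zeta> *F x))" if FG: "agree F G" and z: "\<zeta> .: Hs" for F G \<zeta>
 proof -
  have e: "F (inX \<zeta> *F (inA a *F inX \<xi>)) = co Z a (%h b. F (inA b *F inX (hconv (hact \<zeta> h) \<xi>)))"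
   if F: "lin Ref Z F" and x: "a .: A" "\<xi> .: Hs" for F a \<xi>
  proof -
   have l: "lin Ref Z (%y. F (y *F inX \<xi>))"
    by (rule lin_compose[OF F lin_mult_left[OF lin_id algRef c(2)[OF x(2)]]])
   have "F (inX \<zeta> *F (inA a *F inX \<xi>)) = F (co Ref a (%h b. inA b *F inX (hact \<zeta> h)) *F inX \<xi>)"
    using x z by (simp add: c Re.m_assoc[symmetric] ref_relation)
   also have "... = co Z a (%h b. F (inA b *F inX (hconv (hact \<zeta> h) \<xi>)))"
    by (rule co_comp'[OF l vsRef Z _ x(1)], (assumption | rule rcalc x z)+,
     simp add: inX_mult hact_closed x z c Re.m_assoc)
   finally show ?thesis .
  qed
  have F: "lin Ref Z F" "lin Ref Z G" using FG by (auto simp: agree_def)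
  have "co Z a (%h b. F (inA b *F inX (hconv (hact \<zeta> h) \<xi>))) = co Z a (%h b. G (inA b *F inX (hconv (hact \<zeta> h) \<xi>)))"
   if x: "a .: A" "\<xi> .: Hs" for a \<xi>
  proof -
   have "co Z a (%h b. F ((inA b *F inX (hact \<zeta> h)) *F inX \<xi>)) = co Z a (%h b. G (inA b *F inX (hconv (hact \<zeta> h) \<xi>)))"
    by (rule co_cong[OF x(1)])
     (use FG x z in \<open>simp add: agree_def inX_mult[symmetric] hact_closed c Re.m_assoc hconv_closed\<close>)
   moreover have "co Z a (%h b. F ((inA b *F inX (hact \<zeta> h)) *F inX \<xi>)) =
     co Z a (%h b. F (inA b *F inX (hconv (hact \<zeta> h) \<xi>)))"
    by (rule co_cong[OF x(1)],
     simp add: inX_mult hact_closed x z c Re.m_assoc)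
   ultimately show ?thesis by simp
  qed
  then show ?thesis
   using F e[OF F(1)] e[OF F(2)] z unfolding agree_def
   by (auto simp: c intro!: lin_compose[OF _ lin_mult_right[OF lin_id algRef]])
 qed
 obtain x where x: "x .: P" "r = pj x" using ref_pres(3)[OF r] by (elim bexE) (rule that)
 have pm: "pj (u \<otimes>\<^bsub>P\<^esub> v) = pj u *F pj v" if "u .: P" "v .: P" for u v
  by (rule alg_homD(3)[OF ref_pres(2) that])
 have fc: "fl a .: P" "fr \<xi> .: P" if "a .: A" "\<xi> .: Hs" for a \<xi>
  using that by (simp_all add: lin_closed[OF lin_fl] lin_closed[OF lin_fr])
 have "f (pj x) = g (pj x)"
 proof (rule free_product_induct[OF prealg_algebra[OF algA] prealg_B Z lin_compose[OF f pl] lin_compose[OF g pl], of Q])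
  show "Q (%x. f (pj x)) (%x. g (pj x))" unfolding Q_def agree_def using f g eq by blast
  show "f' \<one>\<^bsub>P\<^esub> = g' \<one>\<^bsub>P\<^esub>" if q: "Q f' g'" for f' g'
  proof -
   obtain F G where FG: "agree F G" "\<forall>x\<in>carrier P. f' x = F (pj x)" "\<forall>x\<in>carrier P. g' x = G (pj x)"
    using q unfolding Q_def by (elim exE conjE) (rule that)
   have "F (inA \<one>\<^bsub>A\<^esub> *F inX eps) = G (inA \<one>\<^bsub>A\<^esub> *F inX eps)"
    using FG(1) one_closed'[OF algA] eps_closed unfolding agree_def by blast
   then show ?thesis
    using FG(2,3) one_closed'[OF algP] alg_homD(2)[OF ref_pres(2)] alg_homD(2)[OF inA_hom]
    by (simp add: inX_one)
  qed
  show "Q (%x. f' (fl a \<otimes>\<^bsub>P\<^esub> x)) (%x. g' (fl a \<otimes>\<^bsub>P\<^esub> x))" if q: "Q f' g'" "a .: A" for f' g' a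
  proof -
   obtain F G where FG: "agree F G" "\<forall>x\<in>carrier P. f' x = F (pj x)" "\<forall>x\<in>carrier P. g' x = G (pj x)"
    using q(1) unfolding Q_def by (elim exE conjE) (rule that)
   show ?thesis unfolding Q_def
    by (rule exI, rule exI, rule conjI[OF A1[OF FG(1) q(2)]])
     (use FG(2,3) q(2) in \<open>simp add: mult_closed[OF algP] lin_closed[OF lin_fl] pm inA_eq\<close>)
  qed
  show "Q (%x. f' (fr b \<otimes>\<^bsub>P\<^esub> x)) (%x. g' (fr b \<otimes>\<^bsub>P\<^esub> x))" if q: "Q f' g'" "b .: B" for f' g' b
  proof -
   obtain F G where FG: "agree F G" "\<forall>x\<in>carrier P. f' x = F (pj x)" "\<forall>x\<in>carrier P. g' x = G (pj x)"
    using q(1) unfolding Q_def by (elim exE conjE) (rule that)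
   have b: "b .: Hs" using q(2) by (simp add: B_simps(2))
   show ?thesis unfolding Q_def
    by (rule exI, rule exI, rule conjI[OF A2[OF FG(1) b]])
     (use FG(2,3) b in \<open>simp add: mult_closed[OF algP] lin_closed[OF lin_fr] pm inX_eq\<close>)
  qed
 qed (rule x(1))
 then show ?thesis using x(2) by simp
qed

end

section \<open>Coactions on the reflective algebra\<close>

text \<open>The target \<open>M\<close> of the coaction is \<open>Drin(H) \<otimes> R\<^sub>H(A)\<close>; the argument only uses
 the images in it of \<open>H\<close>, \<open>H\<^sup>*\<close> (as \<open>dX\<close>), the reflective functionals (as \<open>cX\<close>) and \<open>A\<close>.\<close>

locale target_base = ref_base K H R A \<rho> + dual_base K H D bs ds
 for K :: "('k, 'r) ring_scheme" (structure) and H :: "('k, 'h, 'm) hopf_scheme" and R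
  and A :: "('k, 'a, 'n) module_scheme" and \<rho> and D :: "'d set" and bs and ds +
 fixes M :: "('k, 'z, 'o) module_scheme" and gH :: "'h \<Rightarrow> 'z" and cX dX :: "('h \<Rightarrow> 'k) \<Rightarrow> 'z" and eA :: "'a \<Rightarrow> 'z"
 assumes algM: "alg M"
  and lin_gH: "lin H M gH" and lin_cX: "lin Hs M cX" and lin_dX: "lin Hs M dX" and eA_hom: "eA \<in> alg_hom K A M"
  and gH_one: "gH uH = \<one>\<^bsub>M\<^esub>"
  and gH_mult: "[|h .: H; l .: H|] ==> gH (h ** l) = gH h \<otimes>\<^bsub>M\<^esub> gH l"
  and cX_eps: "cX eps = \<one>\<^bsub>M\<^esub>"
  and cX_mult: "[|\<xi> .: Hs; \<zeta> .: Hs|] ==> cX (hconv \<xi> \<zeta>) = cX \<xi> \<otimes>\<^bsub>M\<^esub> cX \<zeta>"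
  and dX_eps: "dX eps = \<one>\<^bsub>M\<^esub>"
  and dX_mult: "[|\<xi> .: Hs; \<zeta> .: Hs|] ==> dX (conv \<xi> \<zeta>) = dX \<xi> \<otimes>\<^bsub>M\<^esub> dX \<zeta>"
  and gH_dX: "[|h .: H; \<xi> .: Hs|] ==> gH h \<otimes>\<^bsub>M\<^esub> dX \<xi> = sw3 M h (%a b c. dX (act a \<xi> c) \<otimes>\<^bsub>M\<^esub> gH b)"
  and cX_eA: "[|\<xi> .: Hs; a .: A|] ==> cX \<xi> \<otimes>\<^bsub>M\<^esub> eA a = co M a (%h b. eA b \<otimes>\<^bsub>M\<^esub> cX (hact \<xi> h))"
  and gH_cX: "[|h .: H; \<xi> .: Hs|] ==> gH h \<otimes>\<^bsub>M\<^esub> cX \<xi> = cX \<xi> \<otimes>\<^bsub>M\<^esub> gH h"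
  and gH_eA: "[|h .: H; a .: A|] ==> gH h \<otimes>\<^bsub>M\<^esub> eA a = eA a \<otimes>\<^bsub>M\<^esub> gH h"
  and dX_cX: "[|\<zeta> .: Hs; \<xi> .: Hs|] ==> dX \<zeta> \<otimes>\<^bsub>M\<^esub> cX \<xi> = cX \<xi> \<otimes>\<^bsub>M\<^esub> dX \<zeta>"
  and dX_eA: "[|\<zeta> .: Hs; a .: A|] ==> dX \<zeta> \<otimes>\<^bsub>M\<^esub> eA a = eA a \<otimes>\<^bsub>M\<^esub> dX \<zeta>"
begin

text \<open>\<open>M\<close> accounts for the tensor factors 1 and 2, so the two copies of H in
  \<open>MHH\<close> are the legs 3 and 4. This explains the names below: \<open>j3\<close> and
  \<open>j4\<close> put the H-leg of an element of \<open>MH\<close> into leg 3 or 4,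
  \<open>dop\<close> spreads it over both by the opposite coproduct, and \<open>R34\<close> is R in
  these legs.\<close>

definition MH where "MH = tensor_alg K M H"
definition mh where "mh = tens K M H"
definition MHH where "MHH = tensor_alg K MH H"
definition nn where "nn m p q = tens K MH H (mh m p) q"
abbreviation M_mult (infixl "*M" 70) where "u *M v \<equiv> u \<otimes>\<^bsub>M\<^esub> v"
abbreviation MH_mult (infixl "*L" 70) where "u *L v \<equiv> u \<otimes>\<^bsub>MH\<^esub> v"
abbreviation MHH_mult (infixl "*N" 70) where "u *N v \<equiv> u \<otimes>\<^bsub>MHH\<^esub> v"

lemmas vsM = assoc_algebraD(1)[OF algM]

lemma algMH: "alg MH" unfolding MH_def by (rule assoc_algebra_tensor_alg[OF algM algH])
lemmas vsMH = assoc_algebraD(1)[OF algMH]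
lemma algMHH: "alg MHH" unfolding MHH_def by (rule assoc_algebra_tensor_alg[OF algMH algH])
lemmas vsMHH = assoc_algebraD(1)[OF algMHH]

lemma MH_same: "same_space MH (tsp M H)" unfolding MH_def by (rule same_space_tensor_alg)
lemma MHH_same: "same_space MHH (tsp MH H)" unfolding MHH_def by (rule same_space_tensor_alg)
lemmas MH_eqs = same_space_eqs[OF MH_same] same_space_bil[OF MH_same]
lemmas MHH_eqs = same_space_eqs[OF MHH_same] same_space_bil[OF MHH_same]
lemma MH_carrier: "carrier MH = carrier (tsp M H)" and MHH_carrier: "carrier MHH = carrier (tsp MH H)"
 using MH_same MHH_same by (simp_all add: same_space_def)

lemma mh_calc:
 "[|m .: M; p .: H|] ==> mh m p .: MH"
 "[|lin U M f; p .: H|] ==> lin U MH (%x. mh (f x) p)"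
 "[|lin U H h; m .: M|] ==> lin U MH (%x. mh m (h x))"
 unfolding MH_eqs MH_carrier mh_def
 by (rule tens_closed[OF vsM vsH] lin_tens_left[OF _ vsM vsH] lin_tens_right[OF _ vsM vsH]; assumption)+

lemma tens_MH_calc:
 "[|z .: MH; q .: H|] ==> tens K MH H z q .: MHH"
 "[|lin U MH f; q .: H|] ==> lin U MHH (%x. tens K MH H (f x) q)"
 "[|lin U H h; z .: MH|] ==> lin U MHH (%x. tens K MH H z (h x))"
 unfolding MHH_eqs MHH_carrier
 by (rule tens_closed[OF vsMH vsH] lin_tens_left[OF _ vsMH vsH] lin_tens_right[OF _ vsMH vsH]; assumption)+

lemma nn_calc:
 "[|m .: M; p .: H; q .: H|] ==> nn m p q .: MHH"
 "[|lin U M f; p .: H; q .: H|] ==> lin U MHH (%x. nn (f x) p q)"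
 "[|lin U H h; m .: M; q .: H|] ==> lin U MHH (%x. nn m (h x) q)"
 "[|lin U H h; m .: M; p .: H|] ==> lin U MHH (%x. nn m p (h x))"
 unfolding nn_def by (assumption | rule tens_MH_calc mh_calc)+

lemma mh_mult: "[|m .: M; p .: H; m' .: M; p' .: H|]
  ==> mh m p *L mh m' p' = mh (m *M m') (p ** p')"
 and MH_one: "\<one>\<^bsub>MH\<^esub> = mh \<one>\<^bsub>M\<^esub> uH"
 unfolding MH_def mh_def by (rule tensor_alg_mult[OF algM algH]; assumption) (rule tensor_alg_simps)

lemma nn_mult: "[|m .: M; p .: H; q .: H; m' .: M; p' .: H; q' .: H|]
  ==> nn m p q *N nn m' p' q' = nn (m *M m') (p ** p') (q ** q')"
 unfolding MHH_def nn_def by (simp add: tensor_alg_mult[OF algMH algH] mh_calc mh_mult)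

lemma MHH_one: "\<one>\<^bsub>MHH\<^esub> = nn \<one>\<^bsub>M\<^esub> uH uH"
 unfolding MHH_def nn_def MH_one[symmetric] by (rule tensor_alg_simps)

lemma MH_ext:
 assumes "vs Z" "lin MH Z f" "lin MH Z g" "!!m p. [|m .: M; p .: H|] ==> f (mh m p) = g (mh m p)"
  "z .: MH"
 shows "f z = g z"
 by (rule tensor_ext[OF vsM vsH assms(1) assms(2,3)[unfolded MH_eqs] assms(4)[unfolded mh_def] assms(5)[unfolded MH_carrier]])

lemma MH_lift:
 assumes "vs Z" "bil M H Z f"
 shows "lin MH Z (lift Z f)" "[|m .: M; p .: H|] ==> lift Z f (mh m p) = f m p"
 unfolding MH_eqs mh_def by (rule lin_tensor_lift[OF vsM vsH assms]) (rule tensor_lift_tens[OF vsM vsH assms])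

lemmas lin_eA = alg_homD(1)[OF eA_hom]

lemmas mcalc = acalc fcalc lin_hact_comp hact_closed hconv_closed algM vsM algMH vsMH algMHH vsMHH mh_calc nn_calc
 lin_compose[OF lin_gH] lin_compose[OF lin_cX] lin_compose[OF lin_dX] lin_compose[OF lin_eA]
 lin_closed[OF lin_gH] lin_closed[OF lin_cX] lin_closed[OF lin_dX] lin_closed[OF lin_eA] one_closed'[OF algM]

definition j3 where "j3 z = tens K MH H z uH"
definition j4 where "j4 = lift MHH (%m p. nn m uH p)"
definition dop where "dop = lift MHH (%m p. sw MHH p (%a b. nn m b a))"
definition R34 where "R34 = Rs MHH (%s t. nn \<one>\<^bsub>M\<^esub> s t)"

lemma bil_j4: "bil M H MHH (%m p. nn m uH p)" and bil_dop: "bil M H MHH (%m p. sw MHH p (%a b. nn m b a))"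
 by (assumption | rule mcalc)+

lemma j3_mh: "j3 (mh m p) = nn m p uH" by (simp add: j3_def nn_def)
lemma j4_mh: "[|m .: M; p .: H|] ==> j4 (mh m p) = nn m uH p"
 unfolding j4_def by (rule MH_lift(2)[OF vsMHH bil_j4])
lemma dop_mh: "[|m .: M; p .: H|] ==> dop (mh m p) = sw MHH p (%a b. nn m b a)"
 unfolding dop_def by (rule MH_lift(2)[OF vsMHH bil_dop])

lemma j3_hom: "j3 \<in> alg_hom K MH MHH"
proof (rule alg_homI[OF algMH algMHH])
 interpret A: assoc_algebra K H by (rule algH)
 show "lin MH MHH j3" unfolding j3_def[abs_def] by (assumption | rule tens_MH_calc mcalc)+
 show "j3 \<one>\<^bsub>MH\<^esub> = \<one>\<^bsub>MHH\<^esub>" by (simp add: MH_one MHH_one j3_mh)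
 show "j3 (x *L y) = j3 x *N j3 y" if "x .: MH" "y .: MH" for x y
  unfolding j3_def MHH_def using tensor_alg_mult[OF algMH algH that(1) oneH that(2) oneH] by simp
qed

lemma j4_hom: "j4 \<in> alg_hom K MH MHH"
 unfolding j4_def MH_def
proof (rule alg_hom_tensor_lift[OF algM algH algMHH bil_j4])
 interpret A: assoc_algebra K H by (rule algH)
 show "nn \<one>\<^bsub>M\<^esub> uH uH = \<one>\<^bsub>MHH\<^esub>" by (simp add: MHH_one)
 show "nn (a *M a') uH (b ** b') = nn a uH b *N nn a' uH b'"
  if "a .: M" "b .: H" "a' .: M" "b' .: H" for a b a' b'
  using that by (simp add: nn_mult)
qed

lemma dop_hom: "dop \<in> alg_hom K MH MHH"
 unfolding dop_def MH_def
proof (rule alg_hom_tensor_lift[OF algM algH algMHH bil_dop])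
 show "sw MHH uH (%a b. nn \<one>\<^bsub>M\<^esub> b a) = \<one>\<^bsub>MHH\<^esub>"
  unfolding MHH_one by (rule sw_one[OF vsMHH]) ((assumption | rule mcalc)+)
 fix m p m' p' assume x: "m .: M" "p .: H" "m' .: M" "p' .: H"
 have "sw MHH (p ** p') (%a b. nn (m *M m') b a) =
  sw MHH p (%a b. sw MHH p' (%a' b'. nn (m *M m') (b ** b') (a ** a')))"
  by (rule sw_mult[OF vsMHH _ x(2,4)]) ((assumption | rule mcalc x)+)
 also have "... = sw MHH p (%a b. sw MHH p' (%a' b'. nn m b a *N nn m' b' a'))"
  by (rule sw_cong[OF x(2)], rule sw_cong[OF x(4)], simp add: nn_mult x)
 also have "... = sw MHH p (%a b. nn m b a) *N sw MHH p' (%a b. nn m' b a)"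
  by (rule tensor_lift_mult[symmetric, OF vsH vsH vsH vsH algMHH _ _ comult_closed[OF x(2)] comult_closed[OF x(4)]];
   (assumption | rule mcalc x)+)
 finally show "sw MHH (p ** p') (%a b. nn (m *M m') b a) =
  sw MHH p (%a b. nn m b a) *N sw MHH p' (%a b. nn m' b a)" .
qed

section \<open>The factors of U and their exchange relations\<close>

definition Um where "Um = Rs MH (%s t. mh (gH s) t)"
definition Xm where "Xm = Cs MH (%x h. mh (cX x) h)"
text \<open>W is the inverse of the canonical element in the tensor product of the opposite algebra
  of H^* with H: their product is the sum over h = h_d of \<xi>_d \<otimes> h_2 S^-1(h_1), which is
  the unit.\<close>

definition Wm where "Wm = Cs MH (%x h. mh (dX x) (T h))"
definition UU where "UU = Um *L (Xm *L Wm)"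

lemma UXW_closed: "Um .: MH" "Xm .: MH" "Wm .: MH" "UU .: MH"
 unfolding UU_def Um_def Xm_def Wm_def by (assumption | rule mcalc)+

lemma R34_closed: "R34 .: MHH" unfolding R34_def by (assumption | rule mcalc)+

lemma legs_comp:
 assumes F: "lin MH Z F" and Z: "vs Z"
 shows "(!!s t. [|s .: H; t .: H|] ==> F (mh (gH s) t) = g s t) ==> F Um = Rs Z g"
  "(!!x h. [|x .: Hs; h .: H|] ==> F (mh (cX x) h) = k x h) ==> F Xm = Cs Z k"
  "(!!x h. [|x .: Hs; h .: H|] ==> F (mh (dX x) (T h)) = k x h) ==> F Wm = Cs Z k"
proof -
 show "F Um = Rs Z g" if "!!s t. [|s .: H; t .: H|] ==> F (mh (gH s) t) = g s t"
  unfolding Um_def by (rule Rs_comp'[OF F vsMH Z], (assumption | rule mcalc)+, rule that)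
 show "F Xm = Cs Z k" if "!!x h. [|x .: Hs; h .: H|] ==> F (mh (cX x) h) = k x h"
  unfolding Xm_def by (rule Cs_comp'[OF F vsMH Z], (assumption | rule mcalc)+, rule that)
 show "F Wm = Cs Z k" if "!!x h. [|x .: Hs; h .: H|] ==> F (mh (dX x) (T h)) = k x h"
  unfolding Wm_def by (rule Cs_comp'[OF F vsMH Z], (assumption | rule mcalc)+, rule that)
qed

lemma j_images:
 "j3 Um = Rs MHH (%s t. nn (gH s) t uH)" "j4 Um = Rs MHH (%s t. nn (gH s) uH t)"
 "dop Um = Rs MHH (%s t. sw MHH t (%a b. nn (gH s) b a))"
 "j3 Xm = Cs MHH (%x h. nn (cX x) h uH)" "j4 Xm = Cs MHH (%x h. nn (cX x) uH h)"
 "dop Xm = Cs MHH (%x h. sw MHH h (%a b. nn (cX x) b a))"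
 "j3 Wm = Cs MHH (%x h. nn (dX x) (T h) uH)" "j4 Wm = Cs MHH (%x h. nn (dX x) uH (T h))"
 "dop Wm = Cs MHH (%x h. sw MHH (T h) (%a b. nn (dX x) b a))"
 by (rule legs_comp[OF alg_homD(1)[OF j3_hom] vsMHH] legs_comp[OF alg_homD(1)[OF j4_hom] vsMHH]
   legs_comp[OF alg_homD(1)[OF dop_hom] vsMHH],
  simp add: j3_mh j4_mh dop_mh lin_closed[OF lin_gH] lin_closed[OF lin_cX] lin_closed[OF lin_dX] T_closed)+

lemmas UUcalc = mcalc UXW_closed R34_closed alg_homD(4)[OF j3_hom] alg_homD(4)[OF j4_hom] alg_homD(4)[OF dop_hom]

lemma Rs_mult: "[|bil H H MHH f; bil H H MHH g|] ==>
  Rs MHH f *N Rs MHH g = Rs MHH (%s t. Rs MHH (%s' t'. f s t *N g s' t'))"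
 by (rule tensor_lift_mult[OF vsH vsH vsH vsH algMHH _ _ R_closed R_closed])

lemma Cs_mult: "[|bil Hs H MHH f; bil Hs H MHH g|] ==>
  Cs MHH f *N Cs MHH g = Cs MHH (%s t. Cs MHH (%s' t'. f s t *N g s' t'))"
 by (rule tensor_lift_mult[OF vsHs vsH vsHs vsH algMHH _ _ C_closed C_closed])

lemma Cs_Rs_mult: "[|bil Hs H MHH f; bil H H MHH g|] ==>
  Cs MHH f *N Rs MHH g = Cs MHH (%s t. Rs MHH (%s' t'. f s t *N g s' t'))"
 by (rule tensor_lift_mult[OF vsHs vsH vsH vsH algMHH _ _ C_closed R_closed])

lemma Rs_Cs_mult: "[|bil Hs H MHH f; bil H H MHH g|] ==>
  Rs MHH g *N Cs MHH f = Cs MHH (%s t. Rs MHH (%s' t'. g s' t' *N f s t))"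
proof -
 assume b: "bil Hs H MHH f" "bil H H MHH g"
 note t = mcalc lin_compose[OF bil1[OF b(1)]] lin_compose[OF bil2[OF b(1)]] bil_closed[OF b(1)]
  lin_compose[OF bil1[OF b(2)]] lin_compose[OF bil2[OF b(2)]] bil_closed[OF b(2)]
 have "Rs MHH g *N Cs MHH f = Rs MHH (%s' t'. Cs MHH (%s t. g s' t' *N f s t))"
  by (rule tensor_lift_mult[OF vsH vsH vsHs vsH algMHH b(2,1) R_closed C_closed])
 also have "... = Cs MHH (%s t. Rs MHH (%s' t'. g s' t' *N f s t))"
  by (rule tensor_lift_swap[OF vsH vsH vsHs vsH vsMHH R_closed C_closed]; (assumption | rule t)+)
 finally show ?thesis .
qed

lemma X_U_commute: "j3 Xm *N j4 Um = j4 Um *N j3 Xm"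
proof -
 interpret A: assoc_algebra K H by (rule algH)
 have b: "bil Hs H MHH (%x h. nn (cX x) h uH)" "bil H H MHH (%s t. nn (gH s) uH t)" by (assumption | rule mcalc)+
 show ?thesis unfolding j_images Cs_Rs_mult[OF b] Rs_Cs_mult[OF b]
  by (rule Cs_cong, rule Rs_cong,
   simp add: nn_mult lin_closed[OF lin_gH] lin_closed[OF lin_cX] gH_cX)
qed

lemma W_X_commute: "j3 Wm *N j4 Xm = j4 Xm *N j3 Wm"
proof -
 interpret A: assoc_algebra K H by (rule algH)
 have b: "bil Hs H MHH (%x h. nn (cX x) uH h)" "bil Hs H MHH (%x h. nn (dX x) (T h) uH)" by (assumption | rule mcalc)+
 have "j3 Wm *N j4 Xm = Cs MHH (%x h. Cs MHH (%x' h'. nn (cX x' *M dX x) (T h) h'))"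
  unfolding j_images Cs_mult[OF b(2,1)]
  by (rule Cs_cong, rule Cs_cong,
   simp add: nn_mult lin_closed[OF lin_dX] lin_closed[OF lin_cX] dX_cX T_closed)
 also have "... = Cs MHH (%x' h'. Cs MHH (%x h. nn (cX x' *M dX x) (T h) h'))"
  by (rule tensor_lift_swap[OF vsHs vsH vsHs vsH vsMHH C_closed C_closed]; (assumption | rule mcalc)+)
 also have "... = j4 Xm *N j3 Wm"
  unfolding j_images Cs_mult[OF b]
  by (rule Cs_cong, rule Cs_cong,
   simp add: nn_mult lin_closed[OF lin_dX] lin_closed[OF lin_cX] T_closed)
 finally show ?thesis .
qed

text \<open>The second hexagon axiom gives s s' \<otimes> t' \<otimes> t for s \<otimes>
  \<Delta>(t). The flip in \<open>dop\<close> restores the order of the legs, and the result is R_13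
  R_14.\<close>

lemma U_U: "j3 Um *N j4 Um = dop Um"
proof -
 interpret A: assoc_algebra K H by (rule algH)
 have b: "bil H H MHH (%s t. nn (gH s) t uH)" "bil H H MHH (%s t. nn (gH s) uH t)" by (assumption | rule mcalc)+
 have "dop Um = Rs MHH (%s t. Rs MHH (%s' t'. nn (gH (s ** s')) t t'))"
  unfolding j_images by (rule R_comult2[OF vsMHH triI]; (assumption | rule mcalc)+)
 also have "... = j3 Um *N j4 Um"
  unfolding j_images Rs_mult[OF b]
  by (rule Rs_cong, rule Rs_cong,
   simp add: nn_mult lin_closed[OF lin_gH] gH_mult)
 finally show ?thesis by simp
qed

lemma Cs_sw3_swap:
 assumes Z: "vs Z" and h: "h .: H"
  and f: "!!x k b c. [|x .: Hs; k .: H; b .: H; c .: H|] ==> lin H Z (%y. f x k b c y)"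
   "!!x k b c. [|x .: Hs; k .: H; b .: H; c .: H|] ==> lin H Z (%y. f x k b y c)"
   "!!x k b c. [|x .: Hs; k .: H; b .: H; c .: H|] ==> lin H Z (%y. f x k y b c)"
   "!!x a b c. [|x .: Hs; a .: H; b .: H; c .: H|] ==> lin H Z (%k. f x k a b c)"
   "!!k a b c. [|k .: H; a .: H; b .: H; c .: H|] ==> lin Hs Z (%x. f x k a b c)"
 shows "Cs Z (%x k. sw3 Z h (f x k)) = sw3 Z h (%a b c. Cs Z (%x k. f x k a b c))"
proof -
 note t = mcalc f Z h
 have "Cs Z (%x k. sw3 Z h (f x k)) = sw Z h (%y c. Cs Z (%x k. sw Z y (%a b. f x k a b c)))"
  by (rule Cs_sw_swap[OF Z h]; (assumption | rule t)+)
 also have "... = sw3 Z h (%a b c. Cs Z (%x k. f x k a b c))"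
  by (rule sw_cong[OF h], rule Cs_sw_swap[OF Z]; (assumption | rule t)+)
 finally show ?thesis .
qed

text \<open>The cross relation of the double says that \<open>\<Sum> x\<^sub>d \<otimes> S\<^sup>-\<^sup>1(h\<^sub>d)\<close>
 intertwines the two coproducts.\<close>

lemma W_intertwine:
 assumes h: "h .: H" and Z: "vs Z" and f: "bil M H Z f"
 shows "sw Z h (%a b. Cs Z (%x k. f (dX x *M gH b) (T k ** a))) =
  sw Z h (%a b. Cs Z (%x k. f (gH a *M dX x) (b ** T k)))"
proof -
 interpret A: assoc_algebra K H by (rule algH)
 note t = mcalc lin_compose[OF bil1[OF f]] lin_compose[OF bil2[OF f]] bil_closed[OF f] Z h
 \<comment> \<open>The slot \<open>y\<close> receives h_4 S^-1(h_3). The cross relation and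
   transposition turn S^-1(k) into S^-1(w) S^-1(k) u, and S^-1(w) cancels against the neighbouring
   leg \<open>b\<close>.\<close>
 let ?G = "%u v y. Cs Z (%x k. f (dX x *M gH v) (y ** (T k ** u)))"
 have "sw Z h (%a b. Cs Z (%x k. f (gH a *M dX x) (b ** T k))) =
  sw Z h (%a b. sw3 Z a (%u v w. ?G u v (b ** T w)))"
 proof (rule sw_cong[OF h])
  fix a b assume y: "a .: H" "b .: H"
  have "Cs Z (%x k. f (gH a *M dX x) (b ** T k)) =
    Cs Z (%x k. sw3 Z a (%u v w. f (dX (act u x w) *M gH v) (b ** T k)))"
  proof (rule Cs_cong)
   fix x k assume x: "x .: Hs" "k .: H"
   show "f (gH a *M dX x) (b ** T k) = sw3 Z a (%u v w. f (dX (act u x w) *M gH v) (b ** T k))"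
    unfolding gH_dX[OF y(1) x(1)]
    by (rule sw3_comp[of M Z "%m. f m (b ** T k)", OF _ vsM Z triI y(1)]; (assumption | rule t x y)+)
  qed
  also have "... = sw3 Z a (%u v w. Cs Z (%x k. f (dX (act u x w) *M gH v) (b ** T k)))"
   by (rule Cs_sw3_swap[OF Z y(1)]; (assumption | rule t y)+)
  also have "... = sw3 Z a (%u v w. ?G u v (b ** T w))"
  proof (rule sw3_cong[OF y(1)])
   fix u v w assume u: "u .: H" "v .: H" "w .: H"
   have "Cs Z (%x k. f (dX (act u x w) *M gH v) (b ** T k)) =
    Cs Z (%x k. f (dX x *M gH v) (b ** T (S u ** (k ** w))))"
    by (rule Cs_act[OF u(1,3) Z, of "%x k. f (dX x *M gH v) (b ** T k)"]) ((assumption | rule t y u)+)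
   also have "... = ?G u v (b ** T w)"
    by (rule Cs_cong,
     simp add: T_mult T_S T_closed antipode_closed A.m_assoc u y)
   finally show "Cs Z (%x k. f (dX (act u x w) *M gH v) (b ** T k)) = ?G u v (b ** T w)" .
  qed
  finally show "Cs Z (%x k. f (gH a *M dX x) (b ** T k)) = sw3 Z a (%u v w. ?G u v (b ** T w))" .
 qed
 also have "... = sw Z h (%p y. sw Z y (%w b. sw Z p (%u v. ?G u v (b ** T w))))"
  by (rule sw_assoc[OF Z triI h]; (assumption | rule t)+)
 also have "... = sw Z h (%p y. \<epsilon> y \<odot>\<^bsub>Z\<^esub> sw Z p (%u v. ?G u v uH))"
  by (rule sym, rule sw_cong[OF h],
   rule sw_T_antipode(1)[OF Z, of "%y. sw Z p (%u v. ?G u v y)" for p, symmetric]; (assumption | rule t)+)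
 also have "... = sw Z h (%u v. ?G u v uH)"
  by (rule sw_counit(2)[OF Z _ h]) ((assumption | rule t)+)
 also have "... = sw Z h (%a b. Cs Z (%x k. f (dX x *M gH b) (T k ** a)))"
  by (rule sw_cong[OF h], rule Cs_cong, simp add: T_closed)
 finally show ?thesis by simp
qed

text \<open>By the first hexagon axiom R_34 R_14 and R_14 R_34 both spread \<Delta>(s) over the legs
  1 and 3, in opposite orders, with t in leg 4. \<open>W_intertwine\<close> says that W_3 exchanges
  exactly these two orders.\<close>

lemma W_R_U: "j3 Wm *N (R34 *N j4 Um) = j4 Um *N (R34 *N j3 Wm)"
proof -
 interpret A: assoc_algebra K H by (rule algH)
 interpret M: assoc_algebra K M by (rule algM)
 interpret N: assoc_algebra K MHH by (rule algMHH)
 have b: "bil H H MHH (%s t. nn \<one>\<^bsub>M\<^esub> s t)" "bil H H MHH (%s t. nn (gH s) uH t)"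
  "bil Hs H MHH (%x h. nn (dX x) (T h) uH)" by (assumption | rule mcalc)+
 note c = lin_closed[OF lin_gH] lin_closed[OF lin_dX] T_closed
 have W: "j3 Wm .: MHH" by (assumption | rule UUcalc)+
 have RU: "R34 *N j4 Um = Rs MHH (%s t. sw MHH s (%a b. nn (gH b) a t))"
 proof -
  have "Rs MHH (%s t. sw MHH s (%a b. nn (gH b) a t)) = Rs MHH (%s t. Rs MHH (%s' t'. nn (gH s') s (t ** t')))"
   by (rule R_comult1[OF vsMHH triI, of "%a b t. nn (gH b) a t"]; (assumption | rule mcalc)+)
  also have "... = R34 *N j4 Um"
   unfolding j_images R34_def Rs_mult[OF b(1,2)]
   by (rule Rs_cong, rule Rs_cong,
    simp add: nn_mult c)
  finally show ?thesis by simp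
 qed
 have UR: "j4 Um *N R34 = Rs MHH (%s t. sw MHH s (%a b. nn (gH a) b t))"
 proof -
  have "Rs MHH (%s t. sw MHH s (%a b. nn (gH a) b t)) = Rs MHH (%s t. Rs MHH (%s' t'. nn (gH s) s' (t ** t')))"
   by (rule R_comult1[OF vsMHH triI, of "%a b t. nn (gH a) b t"]; (assumption | rule mcalc)+)
  also have "... = j4 Um *N R34"
   unfolding j_images R34_def Rs_mult[OF b(2,1)]
   by (rule Rs_cong, rule Rs_cong,
    simp add: nn_mult c)
  finally show ?thesis by simp
 qed
 have "j3 Wm *N (R34 *N j4 Um) = Rs MHH (%s t. j3 Wm *N sw MHH s (%a b. nn (gH b) a t))"
  unfolding RU by (rule Rs_comp[OF lin_mult_right[OF lin_id algMHH W] vsMHH vsMHH]) ((assumption | rule mcalc)+)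
 also have "... = Rs MHH (%s t. sw MHH s (%a b. Cs MHH (%x k. nn (dX x *M gH b) (T k ** a) t)))"
 proof (rule sym, rule Rs_cong)
  fix s t assume st: "s .: H" "t .: H"
  have "j3 Wm *N sw MHH s (%a b. nn (gH b) a t) = sw MHH s (%a b. j3 Wm *N nn (gH b) a t)"
   by (rule sw_comp[OF lin_mult_right[OF lin_id algMHH W] vsMHH vsMHH _ st(1)]) ((assumption | rule mcalc st)+)
  also have "... = sw MHH s (%a b. Cs MHH (%x k. nn (dX x *M gH b) (T k ** a) t))"
  proof (rule sym, rule sw_cong[OF st(1)])
   fix a b assume y: "a .: H" "b .: H"
   have nc: "nn (gH b) a t .: MHH" by (assumption | rule mcalc st y)+
   have "j3 Wm *N nn (gH b) a t = Cs MHH (%x k. nn (dX x *M gH b) (T k ** a) t)"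
    unfolding j_images by (rule Cs_comp'[OF lin_mult_left[OF lin_id algMHH nc] vsMHH vsMHH b(3)], simp add: nn_mult c st y)
   then show "Cs MHH (%x k. nn (dX x *M gH b) (T k ** a) t) = j3 Wm *N nn (gH b) a t" by simp
  qed
  finally show "sw MHH s (%a b. Cs MHH (%x k. nn (dX x *M gH b) (T k ** a) t)) =
    j3 Wm *N sw MHH s (%a b. nn (gH b) a t)" by simp
 qed
 also have "... = Rs MHH (%s t. sw MHH s (%a b. Cs MHH (%x k. nn (gH a *M dX x) (b ** T k) t)))"
  by (rule Rs_cong,
   rule W_intertwine[OF _ vsMHH, of _ "%m p. nn m p t" for t]; (assumption | rule mcalc)+)
 also have "... = Rs MHH (%s t. sw MHH s (%a b. nn (gH a) b t) *N j3 Wm)"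
 proof (rule Rs_cong)
  fix s t assume st: "s .: H" "t .: H"
  have "sw MHH s (%a b. nn (gH a) b t) *N j3 Wm = sw MHH s (%a b. nn (gH a) b t *N j3 Wm)"
   by (rule sw_comp[OF lin_mult_left[OF lin_id algMHH W] vsMHH vsMHH _ st(1)]) ((assumption | rule mcalc st)+)
  also have "... = sw MHH s (%a b. Cs MHH (%x k. nn (gH a *M dX x) (b ** T k) t))"
  proof (rule sym, rule sw_cong[OF st(1)])
   fix a b assume y: "a .: H" "b .: H"
   have nc: "nn (gH a) b t .: MHH" by (assumption | rule mcalc st y)+
   have "nn (gH a) b t *N j3 Wm = Cs MHH (%x k. nn (gH a *M dX x) (b ** T k) t)"
    unfolding j_images by (rule Cs_comp'[OF lin_mult_right[OF lin_id algMHH nc] vsMHH vsMHH b(3)], simp add: nn_mult c st y)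
   then show "Cs MHH (%x k. nn (gH a *M dX x) (b ** T k) t) = nn (gH a) b t *N j3 Wm" by simp
  qed
  finally show "sw MHH s (%a b. Cs MHH (%x k. nn (gH a *M dX x) (b ** T k) t)) =
   sw MHH s (%a b. nn (gH a) b t) *N j3 Wm" by simp
 qed
 also have "... = (j4 Um *N R34) *N j3 Wm"
  unfolding UR by (rule Rs_comp[symmetric, OF lin_mult_left[OF lin_id algMHH W] vsMHH vsMHH]) ((assumption | rule mcalc)+)
 also have "... = j4 Um *N (R34 *N j3 Wm)"
  by (rule N.m_assoc) ((assumption | rule UUcalc)+)
 finally show ?thesis .
qed

lemma lift_hcom:
 assumes Z: "vs Z" and f: "bil H H Z f" and h: "h .: H"
 shows "lift Z f (hcom h) =
  Rs Z (%s t. Rs Z (%s' t'. sw Z h (%a b. f ((t' ** a) ** t) ((b ** s) ** T s'))))"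
proof -
 note F = lin_tensor_lift[OF vsH vsH Z f]
 note t = mcalc lin_compose[OF bil1[OF f]] lin_compose[OF bil2[OF f]] bil_closed[OF f] lin_compose[OF F] Z h
 note vHH = vs_tensor[OF vsH vsH]
 have "lift Z f (hcom h) = Rs Z (%s t. Rs Z (%s' t'. lift Z f
   (sw HH h (%a b. tens K H H ((t' ** a) ** t) ((b ** s) ** T s')))))"
  unfolding hat_simps(3) by (rule Rs_comp'[OF F vHH Z], (assumption | rule t)+, rule Rs_comp[OF F vHH Z]; (assumption | rule t)+)
 also have "... = Rs Z (%s t. Rs Z (%s' t'. sw Z h (%a b. f ((t' ** a) ** t) ((b ** s) ** T s'))))"
 proof (rule sym, rule Rs_cong, rule Rs_cong)
  fix s t' s' t'' assume st: "s .: H" "t' .: H" "s' .: H" "t'' .: H"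
  have "lift Z f (sw HH h (%a b. tens K H H ((t'' ** a) ** t') ((b ** s) ** T s'))) = sw Z h (%a b. f ((t'' ** a) ** t') ((b ** s) ** T s'))"
   by (rule sw_comp'[OF F vHH Z _ h], (assumption | rule t st)+,
    simp add: tensor_lift_tens[OF vsH vsH Z f] mult_closed algH st T_closed)
  then show "sw Z h (%a b. f ((t'' ** a) ** t') ((b ** s) ** T s')) =
   lift Z f (sw HH h (%a b. tens K H H ((t'' ** a) ** t') ((b ** s) ** T s')))" by simp
 qed
 finally show ?thesis .
qed

end

context field_base
begin

lemma smult_swap:
 assumes "vs V" "c .: K" "d .: K" "v .: V"
 shows "c \<odot>\<^bsub>V\<^esub> (d \<odot>\<^bsub>V\<^esub> v) = d \<odot>\<^bsub>V\<^esub> (c \<odot>\<^bsub>V\<^esub> v)"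
 using assms by (simp add: module.smult_assoc1[OF vsD(2)[OF assms(1)], symmetric] m_comm)

end

section \<open>The reflection equation for U and multiplicativity on functionals\<close>

context target_base
begin

lemma hconv_lin:
 "[|lin U Hs f; \<zeta> .: Hs|] ==> lin U Hs (%x. hconv (f x) \<zeta>)"
 "[|lin U Hs f; \<zeta> .: Hs|] ==> lin U Hs (%x. hconv \<zeta> (f x))"
proof -
 have "lin Hs Hs (%\<xi>. hconv \<xi> \<zeta>)" "lin Hs Hs (hconv \<zeta>)" if "\<zeta> .: Hs" for \<zeta>
  unfolding hconv_def by (insert that, (assumption | rule kcalc' lin_compose[OF lin_hcom] lin_closed[OF lin_hcom])+)
 then show "[|lin U Hs f; \<zeta> .: Hs|] ==> lin U Hs (%x. hconv (f x) \<zeta>)"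
  "[|lin U Hs f; \<zeta> .: Hs|] ==> lin U Hs (%x. hconv \<zeta> (f x))"
  using lin_compose by blast+
qed

lemma cX_convolution:
 assumes "x .: Hs" "x' .: Hs"
 shows "cX x *M cX x' = cX (\<lambda>c\<in>carrier H. lift (scalars K) (%a b. x' a \<otimes> x b) (hcom c))"
 using cX_mult[OF assms] by (simp add: hconv_def)

text \<open>The coproduct of \<open>\<widehat>H\<close> is made for this relation: it turns the product of the two
 copies into \<open>R\<^sub>2\<^sub>1\<close>-conjugates, which cancel against \<open>R\<^sub>3\<^sub>4\<close>.\<close>

lemma X_R_X: "j3 Xm *N (R34 *N j4 Xm) = dop Xm *N R34"
proof -
 interpret A: assoc_algebra K H by (rule algH)
 interpret M: assoc_algebra K M by (rule algM)
 note c = lin_closed[OF lin_cX] T_closed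
 have b: "bil H H MHH (%s t. nn \<one>\<^bsub>M\<^esub> s t)" "bil Hs H MHH (%x h. nn (cX x) h uH)"
  "bil Hs H MHH (%x h. nn (cX x) uH h)" "bil Hs H MHH (%x h. sw MHH h (%a b. nn (cX x) b a))"
  "bil Hs H MHH (%x h. Rs MHH (%s t. nn (cX x) s (t ** h)))"
  by (assumption | rule mcalc)+
 let ?f = "%y h' h. Rs MHH (%s t. nn (cX y) (h ** s) (t ** h'))"
 have RX: "R34 *N j4 Xm = Cs MHH (%x h. Rs MHH (%s t. nn (cX x) s (t ** h)))"
  unfolding j_images R34_def Rs_Cs_mult[OF b(3,1)]
  by (rule Cs_cong, rule Rs_cong,
   simp add: nn_mult c)
 have "j3 Xm *N (R34 *N j4 Xm) =
  Cs MHH (%x h. Cs MHH (%x' h'. nn (cX x) h uH *N Rs MHH (%s t. nn (cX x') s (t ** h'))))"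
  unfolding RX unfolding j_images by (rule Cs_mult[OF b(2,5)])
 also have "... = Cs MHH (%x h. Cs MHH (%x' h'. ?f (\<lambda>c\<in>carrier H. lift (scalars K) (%a b. x' a \<otimes> x b) (hcom c)) h' h))"
 proof (rule Cs_cong, rule Cs_cong)
  fix x h x' h' assume x: "x .: Hs" "h .: H" "x' .: Hs" "h' .: H"
  have n: "nn (cX x) h uH .: MHH" by (assumption | rule mcalc x)+
  have "nn (cX x) h uH *N Rs MHH (%s t. nn (cX x') s (t ** h')) = Rs MHH (%s t. nn (cX x *M cX x') (h ** s) (t ** h'))"
   by (rule Rs_comp'[OF lin_mult_right[OF lin_id algMHH n] vsMHH vsMHH], (assumption | rule mcalc x)+, simp add: nn_mult c x)
  then show "nn (cX x) h uH *N Rs MHH (%s t. nn (cX x') s (t ** h')) =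
   ?f (\<lambda>c\<in>carrier H. lift (scalars K) (%a b. x' a \<otimes> x b) (hcom c)) h' h"
   unfolding cX_convolution[OF x(1,3)] .
 qed
 also have "... = Cs MHH (%x h. Cs MHH (%x' h'. ?f (hconv x x') h' h))"
  unfolding hconv_def ..
 also have "... = Cs MHH (%x' h'. Cs MHH (%x h. ?f (hconv x x') h' h))"
  by (rule tensor_lift_swap[OF vsHs vsH vsHs vsH vsMHH C_closed C_closed]; (assumption | rule hconv_lin mcalc)+)
 also have "... = Cs MHH (%x h. lift MHH (?f x) (hcom h))"
  unfolding hconv_def
  by (rule canonical_convolution[OF db vsMHH lin_hcom]; (assumption | rule mcalc)+)
 also have "... = Cs MHH (%x h. Rs MHH (%s t. sw MHH h (%a b. nn (cX x) (b ** s) (a ** t))))"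
 proof (rule sym, rule Cs_cong)
  fix x h assume x: "x .: Hs" "h .: H"
  let ?g = "%a b s t s' t' u v. nn (cX x) (((b ** s) ** T s') ** u) (v ** ((t' ** a) ** t))"
  have "lift MHH (?f x) (hcom h) =
   Rs MHH (%s t. Rs MHH (%s' t'. sw MHH h (%a b. Rs MHH (%u v. ?g a b s t s' t' u v))))"
   by (rule lift_hcom[OF vsMHH _ x(2)]) ((assumption | rule mcalc x)+)
  also have "... = Rs MHH (%s t. sw MHH h (%a b. Rs MHH (%s' t'. Rs MHH (%u v. ?g a b s t s' t' u v))))"
   by (rule Rs_cong,
    rule tensor_lift_swap[OF vsH vsH vsH vsH vsMHH R_closed comult_closed[OF x(2)]]; (assumption | rule mcalc x)+)
  also have "... = Rs MHH (%s t. sw MHH h (%a b. Rs MHH (%u v. Rs MHH (%s' t'. ?g a b s t s' t' u v))))"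
   by (rule Rs_cong, rule sw_cong[OF x(2)],
    rule Rs_swap[OF vsMHH]; (assumption | rule mcalc x)+)
  also have "... = Rs MHH (%s t. sw MHH h (%a b. nn (cX x) ((b ** s) ** uH) (uH ** (a ** t))))"
  proof (rule Rs_cong, rule sw_cong[OF x(2)])
   fix s t a b assume y: "s .: H" "t .: H" "a .: H" "b .: H"
   \<comment> \<open>The pair u, v comes from R_34 and the pair s', t' from the outer twist in the
     coproduct of H-hat. They meet as S^-1(s') u and v t' and cancel, so only the inner copy of R
     survives, on the right.\<close>
   have "Rs MHH (%u v. Rs MHH (%s' t'. ?g a b s t s' t' u v)) =
    Rs MHH (%u v. Rs MHH (%s' t'. nn (cX x) ((b ** s) ** (T s' ** u)) ((v ** t') ** (a ** t))))"
    by (rule Rs_cong, rule Rs_cong,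
     simp add: A.m_assoc T_closed y)
   also have "... = nn (cX x) ((b ** s) ** uH) (uH ** (a ** t))"
    by (rule R_cancel_T(2)[OF vsMHH, of "%p q. nn (cX x) ((b ** s) ** p) (q ** (a ** t))"]) ((assumption | rule mcalc x y)+)
   finally show "Rs MHH (%u v. Rs MHH (%s' t'. ?g a b s t s' t' u v)) = nn (cX x) ((b ** s) ** uH) (uH ** (a ** t))" .
  qed
  also have "... = Rs MHH (%s t. sw MHH h (%a b. nn (cX x) (b ** s) (a ** t)))"
   by (rule sym, rule Rs_cong, rule sw_cong[OF x(2)], simp)
  finally show "Rs MHH (%s t. sw MHH h (%a b. nn (cX x) (b ** s) (a ** t))) = lift MHH (?f x) (hcom h)" by simp
 qed
 also have "... = dop Xm *N R34"
  unfolding j_images R34_def Cs_Rs_mult[OF b(4,1)]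
 proof (rule Cs_cong, rule Rs_cong)
  fix x h s t assume x: "x .: Hs" "h .: H" "s .: H" "t .: H"
  have n: "nn \<one>\<^bsub>M\<^esub> s t .: MHH" by (assumption | rule mcalc x)+
  have "sw MHH h (%a b. nn (cX x) b a) *N nn \<one>\<^bsub>M\<^esub> s t = sw MHH h (%a b. nn (cX x) (b ** s) (a ** t))"
   by (rule sw_comp'[OF lin_mult_left[OF lin_id algMHH n] vsMHH vsMHH _ x(2)], (assumption | rule mcalc x)+, simp add: nn_mult c x)
  then show "sw MHH h (%a b. nn (cX x) (b ** s) (a ** t)) = sw MHH h (%a b. nn (cX x) b a) *N nn \<one>\<^bsub>M\<^esub> s t" by simp
 qed
 finally show ?thesis .
qed

text \<open>S^-1 reverses coproducts, so the product W_3 W_4 has \<Delta>(S^-1(h)) in the legs 3 and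
  4. The claim is then R \<Delta> = \<Delta>^op R at S^-1(h).\<close>

lemma R_W_W: "R34 *N (j3 Wm *N j4 Wm) = dop Wm *N R34"
proof -
 interpret A: assoc_algebra K H by (rule algH)
 interpret M: assoc_algebra K M by (rule algM)
 note c = lin_closed[OF lin_dX] T_closed
 have b: "bil H H MHH (%s t. nn \<one>\<^bsub>M\<^esub> s t)" "bil Hs H MHH (%x h. nn (dX x) (T h) uH)"
  "bil Hs H MHH (%x h. nn (dX x) uH (T h))" "bil Hs H MHH (%x h. sw MHH (T h) (%a b. nn (dX x) b a))"
  "bil Hs H MHH (%x h. sw MHH (T h) (%a b. nn (dX x) a b))"
  by (assumption | rule mcalc)+
 let ?f = "%y h' h. nn (dX y) (T h) (T h')"
 have "j3 Wm *N j4 Wm = Cs MHH (%x h. Cs MHH (%x' h'. ?f (conv x x') h' h))"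
  unfolding j_images Cs_mult[OF b(2,3)]
  by (rule Cs_cong, rule Cs_cong,
   simp add: nn_mult c dX_mult)
 also have "... = Cs MHH (%x' h'. Cs MHH (%x h. ?f (conv x x') h' h))"
  by (rule tensor_lift_swap[OF vsHs vsH vsHs vsH vsMHH C_closed C_closed]; (assumption | rule mcalc)+)
 also have "... = Cs MHH (%x h. sw MHH h (?f x))"
  unfolding conv_def
  by (rule canonical_convolution[OF db vsMHH lin_comult0]; (assumption | rule mcalc)+)
 also have "... = Cs MHH (%x h. sw MHH (T h) (%a b. nn (dX x) a b))"
  by (rule Cs_cong,
   rule sw_T[OF vsMHH, of "%a b. nn (dX x) a b" for x, symmetric]; (assumption | rule mcalc)+)
 finally have WW: "j3 Wm *N j4 Wm = Cs MHH (%x h. sw MHH (T h) (%a b. nn (dX x) a b))" .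
 have "R34 *N (j3 Wm *N j4 Wm) =
  Cs MHH (%x h. Rs MHH (%s t. nn \<one>\<^bsub>M\<^esub> s t *N sw MHH (T h) (%a b. nn (dX x) a b)))"
  unfolding WW R34_def by (rule Rs_Cs_mult[OF b(5,1)])
 also have "... = Cs MHH (%x h. Rs MHH (%s t. sw MHH (T h) (%a b. nn (dX x) (s ** a) (t ** b))))"
 proof (rule sym, rule Cs_cong, rule Rs_cong)
  fix x h s t assume x: "x .: Hs" "h .: H" "s .: H" "t .: H"
  have n: "nn \<one>\<^bsub>M\<^esub> s t .: MHH" by (assumption | rule mcalc x)+
  have "nn \<one>\<^bsub>M\<^esub> s t *N sw MHH (T h) (%a b. nn (dX x) a b) = sw MHH (T h) (%a b. nn (dX x) (s ** a) (t ** b))"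
   by (rule sw_comp'[OF lin_mult_right[OF lin_id algMHH n] vsMHH vsMHH _ T_closed[OF x(2)]], (assumption | rule mcalc x)+, simp add: nn_mult c x)
  then show "sw MHH (T h) (%a b. nn (dX x) (s ** a) (t ** b)) = nn \<one>\<^bsub>M\<^esub> s t *N sw MHH (T h) (%a b. nn (dX x) a b)"
   by simp
 qed
 also have "... = Cs MHH (%x h. sw MHH (T h) (%a b. Rs MHH (%s t. nn (dX x) (b ** s) (a ** t))))"
  by (rule Cs_cong,
   rule R_intertwine[OF vsMHH, of "%p q. nn (dX x) p q" for x]; (assumption | rule mcalc)+)
 also have "... = Cs MHH (%x h. Rs MHH (%s t. sw MHH (T h) (%a b. nn (dX x) (b ** s) (a ** t))))"
  by (rule Cs_cong,
   rule tensor_lift_swap[OF vsH vsH vsH vsH vsMHH comult_closed R_closed]; (assumption | rule mcalc)+)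
 also have "... = dop Wm *N R34"
  unfolding j_images R34_def Cs_Rs_mult[OF b(4,1)]
 proof (rule Cs_cong, rule Rs_cong)
  fix x h s t assume x: "x .: Hs" "h .: H" "s .: H" "t .: H"
  have n: "nn \<one>\<^bsub>M\<^esub> s t .: MHH" by (assumption | rule mcalc x)+
  have "sw MHH (T h) (%a b. nn (dX x) b a) *N nn \<one>\<^bsub>M\<^esub> s t = sw MHH (T h) (%a b. nn (dX x) (b ** s) (a ** t))"
   by (rule sw_comp'[OF lin_mult_left[OF lin_id algMHH n] vsMHH vsMHH _ T_closed[OF x(2)]], (assumption | rule mcalc x)+, simp add: nn_mult c x)
  then show "sw MHH (T h) (%a b. nn (dX x) (b ** s) (a ** t)) = sw MHH (T h) (%a b. nn (dX x) b a) *N nn \<one>\<^bsub>M\<^esub> s t"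
   by simp
 qed
 finally show ?thesis .
qed

text \<open>In U_3 X_3 W_3 R_34 U_4 X_4 W_4, with U standing here for its factor R_13 in the
  corresponding legs, W_3 is moved past R_34 U_4, next U_4 past X_3 and X_4 past W_3. This leaves
  the blocks U_3 U_4, X_3 R_34 X_4 and R_34 W_3 W_4, each of which has been computed.\<close>

lemma UU_product: "j3 UU *N (R34 *N j4 UU) = dop UU *N R34"
proof -
 interpret N: assoc_algebra K MHH by (rule algMHH)
 interpret P: assoc_algebra K MH by (rule algMH)
 have c: "j3 Um .: MHH" "j3 Xm .: MHH" "j3 Wm .: MHH" "j4 Um .: MHH" "j4 Xm .: MHH"
  "j4 Wm .: MHH" "dop Um .: MHH" "dop Xm .: MHH" "dop Wm .: MHH" "R34 .: MHH"
  by (assumption | rule UUcalc)+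
 have e: "j3 UU = j3 Um *N (j3 Xm *N j3 Wm)" "j4 UU = j4 Um *N (j4 Xm *N j4 Wm)"
  "dop UU = dop Um *N (dop Xm *N dop Wm)"
  unfolding UU_def by (simp_all add: alg_homD(3)[OF j3_hom] alg_homD(3)[OF j4_hom] alg_homD(3)[OF dop_hom] UXW_closed)
 let ?m = "%x y. x *N y"
 have "?m (j3 UU) (?m R34 (j4 UU)) =
  ?m (?m (j3 Um) (j3 Xm)) (?m (?m (j3 Wm) (?m R34 (j4 Um))) (?m (j4 Xm) (j4 Wm)))"
  unfolding e using c by (simp add: N.m_assoc)
 also have "... = ?m (j3 Um) (?m (?m (j3 Xm) (j4 Um)) (?m R34 (?m (?m (j3 Wm) (j4 Xm)) (j4 Wm))))"
  unfolding W_R_U using c by (simp add: N.m_assoc)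
 also have "... = ?m (?m (j3 Um) (j4 Um)) (?m (?m (j3 Xm) (?m R34 (j4 Xm))) (?m (j3 Wm) (j4 Wm)))"
  unfolding X_U_commute W_X_commute using c by (simp add: N.m_assoc)
 also have "... = ?m (dop Um) (?m (dop Xm) (?m R34 (?m (j3 Wm) (j4 Wm))))"
  unfolding U_U X_R_X using c by (simp add: N.m_assoc)
 also have "... = ?m (dop UU) R34"
  unfolding R_W_W e using c by (simp add: N.m_assoc)
 finally show ?thesis .
qed

text \<open>\<open>Th\<close> undoes the factor \<open>R\<^sub>3\<^sub>4\<close>.\<close>

definition ev where "ev \<xi> = lift M (%m p. \<xi> p \<odot>\<^bsub>M\<^esub> m)"
definition Th where "Th \<xi> \<zeta> = lift M (%z q. lift M (%m p.
  Rs M (%s t. \<xi> (p ** T s) \<odot>\<^bsub>M\<^esub> (\<zeta> (t ** q) \<odot>\<^bsub>M\<^esub> m))) z)"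

lemma lin_ev: "\<xi> .: Hs ==> lin MH M (ev \<xi>)"
 and ev_mh: "[|\<xi> .: Hs; m .: M; p .: H|] ==> ev \<xi> (mh m p) = \<xi> p \<odot>\<^bsub>M\<^esub> m"
proof -
 have b: "bil M H M (%m p. \<xi> p \<odot>\<^bsub>M\<^esub> m)" if "\<xi> .: Hs" for \<xi> by (assumption | rule mcalc that)+
 show "\<xi> .: Hs ==> lin MH M (ev \<xi>)" unfolding ev_def by (rule MH_lift(1)[OF vsM b])
 show "[|\<xi> .: Hs; m .: M; p .: H|] ==> ev \<xi> (mh m p) = \<xi> p \<odot>\<^bsub>M\<^esub> m"
  unfolding ev_def by (rule MH_lift(2)[OF vsM b])
qed

lemma Th_props:
 assumes x: "\<xi> .: Hs" "\<zeta> .: Hs"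
 shows lin_Th: "lin MHH M (Th \<xi> \<zeta>)"
  and Th_nn: "[|m .: M; p .: H; q .: H|]
   ==> Th \<xi> \<zeta> (nn m p q) = Rs M (%s t. \<xi> (p ** T s) \<odot>\<^bsub>M\<^esub> (\<zeta> (t ** q) \<odot>\<^bsub>M\<^esub> m))"
proof -
 have b0: "bil M H M (%m p. Rs M (%s t. \<xi> (p ** T s) \<odot>\<^bsub>M\<^esub> (\<zeta> (t ** q) \<odot>\<^bsub>M\<^esub> m)))" if "q .: H" for q
  by (assumption | rule mcalc that x)+
 have b: "bil MH H M (%z q. lift M (%m p. Rs M (%s t. \<xi> (p ** T s) \<odot>\<^bsub>M\<^esub> (\<zeta> (t ** q) \<odot>\<^bsub>M\<^esub> m))) z)"
 proof (rule bilI)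
  show "lin MH M (lift M (%m p. Rs M (%s t. \<xi> (p ** T s) \<odot>\<^bsub>M\<^esub> (\<zeta> (t ** q) \<odot>\<^bsub>M\<^esub> m))))" if "q .: H" for q
   by (rule MH_lift(1)[OF vsM b0[OF that]])
  show "lin H M (%q. lift M (%m p. Rs M (%s t. \<xi> (p ** T s) \<odot>\<^bsub>M\<^esub> (\<zeta> (t ** q) \<odot>\<^bsub>M\<^esub> m))) z)" if z: "z .: MH" for z
   by (rule lin_lift_fun[OF z[unfolded MH_carrier] vsM vsH vsM vsH b0]) (assumption | rule mcalc x)+
 qed
 show "lin MHH M (Th \<xi> \<zeta>)"
  unfolding Th_def MHH_eqs by (rule lin_tensor_lift[OF vsMH vsH vsM b])
 show "[|m .: M; p .: H; q .: H|]
   ==> Th \<xi> \<zeta> (nn m p q) = Rs M (%s t. \<xi> (p ** T s) \<odot>\<^bsub>M\<^esub> (\<zeta> (t ** q) \<odot>\<^bsub>M\<^esub> m))"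
  unfolding Th_def nn_def by (simp add: tensor_lift_tens[OF vsMH vsH vsM b] mh_calc MH_lift(2)[OF vsM b0])
qed

text \<open>\<open>Th\<close> multiplies leg 3 by S^-1(s') on the right and leg 4 by t' on the left.
  Against R_34 this produces s S^-1(s') and t' t, which cancel by \<open>R_cancel_T\<close>, so the
  two H-legs are evaluated independently.\<close>

lemma Th_product:
 assumes x: "\<xi> .: Hs" "\<zeta> .: Hs" and z: "z .: MH" "z' .: MH"
 shows "Th \<xi> \<zeta> (j3 z *N (R34 *N j4 z')) = ev \<xi> z *M ev \<zeta> z'"
proof -
 interpret A: assoc_algebra K H by (rule algH)
 interpret M: assoc_algebra K M by (rule algM)
 note l = lin_compose[OF alg_homD(1)[OF j3_hom]] lin_compose[OF alg_homD(1)[OF j4_hom]]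
  lin_compose[OF lin_Th[OF x]] lin_compose[OF lin_ev] lin_closed[OF lin_ev]
 note t = UUcalc l x
 note lc = lin_closed[OF lin_ev]
 show ?thesis
 proof (rule MH_ext[OF vsM _ _ _ z(1)], ((assumption | rule t z)+)[2])
  fix m p assume m: "m .: M" "p .: H"
  show "Th \<xi> \<zeta> (j3 (mh m p) *N (R34 *N j4 z')) = ev \<xi> (mh m p) *M ev \<zeta> z'"
  proof (rule MH_ext[OF vsM _ _ _ z(2)], ((assumption | rule t m)+)[2])
   fix m' q assume m': "m' .: M" "q .: H"
   have n: "nn m' uH q .: MHH" "nn m p uH .: MHH" by (assumption | rule t m m')+
   have "R34 *N j4 (mh m' q) = Rs MHH (%s t. nn m' s (t ** q))"
    unfolding R34_def j4_mh[OF m'] by (rule Rs_comp'[OF lin_mult_left[OF lin_id algMHH n(1)] vsMHH vsMHH], (assumption | rule t)+, simp add: nn_mult m')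
   then have "j3 (mh m p) *N (R34 *N j4 (mh m' q)) = nn m p uH *N Rs MHH (%s t. nn m' s (t ** q))"
    by (simp add: j3_mh)
   also have "... = Rs MHH (%s t. nn (m *M m') (p ** s) (t ** q))"
    by (rule Rs_comp'[OF lin_mult_right[OF lin_id algMHH n(2)] vsMHH vsMHH], (assumption | rule t m')+, simp add: nn_mult m m')
   finally have "Th \<xi> \<zeta> (j3 (mh m p) *N (R34 *N j4 (mh m' q))) =
    Th \<xi> \<zeta> (Rs MHH (%s t. nn (m *M m') (p ** s) (t ** q)))" by simp
   also have "... = Rs M (%s t. Th \<xi> \<zeta> (nn (m *M m') (p ** s) (t ** q)))"
    by (rule Rs_comp[OF lin_Th[OF x] vsMHH vsM]) ((assumption | rule t m m')+)
   also have "... = Rs M (%s t. Rs M (%s' t'. \<xi> (p ** (s ** T s')) \<odot>\<^bsub>M\<^esub> (\<zeta> ((t' ** t) ** q) \<odot>\<^bsub>M\<^esub> (m *M m'))))"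
    by (rule sym, rule Rs_cong, rule trans[OF _ Th_nn[OF x, symmetric]],
      rule Rs_cong, simp add: A.m_assoc m m' T_closed,
      (assumption | rule t m m')+)
   also have "... = Rs M (%s' t'. Rs M (%s t. \<xi> (p ** (s ** T s')) \<odot>\<^bsub>M\<^esub> (\<zeta> ((t' ** t) ** q) \<odot>\<^bsub>M\<^esub> (m *M m'))))"
    by (rule Rs_swap[OF vsM]; (assumption | rule t m m')+)
   also have "... = \<xi> (p ** uH) \<odot>\<^bsub>M\<^esub> (\<zeta> (uH ** q) \<odot>\<^bsub>M\<^esub> (m *M m'))"
    by (rule R_cancel_T(1)[OF vsM, of "%y w. \<xi> (p ** y) \<odot>\<^bsub>M\<^esub> (\<zeta> (w ** q) \<odot>\<^bsub>M\<^esub> (m *M m'))"]) ((assumption | rule t m m')+)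
   also have "... = ev \<xi> (mh m p) *M ev \<zeta> (mh m' q)"
    using m m' smult_swap[OF vsM, of "\<xi> p" "\<zeta> q" "m *M m'"]
    by (simp add: ev_mh x dual_app_closed M.smult_mult_left M.smult_mult_right)
   finally show "Th \<xi> \<zeta> (j3 (mh m p) *N (R34 *N j4 (mh m' q))) = ev \<xi> (mh m p) *M ev \<zeta> (mh m' q)" .
  qed
 qed
qed

text \<open>The R-factors of \<open>hcom\<close> come from two sources: R_34 supplies t_i and s_i,
  and \<open>Th\<close> supplies t_j on the left of one leg and S^-1(s_j) on the right of the other.
  The flip in \<open>dop\<close> matches the opposite order in \<open>hconv\<close>.\<close>

lemma Th_coproduct:
 assumes x: "\<xi> .: Hs" "\<zeta> .: Hs" and z: "z .: MH"
 shows "Th \<xi> \<zeta> (dop z *N R34) = ev (hconv \<xi> \<zeta>) z"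
proof -
 interpret A: assoc_algebra K H by (rule algH)
 interpret M: assoc_algebra K M by (rule algM)
 note t = UUcalc lin_compose[OF alg_homD(1)[OF dop_hom]] lin_compose[OF lin_Th[OF x]] lin_compose[OF lin_ev] x
 show ?thesis
 proof (rule MH_ext[OF vsM _ _ _ z], ((assumption | rule t)+)[2])
  fix m p assume m: "m .: M" "p .: H"
  have R: "R34 .: MHH" by (rule R34_closed)
  have b: "bil H H MHH (%s t. nn \<one>\<^bsub>M\<^esub> s t)" by (assumption | rule t)+
  have "dop (mh m p) *N R34 = sw MHH p (%a b. Rs MHH (%s t. nn m b a *N nn \<one>\<^bsub>M\<^esub> s t))"
   unfolding dop_mh[OF m] R34_def
   by (rule tensor_lift_mult[OF vsH vsH vsH vsH algMHH _ b comult_closed[OF m(2)] R_closed]) ((assumption | rule t m)+)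
  also have "... = sw MHH p (%a b. Rs MHH (%s t. nn m (b ** s) (a ** t)))"
   by (rule sw_cong[OF m(2)], rule Rs_cong, simp add: nn_mult m)
  finally have "Th \<xi> \<zeta> (dop (mh m p) *N R34) = Th \<xi> \<zeta> (sw MHH p (%a b. Rs MHH (%s t. nn m (b ** s) (a ** t))))" by simp
  also have "... = sw M p (%a b. Rs M (%s t. Th \<xi> \<zeta> (nn m (b ** s) (a ** t))))"
   by (rule sw_comp'[OF lin_Th[OF x] vsMHH vsM _ m(2)], (assumption | rule t m)+, rule Rs_comp[OF lin_Th[OF x] vsMHH vsM];
    (assumption | rule t m)+)
  also have "... = sw M p (%a b. Rs M (%s t. Rs M (%s' t'. \<xi> ((b ** s) ** T s') \<odot>\<^bsub>M\<^esub> (\<zeta> ((t' ** a) ** t) \<odot>\<^bsub>M\<^esub> m))))"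
   by (rule sym, rule sw_cong[OF m(2)], rule Rs_cong,
     rule trans[OF _ Th_nn[OF x, symmetric]],
     rule Rs_cong, simp add: A.m_assoc m T_closed,
     (assumption | rule t m)+)
  also have "... = Rs M (%s t. sw M p (%a b. Rs M (%s' t'. \<xi> ((b ** s) ** T s') \<odot>\<^bsub>M\<^esub> (\<zeta> ((t' ** a) ** t) \<odot>\<^bsub>M\<^esub> m))))"
   by (rule tensor_lift_swap[OF vsH vsH vsH vsH vsM comult_closed[OF m(2)] R_closed]; (assumption | rule t m)+)
  also have "... = Rs M (%s t. Rs M (%s' t'. sw M p (%a b. \<xi> ((b ** s) ** T s') \<odot>\<^bsub>M\<^esub> (\<zeta> ((t' ** a) ** t) \<odot>\<^bsub>M\<^esub> m))))"
   by (rule Rs_cong,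
    rule tensor_lift_swap[OF vsH vsH vsH vsH vsM comult_closed[OF m(2)] R_closed]; (assumption | rule t m)+)
  also have "... = lift M (%y w. \<xi> w \<odot>\<^bsub>M\<^esub> (\<zeta> y \<odot>\<^bsub>M\<^esub> m)) (hcom p)"
   by (rule lift_hcom[symmetric, OF vsM _ m(2)]) ((assumption | rule t m)+)
  also have "... = lift M (%y w. (\<zeta> y \<otimes> \<xi> w) \<odot>\<^bsub>M\<^esub> m) (hcom p)"
   by (rule tensor_lift_cong[OF lin_closed[OF lin_hcom m(2)] vsH vsH],
    simp add: m dual_app_closed[OF x(1)] dual_app_closed[OF x(2)] M.smult_assoc1[symmetric] m_comm)
  also have "... = hconv \<xi> \<zeta> p \<odot>\<^bsub>M\<^esub> m"
   unfolding hconv_apply[OF m(2)]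
   by (rule lin_tensor_lift_comp[symmetric, OF lin_smult_left[OF vsM lin_id m(1)] vsH vsH vs_scalars vsM _ lin_closed[OF lin_hcom m(2)]])
    ((assumption | rule t m)+)
  also have "... = ev (hconv \<xi> \<zeta>) (mh m p)" by (simp add: ev_mh hconv_closed x m)
  finally show "Th \<xi> \<zeta> (dop (mh m p) *N R34) = ev (hconv \<xi> \<zeta>) (mh m p)" .
 qed
qed

definition psi where "psi \<xi> = ev \<xi> UU"

lemma psi_mult: "[|\<xi> .: Hs; \<zeta> .: Hs|] ==> psi (hconv \<xi> \<zeta>) = psi \<xi> *M psi \<zeta>"
 unfolding psi_def using Th_product[of \<xi> \<zeta> UU UU] Th_coproduct[of \<xi> \<zeta> UU] by (simp add: UU_product UXW_closed)

lemma ev_mult_eps: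
 assumes z: "z .: MH" "z' .: MH"
 shows "ev eps (z *L z') = ev eps z *M ev eps z'"
proof -
 interpret M: assoc_algebra K M by (rule algM)
 note t = UUcalc lin_compose[OF lin_ev] lin_closed[OF lin_ev]
 show ?thesis
 proof (rule MH_ext[OF vsM _ _ _ z(1)], ((assumption | rule t z)+)[2])
  fix m p assume m: "m .: M" "p .: H"
  show "ev eps (mh m p *L z') = ev eps (mh m p) *M ev eps z'"
   by (rule MH_ext[OF vsM _ _ _ z(2)], ((assumption | rule t m)+)[2])
    (simp add: mh_mult m ev_mh eps_closed mult_closed algH eps_apply counit_mult counit_closed M.smult_mult_left
     M.smult_mult_right M.smult_assoc1 smult_swap[OF vsM, of "\<epsilon> p"])
 qed
qed

lemma counit_T: assumes h: "h .: H" shows "\<epsilon> (T h) = \<epsilon> h"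
 using counit_antipode[OF T_closed[OF h]] by (simp add: S_T h)

text \<open>The counit on the H-leg is multiplicative and sends each of the three factors to 1: R_13
  by \<open>R_counit\<close>, X and W by contracting the canonical element with the counit.\<close>

lemma psi_eps: "psi eps = \<one>\<^bsub>M\<^esub>"
proof -
 interpret M: assoc_algebra K M by (rule algM)
 note L = legs_comp[OF lin_ev[OF eps_closed] vsM]
 have "ev eps Um = Rs M (%s t. \<epsilon> t \<odot>\<^bsub>M\<^esub> gH s)" "ev eps Xm = Cs M (%x h. eps h \<odot>\<^bsub>M\<^esub> cX x)"
  "ev eps Wm = Cs M (%x h. eps h \<odot>\<^bsub>M\<^esub> dX x)"
  by (rule L, simp add: ev_mh eps_closed lin_closed[OF lin_gH] lin_closed[OF lin_cX] lin_closed[OF lin_dX] T_closed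
    eps_apply counit_T)+
 then have "ev eps Um = \<one>\<^bsub>M\<^esub>" "ev eps Xm = \<one>\<^bsub>M\<^esub>" "ev eps Wm = \<one>\<^bsub>M\<^esub>"
  by (simp_all add: R_counit(2)[OF vsM lin_gH] canonical_dual[OF db vsM _ eps_closed] lin_cX lin_dX gH_one cX_eps dX_eps)
 then show ?thesis
  unfolding psi_def UU_def by (simp add: ev_mult_eps UXW_closed mult_closed[OF algMH])
qed

lemma lin_psi: "lin Hs M psi"
proof -
 have "lin Hs M (%\<xi>. ev \<xi> UU)"
  unfolding ev_def
  by (rule lin_lift_fun[OF UXW_closed(4)[unfolded MH_carrier] vsM vsH vsM vsHs]) (assumption | rule mcalc)+
 then show ?thesis unfolding psi_def[abs_def] .
qed

lemma psi_hom: "prehom B M psi"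
 using lin_psi psi_eps psi_mult by (simp add: prehom_B_iff)

end

section \<open>Compatibility with the comodule algebra\<close>

context target_base
begin

definition phi where "phi a = co M a (%h b. gH h *M eA b)"

lemma bil_phi: "bil H A M (%h b. gH h *M eA b)" by (assumption | rule mcalc)+

text \<open>The map is the coaction, an algebra homomorphism, followed by the product of the images
  of H and A in M; these images commute by \<open>gH_eA\<close>, so the second map is a homomorphism
  as well.\<close>

lemma phi_hom: "phi \<in> alg_hom K A M"
proof -
 interpret M: assoc_algebra K M by (rule algM)
 have e: "eA (a \<otimes>\<^bsub>A\<^esub> b) = eA a *M eA b" if "a .: A" "b .: A" for a b
  by (rule alg_homD(3)[OF eA_hom that])
 note c = lin_closed[OF lin_gH] lin_closed[OF lin_eA]
 have F: "lift M (%h b. gH h *M eA b) \<in> alg_hom K (tensor_alg K H A) M"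
 proof (rule alg_hom_tensor_lift[OF algH algA algM bil_phi])
  show "gH uH *M eA \<one>\<^bsub>A\<^esub> = \<one>\<^bsub>M\<^esub>" by (simp add: gH_one alg_homD(2)[OF eA_hom])
  fix h a h' a' assume x: "h .: H" "a .: A" "h' .: H" "a' .: A"
  have "gH (h ** h') *M eA (a \<otimes>\<^bsub>A\<^esub> a') = gH h *M ((gH h' *M eA a) *M eA a')"
   using x by (simp add: gH_mult e c M.m_assoc)
  also have "... = (gH h *M eA a) *M (gH h' *M eA a')"
   unfolding gH_eA[OF x(3,2)] using x by (simp add: c M.m_assoc)
  finally show "gH (h ** h') *M eA (a \<otimes>\<^bsub>A\<^esub> a') = (gH h *M eA a) *M (gH h' *M eA a')" .
 qed
 show ?thesis
 proof (rule alg_homI[OF algA algM])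
  show "lin A M phi" unfolding phi_def[abs_def] by (assumption | rule bil_phi mcalc)+
  show "phi \<one>\<^bsub>A\<^esub> = \<one>\<^bsub>M\<^esub>" unfolding phi_def alg_homD(2)[OF rho_hom] by (rule alg_homD(2)[OF F])
  show "phi (x \<otimes>\<^bsub>A\<^esub> y) = phi x *M phi y" if "x .: A" "y .: A" for x y
   unfolding phi_def alg_homD(3)[OF rho_hom that] using that
   by (intro alg_homD(3)[OF F]) (simp_all add: rho_closed)
 qed
qed

lemmas lin_phi = alg_homD(1)[OF phi_hom]
lemmas pcalc' = mcalc UXW_closed lin_compose[OF lin_phi] lin_closed[OF lin_phi]

text \<open>Two ways to place the iterated coaction a_[-2] \<otimes> a_[-1] \<otimes> a_[0] in M
  \<otimes> H: \<open>al\<close> has a_[-1] in leg 1 and a_[-2] in leg 3 (see \<open>al_eq\<close>),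
  \<open>be\<close> has them interchanged. W carries \<open>al\<close> to \<open>be\<close>, X
  commutes with \<open>be\<close>, and R_13 carries \<open>be\<close> back to \<open>al\<close>, so
  that U commutes with \<open>al\<close>.\<close>

definition al where "al a = co MH a (%q c. mh (phi c) q)"
definition be where "be a = co MH a (%l b. sw MH l (%q r. mh (gH q *M eA b) r))"

lemma al_be_closed: "a .: A ==> al a .: MH" "a .: A ==> be a .: MH"
 unfolding al_def be_def by (assumption | rule pcalc')+

lemma al_eq:
 assumes a: "a .: A"
 shows "al a = co MH a (%l b. sw MH l (%q r. mh (gH r *M eA b) q))"
proof -
 have "al a = co MH a (%q c. co MH c (%r b. mh (gH r *M eA b) q))"
  unfolding al_def phi_def
  by (rule sym, rule co_cong[OF a],
   rule co_comp[of M MH "%m. mh m q" for q, OF _ vsM vsMH bil_phi, symmetric]; (assumption | rule pcalc')+)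
 also have "... = co MH a (%l b. sw MH l (%q r. mh (gH r *M eA b) q))"
  by (rule co_coassoc[OF vsMH a, symmetric]; (assumption | rule pcalc')+)
 finally show ?thesis .
qed

lemma co_sw_comp:
 assumes F: "lin MH MH F" and a: "a .: A"
  and f: "!!q r. [|q .: H; r .: H|] ==> lin A MH (%b. f b q r)"
   "!!b r. [|b .: A; r .: H|] ==> lin H MH (%q. f b q r)"
   "!!b q. [|b .: A; q .: H|] ==> lin H MH (%r. f b q r)"
 shows "F (co MH a (%l b. sw MH l (%q r. f b q r))) = co MH a (%l b. sw MH l (%q r. F (f b q r)))"
proof -
 note t = pcalc' f lin_compose[OF F]
 have "F (co MH a (%l b. sw MH l (%q r. f b q r))) = co MH a (%l b. sw MH l (%q r. F (f b q r)))"
  by (rule co_comp'[OF F vsMH vsMH _ a], (assumption | rule t)+, rule sw_comp[OF F vsMH vsMH]; (assumption | rule t)+)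
 then show ?thesis .
qed

lemma leg_mult:
 assumes m: "m .: M" "p .: H"
 shows "Um *L mh m p = Rs MH (%s t. mh (gH s *M m) (t ** p))"
  "mh m p *L Um = Rs MH (%s t. mh (m *M gH s) (p ** t))"
  "Xm *L mh m p = Cs MH (%x h. mh (cX x *M m) (h ** p))"
  "mh m p *L Xm = Cs MH (%x h. mh (m *M cX x) (p ** h))"
  "Wm *L mh m p = Cs MH (%x h. mh (dX x *M m) (T h ** p))"
  "mh m p *L Wm = Cs MH (%x h. mh (m *M dX x) (p ** T h))"
proof -
 have z: "mh m p .: MH" by (assumption | rule mcalc m)+
 note L = legs_comp[OF lin_mult_left[OF lin_id algMH z] vsMH] legs_comp[OF lin_mult_right[OF lin_id algMH z] vsMH]
 show "Um *L mh m p = Rs MH (%s t. mh (gH s *M m) (t ** p))" "mh m p *L Um = Rs MH (%s t. mh (m *M gH s) (p ** t))"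
  "Xm *L mh m p = Cs MH (%x h. mh (cX x *M m) (h ** p))" "mh m p *L Xm = Cs MH (%x h. mh (m *M cX x) (p ** h))"
  "Wm *L mh m p = Cs MH (%x h. mh (dX x *M m) (T h ** p))" "mh m p *L Wm = Cs MH (%x h. mh (m *M dX x) (p ** T h))"
  by (rule L, simp add: mh_mult m lin_closed[OF lin_gH] lin_closed[OF lin_cX] lin_closed[OF lin_dX] T_closed)+
qed

lemma W_al: assumes a: "a .: A" shows "Wm *L al a = be a *L Wm"
proof -
 interpret M: assoc_algebra K M by (rule algM)
 note c = lin_closed[OF lin_gH] lin_closed[OF lin_dX] lin_closed[OF lin_eA] T_closed
 have W: "Wm .: MH" by (rule UXW_closed)
 have "Wm *L al a = co MH a (%l b. sw MH l (%q r. Wm *L mh (gH r *M eA b) q))"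
  unfolding al_eq[OF a]
  by (rule co_sw_comp[OF lin_mult_right[OF lin_id algMH W] a]; (assumption | rule mcalc)+)
 also have "... = co MH a (%l b. sw MH l (%q r. Cs MH (%x k. mh ((dX x *M gH r) *M eA b) (T k ** q))))"
  by (rule sym, rule co_cong[OF a], rule sw_cong, assumption, subst leg_mult, ((assumption | rule mcalc)+)[2],
   rule Cs_cong, simp add: M.m_assoc c)
 also have "... = co MH a (%l b. sw MH l (%q r. Cs MH (%x k. mh ((gH q *M dX x) *M eA b) (r ** T k))))"
  by (rule co_cong[OF a],
   rule W_intertwine[OF _ vsMH, of _ "%m p. mh (m *M eA b) p" for b]; (assumption | rule mcalc)+)
 also have "... = co MH a (%l b. sw MH l (%q r. mh (gH q *M eA b) r *L Wm))"
  by (rule co_cong[OF a], rule sw_cong, assumption, subst leg_mult, ((assumption | rule mcalc)+)[2],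
   rule Cs_cong, simp add: M.m_assoc c dX_eA)
 also have "... = be a *L Wm"
  unfolding be_def
  by (rule co_sw_comp[OF lin_mult_left[OF lin_id algMH W] a, symmetric]; (assumption | rule mcalc)+)
 finally show ?thesis .
qed

lemma U_be: assumes a: "a .: A" shows "Um *L be a = al a *L Um"
proof -
 interpret M: assoc_algebra K M by (rule algM)
 note c = lin_closed[OF lin_gH] lin_closed[OF lin_eA]
 have U: "Um .: MH" by (rule UXW_closed)
 have "Um *L be a = co MH a (%l b. sw MH l (%q r. Um *L mh (gH q *M eA b) r))"
  unfolding be_def
  by (rule co_sw_comp[OF lin_mult_right[OF lin_id algMH U] a]; (assumption | rule mcalc)+)
 also have "... = co MH a (%l b. sw MH l (%q r. Rs MH (%s t. mh (gH (s ** q) *M eA b) (t ** r))))"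
  by (rule sym, rule co_cong[OF a], rule sw_cong, assumption, subst leg_mult, ((assumption | rule mcalc)+)[2],
   rule Rs_cong, simp add: M.m_assoc c gH_mult)
 also have "... = co MH a (%l b. Rs MH (%s t. sw MH l (%q r. mh (gH (s ** q) *M eA b) (t ** r))))"
  by (rule co_cong[OF a],
   rule tensor_lift_swap[OF vsH vsH vsH vsH vsMH comult_closed R_closed]; (assumption | rule mcalc)+)
 also have "... = co MH a (%l b. sw MH l (%q r. Rs MH (%s t. mh (gH (r ** s) *M eA b) (q ** t))))"
  by (rule co_cong[OF a],
   rule R_intertwine[OF vsMH, of "%m p. mh (gH m *M eA b) p" for b]; (assumption | rule mcalc)+)
 also have "... = co MH a (%l b. sw MH l (%q r. mh (gH r *M eA b) q *L Um))"
  by (rule co_cong[OF a], rule sw_cong, assumption, subst leg_mult, ((assumption | rule mcalc)+)[2],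
   rule Rs_cong, simp add: M.m_assoc c gH_mult gH_eA[symmetric])
 also have "... = al a *L Um"
  unfolding al_eq[OF a]
  by (rule co_sw_comp[OF lin_mult_left[OF lin_id algMH U] a, symmetric]; (assumption | rule mcalc)+)
 finally show ?thesis .
qed

lemma Cs_co_swap:
 assumes "vs Z" "a .: A"
  and "!!u v. [|u .: Hs; v .: H|] ==> bil H A Z (f u v)"
  and "!!c d. [|c .: H; d .: A|] ==> bil Hs H Z (%u v. f u v c d)"
 shows "Cs Z (%u v. co Z a (f u v)) = co Z a (%c d. Cs Z (%u v. f u v c d))"
 by (rule tensor_lift_swap[OF vsHs vsH vsH vsA assms(1) C_closed rho_closed[OF assms(2)] assms(3,4)])

lemma Cs_hact:
 assumes l: "l .: H" and Z: "vs Z" and f: "bil Hs H Z f"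
 shows "Cs Z (%x h. f (hact x l) h) = sw Z l (%u v. Cs Z (%x h. f x ((v ** h) ** T u)))"
proof -
 note t = mcalc lin_compose[OF bil1[OF f]] lin_compose[OF bil2[OF f]] bil_closed[OF f] Z l
 let ?L = "%h. sw H l (%u v. (v ** h) ** T u)"
 have "Cs Z (%x h. f (hact x l) h) = Cs Z (%x h. f (\<lambda>v\<in>carrier H. x (?L v)) h)"
  unfolding hact_def hat_dual_act_def hat_act_def ..
 also have "... = Cs Z (%x h. f x (?L h))"
  by (rule canonical_transpose[OF db Z f]) ((assumption | rule t)+)
 also have "... = Cs Z (%x h. sw Z l (%u v. f x ((v ** h) ** T u)))"
  by (rule Cs_cong, rule sw_comp[OF bil1[OF f] vsH Z]; (assumption | rule t)+)
 also have "... = sw Z l (%u v. Cs Z (%x h. f x ((v ** h) ** T u)))"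
  by (rule Cs_sw_swap[OF Z l]; (assumption | rule t)+)
 finally show ?thesis .
qed

text \<open>Passing eA turns the functional leg of X into \<open>hact\<close>; transposed to the
  vector leg this replaces h by v h S^-1(u), with u and v the two newest legs of the coaction. The
  leg r already present in \<open>be\<close> precedes u, so S^-1(u) r cancels, and v remains on the
  left of h, as in the product of \<open>be\<close> with X.\<close>

lemma X_be: assumes a: "a .: A" shows "Xm *L be a = be a *L Xm"
proof -
 interpret M: assoc_algebra K M by (rule algM)
 interpret A': assoc_algebra K H by (rule algH)
 note c = lin_closed[OF lin_gH] lin_closed[OF lin_eA] lin_closed[OF lin_cX]
 have X: "Xm .: MH" by (rule UXW_closed)
 let ?G = "%q v y e. Cs MH (%x h. mh (gH q *M (eA e *M cX x)) ((v ** h) ** y))"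
 let ?F = "%q r l e. sw MH l (%u v. ?G q v (T u ** r) e)"
 have "Xm *L be a = co MH a (%l b. sw MH l (%q r. Xm *L mh (gH q *M eA b) r))"
  unfolding be_def
  by (rule co_sw_comp[OF lin_mult_right[OF lin_id algMH X] a]; (assumption | rule mcalc)+)
 also have "... = co MH a (%l b. sw MH l (%q r. co MH b (?F q r)))"
 proof (rule sym, rule co_cong[OF a], rule sw_cong, assumption)
  fix l b q r assume x: "l .: H" "b .: A" "q .: H" "r .: H"
  let ?k = "%x h l e. mh (gH q *M (eA e *M cX (hact x l))) (h ** r)"
  have "Xm *L mh (gH q *M eA b) r = Cs MH (%x h. mh (cX x *M (gH q *M eA b)) (h ** r))"
   by (rule leg_mult) ((assumption | rule mcalc x)+)
  also have "... = Cs MH (%x h. co MH b (?k x h))"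
  proof (rule Cs_cong)
   fix y h assume y: "y .: Hs" "h .: H"
   have "cX y *M (gH q *M eA b) = gH q *M (cX y *M eA b)"
    using x y by (simp add: M.m_assoc[symmetric] c gH_cX)
   then have "mh (cX y *M (gH q *M eA b)) (h ** r) =
     mh (gH q *M co M b (%l e. eA e *M cX (hact y l))) (h ** r)" by (simp add: cX_eA x y)
   also have "... = co MH b (?k y h)"
    by (rule co_comp[of M MH "%m. mh (gH q *M m) (h ** r)", OF _ vsM vsMH _ x(2)]) ((assumption | rule mcalc x y)+)
   finally show "mh (cX y *M (gH q *M eA b)) (h ** r) = co MH b (?k y h)" .
  qed
  also have "... = co MH b (%l e. Cs MH (%x h. ?k x h l e))"
   by (rule Cs_co_swap[OF vsMH x(2)]; (assumption | rule lin_compose[OF lin_hact1] mcalc x)+)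
  also have "... = co MH b (?F q r)"
  proof (rule sym, rule co_cong[OF x(2)])
   fix l e assume y: "l .: H" "e .: A"
   have "Cs MH (%x h. ?k x h l e) = sw MH l (%u v. Cs MH (%x h. mh (gH q *M (eA e *M cX x)) (((v ** h) ** T u) ** r)))"
    by (rule Cs_hact[OF y(1) vsMH, of "%x h. mh (gH q *M (eA e *M cX x)) (h ** r)"]) ((assumption | rule mcalc x y)+)
   also have "... = ?F q r l e"
    by (rule sw_cong[OF y(1)], rule Cs_cong,
     simp add: A'.m_assoc x T_closed)
   finally show "?F q r l e = Cs MH (%x h. ?k x h l e)" by simp
  qed
  finally show "co MH b (?F q r) = Xm *L mh (gH q *M eA b) r" by simp
 qed
 also have "... = co MH a (%q b'. co MH b' (%r b. co MH b (?F q r)))"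
  by (rule co_coassoc[OF vsMH a]; (assumption | rule mcalc)+)
 also have "... = co MH a (%q b'. co MH b' (%m e. ?G q m uH e))"
 proof (rule sym, rule co_cong[OF a])
  fix q b assume x: "q .: H" "b .: A"
  have "co MH b (%r b. co MH b (?F q r)) = co MH b (%m e. sw MH m (%r l. ?F q r l e))"
   by (rule co_coassoc[OF vsMH x(2), symmetric]; (assumption | rule mcalc x)+)
  also have "... = co MH b (%m e. ?G q m uH e)"
  proof (rule sym, rule co_cong[OF x(2)])
   fix m e assume y: "m .: H" "e .: A"
   have "sw MH m (%r l. ?F q r l e) = sw MH m (%w v. sw MH w (%r u. ?G q v (T u ** r) e))"
    by (rule sw_assoc[OF vsMH triI y(1), symmetric]; (assumption | rule mcalc x y)+)
   also have "... = sw MH m (%w v. \<epsilon> w \<odot>\<^bsub>MH\<^esub> ?G q v uH e)"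
    by (rule sym, rule sw_cong[OF y(1)],
     rule sw_T_antipode(2)[OF vsMH, of "%y. ?G q v y e" for v, symmetric]; (assumption | rule mcalc x y)+)
   also have "... = ?G q m uH e"
    by (rule sw_counit(1)[OF vsMH _ y(1)]) ((assumption | rule mcalc x y)+)
   finally show "?G q m uH e = sw MH m (%r l. ?F q r l e)" by simp
  qed
  finally show "co MH b (%m e. ?G q m uH e) = co MH b (%r b. co MH b (?F q r))" by simp
 qed
 also have "... = co MH a (%l e. sw MH l (%q m. ?G q m uH e))"
  by (rule co_coassoc[OF vsMH a, symmetric]; (assumption | rule mcalc)+)
 also have "... = co MH a (%l e. sw MH l (%q m. mh (gH q *M eA e) m *L Xm))"
  by (rule co_cong[OF a], rule sw_cong, assumption, subst leg_mult, ((assumption | rule mcalc)+)[2],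
   rule Cs_cong, simp add: M.m_assoc c)
 also have "... = be a *L Xm"
  unfolding be_def
  by (rule co_sw_comp[OF lin_mult_left[OF lin_id algMH X] a, symmetric]; (assumption | rule mcalc)+)
 finally show ?thesis .
qed

lemma UU_al: assumes a: "a .: A" shows "UU *L al a = al a *L UU"
proof -
 interpret P: assoc_algebra K MH by (rule algMH)
 note c = al_be_closed[OF a] UXW_closed
 have "UU *L al a = Um *L (Xm *L (Wm *L al a))" unfolding UU_def using c by (simp add: P.m_assoc)
 also have "... = Um *L ((Xm *L be a) *L Wm)" unfolding W_al[OF a] using c by (simp add: P.m_assoc)
 also have "... = (Um *L be a) *L (Xm *L Wm)" unfolding X_be[OF a] using c by (simp add: P.m_assoc)
 also have "... = al a *L UU" unfolding U_be[OF a] UU_def using c by (simp add: P.m_assoc)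
 finally show ?thesis .
qed

lemma ev_right:
 assumes x: "\<xi> .: Hs" and m: "m .: M" and z: "z .: MH"
 shows "ev \<xi> (z *L mh m uH) = ev \<xi> z *M m"
proof -
 interpret M: assoc_algebra K M by (rule algM)
 interpret A': assoc_algebra K H by (rule algH)
 note t = pcalc' lin_compose[OF lin_ev] x m
 show ?thesis
  by (rule MH_ext[OF vsM _ _ _ z], ((assumption | rule t)+)[2])
   (simp add: mh_mult m ev_mh x M.smult_mult_left dual_app_closed)
qed

lemma ev_hact:
 assumes x: "\<xi> .: Hs" and l: "l .: H" and n: "n .: M" and z: "z .: MH"
 shows "n *M ev (hact \<xi> l) z = ev \<xi> (sw MH l (%p q. (mh n q *L z) *L mh \<one>\<^bsub>M\<^esub> (T p)))"
proof -
 interpret M: assoc_algebra K M by (rule algM)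
 interpret A': assoc_algebra K H by (rule algH)
 note t = pcalc' lin_compose[OF lin_ev] x l n
 note le = lin_ev[OF x]
 show ?thesis
 proof (rule MH_ext[OF vsM _ _ _ z], ((assumption | rule t)+)[2])
  fix m y assume m: "m .: M" "y .: H"
  have "ev \<xi> (sw MH l (%p q. (mh n q *L mh m y) *L mh \<one>\<^bsub>M\<^esub> (T p))) = sw M l (%p q. \<xi> ((q ** y) ** T p) \<odot>\<^bsub>M\<^esub> (n *M m))"
   by (rule sw_comp'[OF le vsMH vsM _ l], (assumption | rule t m)+, simp add: mh_mult m n T_closed ev_mh x)
  also have "... = \<xi> (sw H l (%p q. (q ** y) ** T p)) \<odot>\<^bsub>M\<^esub> (n *M m)"
   by (rule sw_comp[of H M "%h. \<xi> h \<odot>\<^bsub>M\<^esub> (n *M m)", symmetric, OF _ vsH vsM _ l]) ((assumption | rule t m)+)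
  also have "... = n *M ev (hact \<xi> l) (mh m y)"
   using dual_app_closed[OF hact_closed[OF x l] m(2)] m
   by (simp add: ev_mh hact_closed x l n M.smult_mult_right hact_apply)
  finally show "n *M ev (hact \<xi> l) (mh m y) = ev \<xi> (sw MH l (%p q. (mh n q *L mh m y) *L mh \<one>\<^bsub>M\<^esub> (T p)))" by simp
 qed
qed

text \<open>\<open>psi (hact \<xi> h)\<close> evaluates \<xi> on h_2 U S^-1(h_1), with U reduced to
  its H-leg. Coassociativity assembles h_2 and \<open>phi b\<close> into \<open>al\<close>, which
  commutes with U by \<open>UU_al\<close>; afterwards h_2 and S^-1(h_1) are neighbours and
  cancel.\<close>

lemma psi_phi:
 assumes x: "\<xi> .: Hs" and a: "a .: A"
 shows "psi \<xi> *M phi a = co M a (%h b. phi b *M psi (hact \<xi> h))"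
proof -
 interpret M: assoc_algebra K M by (rule algM)
 interpret P: assoc_algebra K MH by (rule algMH)
 interpret A': assoc_algebra K H by (rule algH)
 note t = pcalc' lin_compose[OF lin_ev] lin_compose[OF lin_psi] lin_closed[OF lin_psi] x
 note le = lin_ev[OF x]
 note c = UXW_closed(4) lin_closed[OF lin_phi] T_closed
 have "co M a (%h b. phi b *M psi (hact \<xi> h)) =
  co M a (%h b. ev \<xi> (sw MH h (%p q. (mh (phi b) q *L UU) *L mh \<one>\<^bsub>M\<^esub> (T p))))"
  by (rule co_cong[OF a], unfold psi_def, rule ev_hact; (assumption | rule t)+)
 also have "... = ev \<xi> (co MH a (%h b. sw MH h (%p q. (mh (phi b) q *L UU) *L mh \<one>\<^bsub>M\<^esub> (T p))))"
  by (rule co_comp[OF le vsMH vsM _ a, symmetric]) ((assumption | rule t)+)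
 also have "co MH a (%h b. sw MH h (%p q. (mh (phi b) q *L UU) *L mh \<one>\<^bsub>M\<^esub> (T p))) =
  co MH a (%p b. co MH b (%q e. (mh (phi e) q *L UU) *L mh \<one>\<^bsub>M\<^esub> (T p)))"
  by (rule co_coassoc[OF vsMH a]; (assumption | rule t)+)
 also have "... = co MH a (%p b. co MH b (%q e. UU *L mh (phi e) (q ** T p)))"
 proof (rule sym, rule co_cong[OF a])
  fix p b assume y: "p .: H" "b .: A"
  have z: "mh \<one>\<^bsub>M\<^esub> (T p) .: MH" by (assumption | rule t y)+
  have ba: "bil H A MH (%q e. mh (phi e) q)" by (assumption | rule t)+
  have "co MH b (%q e. (mh (phi e) q *L UU) *L mh \<one>\<^bsub>M\<^esub> (T p)) = (al b *L UU) *L mh \<one>\<^bsub>M\<^esub> (T p)"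
   unfolding al_def
   by (rule co_comp[OF lin_mult_left[OF lin_mult_left[OF lin_id algMH c(1)] algMH z] vsMH vsMH ba y(2), symmetric])
  also have "... = UU *L (al b *L mh \<one>\<^bsub>M\<^esub> (T p))"
   unfolding UU_al[OF y(2), symmetric] using al_be_closed[OF y(2)] c(1) z by (simp add: P.m_assoc)
  also have "... = co MH b (%q e. UU *L mh (phi e) (q ** T p))"
   unfolding al_def
   by (rule co_comp'[OF lin_mult_right[OF lin_mult_left[OF lin_id algMH z] algMH c(1)] vsMH vsMH ba y(2)], simp add: mh_mult c y)
  finally show "co MH b (%q e. UU *L mh (phi e) (q ** T p)) =
    co MH b (%q e. (mh (phi e) q *L UU) *L mh \<one>\<^bsub>M\<^esub> (T p))" by simp
 qed
 also have "... = co MH a (%h e. sw MH h (%p q. UU *L mh (phi e) (q ** T p)))"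
  by (rule co_coassoc[OF vsMH a, symmetric]; (assumption | rule t)+)
 also have "... = co MH a (%h e. \<epsilon> h \<odot>\<^bsub>MH\<^esub> (UU *L mh (phi e) uH))"
  by (rule sym, rule co_cong[OF a],
   rule sw_T_antipode(1)[OF vsMH, of "%y. UU *L mh (phi e) y" for e, symmetric]; (assumption | rule t)+)
 also have "... = UU *L mh (phi a) uH"
  by (rule co_counit[OF vsMH _ a]) ((assumption | rule t)+)
 also have "ev \<xi> (UU *L mh (phi a) uH) = psi \<xi> *M phi a"
  unfolding psi_def by (rule ev_right[OF x _ c(1)]) ((assumption | rule t a)+)
 finally show ?thesis by simp
qed

lemma delta_exists:
 obtains \<delta> where "\<delta> \<in> alg_hom K Ref M" "!!a. a .: A ==> \<delta> (inA a) = phi a" "!!\<xi>. \<xi> .: Hs ==> \<delta> (inX \<xi>) = psi \<xi>"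
proof (rule ref_universal[OF algM phi_hom psi_hom psi_phi])
 fix \<delta>
 assume "\<delta> \<in> alg_hom K Ref M" "!!a. a .: A ==> \<delta> (inA a) = phi a" "!!\<xi>. \<xi> .: Hs ==> \<delta> (inX \<xi>) = psi \<xi>"
 then show thesis by (rule that)
qed

lemma psi_expand:
 assumes x: "\<xi> .: Hs"
 shows "psi \<xi> = Rs M (%s t. Cs M (%y h. Cs M (%y' h'. \<xi> ((t ** h') ** T h) \<odot>\<^bsub>M\<^esub> ((gH s *M dX y) *M cX y'))))"
proof -
 interpret M: assoc_algebra K M by (rule algM)
 interpret A': assoc_algebra K H by (rule algH)
 note c = lin_closed[OF lin_gH] lin_closed[OF lin_dX] lin_closed[OF lin_cX] T_closed
 note t = mcalc lin_compose[OF lin_ev] x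
 let ?f = "%y h y' h'. mh (cX y' *M dX y) (h' ** T h)"
 have b: "bil Hs H MH (%y h. mh (cX y) h)" "bil Hs H MH (%y h. mh (dX y) (T h))" "bil H H MH (%s t. mh (gH s) t)"
  "bil Hs H MH (%y h. Cs MH (%y' h'. ?f y h y' h'))"
  by (assumption | rule t)+
 have "Xm *L Wm = Cs MH (%y' h'. Cs MH (%y h. mh (cX y') h' *L mh (dX y) (T h)))"
  unfolding Xm_def Wm_def by (rule tensor_lift_mult[OF vsHs vsH vsHs vsH algMH b(1,2) C_closed C_closed])
 also have "... = Cs MH (%y' h'. Cs MH (%y h. ?f y h y' h'))"
  by (rule Cs_cong, rule Cs_cong,
   simp add: mh_mult c)
 also have "... = Cs MH (%y h. Cs MH (%y' h'. ?f y h y' h'))"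
  by (rule tensor_lift_swap[OF vsHs vsH vsHs vsH vsMH C_closed C_closed]; (assumption | rule t)+)
 finally have XW: "Xm *L Wm = Cs MH (%y h. Cs MH (%y' h'. ?f y h y' h'))" .
 have "psi \<xi> = ev \<xi> (Rs MH (%s t. Cs MH (%y h. mh (gH s) t *L Cs MH (%y' h'. ?f y h y' h'))))"
  unfolding psi_def UU_def XW unfolding Um_def
  by (subst tensor_lift_mult[OF vsH vsH vsHs vsH algMH b(3,4) R_closed C_closed]) (rule refl)
 also have "... = Rs M (%s t. Cs M (%y h. ev \<xi> (mh (gH s) t *L Cs MH (%y' h'. ?f y h y' h'))))"
  by (rule Rs_comp'[OF lin_ev[OF x] vsMH vsM], (assumption | rule t)+, rule Cs_comp[OF lin_ev[OF x] vsMH vsM]; (assumption | rule t)+)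
 also have "... = Rs M (%s t. Cs M (%y h. Cs M (%y' h'. ev \<xi> (mh (gH s) t *L ?f y h y' h'))))"
  by (rule Rs_cong, rule Cs_cong,
   rule Cs_comp[of MH M "%z. ev \<xi> (mh (gH s) t *L z)" for s t, OF _ vsMH vsM]; (assumption | rule t)+)
 also have "... = Rs M (%s t. Cs M (%y h. Cs M (%y' h'. \<xi> ((t ** h') ** T h) \<odot>\<^bsub>M\<^esub> ((gH s *M dX y) *M cX y'))))"
  by (rule Rs_cong, rule Cs_cong,
   rule Cs_cong, simp add: mh_mult c ev_mh x A'.m_assoc M.m_assoc dX_cX)
 finally show ?thesis .
qed

text \<open>The sum over the dual basis belonging to X is carried out; it replaces \<xi> by its
  translate v \<mapsto> \<xi>(t v S^-1(h)). In this form the map can be iterated, since translates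
  compose by \<open>bi_bi\<close>.\<close>

lemma psi_eq:
 assumes x: "\<xi> .: Hs"
 shows "psi \<xi> = Rs M (%s t. Cs M (%y h. (gH s *M dX y) *M cX (bi t \<xi> (T h))))"
proof -
 interpret A': assoc_algebra K H by (rule algH)
 show ?thesis
  unfolding psi_expand[OF x]
 proof (rule sym, rule Rs_cong, rule Cs_cong)
  fix s t y h assume z: "s .: H" "t .: H" "y .: Hs" "h .: H"
  have "(gH s *M dX y) *M cX (bi t \<xi> (T h)) = Cs M (%y' h'. bi t \<xi> (T h) h' \<odot>\<^bsub>M\<^esub> ((gH s *M dX y) *M cX y'))"
   by (rule canonical_dual[OF db vsM, of "%y'. (gH s *M dX y) *M cX y'", symmetric]) ((assumption | rule mcalc x z)+)
  also have "... = Cs M (%y' h'. \<xi> ((t ** h') ** T h) \<odot>\<^bsub>M\<^esub> ((gH s *M dX y) *M cX y'))"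
   by (rule Cs_cong, simp add: bi_apply A'.m_assoc z T_closed)
  finally show "(gH s *M dX y) *M cX (bi t \<xi> (T h)) =
   Cs M (%y' h'. \<xi> ((t ** h') ** T h) \<odot>\<^bsub>M\<^esub> ((gH s *M dX y) *M cX y'))" .
 qed
qed

end

section \<open>Tensor products and rebracketing of algebra homomorphisms\<close>

context field_base
begin

lemma alg_hom_tensor_map:
 assumes A: "alg A" "alg A'" and B: "alg B" "alg B'"
  and f: "f \<in> alg_hom K A A'" and g: "g \<in> alg_hom K B B'"
 shows "tensor_map K A' B' f g \<in> alg_hom K (tensor_alg K A B) (tensor_alg K A' B')"
proof -
 let ?N = "tensor_alg K A' B'"
 note E = same_space_eqs[OF same_space_tensor_alg[of A' B']] same_space_bil[OF same_space_tensor_alg[of A' B']]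
 note v = assoc_algebraD(1)[OF A(2)] assoc_algebraD(1)[OF B(2)]
 note t = calc v lin_compose[OF alg_homD(1)[OF f]] lin_compose[OF alg_homD(1)[OF g]] alg_homD(4)[OF f] alg_homD(4)[OF g]
 have b: "bil A B ?N (%v w. tens K A' B' (f v) (g w))" unfolding E by (assumption | rule t)+
 have "lift ?N (%v w. tens K A' B' (f v) (g w)) \<in> alg_hom K (tensor_alg K A B) ?N"
  by (rule alg_hom_tensor_lift[OF A(1) B(1) assoc_algebra_tensor_alg[OF A(2) B(2)] b])
   (simp_all add: alg_homD(2,3)[OF f] alg_homD(2,3)[OF g] tensor_alg_mult[OF A(2) B(2)] alg_homD(4)[OF f] alg_homD(4)[OF g])
 then show ?thesis unfolding tensor_map_def E .
qed

lemma alg_hom_tensor_assoc: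
 assumes A: "alg A" and B: "alg B" and C: "alg C"
 shows "tensor_assoc K A B C \<in> alg_hom K (tensor_alg K A (tensor_alg K B C)) (tensor_alg K (tensor_alg K A B) C)"
proof -
 let ?BC = "tensor_alg K B C" and ?AB = "tensor_alg K A B"
 let ?T = "tensor_alg K A ?BC" and ?N = "tensor_alg K ?AB C"
 let ?S = "tsp A (tsp B C)"
 note vA = assoc_algebraD(1)[OF A] and vB = assoc_algebraD(1)[OF B] and vC = assoc_algebraD(1)[OF C]
 note aBC = assoc_algebra_tensor_alg[OF B C] and aAB = assoc_algebra_tensor_alg[OF A B]
 note T = assoc_algebra_tensor_alg[OF A aBC] and N = assoc_algebra_tensor_alg[OF aAB C]
 note vN = assoc_algebraD(1)[OF N] and vBC = vs_tensor[OF vB vC]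
 note E = same_space_eqs[OF same_space_tensor_alg[of A ?BC]] same_space_eqs[OF same_space_tensor_alg[of ?AB C]]
  same_space_eqs[OF same_space_tensor_alg[of B C]] same_space_eqs[OF same_space_tensor_alg[of A B]]
 let ?F = "tensor_assoc K A B C"
 have lF: "lin ?S ?N ?F" using lin_tensor_assoc[OF vA vB vC] by (simp add: E)
 have ext3: "G x = G' x" if g: "lin ?S ?N G" "lin ?S ?N G'"
  and eq: "!!a b c. [|a .: A; b .: B; c .: C|] ==>
    G (tens K A ?BC a (tens K B C b c)) = G' (tens K A ?BC a (tens K B C b c))"
  and x: "x .: ?S" for G G' x
 proof (rule tensor_ext[OF vA vBC vN g _ x])
  fix a t assume a: "a .: A" and t: "t .: (tsp B C)"
  note l = lin_tens_right[OF lin_id vA vBC a]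
  show "G (tens K A (tsp B C) a t) = G' (tens K A (tsp B C) a t)"
   by (rule tensor_ext[OF vB vC vN lin_compose[OF g(1) l] lin_compose[OF g(2) l] _ t])
    (use eq[OF a] in \<open>simp add: E\<close>)
 qed
 have LM: "lin ?S ?S (%x. x \<otimes>\<^bsub>?T\<^esub> y)" "lin ?S ?S (%x. y \<otimes>\<^bsub>?T\<^esub> x)" if "y .: ?S" for y
  using lin_mult_left[OF lin_id T, of y] lin_mult_right[OF lin_id T, of y] that by (simp_all add: E)
 have at: "?F (tens K A ?BC a (tens K B C b c)) = tens K ?AB C (tens K A B a b) c"
  if "a .: A" "b .: B" "c .: C" for a b c
  using tensor_assoc_tens[OF vA vB vC that] by (simp add: E)
 have tc: "tens K B C b c .: (tsp B C)" if "b .: B" "c .: C" for b c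
  by (rule tens_closed[OF vB vC that])
 have tc': "tens K A B b c .: (tsp A B)" if "b .: A" "c .: B" for b c
  by (rule tens_closed[OF vA vB that])
 have tS: "tens K A ?BC a (tens K B C b c) .: ?S" if "a .: A" "b .: B" "c .: C" for a b c
  using tens_closed[OF vA vBC that(1) tc[OF that(2,3)]] by (simp add: E)
 note Fc = lin_closed[OF lF]
 show ?thesis
 proof (rule alg_homI[OF T N])
  show "lin ?T ?N ?F" using lF by (simp add: E)
  show "?F \<one>\<^bsub>?T\<^esub> = \<one>\<^bsub>?N\<^esub>" by (simp add: at one_closed' A B C)
  fix x y assume xy: "x .: ?T" "y .: ?T"
  then have x: "x .: ?S" and y: "y .: ?S" by (simp_all add: E)
  show "?F (x \<otimes>\<^bsub>?T\<^esub> y) = ?F x \<otimes>\<^bsub>?N\<^esub> ?F y"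
  proof (rule ext3[OF lin_compose[OF lF LM(1)[OF y]] lin_mult_left[OF lF N Fc[OF y]] _ x])
   fix a b c assume p: "a .: A" "b .: B" "c .: C"
   show "?F (tens K A ?BC a (tens K B C b c) \<otimes>\<^bsub>?T\<^esub> y) = ?F (tens K A ?BC a (tens K B C b c)) \<otimes>\<^bsub>?N\<^esub> ?F y"
   proof (rule ext3[OF lin_compose[OF lF LM(2)[OF tS[OF p]]] lin_mult_right[OF lF N Fc[OF tS[OF p]]] _ y])
    fix a' b' c' assume q: "a' .: A" "b' .: B" "c' .: C"
    show "?F (tens K A ?BC a (tens K B C b c) \<otimes>\<^bsub>?T\<^esub> tens K A ?BC a' (tens K B C b' c')) =
     ?F (tens K A ?BC a (tens K B C b c)) \<otimes>\<^bsub>?N\<^esub> ?F (tens K A ?BC a' (tens K B C b' c'))"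
     using p q by (simp add: tensor_alg_mult[OF A aBC] tensor_alg_mult[OF B C] tensor_alg_mult[OF aAB C]
      tensor_alg_mult[OF A B] tc tc' at mult_closed A B C)
   qed
  qed
 qed
qed

end

section \<open>The target: the tensor product of the double and the reflective algebra\<close>

locale coaction_base = ref_base K H R A \<rho> + dual_base K H D bs ds
 for K :: "('k, 'r) ring_scheme" (structure) and H :: "('k, 'h, 'm) hopf_scheme" and R
  and A :: "('k, 'a, 'n) module_scheme" and \<rho> and D :: "'d set" and bs and ds
begin

definition DR where "DR = tensor_alg K Drin Ref"
definition dr where "dr = tens K Drin Ref"
abbreviation DR_mult (infixl "*R" 70) where "u *R v \<equiv> u \<otimes>\<^bsub>DR\<^esub> v"

lemma algDR: "alg DR" unfolding DR_def by (rule assoc_algebra_tensor_alg[OF algD algRef])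
lemmas vsDR = assoc_algebraD(1)[OF algDR]

lemma DR_same: "same_space DR (tsp DT Ref)" and dr_eq: "dr = tens K DT Ref"
 using same_space_tensor_alg[of Drin Ref] by (simp_all add: DR_def dr_def Drin_same)
lemmas DR_eqs = same_space_eqs[OF DR_same] same_space_bil[OF DR_same]
lemma DR_carrier: "carrier DR = carrier (tsp DT Ref)" using DR_same by (simp add: same_space_def)

lemma dr_calc:
 "[|u .: DT; r .: Ref|] ==> dr u r .: DR"
 "[|lin U DT f; r .: Ref|] ==> lin U DR (%x. dr (f x) r)"
 "[|lin U Ref g; u .: DT|] ==> lin U DR (%x. dr u (g x))"
 unfolding DR_eqs DR_carrier dr_eq
 by (rule tens_closed[OF vsDT vsRef] lin_tens_left[OF _ vsDT vsRef] lin_tens_right[OF _ vsDT vsRef]; assumption)+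

lemma dr_mult: "[|u .: DT; r .: Ref; u' .: DT; r' .: Ref|]
  ==> dr u r *R dr u' r' = dr (u *D u') (r *F r')"
 and DR_one: "\<one>\<^bsub>DR\<^esub> = dr (pt eps uH) \<one>\<^bsub>Ref\<^esub>"
 unfolding DR_def dr_def by (rule tensor_alg_mult[OF algD algRef]; simp add: Drin_simps) (simp add: Drin_simps)

abbreviation one1 where "one1 \<equiv> pt eps uH"

definition gD where "gD h = dr (pt eps h) \<one>\<^bsub>Ref\<^esub>"
definition cD where "cD \<xi> = dr one1 (inX \<xi>)"
definition dD where "dD \<xi> = dr (pt \<xi> uH) \<one>\<^bsub>Ref\<^esub>"
definition eD where "eD a = dr one1 (inA a)"

lemmas ccalc = rcalc fcalc algDR vsDR dr_calc one_closed'[OF algRef]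

lemma pt_closed: "[|\<xi> .: Hs; h .: H|] ==> pt \<xi> h .: DT" by (assumption | rule fcalc)+

lemma dr_split:
 assumes "u .: DT" "r .: Ref"
 shows "dr u \<one>\<^bsub>Ref\<^esub> *R dr one1 r = dr u r" "dr one1 r *R dr u \<one>\<^bsub>Ref\<^esub> = dr u r"
proof -
 interpret Dr: assoc_algebra K Drin by (rule algD)
 interpret Re: assoc_algebra K Ref by (rule algRef)
 show "dr u \<one>\<^bsub>Ref\<^esub> *R dr one1 r = dr u r" "dr one1 r *R dr u \<one>\<^bsub>Ref\<^esub> = dr u r"
  using assms Dr.l_one[unfolded Drin_simps, OF assms(1)] Dr.r_one[unfolded Drin_simps, OF assms(1)]
  by (simp_all add: dr_mult pt_closed eps_closed oneH)
qed

text \<open>The commutation requirements hold because the images lie in different tensor factors.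
  The relation between gH and dX is the cross relation of the double, and the one between cX and eA
  is the defining relation of the reflective algebra.\<close>

sublocale Tg: target_base K H R A \<rho> D bs ds DR gD cD dD eD
proof (rule target_base.intro[OF ref_base_axioms dual_base_axioms], rule target_base_axioms.intro)
 interpret Dr: assoc_algebra K Drin by (rule algD)
 interpret Re: assoc_algebra K Ref by (rule algRef)
 interpret A': assoc_algebra K H by (rule algH)
 have one1: "one1 *D one1 = one1" using Dr.l_one[OF Dr.one_closed] by (simp add: Drin_simps)
 note c = pt_closed eps_closed oneH lin_closed[OF lin_inA] lin_closed[OF lin_inX]
 show "alg DR" by (rule algDR)
 show "lin H DR gD" unfolding gD_def[abs_def] by (assumption | rule ccalc)+
 show "lin Hs DR cD" unfolding cD_def[abs_def] by (assumption | rule ccalc)+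
 show "lin Hs DR dD" unfolding dD_def[abs_def] by (assumption | rule ccalc)+
 have "lin A DR eD" unfolding eD_def[abs_def] by (assumption | rule ccalc)+
 then show "eD \<in> alg_hom K A DR"
  by (rule alg_homI[OF algA algDR]) (simp_all add: eD_def DR_one alg_homD(2,3)[OF inA_hom] dr_mult c one1)
 show "gD uH = \<one>\<^bsub>DR\<^esub>" "cD eps = \<one>\<^bsub>DR\<^esub>" "dD eps = \<one>\<^bsub>DR\<^esub>"
  by (simp_all add: gD_def cD_def dD_def DR_one inX_one)
 show "gD (h ** l) = gD h *R gD l" if "h .: H" "l .: H" for h l
  using that by (simp add: gD_def dr_mult c pt_mult_eps)
 show "cD (hconv \<xi> \<zeta>) = cD \<xi> *R cD \<zeta>" if "\<xi> .: Hs" "\<zeta> .: Hs" for \<xi> \<zeta>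
  using that by (simp add: cD_def dr_mult c inX_mult one1)
 show "dD (conv \<xi> \<zeta>) = dD \<xi> *R dD \<zeta>" if "\<xi> .: Hs" "\<zeta> .: Hs" for \<xi> \<zeta>
  using that by (simp add: dD_def dr_mult c pt_mult_dual)
 show "gD h *R dD \<xi> = sw3 DR h (%a b c. dD (act a \<xi> c) *R gD b)" if x: "h .: H" "\<xi> .: Hs" for h \<xi>
 proof -
  have "gD h *R dD \<xi> = dr (sw3 DT h (%a b c. pt (act a \<xi> c) b)) \<one>\<^bsub>Ref\<^esub>"
   using x by (simp add: gD_def dD_def dr_mult c pt_eps_mult)
  also have "... = sw3 DR h (%a b c. dr (pt (act a \<xi> c) b) \<one>\<^bsub>Ref\<^esub>)"
   by (rule sw3_comp[of DT DR "%u. dr u \<one>\<^bsub>Ref\<^esub>", OF _ vsDT vsDR triI x(1)]; (assumption | rule ccalc x)+)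
  also have "... = sw3 DR h (%a b c. dD (act a \<xi> c) *R gD b)"
   by (rule sw3_cong[OF x(1)])
    (simp add: dD_def gD_def dr_mult c act_closed x pt_mult_eps A'.l_one)
  finally show ?thesis .
 qed
 show "cD \<xi> *R eD a = co DR a (%h b. eD b *R cD (hact \<xi> h))" if x: "\<xi> .: Hs" "a .: A" for \<xi> a
 proof -
  have "cD \<xi> *R eD a = dr one1 (co Ref a (%h b. inA b *F inX (hact \<xi> h)))"
   using x by (simp add: cD_def eD_def dr_mult c one1 ref_relation)
  also have "... = co DR a (%h b. dr one1 (inA b *F inX (hact \<xi> h)))"
   by (rule co_comp[of Ref DR "%u. dr one1 u", OF _ vsRef vsDR _ x(2)]) ((assumption | rule ccalc x)+)
  also have "... = co DR a (%h b. eD b *R cD (hact \<xi> h))"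
   by (rule co_cong[OF x(2)],
    simp add: cD_def eD_def dr_mult c one1 hact_closed x)
  finally show ?thesis .
 qed
qed (simp_all add: gD_def cD_def dD_def eD_def dr_split pt_closed eps_closed oneH lin_closed[OF lin_inA] lin_closed[OF lin_inX])

text \<open>By \<open>pt_eps_mult\<close> and \<open>drin_cross_eq\<close> this product is
  \<open>drin_cross K H s y\<close>, the first tensor factor in the stated formula.\<close>

abbreviation E where "E s y \<equiv> pt eps s *D pt y uH"

lemma phi_eq:
 assumes a: "a .: A" shows "Tg.phi a = co DR a (%h b. dr (pt eps h) (inA b))"
 unfolding Tg.phi_def
 by (rule co_cong[OF a],
  simp add: gD_def eD_def dr_split pt_closed eps_closed lin_closed[OF lin_inA])

lemma psi_eq:
 assumes x: "\<xi> .: Hs"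
 shows "Tg.psi \<xi> = Rs DR (%s t. Cs DR (%y h. dr (E s y) (inX (bi t \<xi> (T h)))))"
proof -
 interpret Re: assoc_algebra K Ref by (rule algRef)
 have e: "(dr u \<one>\<^bsub>Ref\<^esub> *R dr v \<one>\<^bsub>Ref\<^esub>) *R dr one1 r = dr (u *D v) r"
  if "u .: DT" "v .: DT" "r .: Ref" for u v r
 proof -
  have "dr u \<one>\<^bsub>Ref\<^esub> *R dr v \<one>\<^bsub>Ref\<^esub> = dr (u *D v) \<one>\<^bsub>Ref\<^esub>" using that by (simp add: dr_mult)
  then show ?thesis using dr_split(1)[OF Dmult(1)[OF that(1,2)] that(3)] by simp
 qed
 show ?thesis
  unfolding Tg.psi_eq[OF x]
  by (rule Rs_cong, rule Cs_cong,
   simp add: gD_def dD_def cD_def e pt_closed eps_closed oneH bi_closed x T_closed lin_closed[OF lin_inX])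
qed

end

context field_base
begin

lemma alg_hom_compose:
 assumes "f \<in> alg_hom K A B" "g \<in> alg_hom K B C" "alg A" "alg C"
 shows "(%x. g (f x)) \<in> alg_hom K A C"
 by (rule alg_homI[OF assms(3,4) lin_compose[OF alg_homD(1)[OF assms(2)] alg_homD(1)[OF assms(1)]]])
  (simp_all add: alg_homD(2,3)[OF assms(1)] alg_homD(2,3)[OF assms(2)] alg_homD(4)[OF assms(1)])

lemma alg_hom_id: "alg A ==> id \<in> alg_hom K A A"
 by (rule alg_homI) (simp_all add: lin_id[folded id_def])

end

section \<open>Coassociativity, counit and the explicit formula\<close>

context coaction_base
begin

definition N3 where "N3 = tensor_alg K DD Ref"
definition nt where "nt = tens K DD Ref"

lemma algN3: "alg N3" unfolding N3_def by (rule assoc_algebra_tensor_alg[OF algDD algRef])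
lemmas vsN3 = assoc_algebraD(1)[OF algN3]

lemma N3_same: "same_space N3 (tsp TT Ref)" and nt_eq: "nt = tens K TT Ref"
 using same_space_tensor_alg[of DD Ref] by (simp_all add: N3_def nt_def DD_eqs)
lemmas N3_eqs = same_space_eqs[OF N3_same] same_space_bil[OF N3_same]
lemma N3_carrier: "carrier N3 = carrier (tsp TT Ref)" using N3_same by (simp add: same_space_def)

lemma nt_calc:
 "[|u .: TT; r .: Ref|] ==> nt u r .: N3"
 "[|lin U TT f; r .: Ref|] ==> lin U N3 (%x. nt (f x) r)"
 "[|lin U Ref g; u .: TT|] ==> lin U N3 (%x. nt u (g x))"
 unfolding N3_eqs N3_carrier nt_eq
 by (rule tens_closed[OF vsTT vsRef] lin_tens_left[OF _ vsTT vsRef] lin_tens_right[OF _ vsTT vsRef]; assumption)+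

lemmas ncalc = ccalc gcalc algN3 vsN3 nt_calc

definition coL where "coL = tensor_map K DD Ref (comult Drin) id"

lemma coL_hom: "coL \<in> alg_hom K DR N3"
 unfolding coL_def DR_def N3_def
 by (rule alg_hom_tensor_map[OF algD algDD algRef algRef comult_Drin_hom alg_hom_id[OF algRef]])

lemma coL_dr: "[|u .: DT; r .: Ref|] ==> coL (dr u r) = nt (comult Drin u) r"
 unfolding coL_def dr_def nt_def
 using tensor_map_tens[OF alg_homD(1)[OF comult_Drin_hom] lin_id[folded id_def] assoc_algebraD(1)[OF algD] vsRef
   assoc_algebraD(1)[OF algDD] vsRef, of u r] by (simp add: Drin_simps(1))

text \<open>Up to rebracketing, id \<otimes> \<delta> sends \<open>dr u r\<close> to
  \<open>Qm u (\<delta> r)\<close>. This reduces the right-hand side of coassociativity to two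
  applications of the formula for \<delta>.\<close>

definition Qm where "Qm u z = tensor_assoc K Drin Drin Ref (tens K Drin DR u z)"

lemma assoc_hom: "tensor_assoc K Drin Drin Ref \<in> alg_hom K (tensor_alg K Drin DR) N3"
 unfolding DR_def N3_def by (rule alg_hom_tensor_assoc[OF algD algD algRef])

lemma Qm_calc:
 "[|u .: DT; z .: DR|] ==> Qm u z .: N3"
 "[|lin U DT f; z .: DR|] ==> lin U N3 (%x. Qm (f x) z)"
 "[|lin U DR g; u .: DT|] ==> lin U N3 (%x. Qm u (g x))"
proof -
 have l: "lin (tsp DT DR) N3 (tensor_assoc K Drin Drin Ref)"
  using alg_homD(1)[OF assoc_hom]
  unfolding same_space_eqs(3)[OF same_space_tensor_alg[of Drin DR]] unfolding Drin_same(7) .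
 have e: "tens K Drin DR = tens K DT DR" by (simp add: Drin_same)
 show "[|u .: DT; z .: DR|] ==> Qm u z .: N3"
  unfolding Qm_def e by (rule lin_closed[OF l tens_closed[OF vsDT vsDR]])
 show "[|lin U DT f; z .: DR|] ==> lin U N3 (%x. Qm (f x) z)"
  unfolding Qm_def e by (rule lin_compose[OF l lin_tens_left[OF _ vsDT vsDR]])
 show "[|lin U DR g; u .: DT|] ==> lin U N3 (%x. Qm u (g x))"
  unfolding Qm_def e by (rule lin_compose[OF l lin_tens_right[OF _ vsDT vsDR]])
qed

lemma Qm_dr: "[|u .: DT; v .: DT; r .: Ref|] ==> Qm u (dr v r) = nt (tt u v) r"
proof -
 assume x: "u .: DT" "v .: DT" "r .: Ref"
 have "Qm u (dr v r) = tensor_assoc K DT DT Ref (tens K DT (tsp DT Ref) u (tens K DT Ref v r))"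
  by (simp add: Qm_def dr_eq Drin_same DR_eqs)
 also have "... = nt (tt u v) r"
  unfolding nt_eq by (rule tensor_assoc_tens[OF vsDT vsDT vsRef x])
 finally show ?thesis .
qed

lemma comult_E:
 assumes s: "s .: H" and y: "y .: Hs"
 shows "comult Drin (E s y) = sw TT s (%p q. Cs TT (%x g. tt (E p x) (E q (bi g y uH))))"
proof -
 note t = gcalc s y
 have b: "bil H H TT (%a b. tt (pt eps a) (pt eps b))" "bil Hs H TT (%x g. tt (pt x uH) (pt (bi g y uH) uH))"
  by (assumption | rule t)+
 have "comult Drin (E s y) = comult Drin (pt eps s) *E comult Drin (pt y uH)"
  by (rule alg_homD(3)[OF comult_Drin_hom]) (simp_all add: Drin_simps(1) pt_closed eps_closed oneH s y)
 also have "... = sw TT s (%p q. Cs TT (%x g. tt (pt eps p) (pt eps q) *E tt (pt x uH) (pt (bi g y uH) uH)))"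
  unfolding comult_eps[OF s] comult_dual_one[OF y]
  using tensor_lift_mult[OF vsH vsH vsHs vsH algDD, of "%a b. tt (pt eps a) (pt eps b)"
   "%x g. tt (pt x uH) (pt (bi g y uH) uH)"] b comult_closed[OF s] C_closed by (simp add: DD_eqs)
 also have "... = sw TT s (%p q. Cs TT (%x g. tt (E p x) (E q (bi g y uH))))"
  by (rule sw_cong[OF s], rule Cs_cong,
   simp add: tt_mult pt_closed eps_closed oneH bi_closed y)
 finally show ?thesis .
qed

lemma coL_phi:
 assumes a: "a .: A"
 shows "coL (Tg.phi a) = co N3 a (%p b. co N3 b (%q c. nt (tt (pt eps p) (pt eps q)) (inA c)))"
proof -
 note t = ncalc lin_compose[OF alg_homD(1)[OF coL_hom]]
 have "coL (Tg.phi a) = co N3 a (%h b. coL (dr (pt eps h) (inA b)))"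
  unfolding phi_eq[OF a] by (rule co_comp[OF alg_homD(1)[OF coL_hom] vsDR vsN3 _ a]) ((assumption | rule t)+)
 also have "... = co N3 a (%h b. sw N3 h (%p q. nt (tt (pt eps p) (pt eps q)) (inA b)))"
 proof (rule sym, rule co_cong[OF a])
  fix h b assume x: "h .: H" "b .: A"
  have "coL (dr (pt eps h) (inA b)) = nt (sw TT h (%p q. tt (pt eps p) (pt eps q))) (inA b)"
   using x by (simp add: coL_dr pt_closed eps_closed lin_closed[OF lin_inA] comult_eps)
  also have "... = sw N3 h (%p q. nt (tt (pt eps p) (pt eps q)) (inA b))"
   by (rule sw_comp[of TT N3 "%u. nt u (inA b)", OF _ vsTT vsN3 _ x(1)]) ((assumption | rule t x)+)
  finally show "sw N3 h (%p q. nt (tt (pt eps p) (pt eps q)) (inA b)) = coL (dr (pt eps h) (inA b))" by simp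
 qed
 also have "... = co N3 a (%p b. co N3 b (%q c. nt (tt (pt eps p) (pt eps q)) (inA c)))"
  by (rule co_coassoc[OF vsN3 a]; (assumption | rule t)+)
 finally show ?thesis .
qed

lemma Qm_phi:
 assumes u: "u .: DT" and b: "b .: A"
 shows "Qm u (Tg.phi b) = co N3 b (%q c. nt (tt u (pt eps q)) (inA c))"
proof -
 note t = ncalc Qm_calc u
 have "Qm u (Tg.phi b) = co N3 b (%q c. Qm u (dr (pt eps q) (inA c)))"
  unfolding phi_eq[OF b] by (rule co_comp[of DR N3 "Qm u", OF _ vsDR vsN3 _ b]) ((assumption | rule t)+)
 also have "... = co N3 b (%q c. nt (tt u (pt eps q)) (inA c))"
  by (rule co_cong[OF b], simp add: Qm_dr u pt_closed eps_closed lin_closed[OF lin_inA])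
 finally show ?thesis .
qed

text \<open>The coproduct of \<open>E s y\<close> splits s and y. The split of s is resolved by the
  first hexagon axiom into two copies of R. In the split of y, the translation by g is transposed to
  the vector leg, where S^-1(gh) = S^-1(h) S^-1(g).\<close>

lemma coL_psi:
 assumes x: "\<xi> .: Hs"
 shows "coL (Tg.psi \<xi>) = Rs N3 (%s t. Rs N3 (%s' t'. Cs N3 (%z g. Cs N3 (%y h.
  nt (tt (E s z) (E s' y)) (inX (bi (t ** t') \<xi> (T h ** T g)))))))"
proof -
 interpret A': assoc_algebra K H by (rule algH)
 note t = ncalc lin_compose[OF alg_homD(1)[OF coL_hom]] x
 let ?f = "%p q t z g y h. nt (tt (E p z) (E q (bi g y uH))) (inX (bi t \<xi> (T h)))"
 have "coL (Tg.psi \<xi>) = Rs N3 (%s t. coL (Cs DR (%y h. dr (E s y) (inX (bi t \<xi> (T h))))))"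
  unfolding psi_eq[OF x] by (rule Rs_comp[OF alg_homD(1)[OF coL_hom] vsDR vsN3]) ((assumption | rule t)+)
 also have "... = Rs N3 (%s t. sw N3 s (%p q. Cs N3 (%z g. Cs N3 (%y h.
   nt (tt (E p z) (E q y)) (inX (bi t \<xi> (T h ** T g)))))))"
 proof (rule sym, rule Rs_cong)
  fix s t' assume st: "s .: H" "t' .: H"
  have "coL (Cs DR (%y h. dr (E s y) (inX (bi t' \<xi> (T h))))) = Cs N3 (%y h. coL (dr (E s y) (inX (bi t' \<xi> (T h)))))"
   by (rule Cs_comp[OF alg_homD(1)[OF coL_hom] vsDR vsN3]) ((assumption | rule t st)+)
  also have "... = Cs N3 (%y h. sw N3 s (%p q. Cs N3 (%z g. ?f p q t' z g y h)))"
  proof (rule sym, rule Cs_cong)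
   fix y h assume y: "y .: Hs" "h .: H"
   let ?X = "inX (bi t' \<xi> (T h))"
   have c: "E s y .: DT" "?X .: Ref" by (assumption | rule t st y)+
   have "coL (dr (E s y) ?X) = nt (sw TT s (%p q. Cs TT (%x g. tt (E p x) (E q (bi g y uH))))) ?X"
    using coL_dr[OF c] comult_E[OF st(1) y(1)] by simp
   also have "... = sw N3 s (%p q. nt (Cs TT (%x g. tt (E p x) (E q (bi g y uH)))) ?X)"
    by (rule sw_comp[of TT N3 "%u. nt u ?X", OF _ vsTT vsN3 _ st(1)]) ((assumption | rule t st y)+)
   also have "... = sw N3 s (%p q. Cs N3 (%z g. ?f p q t' z g y h))"
    by (rule sw_cong[OF st(1)],
     rule Cs_comp[of TT N3 "%u. nt u ?X", OF _ vsTT vsN3]; (assumption | rule t st y)+)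
   finally show "sw N3 s (%p q. Cs N3 (%z g. ?f p q t' z g y h)) = coL (dr (E s y) ?X)" by simp
  qed
  also have "... = sw N3 s (%p q. Cs N3 (%y h. Cs N3 (%z g. ?f p q t' z g y h)))"
   by (rule Cs_sw_swap[OF vsN3 st(1)]; (assumption | rule t st)+)
  also have "... = sw N3 s (%p q. Cs N3 (%z g. Cs N3 (%y h. ?f p q t' z g y h)))"
   by (rule sw_cong[OF st(1)],
    rule tensor_lift_swap[OF vsHs vsH vsHs vsH vsN3 C_closed C_closed]; (assumption | rule t st)+)
  also have "... = sw N3 s (%p q. Cs N3 (%z g. Cs N3 (%y h. nt (tt (E p z) (E q y)) (inX (bi t' \<xi> (T h ** T g))))))"
  proof (rule sw_cong[OF st(1)], rule Cs_cong)
   fix p q z g assume y: "p .: H" "q .: H" "z .: Hs" "g .: H"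
   have "Cs N3 (%y h. ?f p q t' z g y h) = Cs N3 (%y h. nt (tt (E p z) (E q y)) (inX (bi t' \<xi> (T (g ** (h ** uH))))))"
    unfolding bi_def[of _ _ "uH"]
    by (rule canonical_transpose[OF db vsN3, of "%y h. nt (tt (E p z) (E q y)) (inX (bi t' \<xi> (T h)))"])
     ((assumption | rule t st y)+)
   also have "... = Cs N3 (%y h. nt (tt (E p z) (E q y)) (inX (bi t' \<xi> (T h ** T g))))"
    by (rule Cs_cong, simp add: T_mult y)
   finally show "Cs N3 (%y h. ?f p q t' z g y h) = Cs N3 (%y h. nt (tt (E p z) (E q y)) (inX (bi t' \<xi> (T h ** T g))))" .
  qed
  finally show "sw N3 s (%p q. Cs N3 (%z g. Cs N3 (%y h. nt (tt (E p z) (E q y)) (inX (bi t' \<xi> (T h ** T g)))))) =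
   coL (Cs DR (%y h. dr (E s y) (inX (bi t' \<xi> (T h)))))" by simp
 qed
 also have "... = Rs N3 (%s t. Rs N3 (%s' t'. Cs N3 (%z g. Cs N3 (%y h.
  nt (tt (E s z) (E s' y)) (inX (bi (t ** t') \<xi> (T h ** T g)))))))"
  by (rule R_comult1[OF vsN3 triI]; (assumption | rule t)+)
 finally show ?thesis .
qed

lemma Qm_psi:
 assumes u: "u .: DT" and x: "\<xi> .: Hs"
 shows "Qm u (Tg.psi \<xi>) = Rs N3 (%s t. Cs N3 (%y h. nt (tt u (E s y)) (inX (bi t \<xi> (T h)))))"
proof -
 note t = ncalc Qm_calc u x
 have l: "lin DR N3 (Qm u)" by (assumption | rule t)+
 have "Qm u (Tg.psi \<xi>) = Rs N3 (%s t. Cs N3 (%y h. Qm u (dr (E s y) (inX (bi t \<xi> (T h))))))"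
  unfolding psi_eq[OF x] by (rule Rs_comp'[OF l vsDR vsN3], (assumption | rule t)+, rule Cs_comp[OF l vsDR vsN3]; (assumption | rule t)+)
 also have "... = Rs N3 (%s t. Cs N3 (%y h. nt (tt u (E s y)) (inX (bi t \<xi> (T h)))))"
  by (rule Rs_cong, rule Cs_cong,
   simp add: Qm_dr u Dmult pt_closed eps_closed oneH lin_closed[OF lin_inX] bi_closed x T_closed)
 finally show ?thesis .
qed

text \<open>Both composites are algebra homomorphisms, so they are compared on the generators. For a
  functional, applying the formula twice yields successive translates of \<xi>, which compose to the
  translate by t t' and S^-1(h) S^-1(g) found in \<open>coL_psi\<close>; for A the claim is
  coassociativity of \<rho>.\<close>

lemma coaction_coassoc:
 assumes \<delta>: "\<delta> \<in> alg_hom K Ref DR" and dA: "!!a. a .: A ==> \<delta> (inA a) = Tg.phi a"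
  and dX: "!!\<xi>. \<xi> .: Hs ==> \<delta> (inX \<xi>) = Tg.psi \<xi>" and r: "r .: Ref"
 shows "tensor_map K (tsp Drin Drin) Ref (comult Drin) id (\<delta> r) =
  tensor_assoc K Drin Drin Ref (tensor_map K Drin (tsp Drin Ref) id \<delta> (\<delta> r))"
proof -
 define Jm where "Jm z = tensor_assoc K Drin Drin Ref (tensor_map K Drin DR id \<delta> z)" for z
 interpret A': assoc_algebra K H by (rule algH)
 have mh: "tensor_map K Drin DR id \<delta> \<in> alg_hom K DR (tensor_alg K Drin DR)"
  using alg_hom_tensor_map[OF algD algD algRef algDR alg_hom_id[OF algD] \<delta>] unfolding DR_def .
 have J: "Jm \<in> alg_hom K DR N3"
  unfolding Jm_def[abs_def] by (rule alg_hom_compose[OF mh assoc_hom algDR algN3])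
 have Jdr: "Jm (dr u r) = Qm u (\<delta> r)" if "u .: DT" "r .: Ref" for u r
  unfolding Jm_def Qm_def dr_def
  using tensor_map_tens[OF alg_homD(1)[OF alg_hom_id[OF algD]] alg_homD(1)[OF \<delta>] assoc_algebraD(1)[OF algD] vsRef
   assoc_algebraD(1)[OF algD] vsDR, of u r] that by (simp add: Drin_simps(1))
 note l = alg_homD(1)[OF J]
 note t = ncalc Qm_calc lin_compose[OF l] lin_compose[OF Tg.lin_phi] lin_closed[OF Tg.lin_phi]
  lin_compose[OF Tg.lin_psi] lin_closed[OF Tg.lin_psi]
 have phi: "coL (Tg.phi a) = Jm (Tg.phi a)" if a: "a .: A" for a
 proof -
  have "Jm (Tg.phi a) = co N3 a (%h b. Qm (pt eps h) (Tg.phi b))"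
   unfolding phi_eq[OF a] by (rule co_comp'[OF l vsDR vsN3 _ a], (assumption | rule t)+,
    simp add: Jdr dA pt_closed eps_closed lin_closed[OF lin_inA])
  also have "... = coL (Tg.phi a)"
   unfolding coL_phi[OF a]
   by (rule co_cong[OF a], rule Qm_phi; (assumption | rule t)+)
  finally show ?thesis by simp
 qed
 have psi: "coL (Tg.psi \<xi>) = Jm (Tg.psi \<xi>)" if x: "\<xi> .: Hs" for \<xi>
 proof -
  let ?g = "%s t z g s' t' y h. nt (tt (E s z) (E s' y)) (inX (bi (t ** t') \<xi> (T h ** T g)))"
  have "Jm (Tg.psi \<xi>) = Rs N3 (%s t. Cs N3 (%y h. Jm (dr (E s y) (inX (bi t \<xi> (T h))))))"
   unfolding psi_eq[OF x] by (rule Rs_comp'[OF l vsDR vsN3], (assumption | rule t x)+, rule Cs_comp[OF l vsDR vsN3]; (assumption | rule t x)+)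
  also have "... = Rs N3 (%s t. Cs N3 (%y h. Qm (E s y) (Tg.psi (bi t \<xi> (T h)))))"
   by (rule Rs_cong, rule Cs_cong,
    simp add: Jdr dX pt_closed eps_closed oneH Dmult lin_closed[OF lin_inX] bi_closed x T_closed)
  also have "... = Rs N3 (%s t. Cs N3 (%z g. Rs N3 (%s' t'. Cs N3 (%y h. ?g s t z g s' t' y h))))"
  proof (rule sym, rule Rs_cong, rule Cs_cong)
   fix s t' z g assume y: "s .: H" "t' .: H" "z .: Hs" "g .: H"
   have c: "E s z .: DT" "bi t' \<xi> (T g) .: Hs" by (assumption | rule t x y)+
   show "Rs N3 (%s' t''. Cs N3 (%y h. ?g s t' z g s' t'' y h)) = Qm (E s z) (Tg.psi (bi t' \<xi> (T g)))"
    unfolding Qm_psi[OF c]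
    by (rule Rs_cong, rule Cs_cong,
     simp add: bi_bi x y T_closed)
  qed
  also have "... = coL (Tg.psi \<xi>)"
   unfolding coL_psi[OF x]
   by (rule Rs_cong,
    rule tensor_lift_swap[OF vsHs vsH vsH vsH vsN3 C_closed R_closed]; (assumption | rule t x)+)
  finally show ?thesis by simp
 qed
 have c: "inA a .: Ref" "inX \<xi> .: Ref" if "a .: A" "\<xi> .: Hs" for a \<xi>
  using that by (simp_all add: lin_closed[OF lin_inA] lin_closed[OF lin_inX])
 have "coL (\<delta> r) = Jm (\<delta> r)"
 proof (rule ref_span[OF vsN3 _ _ _ r])
  show "lin Ref N3 (%r. coL (\<delta> r))" "lin Ref N3 (%r. Jm (\<delta> r))"
   by (rule lin_compose[OF alg_homD(1)[OF coL_hom] alg_homD(1)[OF \<delta>]] lin_compose[OF l alg_homD(1)[OF \<delta>]])+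
  show "coL (\<delta> (inA a *F inX \<xi>)) = Jm (\<delta> (inA a *F inX \<xi>))" if "a .: A" "\<xi> .: Hs" for a \<xi>
   using that by (simp add: alg_homD(3)[OF \<delta>] c dA dX alg_homD(3)[OF coL_hom] alg_homD(3)[OF J] phi psi
    lin_closed[OF Tg.lin_phi] lin_closed[OF Tg.lin_psi])
 qed
 then show ?thesis
  unfolding coL_def Jm_def DR_def same_space_map(1)[OF same_space_tensor_alg[of Drin Drin]]
   same_space_map(2)[OF same_space_tensor_alg[of Drin Ref]] .
qed

text \<open>The counit of the double sends s y to \<epsilon>(s) y(1). Contraction sets the vector
  leg of W to 1, and \<open>R_counit\<close> sets t to 1, so the remaining translate of \<xi> is
  \<xi> itself.\<close>

lemma coaction_counit:
 assumes \<delta>: "\<delta> \<in> alg_hom K Ref DR" and dA: "!!a. a .: A ==> \<delta> (inA a) = Tg.phi a"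
  and dX: "!!\<xi>. \<xi> .: Hs ==> \<delta> (inX \<xi>) = Tg.psi \<xi>" and r: "r .: Ref"
 shows "lift Ref (%u b. counit Drin u \<odot>\<^bsub>Ref\<^esub> b) (\<delta> r) = r"
proof -
 interpret A': assoc_algebra K H by (rule algH)
 interpret Re: assoc_algebra K Ref by (rule algRef)
 define G where "G = lift Ref (%u b. counit Drin u \<odot>\<^bsub>Ref\<^esub> b)"
 note lc = lin_closed[OF lin_counit_Drin, simplified]
 note t0 = ccalc lin_compose[OF lin_counit_Drin] lc
 have b: "bil DT Ref Ref (%u b. counit Drin u \<odot>\<^bsub>Ref\<^esub> b)" by (assumption | rule t0)+
 have Gdr: "G (dr u b) = counit Drin u \<odot>\<^bsub>Ref\<^esub> b" if "u .: DT" "b .: Ref" for u b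
  unfolding G_def dr_eq by (rule tensor_lift_tens[OF vsDT vsRef vsRef b that])
 have G: "G \<in> alg_hom K DR Ref"
  unfolding G_def DR_def
 proof (rule alg_hom_tensor_lift[OF algD algRef algRef b[folded Drin_same]])
  show "counit Drin \<one>\<^bsub>Drin\<^esub> \<odot>\<^bsub>Ref\<^esub> \<one>\<^bsub>Ref\<^esub> = \<one>\<^bsub>Ref\<^esub>" using alg_homD(2)[OF counit_Drin_hom] by simp
  fix u b u' b' assume x: "u .: Drin" "b .: Ref" "u' .: Drin" "b' .: Ref"
  then have k: "counit Drin u .: K" "counit Drin u' .: K" by (simp_all add: Drin_simps(1) lc)
  show "counit Drin (u *D u') \<odot>\<^bsub>Ref\<^esub> (b *F b') = (counit Drin u \<odot>\<^bsub>Ref\<^esub> b) *F (counit Drin u' \<odot>\<^bsub>Ref\<^esub> b')"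
   using x k alg_homD(3)[OF counit_Drin_hom x(1,3)] smult_swap[OF vsRef k, of "b *F b'"]
   by (simp add: Re.smult_mult_left Re.smult_mult_right Re.smult_assoc1)
 qed
 note l = alg_homD(1)[OF G]
 note t = t0 lin_compose[OF l]
 have phi: "G (Tg.phi a) = inA a" if a: "a .: A" for a
 proof -
  have "G (Tg.phi a) = co Ref a (%h b. \<epsilon> h \<odot>\<^bsub>Ref\<^esub> inA b)"
   unfolding phi_eq[OF a] by (rule co_comp'[OF l vsDR vsRef _ a], (assumption | rule t)+,
    simp add: Gdr pt_closed eps_closed lin_closed[OF lin_inA] counit_pt eps_apply counit_one counit_closed)
  also have "... = inA a" by (rule co_counit[OF vsRef lin_inA a])
  finally show ?thesis .
 qed
 have psi: "G (Tg.psi \<xi>) = inX \<xi>" if x: "\<xi> .: Hs" for \<xi>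
 proof -
  have cE: "counit Drin (E s y) = \<epsilon> s \<otimes> y uH" if "s .: H" "y .: Hs" for s y
   using alg_homD(3)[OF counit_Drin_hom, of "pt eps s" "pt y uH"] that
   by (simp add: Drin_simps(1) pt_closed eps_closed counit_pt eps_apply counit_one counit_closed dual_app_closed)
  have "G (Tg.psi \<xi>) = Rs Ref (%s t. Cs Ref (%y h. G (dr (E s y) (inX (bi t \<xi> (T h))))))"
   unfolding psi_eq[OF x] by (rule Rs_comp'[OF l vsDR vsRef], (assumption | rule t x)+, rule Cs_comp[OF l vsDR vsRef]; (assumption | rule t x)+)
  also have "... = Rs Ref (%s t. Cs Ref (%y h. y uH \<odot>\<^bsub>Ref\<^esub> (\<epsilon> s \<odot>\<^bsub>Ref\<^esub> inX (bi t \<xi> (T h)))))"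
   by (rule Rs_cong, rule Cs_cong,
    simp add: Gdr cE pt_closed eps_closed oneH Dmult lin_closed[OF lin_inX] bi_closed x T_closed counit_closed
     dual_app_closed Re.smult_assoc1 smult_swap[OF vsRef])
  also have "... = Rs Ref (%s t. \<epsilon> s \<odot>\<^bsub>Ref\<^esub> inX (bi t \<xi> (T uH)))"
   by (rule sym, rule Rs_cong,
    rule canonical_vector[OF db vsRef, symmetric, of "%h. \<epsilon> s \<odot>\<^bsub>Ref\<^esub> inX (bi t \<xi> (T h))" for s t];
    (assumption | rule t x)+)
  also have "... = inX (bi uH \<xi> (T uH))"
   by (rule R_counit(1)[OF vsRef, of "%t. inX (bi t \<xi> (T uH))"]) ((assumption | rule t x)+)
  finally show ?thesis by (simp add: T_one bi_one x)
 qed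
 have c: "inA a .: Ref" "inX \<xi> .: Ref" if "a .: A" "\<xi> .: Hs" for a \<xi>
  using that by (simp_all add: lin_closed[OF lin_inA] lin_closed[OF lin_inX])
 have "G (\<delta> r) = r"
 proof (rule ref_span[OF vsRef _ lin_id _ r, of "%r. G (\<delta> r)"])
  show "lin Ref Ref (%r. G (\<delta> r))" by (rule lin_compose[OF l alg_homD(1)[OF \<delta>]])
  show "G (\<delta> (inA a *F inX \<xi>)) = inA a *F inX \<xi>" if "a .: A" "\<xi> .: Hs" for a \<xi>
   using that by (simp add: alg_homD(3)[OF \<delta>] c dA dX alg_homD(3)[OF G] phi psi
    lin_closed[OF Tg.lin_phi] lin_closed[OF Tg.lin_psi])
 qed
 then show ?thesis by (simp add: G_def)
qed

lemma coaction_exists: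
 "\<exists>\<delta>. left_comodule_algebra K Drin Ref \<delta> \<and> \<delta> \<in> alg_hom K Ref DR \<and>
  (\<forall>a\<in>carrier A. \<delta> (inA a) = Tg.phi a) \<and> (\<forall>\<xi>\<in>carrier Hs. \<delta> (inX \<xi>) = Tg.psi \<xi>)"
proof (rule Tg.delta_exists)
 fix \<delta>
 assume d: "\<delta> \<in> alg_hom K Ref DR" "!!a. a .: A ==> \<delta> (inA a) = Tg.phi a"
  "!!\<xi>. \<xi> .: Hs ==> \<delta> (inX \<xi>) = Tg.psi \<xi>"
 have "left_comodule_algebra K Drin Ref \<delta>"
  unfolding left_comodule_algebra_def left_comodule_algebra_axioms_def
  using bialgebra_Drin algRef d(1)[unfolded DR_def] coaction_coassoc[OF d] coaction_counit[OF d] by blast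
 then show ?thesis using d by blast
qed

lemma Rs_sum:
 assumes I: "finite I" "s \<in> I \<rightarrow> carrier H" "t \<in> I \<rightarrow> carrier H"
  and R: "R = (\<Oplus>\<^bsub>HH\<^esub>k\<in>I. tens K H H (s k) (t k))" and Z: "vs Z" and f: "bil H H Z f"
 shows "Rs Z f = (\<Oplus>\<^bsub>Z\<^esub>k\<in>I. f (s k) (t k))"
proof -
 interpret Z: vectorspace K Z by (rule Z)
 have "Rs Z f = (\<Oplus>\<^bsub>Z\<^esub>k\<in>I. lift Z f (tens K H H (s k) (t k)))"
  unfolding R by (rule lin_finsum[OF vs_tensor[OF vsH vsH] Z lin_tensor_lift[OF vsH vsH Z f]])
   (use I in \<open>auto intro!: tens_closed vsH\<close>)
 also have "... = (\<Oplus>\<^bsub>Z\<^esub>k\<in>I. f (s k) (t k))"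
  using I by (intro Z.finsum_cong') (auto simp: Pi_iff tensor_lift_tens[OF vsH vsH Z f] intro!: bil_closed[OF f])
 finally show ?thesis .
qed

text \<open>The sum contained in W runs over D, the dual basis on which the construction is built.
  The sum belonging to X was contracted in \<open>psi_eq\<close> and can be expanded again over the
  independent dual basis indexed by D'.\<close>

lemma psi_sum:
 assumes x: "\<xi> .: Hs" and I: "finite I" "s \<in> I \<rightarrow> carrier H" "t \<in> I \<rightarrow> carrier H"
  and R: "R = (\<Oplus>\<^bsub>HH\<^esub>k\<in>I. tens K H H (s k) (t k))" and db': "dual_bases K H D' bs' ds'"
 shows "Tg.psi \<xi> = (\<Oplus>\<^bsub>DR\<^esub>k\<in>I. \<Oplus>\<^bsub>DR\<^esub>d\<in>D. \<Oplus>\<^bsub>DR\<^esub>d'\<in>D'.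
  \<xi> ((t k ** bs' d') ** T (bs d)) \<odot>\<^bsub>DR\<^esub> dr (drin_cross K H (s k) (ds d)) (inX (ds' d')))"
proof -
 interpret A': assoc_algebra K H by (rule algH)
 interpret Z: vectorspace K DR by (rule vsDR)
 note e = dual_bases_expand[OF db] and e' = dual_bases_expand[OF db']
 note t = ccalc x
 have b: "bil H H DR (%s t. Cs DR (%y h. dr (E s y) (inX (bi t \<xi> (T h)))))" by (assumption | rule t)+
 have 1: "Cs DR (%y h. dr (E a y) (inX (bi c \<xi> (T h)))) = (\<Oplus>\<^bsub>DR\<^esub>d\<in>D. dr (E a (ds d)) (inX (bi c \<xi> (T (bs d)))))"
  if "a .: H" "c .: H" for a c
  by (rule lift_canonical[OF db vsDR]) ((assumption | rule t that)+)
 have 2: "dr (E a y) (inX (bi c \<xi> (T h))) =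
   (\<Oplus>\<^bsub>DR\<^esub>d'\<in>D'. \<xi> ((c ** bs' d') ** T h) \<odot>\<^bsub>DR\<^esub> dr (drin_cross K H a y) (inX (ds' d')))"
  if z: "a .: H" "c .: H" "y .: Hs" "h .: H" for a c y h
 proof -
  have cr: "drin_cross K H a y = E a y" using drin_cross_eq[OF z(1,3)] pt_eps_mult[OF z(1,3)] by simp
  have bc: "bi c \<xi> (T h) .: Hs" by (assumption | rule t z)+
  have "dr (E a y) (inX (bi c \<xi> (T h))) =
   lift DR (%z k. bi c \<xi> (T h) k \<odot>\<^bsub>DR\<^esub> dr (E a y) (inX z)) (canonical H D' bs' ds')"
   by (rule canonical_dual[OF db' vsDR _ bc, of "%z. dr (E a y) (inX z)", symmetric]) ((assumption | rule t z)+)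
  also have "... = (\<Oplus>\<^bsub>DR\<^esub>d'\<in>D'. bi c \<xi> (T h) (bs' d') \<odot>\<^bsub>DR\<^esub> dr (E a y) (inX (ds' d')))"
   by (rule lift_canonical[OF db' vsDR]) ((assumption | rule t z)+)
  also have "... = (\<Oplus>\<^bsub>DR\<^esub>d'\<in>D'. \<xi> ((c ** bs' d') ** T h) \<odot>\<^bsub>DR\<^esub> dr (drin_cross K H a y) (inX (ds' d')))"
  proof (rule Z.finsum_cong'[OF refl])
   fix d' assume d: "d' \<in> D'"
   show "bi c \<xi> (T h) (bs' d') \<odot>\<^bsub>DR\<^esub> dr (E a y) (inX (ds' d')) =
    \<xi> ((c ** bs' d') ** T h) \<odot>\<^bsub>DR\<^esub> dr (drin_cross K H a y) (inX (ds' d'))"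
    by (simp add: cr bi_apply e'(3)[OF d] A'.m_assoc z T_closed)
  next
   show "(%d'. \<xi> ((c ** bs' d') ** T h) \<odot>\<^bsub>DR\<^esub> dr (drin_cross K H a y) (inX (ds' d'))) \<in> D' \<rightarrow> carrier DR"
    unfolding cr by (rule Pi_I, (assumption | rule t z e'(3,4))+)
  qed
  finally show ?thesis .
 qed
 have "Tg.psi \<xi> = (\<Oplus>\<^bsub>DR\<^esub>k\<in>I. Cs DR (%y h. dr (E (s k) y) (inX (bi (t k) \<xi> (T h)))))"
  unfolding psi_eq[OF x] by (rule Rs_sum[OF I R vsDR b])
 also have "... = (\<Oplus>\<^bsub>DR\<^esub>k\<in>I. \<Oplus>\<^bsub>DR\<^esub>d\<in>D. \<Oplus>\<^bsub>DR\<^esub>d'\<in>D'.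
  \<xi> ((t k ** bs' d') ** T (bs d)) \<odot>\<^bsub>DR\<^esub> dr (drin_cross K H (s k) (ds d)) (inX (ds' d')))"
 proof (rule sym, rule Z.finsum_cong'[OF refl])
  show "(%k. Cs DR (%y h. dr (E (s k) y) (inX (bi (t k) \<xi> (T h))))) \<in> I \<rightarrow> carrier DR"
  proof (rule Pi_I)
   fix k assume "k \<in> I"
   then have k: "s k .: H" "t k .: H" using I by auto
   show "Cs DR (%y h. dr (E (s k) y) (inX (bi (t k) \<xi> (T h)))) .: DR" by (assumption | rule t k)+
  qed
  fix k assume "k \<in> I"
  then have k: "s k .: H" "t k .: H" using I by auto
  show "(\<Oplus>\<^bsub>DR\<^esub>d\<in>D. \<Oplus>\<^bsub>DR\<^esub>d'\<in>D'.
    \<xi> ((t k ** bs' d') ** T (bs d)) \<odot>\<^bsub>DR\<^esub> dr (drin_cross K H (s k) (ds d)) (inX (ds' d'))) =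
   Cs DR (%y h. dr (E (s k) y) (inX (bi (t k) \<xi> (T h))))"
   unfolding 1[OF k]
  proof (rule Z.finsum_cong'[OF refl])
   show "(%d. dr (E (s k) (ds d)) (inX (bi (t k) \<xi> (T (bs d))))) \<in> D \<rightarrow> carrier DR"
    by (rule Pi_I, (assumption | rule t k e(3,4))+)
   fix d assume d: "d \<in> D"
   show "(\<Oplus>\<^bsub>DR\<^esub>d'\<in>D'. \<xi> ((t k ** bs' d') ** T (bs d)) \<odot>\<^bsub>DR\<^esub> dr (drin_cross K H (s k) (ds d)) (inX (ds' d'))) =
     dr (E (s k) (ds d)) (inX (bi (t k) \<xi> (T (bs d))))"
    by (rule 2[OF k e(4)[OF d] e(3)[OF d], symmetric])
  qed
 qed
 finally show ?thesis .
qed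

end

theorem propositionE:
  fixes K :: "('k, 'r) ring_scheme"
    and H :: "('k, 'h, 'm) hopf_scheme"
    and R :: "('k, 'h, 'h) tensor"
    and A :: "('k, 'a, 'n) module_scheme"
    and \<rho> :: "'a \<Rightarrow> ('k, 'h, 'a) tensor"
    and I :: "'i set" and s t :: "'i \<Rightarrow> 'h"
    and D :: "'d set" and h :: "'d \<Rightarrow> 'h" and x :: "'d \<Rightarrow> 'h \<Rightarrow> 'k"
    and D' :: "'e set" and h' :: "'e \<Rightarrow> 'h" and x' :: "'e \<Rightarrow> 'h \<Rightarrow> 'k"
  assumes "algebraically_closed K"
    and "quasitriangular_hopf_algebra K H R"
    and "vectorspace.fin_dim K H"
    and "left_comodule_algebra K H A \<rho>"
    and "finite I" and "s \<in> I \<rightarrow> carrier H" and "t \<in> I \<rightarrow> carrier H"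
    and "R = (\<Oplus>\<^bsub>tensor_space K H H\<^esub>k\<in>I. tens K H H (s k) (t k))"
    and "dual_bases K H D h x"
    and "dual_bases K H D' h' x'"
  shows "let Drin = drinfeld_double K H;
             Ref = reflective_alg K H R A \<rho>;
             DR = tensor_alg K Drin Ref;
             inA = reflective_inl K H R A \<rho>;
             inX = reflective_inr K H R A \<rho>;
             formulas = (\<lambda>\<delta>.
               (\<forall>a\<in>carrier A.
                 \<delta> (inA a) =
                   tensor_lift K DR (\<lambda>g b. tens K Drin Ref (drin_incl K H g) (inA b)) (\<rho> a)) \<and>
               (\<forall>\<xi>\<in>carrier (hat_dual_op K H R).
                 \<delta> (inX \<xi>) =
                   (\<Oplus>\<^bsub>DR\<^esub>k\<in>I. \<Oplus>\<^bsub>DR\<^esub>d\<in>D. \<Oplus>\<^bsub>DR\<^esub>d'\<in>D'.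
                     \<xi> (t k \<otimes>\<^bsub>H\<^esub> h' d' \<otimes>\<^bsub>H\<^esub> antipode_inv H (h d)) \<odot>\<^bsub>DR\<^esub>
                       tens K Drin Ref (drin_cross K H (s k) (x d)) (inX (x' d')))) \<and>
               (\<forall>a\<in>carrier A. \<forall>\<xi>\<in>carrier (hat_dual_op K H R).
                 \<delta> (inA a \<otimes>\<^bsub>Ref\<^esub> inX \<xi>) = \<delta> (inA a) \<otimes>\<^bsub>DR\<^esub> \<delta> (inX \<xi>)))
         in \<exists>\<delta>. left_comodule_algebra K Drin Ref \<delta> \<and> formulas \<delta> \<and>
              (\<forall>\<delta>'. linear_map K Ref DR \<delta>' \<and> formulas \<delta>' \<longrightarrow>
                 (\<forall>r\<in>carrier Ref. \<delta>' r = \<delta> r))"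
proof -
 interpret Q: quasitriangular_hopf_algebra K H R by (rule assms(2))
 interpret Co: coaction_base K H R A \<rho> D h x
  by (intro coaction_base.intro ref_base.intro ref_base_axioms.intro qt_base.intro qt_base_axioms.intro
   dual_base.intro dual_base_axioms.intro hopf_base.intro hopf_base_axioms.intro field_base.intro)
   (use assms Q.field_axioms Q.hopf_algebra_axioms in simp_all)
 obtain \<delta> where d0: "left_comodule_algebra K Co.Drin Co.Ref \<delta>" "\<delta> \<in> alg_hom K Co.Ref Co.DR"
  "\<forall>a\<in>carrier A. \<delta> (Co.inA a) = Co.Tg.phi a"
  "\<forall>\<xi>\<in>carrier Co.Hs. \<delta> (Co.inX \<xi>) = Co.Tg.psi \<xi>"
  using Co.coaction_exists by (elim exE conjE)
 note d = d0(1,2) bspec[OF d0(3)] bspec[OF d0(4)]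
 have incl: "drin_incl K H g = Co.pt Co.eps g" for g
  by (simp add: drin_incl_def Co.dual_alg_simps Co.eps_def)
 note c = Co.lin_closed[OF Co.lin_inA] Co.lin_closed[OF Co.lin_inX]
 show ?thesis
  unfolding Let_def Co.B_simps(2) Co.DR_def[symmetric] Co.dr_def[symmetric]
 proof (intro exI[of _ \<delta>] conjI ballI allI impI)
  show "left_comodule_algebra K Co.Drin Co.Ref \<delta>" by (rule d(1))
  show "\<delta> (Co.inA a) = tensor_lift K Co.DR (\<lambda>g b. Co.dr (drin_incl K H g) (Co.inA b)) (\<rho> a)" if "a \<in> carrier A" for a
   unfolding d(3)[OF that] incl by (rule Co.phi_eq[OF that])
  show "\<delta> (Co.inX \<xi>) = (\<Oplus>\<^bsub>Co.DR\<^esub>k\<in>I. \<Oplus>\<^bsub>Co.DR\<^esub>d\<in>D. \<Oplus>\<^bsub>Co.DR\<^esub>d'\<in>D'.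
    \<xi> (t k \<otimes>\<^bsub>H\<^esub> h' d' \<otimes>\<^bsub>H\<^esub> antipode_inv H (h d)) \<odot>\<^bsub>Co.DR\<^esub>
     Co.dr (drin_cross K H (s k) (x d)) (Co.inX (x' d')))" if "\<xi> \<in> carrier Co.Hs" for \<xi>
   unfolding d(4)[OF that] by (rule Co.psi_sum[OF that assms(5-8) assms(10)])
  show "\<delta> (Co.inA a \<otimes>\<^bsub>Co.Ref\<^esub> Co.inX \<xi>) = \<delta> (Co.inA a) \<otimes>\<^bsub>Co.DR\<^esub> \<delta> (Co.inX \<xi>)"
   if "a \<in> carrier A" "\<xi> \<in> carrier Co.Hs" for a \<xi>
   by (rule Co.alg_homD(3)[OF d(2) c(1)[OF that(1)] c(2)[OF that(2)]])
  fix \<delta>' r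
  assume *: "linear_map K Co.Ref Co.DR \<delta>' \<and>
   ((\<forall>a\<in>carrier A. \<delta>' (Co.inA a) = tensor_lift K Co.DR (\<lambda>g b. Co.dr (drin_incl K H g) (Co.inA b)) (\<rho> a)) \<and>
    (\<forall>\<xi>\<in>carrier Co.Hs. \<delta>' (Co.inX \<xi>) = (\<Oplus>\<^bsub>Co.DR\<^esub>k\<in>I. \<Oplus>\<^bsub>Co.DR\<^esub>d\<in>D. \<Oplus>\<^bsub>Co.DR\<^esub>d'\<in>D'.
    \<xi> (t k \<otimes>\<^bsub>H\<^esub> h' d' \<otimes>\<^bsub>H\<^esub> antipode_inv H (h d)) \<odot>\<^bsub>Co.DR\<^esub>
     Co.dr (drin_cross K H (s k) (x d)) (Co.inX (x' d')))) \<and>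
    (\<forall>a\<in>carrier A. \<forall>\<xi>\<in>carrier Co.Hs.
     \<delta>' (Co.inA a \<otimes>\<^bsub>Co.Ref\<^esub> Co.inX \<xi>) = \<delta>' (Co.inA a) \<otimes>\<^bsub>Co.DR\<^esub> \<delta>' (Co.inX \<xi>)))"
   and r: "r \<in> carrier Co.Ref"
  note f = conjunct1[OF *] bspec[OF conjunct1[OF conjunct2[OF *]]]
   bspec[OF conjunct1[OF conjunct2[OF conjunct2[OF *]]]]
   bspec[OF bspec[OF conjunct2[OF conjunct2[OF conjunct2[OF *]]]]]
  have A: "\<delta>' (Co.inA a) = \<delta> (Co.inA a)" if "a \<in> carrier A" for a
   unfolding d(3)[OF that] Co.phi_eq[OF that] f(2)[OF that] incl ..
  have X: "\<delta>' (Co.inX \<xi>) = \<delta> (Co.inX \<xi>)" if "\<xi> \<in> carrier Co.Hs" for \<xi>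
   unfolding d(4)[OF that] Co.psi_sum[OF that assms(5-8) assms(10)] by (rule f(3)[OF that])
  \<comment> \<open>Both maps are linear and agree on the products a \<xi>, since each sends such a
    product to the product of the prescribed values; \<open>ref_span\<close> extends the agreement
    to all of \<open>Ref\<close>.\<close>
  show "\<delta>' r = \<delta> r"
  proof (rule Co.ref_span[OF Co.vsDR _ Co.alg_homD(1)[OF d(2)] _ r])
   show "Co.lin Co.Ref Co.DR \<delta>'" using f(1) by (simp add: Co.linear_map_iff)
   show "\<delta>' (Co.inA a \<otimes>\<^bsub>Co.Ref\<^esub> Co.inX \<xi>) = \<delta> (Co.inA a \<otimes>\<^bsub>Co.Ref\<^esub> Co.inX \<xi>)"
    if "a \<in> carrier A" "\<xi> \<in> carrier Co.Hs" for a \<xi>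
    unfolding f(4)[OF that] A[OF that(1)] X[OF that(2)]
    by (rule Co.alg_homD(3)[OF d(2) c(1)[OF that(1)] c(2)[OF that(2)], symmetric])
  qed
 qed
qed

end
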